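(* Let $M\ge1$ be fixed, let $0=\tau_0<\tau_1<\dots<\tau_M<\tau_{M+1}=m$ be integers, $\tau=(\tau_1,\dots,\tau_M)$, and let $\mu=(\mu_1,\dots,\mu_{M+1})$ be real numbers with $\mu_k\ne\mu_{k+1}$. Let $X_1,\dots,X_m$ be independent normal random variables with variance $1$ such that $X_i$ has mean $\mu_k$ for $\tau_{k-1}<i\le\tau_k$, $1\le k\le M+1$; write $\mathbb P_{\tau,\mu}$ for the corresponding probability. Let $S_i=\sum_{j=1}^iX_j$ for $0\le i\le m$, and for integers $0=t_0<t_1<\dots<t_M<t_{M+1}=m$, $t=(t_1,\dots,t_M)$, let $$U_{t,\tau,\mu}=\sum_{k=1}^{M+1}\frac{(S_{t_k}-S_{t_{k-1}})^2}{2(t_k-t_{k-1})}-\sum_{k=1}^{M+1}\Big[\mu_k(S_{\tau_k}-S_{\tau_{k-1}})-\frac{\mu_k^2}{2}(\tau_k-\tau_{k-1})\Big].$$ Define $\delta_k=\mu_{k+1}-\mu_k$ for $1\le k\le M$ and $m_k=\tau_k-\tau_{k-1}$ for $1\le k\le M+1$, and let $n_1,\dots,n_M$ be positive integers. Suppose that $|\delta_k|\asymp1$ and $$1\ll a\ll n_k\ll (m_k\wedge m_{k+1})/a$$ for all $1\le k\le M$. Then $$\mathbb P_{\tau,\mu}\Big(\max_{t:\,|t_k-\tau_k|\le n_k,\ 1\le k\le M}U_{t,\tau,\mu}>a\Big)\sim\mathbb P\Big(\sum_{k=1}^MW_k+\frac12\chi^2_{M+1}>a\Big),$$ where $W_1,\dots,W_M,\chi^2_{M+1}$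 are independent, $\chi^2_{M+1}$ is a chi-squared random variable with $M+1$ degrees of freedom, and for $1\le k\le M$ the distribution of $W_k$ is given by $$\mathbb P(W_k>x)=2\nu(|\delta_k|)e^{-x}-\nu^2(|\delta_k|)e^{-2x},\qquad x\ge0$$ (with $W_k\ge 0$).
   Context: $\Phi$ is the standard normal distribution function. The function $\nu:(0,\infty)\to(0,1)$ is $$\nu(x)=\frac{2}{x^{2}}\exp\Big(-2\sum_{n=1}^{\infty}\frac1n\,\Phi\big(-\tfrac{x\sqrt n}{2}\big)\Big).$$ Asymptotic notation: limits are taken as $a\to\infty$, with $m,\tau,\mu,n_1,\dots,n_M$ allowed to depend on $a$. $A\asymp B$ means $0<c_1\le A/B\le c_2<\infty$ for two absolute constants $c_1,c_2$; $A\ll B$ means $A/B\to0$; $A\sim B$ means $A/B\to1$; $x\wedge y=\min(x,y)$. *)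

theory Defs
  imports "HOL-Probability.Probability" "HOL-Library.Landau_Symbols"
begin

definition Phi :: "real \<Rightarrow> real" where
  "Phi x = cdf std_normal_distribution x"

text \<open>The series over $n \ge 1$ is indexed by its predecessor.\<close>

definition nu :: "real \<Rightarrow> real" where
  "nu x = 2 / x\<^sup>2 * exp (- 2 * (\<Sum>n. 1 / real (Suc n) * Phi (- (x * sqrt (real (Suc n)) / 2))))"

definition chi_squared_distribution :: "nat \<Rightarrow> real measure" where
  "chi_squared_distribution d =
     distr (Pi\<^sub>M {..<d} (\<lambda>_. std_normal_distribution)) borel (\<lambda>z. \<Sum>i<d. (z i)\<^sup>2)"

text \<open>
  Vectors indexed by $1, \dots, r$ are functions on the naturals of which only the values at
  $1, \dots, r$ matter; split points \<open>t\<close> carry in addition the end points \<open>t 0 = 0\<close> and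
  \<open>t (Suc M) = m\<close>.
\<close>

definition split_points :: "nat \<Rightarrow> nat \<Rightarrow> (nat \<Rightarrow> nat) \<Rightarrow> bool" where
  "split_points M m t \<longleftrightarrow> t 0 = 0 \<and> t (Suc M) = m \<and> (\<forall>k\<le>M. t k < t (Suc k))"

definition jump :: "(nat \<Rightarrow> real) \<Rightarrow> nat \<Rightarrow> real" where
  "jump \<mu> k = \<mu> (Suc k) - \<mu> k"

definition seg_length :: "(nat \<Rightarrow> nat) \<Rightarrow> nat \<Rightarrow> nat" where
  "seg_length t k = t k - t (k - 1)"

definition change_point_model ::
    "nat \<Rightarrow> nat \<Rightarrow> (nat \<Rightarrow> nat) \<Rightarrow> (nat \<Rightarrow> real) \<Rightarrow> 'a measure \<Rightarrow> (nat \<Rightarrow> 'a \<Rightarrow> real) \<Rightarrow> bool" where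
  "change_point_model M m \<tau> \<mu> P X \<longleftrightarrow>
     prob_space P \<and>
     prob_space.indep_vars P (\<lambda>_. borel) X {1..m} \<and>
     (\<forall>k\<in>{1..Suc M}. \<forall>i\<in>{\<tau> (k - 1)<..\<tau> k}. distributed P lborel (X i) (normal_density (\<mu> k) 1))"

definition partial_sum :: "(nat \<Rightarrow> 'a \<Rightarrow> real) \<Rightarrow> nat \<Rightarrow> 'a \<Rightarrow> real" where
  "partial_sum X i \<omega> = (\<Sum>j=1..i. X j \<omega>)"

definition U_stat ::
    "nat \<Rightarrow> (nat \<Rightarrow> 'a \<Rightarrow> real) \<Rightarrow> (nat \<Rightarrow> nat) \<Rightarrow> (nat \<Rightarrow> nat) \<Rightarrow> (nat \<Rightarrow> real) \<Rightarrow> 'a \<Rightarrow> real" where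
  "U_stat M X t \<tau> \<mu> \<omega> =
     (\<Sum>k=1..Suc M. (partial_sum X (t k) \<omega> - partial_sum X (t (k - 1)) \<omega>)\<^sup>2
                      / (2 * real (seg_length t k)))
     - (\<Sum>k=1..Suc M. \<mu> k * (partial_sum X (\<tau> k) \<omega> - partial_sum X (\<tau> (k - 1)) \<omega>)
                      - (\<mu> k)\<^sup>2 / 2 * real (seg_length \<tau> k))"

text \<open>
  Extensionality outside $\{0, \dots, M+1\}$ gives each vector a unique representative, so the
  set is finite.
\<close>

definition nearby_splits :: "nat \<Rightarrow> nat \<Rightarrow> (nat \<Rightarrow> nat) \<Rightarrow> (nat \<Rightarrow> nat) \<Rightarrow> (nat \<Rightarrow> nat) set" where
  "nearby_splits M m \<tau> n =
     {t \<in> {0..Suc M} \<rightarrow>\<^sub>E {0..m}. split_points M m t \<and>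
        (\<forall>k\<in>{1..M}. \<bar>int (t k) - int (\<tau> k)\<bar> \<le> int (n k))}"

definition limit_model ::
    "nat \<Rightarrow> (nat \<Rightarrow> real) \<Rightarrow> 'b measure \<Rightarrow> (nat \<Rightarrow> 'b \<Rightarrow> real) \<Rightarrow> ('b \<Rightarrow> real) \<Rightarrow> bool" where
  "limit_model M \<mu> Q W C \<longleftrightarrow>
     prob_space Q \<and>
     prob_space.indep_vars Q (\<lambda>_. borel) (W(Suc M := C)) {1..Suc M} \<and>
     distr Q borel C = chi_squared_distribution (Suc M) \<and>
     (\<forall>k\<in>{1..M}. (AE \<omega> in Q. 0 \<le> W k \<omega>) \<and>
        (\<forall>x\<ge>0. measure Q {\<omega> \<in> space Q. W k \<omega> > x} =
           2 * nu \<bar>jump \<mu> k\<bar> * exp (- x) - (nu \<bar>jump \<mu> k\<bar>)\<^sup>2 * exp (- 2 * x)))"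

end

theory Submission
  imports Defs "HOL-Real_Asymp.Real_Asymp"
begin

text \<open>
  Write \<open>\<delta>\<^sub>k = \<mu>\<^sub>k\<^sub>+\<^sub>1 - \<mu>\<^sub>k\<close>. Completing the squares with the true means and summing by parts gives, for
  every vector of split points, \<open>U\<^sub>t = \<Sum>\<^sub>k V\<^sub>k(t\<^sub>k) + \<Sum>\<^sub>k Z\<^sub>k(t)\<^sup>2 / 2\<close>
  (\<open>U_stat_decomposition\<close>). Here \<open>V\<^sub>k\<close> is the log likelihood ratio for moving the \<open>k\<close>-th change
  point from \<open>\<tau>\<^sub>k\<close> to \<open>t\<^sub>k\<close>, a two-sided random walk with steps \<open>\<bar>\<delta>\<^sub>k\<bar> \<epsilon> - \<delta>\<^sub>k\<^sup>2 / 2\<close>, and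
  \<open>Z\<^sub>k(t)\<close> is the standardized sum of the deviations from \<open>\<mu>\<^sub>k\<close> over the \<open>k\<close>-th segment. The walks depend only on the
  observations in the windows of radius \<open>n\<^sub>k\<close> around the change points. The segments are longer than the
  windows by a factor that grows faster than \<open>a\<close>, so up to a negligible error the \<open>Z\<^sub>k\<close> are the standardized
  sums over the cores between the windows. Windows and cores are disjoint, so the maximum
  of \<open>U\<^sub>t\<close> is close to a sum of independent variables: the window maxima \<open>R\<^sub>k\<close> and half a chi-squared
  variable with \<open>M + 1\<close> degrees of freedom. Quantitatively (\<open>U_upper\<close>, \<open>U_lower\<close>), the squares
  that leak from the windows into the segments perturb the walks by quadratic forms with coefficients so
  small that all exponential moments in use stay bounded.

  The tails of such sums are compared through the truncated exponential moment
  \<open>texp A = E exp (min X A)\<close>. Two of the squares make up a standard exponential variable, and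
  adding an independent standard exponential variable \<open>E\<close> turns this moment into a tail:
  \<open>P(Y + E > a) = e\<^sup>-\<^sup>a texp a\<close> (\<open>exp_tail_convolution\<close>). Hence, up to the errors above, both
  probabilities in the theorem are \<open>e\<^sup>-\<^sup>a\<close> times a truncated moment of the sum of the \<open>M\<close> nonnegative variables and of half a
  chi-squared variable with \<open>M - 1\<close> degrees of freedom. Truncated moments behave well under convolution, and
  independent summands may be exchanged one at a time: replacing \<open>R\<^sub>k\<close> by \<open>W\<^sub>k\<close> is harmless if their
  truncated moments differ by \<open>o(a)\<close> uniformly over the levels \<open>A \<le> a\<close> (\<open>total_texp_compare\<close>).
  For \<open>W\<^sub>k\<close> the moment is \<open>2 \<nu> A + O(1)\<close> by integration of the tail (\<open>texp_limit_law\<close>).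

  It remains to find the moment of the maximum of the walk. Tilting by \<open>e\<^sup>V\<close> and reversing time at the
  first maximum give \<open>E exp (max\<^sub>j\<^sub>\<le>\<^sub>n V\<^sub>j) = \<Sum>\<^sub>j p\<^sub>j p\<^sub>n\<^sub>-\<^sub>j\<close>, where \<open>p\<^sub>j\<close> is the probability that the
  walk is nonpositive up to time \<open>j\<close> (\<open>nn_integral_exp_walk_max\<close>). Since \<open>p\<^sub>j\<close> converges geometrically to
  \<open>p\<^sub>\<infinity>\<close> and the tilted walk needs about \<open>2 A / \<delta>\<^sup>2\<close> steps to reach the level \<open>A\<close>, the moment
  truncated at \<open>A\<close> is about \<open>2 A p\<^sub>\<infinity>\<^sup>2 / \<delta>\<^sup>2\<close> for one side, and
  twice that for the two sides. A cyclic lemma for ladder epochs yields Spitzer's formula for \<open>p\<^sub>\<infinity>\<close>, which identifies \<open>2 p\<^sub>\<infinity>\<^sup>2 / \<delta>\<^sup>2\<close> as \<open>\<nu>(\<bar>\<delta>\<bar>)\<close>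
  (\<open>nu_eq_stay_prob\<close>). So \<open>R\<^sub>k\<close> and \<open>W\<^sub>k\<close> agree to leading order (\<open>window_max_texp\<close>).
\<close>

section \<open>Truncated exponential moments\<close>

text \<open>
  The expectation is taken over the law itself, so that it can be combined with convolutions.
  Truncation keeps it finite for every distribution, and up to the factor \<open>exp (- A)\<close>
  it is the tail at \<open>A\<close> of the law convolved with the standard exponential law.
\<close>
definition texp :: "real measure \<Rightarrow> real \<Rightarrow> real" where
  "texp \<alpha> A = (\<integral>x. exp (min x A) \<partial>\<alpha>)"

abbreviation nonneg_law :: "real measure \<Rightarrow> bool" where
  "nonneg_law \<alpha> \<equiv> real_distribution \<alpha> \<and> (AE x in \<alpha>. 0 \<le> x)"

lemma texp_integrable:
  assumes "real_distribution \<alpha>" shows "integrable \<alpha> (\<lambda>x. exp (min x A))"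
proof -
  interpret real_distribution \<alpha> by fact
  show ?thesis
    by (rule integrable_const_bound[where B="exp A"]) auto
qed

lemma texp_nonneg: "0 \<le> texp \<alpha> A"
  unfolding texp_def by (rule integral_nonneg_AE) auto

lemma texp_mono:
  assumes "real_distribution \<alpha>" "A \<le> B" shows "texp \<alpha> A \<le> texp \<alpha> B"
  unfolding texp_def using assms
  by (intro integral_mono texp_integrable) auto

lemma texp_ge_1:
  assumes "nonneg_law \<alpha>" "0 \<le> A" shows "1 \<le> texp \<alpha> A"
proof -
  interpret real_distribution \<alpha> using assms by simp
  have "(\<integral>x. 1 \<partial>\<alpha>) \<le> texp \<alpha> A"
    unfolding texp_def using assms
    by (intro integral_mono_AE texp_integrable) auto
  then show ?thesis using prob_space by simp
qed

lemma texp_add_le: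
  assumes "real_distribution \<alpha>" "0 \<le> h" shows "texp \<alpha> (A + h) \<le> exp h * texp \<alpha> A"
proof -
  have "texp \<alpha> (A + h) \<le> (\<integral>x. exp h * exp (min x A) \<partial>\<alpha>)"
    unfolding texp_def using assms
    by (intro integral_mono integrable_mult_right texp_integrable)
       (auto simp: exp_add[symmetric] min_def)
  then show ?thesis by (simp add: texp_def)
qed

lemma real_distribution_convolution:
  assumes "real_distribution \<alpha>" "real_distribution \<beta>"
  shows "real_distribution (\<alpha> \<star> \<beta>)"
proof -
  interpret a: real_distribution \<alpha> by fact
  interpret b: real_distribution \<beta> by fact
  interpret p: pair_prob_space \<alpha> \<beta> ..
  note [measurable_cong] = a.events_eq_borel b.events_eq_borel
  have "(\<lambda>z. fst z + snd z) \<in> borel_measurable (\<alpha> \<Otimes>\<^sub>M \<beta>)" by measurable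
  then show ?thesis unfolding convolution_def
    by (intro p.real_distribution_distr) (simp add: split_beta')
qed

lemma nonneg_law_convolution:
  assumes "nonneg_law \<alpha>" "nonneg_law \<beta>"
  shows "nonneg_law (\<alpha> \<star> \<beta>)"
proof -
  interpret a: real_distribution \<alpha> using assms by simp
  interpret b: real_distribution \<beta> using assms by simp
  interpret p: pair_prob_space \<alpha> \<beta> ..
  note [measurable_cong] = a.events_eq_borel b.events_eq_borel
  have "AE z in \<alpha> \<star> \<beta>. 0 \<le> z"
    unfolding convolution_def
  proof (subst AE_distr_iff)
    have ae: "AE x in \<alpha>. AE y in \<beta>. 0 \<le> fst (x, y) + snd (x, y)"
      using assms by (auto elim!: eventually_mono)
    have m: "(\<lambda>z. fst z + snd z) \<in> borel_measurable (\<alpha> \<Otimes>\<^sub>M \<beta>)" by measurable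
    have "{z \<in> space (\<alpha> \<Otimes>\<^sub>M \<beta>). 0 \<le> fst z + snd z} \<in> sets (\<alpha> \<Otimes>\<^sub>M \<beta>)"
      using measurable_sets[OF m, of "{0..}"] by (simp add: vimage_def Int_def conj_commute)
    from p.AE_pair_measure[OF this ae]
    show "AE x in \<alpha> \<Otimes>\<^sub>M \<beta>. 0 \<le> (case x of (x, y) \<Rightarrow> x + y)"
      by (simp add: split_beta')
  qed (auto simp: split_beta')
  then show ?thesis using assms real_distribution_convolution by auto
qed

lemma
  assumes "real_distribution \<alpha>" "real_distribution \<beta>"
  shows texp_convolution: "texp (\<alpha> \<star> \<beta>) A = (\<integral>y. (\<integral>x. exp (min (x + y) A) \<partial>\<alpha>) \<partial>\<beta>)" (is ?t1)
    and texp_convolution_integrable: "integrable \<beta> (\<lambda>y. (\<integral>x. exp (min (x + y) A) \<partial>\<alpha>))" (is ?t2)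
proof -
  interpret a: real_distribution \<alpha> by fact
  interpret b: real_distribution \<beta> by fact
  interpret p: pair_prob_space \<alpha> \<beta> ..
  note [measurable_cong] = a.events_eq_borel b.events_eq_borel
  have i: "integrable (\<alpha> \<Otimes>\<^sub>M \<beta>) (\<lambda>(x,y). exp (min (x + y) A))"
    by (rule p.integrable_const_bound[where B="exp A"]) auto
  show ?t1 unfolding texp_def convolution_def
    using p.integral_snd[OF i] by (subst integral_distr) (auto simp: split_beta')
  show ?t2 using p.integrable_snd[OF i] .
qed

text \<open>
  Truncation is subadditive on nonnegative numbers: \<open>min (x + y) A \<le> min x A + min y
  A\<close>.
\<close>
lemma texp_convolution_le:
  assumes "nonneg_law \<alpha>" "nonneg_law \<beta>" "0 \<le> A"
  shows "texp (\<alpha> \<star> \<beta>) A \<le> texp \<alpha> A * texp \<beta> A"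
proof -
  interpret a: real_distribution \<alpha> using assms by simp
  interpret b: real_distribution \<beta> using assms by simp
  have "texp (\<alpha> \<star> \<beta>) A \<le> (\<integral>y. texp \<alpha> A * exp (min y A) \<partial>\<beta>)"
    unfolding texp_convolution[OF a.real_distribution_axioms b.real_distribution_axioms]
  proof (rule integral_mono_AE)
    have "(\<integral>x. exp (min (x + y) A) \<partial>\<alpha>) \<le> texp \<alpha> A * exp (min y A)" if "0 \<le> y" for y
    proof -
      have "(\<integral>x. exp (min (x + y) A) \<partial>\<alpha>) \<le> (\<integral>x. exp (min x A) * exp (min y A) \<partial>\<alpha>)"
      proof (rule integral_mono_AE)
        show "AE x in \<alpha>. exp (min (x + y) A) \<le> exp (min x A) * exp (min y A)"
          using assms(1)
          by (auto elim!: eventually_mono simp: exp_add[symmetric] min_def \<open>0 \<le> y\<close> \<open>0 \<le> A\<close>)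
             (use \<open>0 \<le> y\<close> \<open>0 \<le> A\<close> in linarith)+
        show "integrable \<alpha> (\<lambda>x. exp (min (x + y) A))"
          by (rule a.integrable_const_bound[where B="exp A"]) auto
      qed (auto intro!: texp_integrable a.real_distribution_axioms)
      then show ?thesis by (simp add: texp_def)
    qed
    then show "AE y in \<beta>. (\<integral>x. exp (min (x + y) A) \<partial>\<alpha>) \<le> texp \<alpha> A * exp (min y A)"
      using assms(2) by (auto elim!: eventually_mono)
  qed (auto intro!: texp_integrable texp_convolution_integrable
        a.real_distribution_axioms b.real_distribution_axioms)
  then show ?thesis by (simp add: texp_def)
qed

text \<open>
  Truncation levels add up: \<open>min x A + min y B \<le> min (x + y) (A + B)\<close>.
\<close>
lemma texp_convolution_ge:
  assumes "real_distribution \<alpha>" "real_distribution \<beta>"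
  shows "texp \<alpha> A * texp \<beta> B \<le> texp (\<alpha> \<star> \<beta>) (A + B)"
proof -
  interpret a: real_distribution \<alpha> using assms by simp
  interpret b: real_distribution \<beta> using assms by simp
  have "(\<integral>y. texp \<alpha> A * exp (min y B) \<partial>\<beta>) \<le> texp (\<alpha> \<star> \<beta>) (A + B)"
    unfolding texp_convolution[OF assms]
  proof (rule integral_mono)
    fix y
    have "(\<integral>x. exp (min x A) * exp (min y B) \<partial>\<alpha>) \<le> (\<integral>x. exp (min (x + y) (A + B)) \<partial>\<alpha>)"
    proof (rule integral_mono)
      show "integrable \<alpha> (\<lambda>x. exp (min (x + y) (A + B)))"
        by (rule a.integrable_const_bound[where B="exp (A + B)"]) auto
      show "integrable \<alpha> (\<lambda>x. exp (min x A) * exp (min y B))"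
        by (intro integrable_mult_left texp_integrable assms)
    qed (auto simp: exp_add[symmetric] min_def)
    then show "texp \<alpha> A * exp (min y B) \<le> (\<integral>x. exp (min (x + y) (A + B)) \<partial>\<alpha>)"
      by (simp add: texp_def)
  qed (auto intro!: texp_integrable texp_convolution_integrable assms)
  then show ?thesis by (simp add: texp_def)
qed

text \<open>
  Conditioning on the value \<open>y\<close> of the common summand leaves the factor \<open>exp
  y\<close> times a truncated moment at the level \<open>a - y\<close>, which lies in \<open>[0,
  a]\<close> unless \<open>y > a\<close>; in that case both truncated sums equal \<open>a\<close>
  by nonnegativity.
\<close>
lemma texp_swap:
  assumes \<alpha>: "nonneg_law \<alpha>" and \<alpha>': "nonneg_law \<alpha>'" and \<beta>: "nonneg_law \<beta>"
    and eps: "\<And>A. 0 \<le> A \<Longrightarrow> A \<le> a \<Longrightarrow> \<bar>texp \<alpha> A - texp \<alpha>' A\<bar> \<le> \<epsilon>" and "0 \<le> \<epsilon>"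
  shows "\<bar>texp (\<alpha> \<star> \<beta>) a - texp (\<alpha>' \<star> \<beta>) a\<bar> \<le> \<epsilon> * texp \<beta> a"
proof -
  interpret a: real_distribution \<alpha> using assms by simp
  interpret a': real_distribution \<alpha>' using assms by simp
  interpret b: real_distribution \<beta> using assms by simp
  let ?f = "\<lambda>\<alpha> y. (\<integral>x. exp (min (x + y) a) \<partial>\<alpha>)"
  \<comment> \<open>shifting by \<open>y\<close> moves the truncation level\<close>
  have small: "?f \<alpha> y = exp y * texp \<alpha> (a - y)" for \<alpha> y
  proof -
    have "?f \<alpha> y = (\<integral>x. exp y * exp (min x (a - y)) \<partial>\<alpha>)"
      by (intro Bochner_Integration.integral_cong) (auto simp: exp_add[symmetric] min_def algebra_simps)
    then show ?thesis by (simp add: texp_def)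
  qed
  \<comment> \<open>beyond the level nonnegativity makes the truncated sum constant\<close>
  have big: "?f \<alpha> y = exp a" if "a < y" "nonneg_law \<alpha>" for \<alpha> y
  proof -
    interpret real_distribution \<alpha> using that by simp
    have "AE x in \<alpha>. min (x + y) a = a"
      using that by (auto elim!: eventually_mono)
    then have "?f \<alpha> y = (\<integral>x. exp a \<partial>\<alpha>)"
      by (intro integral_cong_AE) auto
    then show ?thesis using prob_space by simp
  qed
  have *: "\<bar>?f \<alpha> y - ?f \<alpha>' y\<bar> \<le> \<epsilon> * exp (min y a)" if "0 \<le> y" for y
  proof (cases "a < y")
    case True
    then show ?thesis using big[OF _ \<alpha>] big[OF _ \<alpha>'] \<open>0 \<le> \<epsilon>\<close> by auto
  next
    case False
    have "\<bar>?f \<alpha> y - ?f \<alpha>' y\<bar> = exp y * \<bar>texp \<alpha> (a - y) - texp \<alpha>' (a - y)\<bar>"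
      unfolding small by (simp add: abs_mult right_diff_distrib[symmetric])
    also have "\<dots> \<le> exp y * \<epsilon>"
      using False that by (intro mult_left_mono eps) auto
    finally show ?thesis using False by (simp add: min_def mult.commute)
  qed
  note ra = a.real_distribution_axioms a'.real_distribution_axioms b.real_distribution_axioms
  have "\<bar>texp (\<alpha> \<star> \<beta>) a - texp (\<alpha>' \<star> \<beta>) a\<bar> = \<bar>\<integral>y. ?f \<alpha> y - ?f \<alpha>' y \<partial>\<beta>\<bar>"
    by (subst (1 2) texp_convolution)
       (auto intro!: ra simp: Bochner_Integration.integral_diff texp_convolution_integrable ra)
  also have "\<dots> \<le> (\<integral>y. \<bar>?f \<alpha> y - ?f \<alpha>' y\<bar> \<partial>\<beta>)" by (rule integral_abs_bound)
  also have "\<dots> \<le> (\<integral>y. \<epsilon> * exp (min y a) \<partial>\<beta>)"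
    using * \<beta> by (intro integral_mono_AE)
       (auto intro!: integrable_abs Bochner_Integration.integrable_diff texp_convolution_integrable ra texp_integrable
         elim!: eventually_mono)
  finally show ?thesis by (simp add: texp_def)
qed

text \<open>
  Given the value \<open>y\<close> of the other summand, the exponential variable must exceed
  \<open>a - y\<close>, which has probability \<open>exp (min y a - a)\<close>.
\<close>
lemma exp_tail_convolution:
  assumes "real_distribution \<eta>" and \<beta>: "real_distribution \<beta>"
    and tail: "\<And>u. 0 \<le> u \<Longrightarrow> measure \<eta> {u<..} = exp (- u)"
  shows "measure (\<eta> \<star> \<beta>) {a<..} = exp (- a) * texp \<beta> a"
proof -
  interpret e: real_distribution \<eta> by fact
  interpret b: real_distribution \<beta> by fact
  interpret p: pair_prob_space \<eta> \<beta> ..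
  note [measurable_cong] = e.events_eq_borel b.events_eq_borel
  have m: "measure \<eta> {a - y <..} = exp (- a) * exp (min y a)" for y
  proof (cases "y \<le> a")
    case True then show ?thesis using tail[of "a - y"] by (simp add: exp_add[symmetric])
  next
    case False
    then have "measure \<eta> {0<..} \<le> measure \<eta> {a - y <..}" by (intro e.finite_measure_mono) auto
    with tail[of 0] e.prob_le_1 have "measure \<eta> {a - y <..} = 1" by (simp add: antisym)
    with False show ?thesis by (simp add: exp_add[symmetric] min_def)
  qed
  have "emeasure (\<eta> \<star> \<beta>) {a<..} = (\<integral>\<^sup>+y. \<integral>\<^sup>+x. indicator {a<..} (x + y) \<partial>\<eta> \<partial>\<beta>)"
  proof -
    have m: "(\<lambda>z. fst z + snd z) \<in> borel_measurable (\<eta> \<Otimes>\<^sub>M \<beta>)" by measurable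
    have "emeasure (\<eta> \<star> \<beta>) {a<..} = (\<integral>\<^sup>+z. indicator {a<..} z \<partial>(\<eta> \<star> \<beta>))"
      by simp
    also have "\<dots> = (\<integral>\<^sup>+z. indicator {a<..} (fst z + snd z) \<partial>(\<eta> \<Otimes>\<^sub>M \<beta>))"
      unfolding convolution_def using m
      by (subst nn_integral_distr) (auto simp: split_beta')
    also have "\<dots> = (\<integral>\<^sup>+y. \<integral>\<^sup>+x. indicator {a<..} (x + y) \<partial>\<eta> \<partial>\<beta>)"
      by (subst p.nn_integral_snd[symmetric]) auto
    finally show ?thesis .
  qed
  also have "\<dots> = (\<integral>\<^sup>+y. ennreal (exp (- a) * exp (min y a)) \<partial>\<beta>)"
  proof (intro nn_integral_cong)
    fix y
    have "(\<integral>\<^sup>+x. indicator {a<..} (x + y) \<partial>\<eta>) = (\<integral>\<^sup>+x. indicator {a - y<..} x \<partial>\<eta>)"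
      by (intro nn_integral_cong) (auto simp: indicator_def)
    also have "\<dots> = ennreal (measure \<eta> {a - y<..})"
      by (simp add: e.emeasure_eq_measure)
    finally show "(\<integral>\<^sup>+x. indicator {a<..} (x + y) \<partial>\<eta>) = ennreal (exp (- a) * exp (min y a))"
      using m by simp
  qed
  also have "\<dots> = ennreal (exp (- a) * texp \<beta> a)"
    unfolding texp_def by (subst nn_integral_eq_integral) (auto intro!: texp_integrable \<beta>)
  finally show ?thesis by (simp add: measure_def texp_nonneg)
qed

section \<open>Half chi-squared laws\<close>

abbreviation half_square_law :: "real measure" where
  "half_square_law \<equiv> distr std_normal_distribution borel (\<lambda>x. x\<^sup>2 / 2)"

definition half_chi :: "nat \<Rightarrow> real measure" where
  "half_chi d = distr (chi_squared_distribution d) borel (\<lambda>x. x / 2)"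

lemma half_chi_eq: "half_chi d = distr (Pi\<^sub>M {..<d} (\<lambda>_. std_normal_distribution)) borel (\<lambda>z. \<Sum>i<d. (z i)\<^sup>2 / 2)"
  unfolding half_chi_def chi_squared_distribution_def
  by (subst distr_distr) (auto simp: comp_def sum_divide_distrib)

lemma prob_space_std_normal: "prob_space std_normal_distribution"
  using real_dist_normal_dist by (simp add: real_distribution_def)

lemma nonneg_law_half_square: "nonneg_law half_square_law"
proof -
  interpret N: prob_space std_normal_distribution by (rule prob_space_std_normal)
  show ?thesis by (auto intro!: N.real_distribution_distr simp: AE_distr_iff)
qed

lemma nonneg_law_half_chi: "nonneg_law (half_chi d)"
proof -
  interpret N: prob_space "Pi\<^sub>M {..<d} (\<lambda>_. std_normal_distribution)"
    by (rule prob_space_PiM) (rule prob_space_std_normal)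
  show ?thesis unfolding half_chi_eq
    by (auto intro!: N.real_distribution_distr sum_nonneg simp: AE_distr_iff)
qed

lemma half_chi_Suc: "half_chi (Suc d) = (half_square_law \<star> half_chi d)"
proof -
  interpret N: prob_space std_normal_distribution by (rule prob_space_std_normal)
  interpret P: prob_space "Pi\<^sub>M {..<d} (\<lambda>_. std_normal_distribution)"
    by (rule prob_space_PiM) (rule prob_space_std_normal)
  let ?N = std_normal_distribution
  let ?P = "\<lambda>d. Pi\<^sub>M {..<d} (\<lambda>_. ?N)"
  have "?P (Suc d) = distr (?N \<Otimes>\<^sub>M ?P d) (?P (Suc d)) (\<lambda>(x, X). X(d := x))"
    unfolding lessThan_Suc using prob_space_std_normal
    by (intro distr_pair_PiM_eq_PiM[symmetric]) auto
  then have "half_chi (Suc d) = distr (distr (?N \<Otimes>\<^sub>M ?P d) (?P (Suc d)) (\<lambda>(x, X). X(d := x))) borel (\<lambda>z. \<Sum>i<Suc d. (z i)\<^sup>2 / 2)"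
    unfolding half_chi_eq by simp
  also have "\<dots> = distr (?N \<Otimes>\<^sub>M ?P d) borel (\<lambda>(x, X). x\<^sup>2 / 2 + (\<Sum>i<d. (X i)\<^sup>2 / 2))"
  proof (subst distr_distr)
    show "(\<lambda>(x, X). X(d := x)) \<in> ?N \<Otimes>\<^sub>M ?P d \<rightarrow>\<^sub>M ?P (Suc d)"
      unfolding lessThan_Suc by measurable
  qed (auto intro!: distr_cong simp: split_beta')
  also have "\<dots> = (half_square_law \<star> half_chi d)"
    unfolding convolution_def half_chi_eq
    by (subst pair_measure_distr)
       (auto intro!: P.prob_space_distr prob_space_imp_sigma_finite simp: distr_distr comp_def split_beta')
  finally show ?thesis .
qed

lemma nn_integral_exp_tail:
  fixes q :: real
  shows "(\<integral>\<^sup>+s. ennreal (exp (- s)) * indicator {q..} s \<partial>lborel) = ennreal (exp (- q))"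
proof -
  have "(\<integral>\<^sup>+s. ennreal (exp (- s)) * indicator {q..} s \<partial>lborel) = 0 - (- exp (- q))"
    by (rule nn_integral_FTC_atLeast) (auto intro!: derivative_eq_intros, real_asymp)
  then show ?thesis by simp
qed

lemma nn_integral_linear_exp_tail:
  fixes q :: real
  shows "(\<integral>\<^sup>+s. ennreal (exp (- s) * (s - q)) * indicator {q..} s \<partial>lborel) = ennreal (exp (- q))"
proof -
  have "(\<integral>\<^sup>+s. ennreal (exp (- s) * (s - q)) * indicator {q..} s \<partial>lborel) = 0 - (- (q - q + 1) * exp (- q))"
  proof (rule nn_integral_FTC_atLeast[where F="\<lambda>s. - (s - q + 1) * exp (- s)"])
    show "((\<lambda>s. - (s - q + 1) * exp (- s)) \<longlongrightarrow> 0) at_top" by real_asymp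
  qed (auto intro!: derivative_eq_intros simp: algebra_simps)
  then show ?thesis by simp
qed

text \<open>
  In polar terms: the area is linear in half the squared radius. This replaces a change to polar
  coordinates in the next lemma.
\<close>
lemma emeasure_annulus:
  fixes u s :: real
  assumes "0 \<le> u" "u \<le> s"
  shows "emeasure lborel {z :: real \<times> real. u < ((fst z)\<^sup>2 + (snd z)\<^sup>2) / 2 \<and> ((fst z)\<^sup>2 + (snd z)\<^sup>2) / 2 \<le> s}
    = ennreal (2 * pi * (s - u))"
proof -
  have disc: "emeasure lborel (cball (0::real\<times>real) (sqrt (2 * s))) = ennreal (2 * pi * s)" if "0 \<le> s" for s
    using that by (subst emeasure_cball) (auto simp: eval_unit_ball_vol power2_eq_square)
  have in_disc: "z \<in> cball 0 (sqrt (2 * s)) \<longleftrightarrow> ((fst z)\<^sup>2 + (snd z)\<^sup>2) / 2 \<le> s" for z :: "real \<times> real" and s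
    by (cases z) (auto simp: norm_Pair)
  have "{z :: real \<times> real. u < ((fst z)\<^sup>2 + (snd z)\<^sup>2) / 2 \<and> ((fst z)\<^sup>2 + (snd z)\<^sup>2) / 2 \<le> s}
     = cball 0 (sqrt (2 * s)) - cball 0 (sqrt (2 * u))"
    by (auto simp only: in_disc Diff_iff mem_Collect_eq not_le)
  moreover have mono: "sqrt (2 * u) \<le> sqrt (2 * s)" using assms by simp
  moreover have "emeasure lborel (cball 0 (sqrt (2 * s)) - cball (0 :: real \<times> real) (sqrt (2 * u)))
      = ennreal (2 * pi * s) - ennreal (2 * pi * u)"
    using assms by (subst emeasure_Diff) (auto simp: disc intro: order_trans[OF _ mono])
  moreover have "ennreal (2 * pi * s) - ennreal (2 * pi * u) = ennreal (2 * pi * (s - u))"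
    using assms by (subst ennreal_minus) (auto simp: algebra_simps)
  ultimately show ?thesis by simp
qed

text \<open>
  The chi-squared law with two degrees of freedom is exponential. With \<open>exp (- q)\<close>
  written as the integral of \<open>exp (- s)\<close> over \<open>s \<ge> q\<close>, exchanging
  the order of integration leaves areas of annuli.
\<close>
lemma half_square_sum_tail:
  assumes "0 \<le> u"
  shows "measure (half_square_law \<star> half_square_law) {u<..} = exp (- u)"
proof -
  interpret N: prob_space std_normal_distribution by (rule prob_space_std_normal)
  let ?N = std_normal_distribution
  define q where "q = (\<lambda>z :: real \<times> real. ((fst z)\<^sup>2 + (snd z)\<^sup>2) / 2)"
  have q[measurable]: "q \<in> borel_measurable (borel \<Otimes>\<^sub>M borel)" unfolding q_def by measurable
  have "emeasure (half_square_law \<star> half_square_law) {u<..} = (\<integral>\<^sup>+z. indicator {u<..} z \<partial>(half_square_law \<star> half_square_law))"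
    by simp
  also have "\<dots> = (\<integral>\<^sup>+x. \<integral>\<^sup>+y. indicator {u<..} (x + y) \<partial>half_square_law \<partial>half_square_law)"
    by (rule nn_integral_convolution) (auto intro: N.finite_measure_distr)
  also have "\<dots> = (\<integral>\<^sup>+x. \<integral>\<^sup>+y. ennreal (1 / (2 * pi)) * (ennreal (exp (- q (x, y))) * indicator {u<..} (q (x, y))) \<partial>lborel \<partial>lborel)"
    by (simp add: nn_integral_distr nn_integral_density nn_integral_cmult[symmetric] q_def add_divide_distrib)
       (auto intro!: nn_integral_cong simp: std_normal_density_def indicator_def ennreal_mult[symmetric] exp_add[symmetric] exp_minus field_simps)
  also have "\<dots> = ennreal (1 / (2 * pi)) * (\<integral>\<^sup>+z. ennreal (exp (- q z)) * indicator {u<..} (q z) \<partial>lborel)"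
    by (subst lborel_prod[symmetric], subst lborel.nn_integral_fst[symmetric]) (auto simp: nn_integral_cmult)
  also have "(\<integral>\<^sup>+z. ennreal (exp (- q z)) * indicator {u<..} (q z) \<partial>lborel)
     = (\<integral>\<^sup>+z. \<integral>\<^sup>+s. ennreal (exp (- s)) * indicator {q z..} s * indicator {u<..} (q z) \<partial>lborel \<partial>lborel)"
    by (simp add: nn_integral_exp_tail nn_integral_multc)
  also have "\<dots> = (\<integral>\<^sup>+s. \<integral>\<^sup>+z. ennreal (exp (- s)) * indicator {q z..} s * indicator {u<..} (q z) \<partial>lborel \<partial>lborel)"
    by (rule lborel_pair.Fubini'[symmetric]) (simp add: q_def indicator_def[abs_def] split_beta' lborel_prod[symmetric])
  also have "\<dots> = (\<integral>\<^sup>+s. ennreal (2 * pi) * (ennreal (exp (- s) * (s - u)) * indicator {u..} s) \<partial>lborel)"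
  proof (intro nn_integral_cong)
    fix s :: real
    let ?A = "{z. u < q z \<and> q z \<le> s}"
    have "(\<integral>\<^sup>+z. ennreal (exp (- s)) * indicator {q z..} s * indicator {u<..} (q z) \<partial>lborel)
      = (\<integral>\<^sup>+z. ennreal (exp (- s)) * indicator ?A z \<partial>lborel)"
      by (intro nn_integral_cong) (auto simp: indicator_def)
    also have "\<dots> = ennreal (exp (- s)) * emeasure lborel ?A"
    proof (rule nn_integral_cmult_indicator)
      have "?A = q -` {u<..s} \<inter> space (borel \<Otimes>\<^sub>M borel)" by (auto simp: space_pair_measure)
      then have "?A \<in> sets (borel \<Otimes>\<^sub>M borel)" using measurable_sets[OF q, of "{u<..s}"] by simp
      then show "?A \<in> sets lborel" by (metis borel_prod sets_lborel)
    qed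
    also have "\<dots> = ennreal (2 * pi) * (ennreal (exp (- s) * (s - u)) * indicator {u..} s)"
    proof (cases "u \<le> s")
      case True
      then show ?thesis using emeasure_annulus[OF assms True]
        by (simp add: q_def ennreal_mult[symmetric] mult_ac)
    next
      case False
      then have e: "?A = {}" by auto
      show ?thesis unfolding e using False by simp
    qed
    finally show "(\<integral>\<^sup>+z. ennreal (exp (- s)) * indicator {q z..} s * indicator {u<..} (q z) \<partial>lborel) = \<dots>" .
  qed
  also have "\<dots> = ennreal (2 * pi) * ennreal (exp (- u))"
    by (simp add: nn_integral_cmult nn_integral_linear_exp_tail)
  also have "ennreal (1 / (2 * pi)) * \<dots> = ennreal (exp (- u))"
    by (simp add: ennreal_mult[symmetric])
  finally show ?thesis by (simp add: measure_def)
qed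

text \<open>
  Where \<open>x\<^sup>2 / 2 \<le> A\<close> the exponential cancels the normal density up to the
  constant \<open>1 / sqrt (2 * pi)\<close>, so an interval of length \<open>2 * sqrt (2 *
  A)\<close> contributes its length. Outside, the integrand is at most the sum of two normal
  densities centred at the end points, which contribute at most \<open>2\<close>.
\<close>
lemma texp_half_square:
  assumes "0 \<le> A"
  shows "sqrt A \<le> texp half_square_law A" "texp half_square_law A \<le> 2 * sqrt A + 2"
proof -
  have eq: "texp half_square_law A = (\<integral>x. std_normal_density x * exp (min (x\<^sup>2 / 2) A) \<partial>lborel)"
    unfolding texp_def by (simp add: integral_distr integral_density)
  have int: "integrable lborel (\<lambda>x. std_normal_density x * exp (min (x\<^sup>2 / 2) A))"
    by (rule Bochner_Integration.integrable_bound[where f="\<lambda>x. exp A * std_normal_density x"])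
       (auto simp: abs_mult mult.commute[of "exp A"] intro!: mult_left_mono AE_I2)
  let ?r = "sqrt (2 * A)"
  have i: "(\<integral>x. indicator {-?r..?r} x / sqrt (2 * pi) \<partial>lborel) = 2 * sqrt (2 * A) / sqrt (2 * pi)"
    using assms by simp
  have s: "2 * sqrt (2 * A) / sqrt (2 * pi) = 2 / sqrt pi * sqrt A"
    by (simp add: real_sqrt_mult field_simps)
  have ind: "integrable lborel (\<lambda>x. indicator {-?r..?r} x / sqrt (2 * pi) :: real)"
    by (intro integrable_divide integrable_real_indicator) (auto simp: emeasure_lborel_Icc_eq)
  \<comment> \<open>the interval on which the truncation is inactive\<close>
  have inn: "x \<in> {-?r..?r} \<longleftrightarrow> x\<^sup>2 / 2 \<le> A" for x
    using abs_le_square_iff[of x ?r] assms by auto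
  have "sqrt pi \<le> 2" using pi_less_4 real_sqrt_le_mono[of pi 4] by simp
  then have "sqrt A \<le> 2 / sqrt pi * sqrt A"
    using assms by (simp add: field_simps mult_left_mono)
  also have "\<dots> \<le> texp half_square_law A"
    unfolding eq s[symmetric] i[symmetric]
  proof (rule integral_mono)
    fix x show "indicator {-?r..?r} x / sqrt (2 * pi) \<le> std_normal_density x * exp (min (x\<^sup>2 / 2) A)"
      by (cases "x\<^sup>2 / 2 \<le> A") (auto simp: indicator_def inn std_normal_density_def exp_add[symmetric] simp del: atLeastAtMost_iff)
  qed (auto intro: int ind)
  finally show "sqrt A \<le> texp half_square_law A" .
  have nd: "normal_density m 1 x = exp (- (x - m)\<^sup>2 / 2) / sqrt (2 * pi)" for m x
    by (simp add: normal_density_def)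
  have "texp half_square_law A \<le> (\<integral>x. indicator {-?r..?r} x / sqrt (2 * pi) + (normal_density ?r 1 x + normal_density (-?r) 1 x) \<partial>lborel)"
    unfolding eq
  proof (rule integral_mono)
    fix x
    show "std_normal_density x * exp (min (x\<^sup>2 / 2) A) \<le> indicator {-?r..?r} x / sqrt (2 * pi) + (normal_density ?r 1 x + normal_density (-?r) 1 x)"
    proof (cases "x\<^sup>2 / 2 \<le> A")
      case True
      then show ?thesis
        by (auto simp: indicator_def inn std_normal_density_def exp_add[symmetric] simp del: atLeastAtMost_iff)
    next
      case False
      then have "x \<notin> {-?r..?r}" using inn by blast
      \<comment> \<open>the end point nearer to \<open>x\<close> works, because \<open>?r\<^sup>2 = 2 * A\<close> and \<open>\<bar>x\<bar> > ?r\<close>\<close>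
      then have "A - x\<^sup>2 / 2 \<le> - (x - ?r)\<^sup>2 / 2 \<or> A - x\<^sup>2 / 2 \<le> - (x + ?r)\<^sup>2 / 2"
      proof -
        have r: "?r * ?r = 2 * A" using assms by simp
        have "x > ?r \<or> x < - ?r" using \<open>x \<notin> _\<close> by auto
        then show ?thesis
        proof
          assume "x > ?r"
          then have "?r * ?r \<le> x * ?r" using assms by (intro mult_right_mono) auto
          then show ?thesis using r by (auto simp: power2_eq_square algebra_simps)
        next
          assume "x < - ?r"
          then have "?r * ?r \<le> (- x) * ?r" using assms by (intro mult_right_mono) auto
          then show ?thesis using r by (auto simp: power2_eq_square algebra_simps)
        qed
      qed
      then have "exp (A - x\<^sup>2 / 2) \<le> exp (- (x - ?r)\<^sup>2 / 2) + exp (- (x + ?r)\<^sup>2 / 2)"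
        by (smt (verit) exp_ge_zero exp_le_cancel_iff)
      then show ?thesis using False \<open>x \<notin> _\<close>
        by (simp add: nd std_normal_density_def min_def exp_add[symmetric] add_divide_distrib[symmetric] divide_right_mono del: atLeastAtMost_iff)
    qed
  qed (auto intro: int ind)
  also have "\<dots> = 2 / sqrt pi * sqrt A + 2"
    using assms by (simp add: s)
  also have "\<dots> \<le> 2 * sqrt A + 2"
  proof -
    have "1 \<le> sqrt pi" using pi_gt3 by simp
    then have "2 / sqrt pi \<le> 2" by (simp add: field_simps)
    then show ?thesis using assms by (intro add_right_mono mult_right_mono) auto
  qed
  finally show "texp half_square_law A \<le> 2 * sqrt A + 2" .
qed

lemma half_chi_0: "texp (half_chi 0) A = exp (min 0 A)"
proof -
  interpret N: prob_space "Pi\<^sub>M {..<0::nat} (\<lambda>_. std_normal_distribution)"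
    by (rule prob_space_PiM) (rule prob_space_std_normal)
  show ?thesis unfolding half_chi_eq texp_def
    using N.prob_space by (simp add: integral_distr)
qed

lemma texp_half_chi_le:
  assumes "1 \<le> A" shows "texp (half_chi d) A \<le> (4 * sqrt A) ^ d"
proof (induction d)
  case 0 then show ?case using assms by (simp add: half_chi_0)
next
  case (Suc d)
  have "texp (half_chi (Suc d)) A \<le> texp half_square_law A * texp (half_chi d) A"
    unfolding half_chi_Suc using assms nonneg_law_half_chi nonneg_law_half_square
    by (intro texp_convolution_le) auto
  also have "\<dots> \<le> (4 * sqrt A) * (4 * sqrt A) ^ d"
  proof (intro mult_mono Suc.IH texp_nonneg)
    have "1 \<le> sqrt A" using assms by simp
    then show "texp half_square_law A \<le> 4 * sqrt A"
      using texp_half_square(2)[of A] assms by linarith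
  qed (use assms in auto)
  finally show ?case by simp
qed

lemma texp_half_chi_ge:
  assumes "0 \<le> A" shows "sqrt A ^ d \<le> texp (half_chi d) (real d * A)"
proof (induction d)
  case 0 then show ?case using assms by (simp add: half_chi_0)
next
  case (Suc d)
  have "sqrt A ^ Suc d \<le> texp half_square_law A * texp (half_chi d) (real d * A)"
    unfolding power_Suc using assms Suc.IH texp_half_square(1) texp_nonneg by (intro mult_mono) auto
  also have "\<dots> \<le> texp (half_chi (Suc d)) (A + real d * A)"
    unfolding half_chi_Suc using nonneg_law_half_chi nonneg_law_half_square
    by (intro texp_convolution_ge) auto
  finally show ?case by (simp add: algebra_simps)
qed

text \<open>
  Two of the squares form a standard exponential variable; the others stay in the truncated
  moment.
\<close>
lemma half_chi_plus2_tail: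
  assumes "real_distribution \<beta>"
  shows "measure (\<beta> \<star> half_chi (Suc (Suc d))) {a<..} = exp (- a) * texp (\<beta> \<star> half_chi d) a"
proof -
  note r = assms nonneg_law_half_chi[THEN conjunct1] nonneg_law_half_square[THEN conjunct1]
  note fin = r[THEN prob_space.finite_measure[OF real_distribution.axioms(1)]]
  note sets = r[THEN real_distribution.events_eq_borel]
  let ?h = half_square_law
  have c1: "(\<beta> \<star> half_chi (Suc (Suc d))) = (half_chi (Suc (Suc d)) \<star> \<beta>)"
    by (intro convolution_commutative) (auto simp: fin sets)
  have c2: "half_chi (Suc (Suc d)) = ((?h \<star> ?h) \<star> half_chi d)"
    unfolding half_chi_Suc by (intro convolution_associative) (auto simp: fin sets)
  have c3: "(((?h \<star> ?h) \<star> half_chi d) \<star> \<beta>) = ((?h \<star> ?h) \<star> (half_chi d \<star> \<beta>))"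
    by (intro convolution_associative[symmetric]) (auto simp: fin sets intro!: convolution_finite)
  have c4: "(half_chi d \<star> \<beta>) = (\<beta> \<star> half_chi d)"
    by (intro convolution_commutative) (auto simp: fin sets)
  show ?thesis
    by (subst c1, subst c2, subst c3, subst c4) (intro exp_tail_convolution real_distribution_convolution half_square_sum_tail r)
qed

section \<open>Gaussian noise and the drifting random walk\<close>

interpretation noise: sequence_space std_normal_distribution
proof -
  interpret product_prob_space "\<lambda>i::nat. std_normal_distribution" UNIV
    by (intro product_prob_spaceI prob_space_std_normal)
  show "sequence_space std_normal_distribution" by unfold_locales
qed

abbreviation noise :: "(nat \<Rightarrow> real) measure" where
  "noise \<equiv> Pi\<^sub>M UNIV (\<lambda>_. std_normal_distribution)"

lemma space_noise [simp]: "space noise = UNIV"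
  by (simp add: space_PiM PiE_UNIV_domain)

lemma coord_measurable [measurable]: "(\<lambda>x. x i) \<in> borel_measurable noise"
proof -
  have "(\<lambda>x. x i) \<in> noise \<rightarrow>\<^sub>M std_normal_distribution" by measurable
  then show ?thesis by simp
qed

lemma measurable_into_noise:
  assumes "\<And>i. (\<lambda>x. f x i) \<in> borel_measurable K"
  shows "f \<in> K \<rightarrow>\<^sub>M noise"
  using assms by (intro measurable_PiM_single') auto

text \<open>
  The first \<open>j\<close> coordinates and the remaining ones are independent.
\<close>
lemma nn_integral_noise_split:
  assumes [measurable]: "f \<in> borel_measurable noise"
  shows "(\<integral>\<^sup>+x. f x \<partial>noise) = (\<integral>\<^sup>+x. \<integral>\<^sup>+y. f (comb_seq j x y) \<partial>noise \<partial>noise)"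
proof -
  have "(\<integral>\<^sup>+x. f x \<partial>noise) = (\<integral>\<^sup>+x. f x \<partial>distr (noise \<Otimes>\<^sub>M noise) noise (\<lambda>(x, y). comb_seq j x y))"
    by (simp add: noise.PiM_comb_seq)
  also have "\<dots> = (\<integral>\<^sup>+z. f (comb_seq j (fst z) (snd z)) \<partial>(noise \<Otimes>\<^sub>M noise))"
    by (subst nn_integral_distr) (auto simp: split_beta')
  also have "\<dots> = (\<integral>\<^sup>+x. \<integral>\<^sup>+y. f (comb_seq j x y) \<partial>noise \<partial>noise)"
    by (subst noise.nn_integral_fst[symmetric]) auto
  finally show ?thesis .
qed

lemma nn_integral_noise_Cons:
  assumes [measurable]: "f \<in> borel_measurable noise"
  shows "(\<integral>\<^sup>+x. f x \<partial>noise) = (\<integral>\<^sup>+y. \<integral>\<^sup>+s. f (case_nat s y) \<partial>std_normal_distribution \<partial>noise)"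
proof -
  interpret N: prob_space std_normal_distribution by (rule prob_space_std_normal)
  interpret p: pair_prob_space std_normal_distribution noise ..
  have m: "(\<lambda>(s, \<omega>). case_nat s \<omega>) \<in> std_normal_distribution \<Otimes>\<^sub>M noise \<rightarrow>\<^sub>M noise"
    by measurable
  have "(\<integral>\<^sup>+x. f x \<partial>noise) = (\<integral>\<^sup>+x. f x \<partial>distr (std_normal_distribution \<Otimes>\<^sub>M noise) noise (\<lambda>(s, y). case_nat s y))"
    by (simp add: noise.PiM_iter)
  also have "\<dots> = (\<integral>\<^sup>+z. f (case_nat (fst z) (snd z)) \<partial>(std_normal_distribution \<Otimes>\<^sub>M noise))"
    using m by (subst nn_integral_distr) (auto simp: split_beta')
  also have "\<dots> = (\<integral>\<^sup>+y. \<integral>\<^sup>+s. f (case_nat s y) \<partial>std_normal_distribution \<partial>noise)"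
    using m by (subst p.nn_integral_snd[symmetric]) (auto simp: split_beta' intro!: measurable_compose[OF _ assms])
  finally show ?thesis .
qed

lemma nn_integral_noise_reindex:
  assumes [measurable]: "f \<in> borel_measurable noise" and "inj \<pi>"
  shows "(\<integral>\<^sup>+x. f (\<lambda>i. x (\<pi> i)) \<partial>noise) = (\<integral>\<^sup>+x. f x \<partial>noise)"
proof -
  have "(\<integral>\<^sup>+x. f x \<partial>noise) = (\<integral>\<^sup>+x. f x \<partial>distr noise noise (\<lambda>x. \<lambda>n\<in>UNIV. x (\<pi> n)))"
    using assms(2) by (subst distr_PiM_reindex) (auto intro: prob_space_std_normal)
  also have "\<dots> = (\<integral>\<^sup>+x. f (\<lambda>i. x (\<pi> i)) \<partial>noise)"
    by (subst nn_integral_distr) (auto intro!: measurable_into_noise simp: restrict_UNIV)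
  finally show ?thesis ..
qed

text \<open>
  Tilting moves the mean to \<open>\<theta>\<close>. The tilted variable is represented as
  \<open>\<theta> - s\<close> instead of \<open>\<theta> + s\<close>, which has the same law: the
  reflection turns the walk below into its negative.
\<close>
lemma nn_integral_std_normal_tilt:
  assumes [measurable]: "g \<in> borel_measurable borel"
  shows "(\<integral>\<^sup>+s. ennreal (exp (\<theta> * s - \<theta>\<^sup>2 / 2)) * g s \<partial>std_normal_distribution)
    = (\<integral>\<^sup>+s. g (\<theta> - s) \<partial>std_normal_distribution)"
proof -
  have dens: "ennreal (std_normal_density s) * (ennreal (exp (\<theta> * s - \<theta>\<^sup>2 / 2)) * g s)
      = ennreal (std_normal_density (\<theta> - s)) * g s" for s
  proof -
    have "- s\<^sup>2 / 2 + (\<theta> * s - \<theta>\<^sup>2 / 2) = - (\<theta> - s)\<^sup>2 / 2"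
      by (simp add: power2_eq_square field_simps)
    then have "std_normal_density s * exp (\<theta> * s - \<theta>\<^sup>2 / 2) = std_normal_density (\<theta> - s)"
      by (simp add: std_normal_density_def exp_add[symmetric])
    then show ?thesis by (simp add: mult.assoc[symmetric] ennreal_mult[symmetric])
  qed
  have "(\<integral>\<^sup>+s. ennreal (exp (\<theta> * s - \<theta>\<^sup>2 / 2)) * g s \<partial>std_normal_distribution)
     = (\<integral>\<^sup>+s. ennreal (std_normal_density (\<theta> - s)) * g s \<partial>lborel)"
    by (subst nn_integral_density) (simp_all add: dens)
  also have "\<dots> = (\<integral>\<^sup>+s. ennreal (std_normal_density s) * g (\<theta> - s) \<partial>lborel)"
    by (subst nn_integral_real_affine[where c="-1" and t=\<theta>]) simp_all
  also have "\<dots> = (\<integral>\<^sup>+s. g (\<theta> - s) \<partial>std_normal_distribution)"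
    by (subst nn_integral_density) simp_all
  finally show ?thesis .
qed

text \<open>
  The logarithm of the likelihood ratio between two unit-variance normal laws whose means differ
  by \<open>d\<close>, evaluated along noise; its exponential has mean one.
\<close>
definition walk :: "real \<Rightarrow> (nat \<Rightarrow> real) \<Rightarrow> nat \<Rightarrow> real" where
  "walk d x j = (\<Sum>i<j. d * x i - d\<^sup>2 / 2)"

definition reflect :: "real \<Rightarrow> nat \<Rightarrow> (nat \<Rightarrow> real) \<Rightarrow> nat \<Rightarrow> real" where
  "reflect \<theta> j x i = (if i < j then \<theta> - x i else x i)"

lemma walk_0 [simp]: "walk d x 0 = 0" and walk_Suc: "walk d x (Suc j) = walk d x j + (d * x j - d\<^sup>2 / 2)"
  by (auto simp: walk_def)

lemma walk_measurable [measurable]: "(\<lambda>x. walk d x j) \<in> borel_measurable noise"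
  unfolding walk_def by measurable

lemma reflect_measurable [measurable]: "reflect \<theta> j \<in> noise \<rightarrow>\<^sub>M noise"
  unfolding reflect_def[abs_def] by (rule measurable_into_noise) auto

lemma nn_integral_tilt_coordinate:
  assumes [measurable]: "f \<in> borel_measurable noise"
  shows "(\<integral>\<^sup>+x. ennreal (exp (\<theta> * x j - \<theta>\<^sup>2 / 2)) * f x \<partial>noise) = (\<integral>\<^sup>+x. f (x(j := \<theta> - x j)) \<partial>noise)"
proof -
  have m: "(\<lambda>x. x(j := \<theta> - x j)) \<in> noise \<rightarrow>\<^sub>M noise"
  proof (rule measurable_into_noise)
    fix i show "(\<lambda>x. (x(j := \<theta> - x j)) i) \<in> borel_measurable noise"
      by (cases "i = j") simp_all
  qed
  have m2: "(\<lambda>s. f (comb_seq j x (case_nat s y))) \<in> borel_measurable borel" for x y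
  proof -
    have "(\<lambda>s. comb_seq j x (case_nat s y)) \<in> borel \<rightarrow>\<^sub>M noise"
      by (rule measurable_into_noise) (auto simp: comb_seq_def split: nat.split)
    from measurable_compose[OF this assms] show ?thesis .
  qed
  have split: "(\<integral>\<^sup>+x. h x \<partial>noise) = (\<integral>\<^sup>+x. \<integral>\<^sup>+y. \<integral>\<^sup>+s. h (comb_seq j x (case_nat s y)) \<partial>std_normal_distribution \<partial>noise \<partial>noise)"
    if [measurable]: "h \<in> borel_measurable noise" for h :: "(nat \<Rightarrow> real) \<Rightarrow> ennreal"
  proof -
    have "(\<lambda>y. comb_seq j x y) \<in> noise \<rightarrow>\<^sub>M noise" for x
      by (rule measurable_into_noise) (auto simp: comb_seq_def)
    then have "(\<lambda>y. h (comb_seq j x y)) \<in> borel_measurable noise" for x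
      by (rule measurable_compose) fact
    from nn_integral_noise_Cons[OF this] show ?thesis
      using nn_integral_noise_split[OF that, of j] by simp
  qed
  have "(\<integral>\<^sup>+x. ennreal (exp (\<theta> * x j - \<theta>\<^sup>2 / 2)) * f x \<partial>noise) =
     (\<integral>\<^sup>+x. \<integral>\<^sup>+y. \<integral>\<^sup>+s. ennreal (exp (\<theta> * s - \<theta>\<^sup>2 / 2)) * f (comb_seq j x (case_nat s y)) \<partial>std_normal_distribution \<partial>noise \<partial>noise)"
    by (rule trans[OF split]) (simp_all add: comb_seq_def)
  also have "\<dots> = (\<integral>\<^sup>+x. \<integral>\<^sup>+y. \<integral>\<^sup>+s. f (comb_seq j x (case_nat (\<theta> - s) y)) \<partial>std_normal_distribution \<partial>noise \<partial>noise)"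
    by (intro nn_integral_cong nn_integral_std_normal_tilt m2)
  also have "\<dots> = (\<integral>\<^sup>+x. \<integral>\<^sup>+y. \<integral>\<^sup>+s. f ((comb_seq j x (case_nat s y))(j := \<theta> - comb_seq j x (case_nat s y) j)) \<partial>std_normal_distribution \<partial>noise \<partial>noise)"
    by (intro nn_integral_cong arg_cong[where f=f]) (auto simp: comb_seq_def fun_eq_iff split: nat.split)
  also have "\<dots> = (\<integral>\<^sup>+x. f (x(j := \<theta> - x j)) \<partial>noise)"
    by (rule split[symmetric]) (rule measurable_compose[OF m assms])
  finally show ?thesis .
qed

text \<open>
  The exponential of the walk is a product over the coordinates, so the coordinates can be tilted
  one after the other.
\<close>
lemma nn_integral_tilt:
  assumes "f \<in> borel_measurable noise"
  shows "(\<integral>\<^sup>+x. ennreal (exp (walk \<theta> x j)) * f x \<partial>noise) = (\<integral>\<^sup>+x. f (reflect \<theta> j x) \<partial>noise)"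
  using assms
proof (induction j arbitrary: f)
  case 0
  then show ?case by (simp add: reflect_def[abs_def])
next
  case (Suc j)
  note [measurable] = Suc.prems
  have "(\<integral>\<^sup>+x. ennreal (exp (walk \<theta> x (Suc j))) * f x \<partial>noise)
     = (\<integral>\<^sup>+x. ennreal (exp (walk \<theta> x j)) * (ennreal (exp (\<theta> * x j - \<theta>\<^sup>2 / 2)) * f x) \<partial>noise)"
    by (simp add: walk_Suc exp_add ennreal_mult mult.assoc)
  also have "\<dots> = (\<integral>\<^sup>+x. ennreal (exp (\<theta> * x j - \<theta>\<^sup>2 / 2)) * f (reflect \<theta> j x) \<partial>noise)"
    by (subst Suc.IH) (auto simp: reflect_def)
  also have "\<dots> = (\<integral>\<^sup>+x. f (reflect \<theta> j (x(j := \<theta> - x j))) \<partial>noise)"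
    by (rule nn_integral_tilt_coordinate) measurable
  also have "\<dots> = (\<integral>\<^sup>+x. f (reflect \<theta> (Suc j) x) \<partial>noise)"
    by (intro nn_integral_cong arg_cong[where f=f]) (auto simp: reflect_def fun_eq_iff less_Suc_eq)
  finally show ?case .
qed

lemma walk_reflect: "k \<le> j \<Longrightarrow> walk d (reflect d j x) k = - walk d x k"
  unfolding walk_def sum_negf[symmetric]
  by (intro sum.cong) (auto simp: reflect_def power2_eq_square algebra_simps)

text \<open>
  A multiple of the walk is the walk with a rescaled drift parameter, up to a deterministic linear
  term.
\<close>
lemma nn_integral_exp_walk:
  "(\<integral>\<^sup>+x. ennreal (exp (\<theta> * walk d x j)) \<partial>noise) = ennreal (exp ((\<theta>\<^sup>2 - \<theta>) * d\<^sup>2 / 2 * j))"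
proof -
  \<comment> \<open>the linear term vanishes for \<open>\<theta> = 1\<close>, the martingale case\<close>
  have eq: "\<theta> * walk d x j = walk (\<theta> * d) x j + (\<theta>\<^sup>2 - \<theta>) * d\<^sup>2 / 2 * j" for x
    by (induction j) (auto simp: walk_Suc power2_eq_square field_simps)
  have "(\<integral>\<^sup>+x. ennreal (exp (\<theta> * walk d x j)) \<partial>noise)
     = (\<integral>\<^sup>+x. ennreal (exp ((\<theta>\<^sup>2 - \<theta>) * d\<^sup>2 / 2 * j)) * (ennreal (exp (walk (\<theta> * d) x j)) * 1) \<partial>noise)"
    by (simp add: eq exp_add ennreal_mult mult.commute)
  also have "\<dots> = ennreal (exp ((\<theta>\<^sup>2 - \<theta>) * d\<^sup>2 / 2 * j))"
    by (subst nn_integral_cmult, measurable, subst nn_integral_tilt)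
       (auto simp: noise.emeasure_space_1[simplified])
  finally show ?thesis .
qed

lemma noise_indep: "noise.indep_vars (\<lambda>_. borel) (\<lambda>i x. x i) I"
proof -
  have "noise.indep_vars (\<lambda>_. borel) (\<lambda>i x. x i) UNIV"
  proof (subst noise.indep_vars_iff_distr_eq_PiM)
    have "distr noise (Pi\<^sub>M UNIV (\<lambda>_. borel)) (\<lambda>x. \<lambda>i\<in>UNIV. x i) = distr noise noise (\<lambda>x. x)"
      by (intro distr_cong sets_PiM_cong) auto
    also have "\<dots> = noise" by (rule distr_id)
    also have "\<dots> = Pi\<^sub>M UNIV (\<lambda>i. distr noise borel (\<lambda>x. x i))"
    proof (intro PiM_cong refl)
      fix i :: nat
      have "distr noise std_normal_distribution (\<lambda>x. x i) = std_normal_distribution"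
        by (rule distr_PiM_component) (auto intro: prob_space_std_normal)
      moreover have "distr noise borel (\<lambda>x. x i) = distr noise std_normal_distribution (\<lambda>x. x i)"
        by (intro distr_cong) auto
      ultimately show "std_normal_distribution = distr noise borel (\<lambda>x. x i)" by simp
    qed
    finally show "distr noise (Pi\<^sub>M UNIV (\<lambda>_. borel)) (\<lambda>x. \<lambda>i\<in>UNIV. x i) = Pi\<^sub>M UNIV (\<lambda>i. distr noise borel (\<lambda>x. x i))" .
  qed auto
  then show ?thesis by (rule noise.indep_vars_subset) auto
qed

lemma coord_distributed: "distributed noise lborel (\<lambda>x. x i) std_normal_density"
proof -
  have "distr noise std_normal_distribution (\<lambda>x. x i) = std_normal_distribution"
    by (rule distr_PiM_component) (auto intro: prob_space_std_normal)
  moreover have "distr noise lborel (\<lambda>x. x i) = distr noise std_normal_distribution (\<lambda>x. x i)"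
    by (intro distr_cong) auto
  ultimately show ?thesis by (simp add: distributed_def)
qed

lemma sum_coords_distributed:
  assumes "finite I" "I \<noteq> {}"
  shows "distributed noise lborel (\<lambda>x. \<Sum>i\<in>I. x i) (normal_density 0 (sqrt (card I)))"
proof -
  have "distributed noise lborel (\<lambda>x. \<Sum>i\<in>I. x i) (normal_density (\<Sum>i\<in>I. 0) (sqrt (\<Sum>i\<in>I. 1\<^sup>2)))"
    by (rule noise.sum_indep_normal[OF assms noise_indep]) (auto intro: coord_distributed)
  then show ?thesis by simp
qed

section \<open>Ladder epochs and Spitzer's formula\<close>

definition psum :: "(nat \<Rightarrow> real) \<Rightarrow> nat \<Rightarrow> real" where
  "psum x k = (\<Sum>i<k. x i)"

definition is_record :: "(nat \<Rightarrow> real) \<Rightarrow> nat \<Rightarrow> bool" where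
  "is_record x k \<longleftrightarrow> (\<forall>i<k. psum x i < psum x k)"

text \<open>
  Counts strict ascending ladder epochs; time \<open>0\<close>, which satisfies the record
  condition vacuously, is left out.
\<close>
definition records :: "(nat \<Rightarrow> real) \<Rightarrow> nat \<Rightarrow> nat" where
  "records x n = card {k \<in> {1..n}. is_record x k}"

lemma psum_cong: "(\<And>i. i < k \<Longrightarrow> x i = y i) \<Longrightarrow> psum x k = psum y k"
  unfolding psum_def by (intro sum.cong) auto

lemma is_record_cong:
  assumes "\<And>i. i < k \<Longrightarrow> x i = y i" shows "is_record x k = is_record y k"
proof -
  have "psum x i = psum y i" if "i \<le> k" for i
    using assms that by (intro psum_cong) auto
  then show ?thesis unfolding is_record_def by auto
qed

lemma records_cong:
  assumes "\<And>i. i < n \<Longrightarrow> x i = y i" shows "records x n = records y n"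
proof -
  have "is_record x k = is_record y k" if "k \<le> n" for k
    using assms that by (intro is_record_cong) auto
  then show ?thesis unfolding records_def by (intro arg_cong[where f=card]) auto
qed

lemma sum_periodic:
  fixes h :: "nat \<Rightarrow> nat"
  assumes "\<And>i. h (i + n) = h i"
  shows "(\<Sum>k=1..n. h (r + k)) = (\<Sum>s<n. h s)"
proof (induction r)
  case 0
  show ?case
  proof (cases n)
    case (Suc m)
    have "(\<Sum>k=1..n. h k) = (\<Sum>k\<in>{1..<n}. h k) + h n"
      by (simp add: Suc atLeastLessThanSuc_atLeastAtMost[symmetric])
    also have "h n = h 0" using assms[of 0] by simp
    also have "(\<Sum>k\<in>{1..<n}. h k) + h 0 = (\<Sum>s\<in>{0..<n}. h s)"
      using Suc by (simp add: sum.atLeast_Suc_lessThan)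
    finally show ?thesis by (simp add: atLeast0LessThan)
  qed simp
next
  case (Suc r)
  have "(\<Sum>k=1..n. h (Suc r + k)) + h (r + 1) = (\<Sum>k=1..n. h (r + k)) + h (r + 1 + n)"
  proof (induction n)
    case (Suc n) then show ?case by (simp add: add.assoc add.commute add.left_commute)
  qed simp
  with Suc assms[of "r + 1"] show ?case by simp
qed

text \<open>
  Extend \<open>x\<close> periodically, with partial sums \<open>T\<close> that increase by
  \<open>D\<close> over each period. The last time \<open>n\<close> is a record of the rotation by
  \<open>r\<close> exactly when \<open>T (r + n)\<close> exceeds the \<open>n\<close> values
  before it. For such a rotation the records are the times at which this property recurs, so each
  of them has the same number of records as there are such rotations, and the weights sum up to
  one. Such a rotation exists if and only if \<open>D > 0\<close>.
\<close>
lemma cyclic_record_sum: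
  assumes "n > 0"
  shows "(\<Sum>r<n. if is_record (\<lambda>i. x ((r + i) mod n)) n then 1 / real (records (\<lambda>i. x ((r + i) mod n)) n) else 0)
    = (if psum x n > 0 then 1 else 0)"
proof -
  define T where "T j = (\<Sum>i<j. x (i mod n))" for j
  define D where "D = psum x n"
  define H where "H r \<longleftrightarrow> (\<forall>k<n. T (r + k) < T (r + n))" for r
  have T_per: "T (j + n) = T j + D" for j
  proof (induction j)
    case 0 then show ?case unfolding T_def D_def psum_def by (auto intro!: sum.cong)
  next
    case (Suc j) then show ?case by (simp add: T_def)
  qed
  have ps: "psum (\<lambda>i. x ((r + i) mod n)) k = T (r + k) - T r" for r k
    by (induction k) (auto simp: psum_def T_def)
  have H_iff: "is_record (\<lambda>i. x ((r + i) mod n)) n \<longleftrightarrow> H r" for r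
    unfolding is_record_def H_def ps by auto
  have H_per: "H (r + n) = H r" for r
    unfolding H_def using T_per[of "r + k" for k] T_per[of "r + n"] by (simp add: add.assoc add.commute add.left_commute)
  \<comment> \<open>along a good rotation, records and good starting points coincide\<close>
  have count: "records (\<lambda>i. x ((r + i) mod n)) n = card {s\<in>{..<n}. H s}" if "H r" for r
  proof -
    have rk: "is_record (\<lambda>i. x ((r + i) mod n)) k \<longleftrightarrow> H (r + k)" if k: "k \<in> {1..n}" for k
    proof
      assume a: "is_record (\<lambda>i. x ((r + i) mod n)) k"
      show "H (r + k)" unfolding H_def
      proof safe
        fix i assume "i < n"
        show "T (r + k + i) < T (r + k + n)"
        proof (cases "k + i < n")
          case True
          then have "T (r + (k + i)) < T (r + n)" using \<open>H r\<close> unfolding H_def by blast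
          also have "\<dots> = T r + D" by (rule T_per)
          also have "T r < T (r + k)" using a k unfolding is_record_def ps
            by (auto dest!: spec[of _ 0])
          finally show ?thesis using T_per[of "r + k"] by (simp add: add.assoc)
        next
          case False
          then obtain l where l: "k + i = l + n" by (metis le_Suc_ex not_less add.commute)
          then have "l < k" using \<open>i < n\<close> by linarith
          then have "T (r + l) < T (r + k)" using a unfolding is_record_def ps by auto
          then show ?thesis using T_per[of "r + l"] T_per[of "r + k"] l by (simp add: add.assoc)
        qed
      qed
    next
      assume a: "H (r + k)"
      show "is_record (\<lambda>i. x ((r + i) mod n)) k" unfolding is_record_def ps
      proof safe
        fix i assume "i < k"
        then have "i + n - k < n" using k by auto
        then have "T (r + k + (i + n - k)) < T (r + k + n)" using a unfolding H_def by blast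
        moreover have "r + k + (i + n - k) = r + i + n" using k by auto
        ultimately show "T (r + i) - T r < T (r + k) - T r"
          using T_per[of "r + i"] T_per[of "r + k"] by simp
      qed
    qed
    have "records (\<lambda>i. x ((r + i) mod n)) n = (\<Sum>k=1..n. if H (r + k) then 1 else 0)"
      unfolding records_def using rk by (subst card_eq_sum, subst sum.inter_filter) (auto intro!: sum.cong)
    also have "\<dots> = (\<Sum>s<n. if H s then 1 else 0)"
      by (rule sum_periodic) (simp add: H_per)
    finally show ?thesis by (subst card_eq_sum, subst sum.inter_filter) auto
  qed
  let ?c = "card {s\<in>{..<n}. H s}"
  have "(\<Sum>r<n. if is_record (\<lambda>i. x ((r + i) mod n)) n then 1 / real (records (\<lambda>i. x ((r + i) mod n)) n) else 0)
     = (\<Sum>r<n. if H r then 1 / real ?c else 0)"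
    using H_iff count by (intro sum.cong) auto
  also have "\<dots> = (\<Sum>r\<in>{s\<in>{..<n}. H s}. 1 / real ?c)"
    by (subst sum.inter_filter) auto
  also have "\<dots> = (if ?c > 0 then 1 else 0)" by simp
  also have "?c > 0 \<longleftrightarrow> D > 0"
  proof
    assume "?c > 0"
    then obtain r where "H r" by (auto simp: card_gt_0_iff)
    then have "T (r + 0) < T (r + n)" using assms unfolding H_def by blast
    then show "D > 0" by (simp add: T_per)
  next
    assume "D > 0"
    \<comment> \<open>the first maximum over the second period ends a good rotation; the first period supplies the preceding values\<close>
    let ?m = "Max (T ` {n..<2 * n})"
    define l where "l = (LEAST l. l \<in> {n..<2 * n} \<and> T l = ?m)"
    have ne: "finite (T ` {n..<2*n})" "T ` {n..<2*n} \<noteq> {}" using assms by auto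
    have "\<exists>l. l \<in> {n..<2 * n} \<and> T l = ?m" using Max_in[OF ne] by auto
    from LeastI_ex[OF this] have l: "l \<in> {n..<2 * n}" "T l = ?m" unfolding l_def by auto
    have below: "T i \<le> T l" if "i \<in> {n..<2*n}" for i
      unfolding l(2) using that by (intro Max_ge) auto
    have first: "T i < T l" if "n \<le> i" "i < l" for i
    proof -
      have "T i \<noteq> ?m" using not_less_Least[of i "\<lambda>l. l \<in> {n..<2 * n} \<and> T l = ?m"] that l(1)
        unfolding l_def[symmetric] by auto
      moreover have "T i \<le> T l" using below[of i] that l(1) by auto
      ultimately show ?thesis using l(2) by simp
    qed
    have "H (l - n)" unfolding H_def
    proof safe
      fix k assume k: "k < n"
      show "T (l - n + k) < T (l - n + n)"
      proof (cases "l - n + k < n")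
        case True
        have "T (l - n + k + n) \<le> T l" using l True by (intro below) auto
        then show ?thesis using \<open>D > 0\<close> l by (simp add: T_per)
      next
        case False
        then show ?thesis using l k by (intro first[of "l - n + k", THEN less_le_trans]) auto
      qed
    qed
    moreover have "l - n < n" using l by auto
    ultimately show "?c > 0" by (auto simp: card_gt_0_iff)
  qed
  finally show ?thesis by (simp add: D_def)
qed

definition steps :: "real \<Rightarrow> (nat \<Rightarrow> real) \<Rightarrow> nat \<Rightarrow> real" where
  "steps d z i = d * z i - d\<^sup>2 / 2"

lemma psum_steps: "psum (steps d z) k = walk d z k"
  by (simp add: psum_def steps_def walk_def)

lemma Collect_noise: "Measurable.pred noise P \<Longrightarrow> {z. P z} \<in> sets noise"
  by (drule predE) simp

lemma is_record_measurable [measurable]: "Measurable.pred noise (\<lambda>z. is_record (steps d z) k)"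
  unfolding is_record_def psum_steps by measurable

lemma records_measurable [measurable]: "(\<lambda>z. records (steps d z) n) \<in> noise \<rightarrow>\<^sub>M count_space UNIV"
proof -
  have "records (steps d z) n = (\<Sum>k=1..n. if is_record (steps d z) k then 1 else 0)" for z
    unfolding records_def by (subst card_eq_sum, subst sum.inter_filter) auto
  then show ?thesis by simp
qed

text \<open>
  Only the first \<open>n\<close> coordinates matter, so the rotation may be completed to an
  injective renumbering of all coordinates.
\<close>
lemma rotation_nn_integral:
  assumes "n > 0" and g [measurable]: "g \<in> borel_measurable noise"
    and dep: "\<And>z z'. (\<And>i. i < n \<Longrightarrow> z i = z' i) \<Longrightarrow> g z = g z'"
  shows "(\<integral>\<^sup>+z. g (\<lambda>i. z ((r + i) mod n)) \<partial>noise) = (\<integral>\<^sup>+z. g z \<partial>noise)"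
proof -
  define \<pi> where "\<pi> i = (if i < n then (r + i) mod n else i)" for i
  have "inj \<pi>"
  proof (rule injI)
    fix i j assume e: "\<pi> i = \<pi> j"
    have lt: "\<pi> i < n \<longleftrightarrow> i < n" for i using assms by (auto simp: \<pi>_def)
    show "i = j"
    proof (cases "i < n")
      case True
      with e lt have "j < n" by metis
      with True e have m: "(r + i) mod n = (r + j) mod n" by (simp add: \<pi>_def)
      have "n dvd j - i" if "i \<le> j" using m mod_eq_dvd_iff_nat[of "r + i" "r + j" n] that by simp
      moreover have "n dvd i - j" if "j \<le> i" using m mod_eq_dvd_iff_nat[of "r + j" "r + i" n] that by simp
      ultimately show ?thesis using True \<open>j < n\<close>
        by (cases "i \<le> j") (auto dest!: dvd_imp_le simp: less_imp_diff_less)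
    next
      case False
      with e lt have "\<not> j < n" by metis
      with False e show ?thesis by (simp add: \<pi>_def)
    qed
  qed
  have "(\<integral>\<^sup>+z. g (\<lambda>i. z ((r + i) mod n)) \<partial>noise) = (\<integral>\<^sup>+z. g (\<lambda>i. z (\<pi> i)) \<partial>noise)"
    by (intro nn_integral_cong dep) (auto simp: \<pi>_def)
  also have "\<dots> = (\<integral>\<^sup>+z. g z \<partial>noise)"
    by (rule nn_integral_noise_reindex) (auto intro: \<open>inj \<pi>\<close>)
  finally show ?thesis .
qed

text \<open>
  Average the cyclic lemma over the rotations, all of which preserve the law of the noise.
\<close>
lemma record_weight_integral:
  assumes "n > 0"
  shows "emeasure noise {z. walk d z n > 0} = ennreal (real n) *
    (\<integral>\<^sup>+z. ennreal (if is_record (steps d z) n then 1 / real (records (steps d z) n) else 0) \<partial>noise)"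
proof -
  let ?g = "\<lambda>z. ennreal (if is_record (steps d z) n then 1 / real (records (steps d z) n) else 0)"
  have [measurable]: "?g \<in> borel_measurable noise" by measurable
  have rot: "(\<lambda>i. steps d z ((r + i) mod n)) = steps d (\<lambda>i. z ((r + i) mod n))" for z r
    by (auto simp: steps_def)
  have m [measurable]: "(\<lambda>z. ?g (\<lambda>i. z ((r + i) mod n))) \<in> borel_measurable noise" for r
  proof -
    have "(\<lambda>z i. z ((r + i) mod n)) \<in> noise \<rightarrow>\<^sub>M noise" by (rule measurable_into_noise) simp
    then show ?thesis by (rule measurable_compose) measurable
  qed
  have "emeasure noise {z. walk d z n > 0} = (\<integral>\<^sup>+z. ennreal (if psum (steps d z) n > 0 then 1 else 0) \<partial>noise)"
    unfolding psum_steps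
    by (subst nn_integral_indicator[symmetric]) (auto intro!: nn_integral_cong Collect_noise simp: indicator_def)
  also have "\<dots> = (\<integral>\<^sup>+z. (\<Sum>r<n. ?g (\<lambda>i. z ((r + i) mod n))) \<partial>noise)"
  proof (rule nn_integral_cong)
    fix z
    show "ennreal (if psum (steps d z) n > 0 then 1 else 0) = (\<Sum>r<n. ?g (\<lambda>i. z ((r + i) mod n)))"
      unfolding cyclic_record_sum[OF assms, of "steps d z", symmetric] rot
      by (rule sum_ennreal[symmetric]) simp
  qed
  also have "\<dots> = (\<Sum>r<n. \<integral>\<^sup>+z. ?g (\<lambda>i. z ((r + i) mod n)) \<partial>noise)"
    by (rule nn_integral_sum) (rule m)
  also have "\<dots> = (\<Sum>r<n. \<integral>\<^sup>+z. ?g z \<partial>noise)"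
  proof (intro sum.cong refl rotation_nn_integral assms)
    fix z z' :: "nat \<Rightarrow> real" assume "\<And>i. i < n \<Longrightarrow> z i = z' i"
    then have "is_record (steps d z) n = is_record (steps d z') n" "records (steps d z) n = records (steps d z') n"
      by (intro is_record_cong records_cong; simp add: steps_def)+
    then show "?g z = ?g z'" by simp
  qed measurable
  also have "\<dots> = ennreal (real n) * (\<integral>\<^sup>+z. ?g z \<partial>noise)"
    by (simp add: ennreal_of_nat_eq_real_of_nat)
  finally show ?thesis .
qed

lemma is_record_0 [simp]: "is_record x 0"
  by (simp add: is_record_def)

lemma records_0 [simp]: "records x 0 = 0"
  by (simp add: records_def)

lemma records_step:
  assumes "k < l" "is_record x l" "\<And>j. k < j \<Longrightarrow> j < l \<Longrightarrow> \<not> is_record x j"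
  shows "records x l = Suc (records x k)"
proof -
  have "{j \<in> {1..l}. is_record x j} = insert l {j \<in> {1..k}. is_record x j}"
  proof (intro set_eqI iffI)
    fix j assume "j \<in> {j \<in> {1..l}. is_record x j}"
    then show "j \<in> insert l {j \<in> {1..k}. is_record x j}"
      using assms(3)[of j] by (cases "j = l") (auto simp: not_less[symmetric])
  qed (use assms in auto)
  then show ?thesis unfolding records_def using assms(1) by simp
qed

lemma records_less:
  assumes "k < l" "is_record x l" shows "records x k < records x l"
proof -
  have "l \<in> {j \<in> {1..l}. is_record x j}" "l \<notin> {j \<in> {1..k}. is_record x j}"
    using assms by auto
  moreover have "{j \<in> {1..k}. is_record x j} \<subseteq> {j \<in> {1..l}. is_record x j}"
    using assms by auto
  ultimately have "{j \<in> {1..k}. is_record x j} \<subset> {j \<in> {1..l}. is_record x j}" by blast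
  then show ?thesis unfolding records_def by (intro psubset_card_mono) auto
qed

definition record_at :: "real \<Rightarrow> nat \<Rightarrow> nat \<Rightarrow> (nat \<Rightarrow> real) set" where
  "record_at d r k = {z. is_record (steps d z) k \<and> records (steps d z) k = r}"

definition exceeds :: "real \<Rightarrow> (nat \<Rightarrow> real) set" where
  "exceeds d = {z. \<exists>k. walk d z k > 0}"

definition stay_prob :: "real \<Rightarrow> real" where
  "stay_prob d = measure noise {z. \<forall>k. walk d z k \<le> 0}"

lemma record_at_sets [measurable]: "record_at d r k \<in> sets noise"
  unfolding record_at_def by (rule Collect_noise) measurable

lemma exceeds_sets [measurable]: "exceeds d \<in> sets noise"
  unfolding exceeds_def by (rule Collect_noise) measurable

lemma record_at_disjoint: "k \<noteq> l \<Longrightarrow> record_at d r k \<inter> record_at d r l = {}"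
proof (induction k l rule: linorder_wlog)
  case (le k l)
  then show ?case using records_less[of k l] by (fastforce simp: record_at_def)
next
  case (sym k l)
  then show ?case by (simp add: Int_commute)
qed

lemma walk_add: "walk d z (k + i) = walk d z k + walk d (\<lambda>j. z (k + j)) i"
  by (induction i) (simp_all add: walk_Suc)

text \<open>
  A further record occurs exactly if the walk restarted at the current record ever becomes
  positive.
\<close>
lemma next_record:
  "(\<Union>l. record_at d (Suc r) l) = (\<Union>k. record_at d r k \<inter> {z. (\<lambda>j. z (k + j)) \<in> exceeds d})"
proof (intro set_eqI iffI)
  fix z assume "z \<in> (\<Union>l. record_at d (Suc r) l)"
  then obtain l where l: "is_record (steps d z) l" "records (steps d z) l = Suc r"
    by (auto simp: record_at_def)
  then have "l > 0" by (cases l) auto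
  let ?K = "{k. k < l \<and> is_record (steps d z) k}"
  define k where "k = Max ?K"
  have fin: "finite ?K" by simp
  have ne: "?K \<noteq> {}" using \<open>l > 0\<close> by auto
  have k: "k \<in> ?K" unfolding k_def by (rule Max_in[OF fin ne])
  have max: "\<And>j. j \<in> ?K \<Longrightarrow> j \<le> k" unfolding k_def by (rule Max_ge[OF fin])
  have "records (steps d z) l = Suc (records (steps d z) k)"
    using k max l by (intro records_step) (auto simp: not_le[symmetric])
  then have "z \<in> record_at d r k" using k l by (simp add: record_at_def)
  moreover have "walk d (\<lambda>j. z (k + j)) (l - k) > 0"
    using l k walk_add[of d z k "l - k"] by (auto simp: is_record_def psum_steps)
  ultimately show "z \<in> (\<Union>k. record_at d r k \<inter> {z. (\<lambda>j. z (k + j)) \<in> exceeds d})"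
    by (auto simp: exceeds_def)
next
  fix z assume "z \<in> (\<Union>k. record_at d r k \<inter> {z. (\<lambda>j. z (k + j)) \<in> exceeds d})"
  then obtain k where k: "is_record (steps d z) k" "records (steps d z) k = r"
    and ex: "\<exists>i. walk d (\<lambda>j. z (k + j)) i > 0"
    by (auto simp: record_at_def exceeds_def)
  define i where "i = (LEAST i. walk d (\<lambda>j. z (k + j)) i > 0)"
  have i: "walk d (\<lambda>j. z (k + j)) i > 0" unfolding i_def using LeastI_ex[OF ex] .
  have first: "walk d (\<lambda>j. z (k + j)) j \<le> 0" if "j < i" for j
    using not_less_Least[of j "\<lambda>i. walk d (\<lambda>j. z (k + j)) i > 0"] that unfolding i_def by auto
  have "i > 0" using i by (cases i) auto
  have "is_record (steps d z) (k + i)"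
    unfolding is_record_def psum_steps
  proof safe
    fix j assume "j < k + i"
    show "walk d z j < walk d z (k + i)"
    proof (cases "j < k")
      case True
      then have "walk d z j < walk d z k" using k by (simp add: is_record_def psum_steps)
      then show ?thesis using i by (simp add: walk_add)
    next
      case False
      then have "j - k < i" using \<open>j < k + i\<close> by linarith
      then have "walk d (\<lambda>l. z (k + l)) (j - k) \<le> 0" by (rule first)
      then show ?thesis using False i walk_add[of d z k "j - k"] by (simp add: walk_add)
    qed
  qed
  moreover have "records (steps d z) (k + i) = Suc (records (steps d z) k)"
  proof (intro records_step)
    fix j assume "k < j" "j < k + i"
    then have "walk d z j \<le> walk d z k"
      using first[of "j - k"] walk_add[of d z k "j - k"] by simp
    then show "\<not> is_record (steps d z) j" using \<open>k < j\<close> by (auto simp: is_record_def psum_steps not_less)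
  qed (use \<open>i > 0\<close> calculation in auto)
  ultimately show "z \<in> (\<Union>l. record_at d (Suc r) l)" using k by (auto simp: record_at_def)
qed

lemma nn_integral_noise_indep:
  assumes f [measurable]: "f \<in> borel_measurable noise" and g [measurable]: "g \<in> borel_measurable noise"
    and dep: "\<And>z z'. (\<And>i. i < k \<Longrightarrow> z i = z' i) \<Longrightarrow> f z = f z'"
  shows "(\<integral>\<^sup>+z. f z * g (\<lambda>j. z (k + j)) \<partial>noise) = (\<integral>\<^sup>+z. f z \<partial>noise) * (\<integral>\<^sup>+z. g z \<partial>noise)"
proof -
  have sh: "(\<lambda>z j. z (k + j)) \<in> noise \<rightarrow>\<^sub>M noise" by (rule measurable_into_noise) simp
  have [measurable]: "(\<lambda>z. g (\<lambda>j. z (k + j))) \<in> borel_measurable noise"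
    using measurable_compose[OF sh g] .
  have "(\<integral>\<^sup>+z. f z * g (\<lambda>j. z (k + j)) \<partial>noise)
     = (\<integral>\<^sup>+x. \<integral>\<^sup>+y. f (comb_seq k x y) * g (\<lambda>j. comb_seq k x y (k + j)) \<partial>noise \<partial>noise)"
    by (rule nn_integral_noise_split) measurable
  also have "\<dots> = (\<integral>\<^sup>+x. \<integral>\<^sup>+y. f x * g y \<partial>noise \<partial>noise)"
  proof (intro nn_integral_cong)
    fix x y
    have "f (comb_seq k x y) = f x" by (rule dep) (simp add: comb_seq_def)
    moreover have "(\<lambda>j. comb_seq k x y (k + j)) = y" by (simp add: comb_seq_def)
    ultimately show "f (comb_seq k x y) * g (\<lambda>j. comb_seq k x y (k + j)) = f x * g y" by simp
  qed
  also have "\<dots> = (\<integral>\<^sup>+x. f x * (\<integral>\<^sup>+y. g y \<partial>noise) \<partial>noise)"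
    by (intro nn_integral_cong nn_integral_cmult g)
  also have "\<dots> = (\<integral>\<^sup>+z. f z \<partial>noise) * (\<integral>\<^sup>+z. g z \<partial>noise)"
    by (rule nn_integral_multc[OF f])
  finally show ?thesis .
qed

lemma emeasure_split_noise:
  assumes A [measurable]: "A \<in> sets noise" and B [measurable]: "B \<in> sets noise"
    and dep: "\<And>z z'. (\<And>i. i < k \<Longrightarrow> z i = z' i) \<Longrightarrow> z \<in> A \<longleftrightarrow> z' \<in> A"
  shows "emeasure noise (A \<inter> {z. (\<lambda>j. z (k + j)) \<in> B}) = emeasure noise A * emeasure noise B"
proof -
  have sh: "(\<lambda>z j. z (k + j)) \<in> noise \<rightarrow>\<^sub>M noise" by (rule measurable_into_noise) simp
  have m: "{z. (\<lambda>j. z (k + j)) \<in> B} \<in> sets noise"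
    using measurable_sets[OF sh B] by (simp add: vimage_def)
  have "emeasure noise (A \<inter> {z. (\<lambda>j. z (k + j)) \<in> B})
     = (\<integral>\<^sup>+z. indicator (A \<inter> {z. (\<lambda>j. z (k + j)) \<in> B}) z \<partial>noise)"
    using m A by simp
  also have "\<dots> = (\<integral>\<^sup>+z. indicator A z * indicator B (\<lambda>j. z (k + j)) \<partial>noise)"
    by (intro nn_integral_cong) (simp add: indicator_def)
  also have "\<dots> = (\<integral>\<^sup>+z. indicator A z \<partial>noise) * (\<integral>\<^sup>+z. indicator B z \<partial>noise)"
  proof (rule nn_integral_noise_indep)
    fix z z' :: "nat \<Rightarrow> real" assume "\<And>i. i < k \<Longrightarrow> z i = z' i"
    then have "z \<in> A \<longleftrightarrow> z' \<in> A" by (rule dep)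
    then show "indicator A z = (indicator A z' :: ennreal)" by (simp add: indicator_def)
  qed measurable
  finally show ?thesis by simp
qed

text \<open>
  The walk restarts independently at each record, so every record is followed by another one with
  the same probability, whatever happened before.
\<close>
lemma record_count_geometric: "(\<Sum>k. emeasure noise (record_at d r k)) = emeasure noise (exceeds d) ^ r"
proof (induction r)
  case 0
  have "record_at d 0 k = (if k = 0 then UNIV else {})" for k
    using records_less[of 0 k] by (auto simp: record_at_def)
  then have "(\<Sum>k. emeasure noise (record_at d 0 k)) = (\<Sum>k. if k = 0 then 1 else 0)"
    using noise.emeasure_space_1 by (intro suminf_cong) simp
  also have "\<dots> = 1" using suminf_finite[of "{0::nat}" "\<lambda>k. if k = 0 then 1 else (0::ennreal)"] by simp
  finally show ?case by simp
next
  case (Suc r)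
  have sh: "(\<lambda>z j. z (k + j)) \<in> noise \<rightarrow>\<^sub>M noise" for k by (rule measurable_into_noise) simp
  have m: "{z. (\<lambda>j. z (k + j)) \<in> exceeds d} \<in> sets noise" for k
    using measurable_sets[OF sh exceeds_sets] by (simp add: vimage_def)
  have "(\<Sum>k. emeasure noise (record_at d (Suc r) k)) = emeasure noise (\<Union>l. record_at d (Suc r) l)"
    by (rule suminf_emeasure) (auto simp: disjoint_family_on_def record_at_disjoint)
  also have "\<dots> = emeasure noise (\<Union>k. record_at d r k \<inter> {z. (\<lambda>j. z (k + j)) \<in> exceeds d})"
    by (simp add: next_record)
  also have "\<dots> = (\<Sum>k. emeasure noise (record_at d r k \<inter> {z. (\<lambda>j. z (k + j)) \<in> exceeds d}))"
    using record_at_disjoint m by (intro suminf_emeasure[symmetric]) (fastforce simp: disjoint_family_on_def)+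
  also have "\<dots> = (\<Sum>k. emeasure noise (record_at d r k) * emeasure noise (exceeds d))"
  proof (intro suminf_cong emeasure_split_noise)
    fix k and z z' :: "nat \<Rightarrow> real" assume "\<And>i. i < k \<Longrightarrow> z i = z' i"
    then have "is_record (steps d z) k = is_record (steps d z') k" "records (steps d z) k = records (steps d z') k"
      by (intro is_record_cong records_cong; simp add: steps_def)+
    then show "z \<in> record_at d r k \<longleftrightarrow> z' \<in> record_at d r k" by (simp add: record_at_def)
  qed measurable
  also have "\<dots> = emeasure noise (exceeds d) ^ Suc r" by (simp add: Suc mult.commute)
  finally show ?case .
qed

lemma suminf_swap_ennreal: "(\<Sum>i. \<Sum>j. f i j :: ennreal) = (\<Sum>j. \<Sum>i. f i j)"
proof -
  have "(\<Sum>i. \<Sum>j. f i j) = (\<integral>\<^sup>+i. (\<Sum>j. f i j) \<partial>count_space UNIV)"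
    by (rule nn_integral_count_space_nat[symmetric])
  also have "\<dots> = (\<Sum>j. \<integral>\<^sup>+i. f i j \<partial>count_space UNIV)"
    by (rule nn_integral_suminf) simp
  finally show ?thesis by (simp add: nn_integral_count_space_nat)
qed

text \<open>
  Sum the weights of the cyclic lemma over all times and sort the terms by the number of the
  record.
\<close>
lemma walk_positive_series:
  "(\<Sum>n. emeasure noise {z. walk d z (Suc n) > 0} / ennreal (real (Suc n)))
    = (\<Sum>r. ennreal (1 / real (Suc r)) * emeasure noise (exceeds d) ^ Suc r)"
proof -
  have weights: "emeasure noise {z. walk d z (Suc n) > 0} / ennreal (real (Suc n))
     = (\<Sum>r. ennreal (1 / real (Suc r)) * emeasure noise (record_at d (Suc r) (Suc n)))" for n
  proof -
    let ?w = "\<lambda>z. ennreal (if is_record (steps d z) (Suc n) then 1 / real (records (steps d z) (Suc n)) else 0)"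
    have "emeasure noise {z. walk d z (Suc n) > 0} / ennreal (real (Suc n)) = (\<integral>\<^sup>+z. ?w z \<partial>noise)"
      unfolding record_weight_integral[OF zero_less_Suc]
      by (subst mult.commute[of "ennreal (real (Suc n))"], rule mult_divide_eq_ennreal) simp_all
    also have "\<dots> = (\<integral>\<^sup>+z. (\<Sum>r. ennreal (1 / real (Suc r)) * indicator (record_at d (Suc r) (Suc n)) z) \<partial>noise)"
    proof (rule nn_integral_cong)
      fix z
      show "?w z = (\<Sum>r. ennreal (1 / real (Suc r)) * indicator (record_at d (Suc r) (Suc n)) z)"
      proof (cases "is_record (steps d z) (Suc n)")
        case True
        then obtain r where r: "records (steps d z) (Suc n) = Suc r"
          using records_less[of 0 "Suc n" "steps d z"] by (auto dest: less_imp_Suc_add)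
        have "(\<Sum>r. ennreal (1 / real (Suc r)) * indicator (record_at d (Suc r) (Suc n)) z)
          = (\<Sum>r'\<in>{r}. ennreal (1 / real (Suc r')) * indicator (record_at d (Suc r') (Suc n)) z)"
          using r by (intro suminf_finite) (auto simp: record_at_def)
        then show ?thesis using True r by (simp add: record_at_def)
      next
        case False then show ?thesis by (simp add: record_at_def)
      qed
    qed
    also have "\<dots> = (\<Sum>r. ennreal (1 / real (Suc r)) * emeasure noise (record_at d (Suc r) (Suc n)))"
      by (subst nn_integral_suminf) (auto simp: nn_integral_cmult_indicator)
    finally show ?thesis .
  qed
  have mass: "(\<Sum>n. emeasure noise (record_at d (Suc r) (Suc n))) = emeasure noise (exceeds d) ^ Suc r" for r
  proof -
    have "record_at d (Suc r) 0 = {}" by (auto simp: record_at_def)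
    then show ?thesis
      using suminf_offset[of "\<lambda>k. emeasure noise (record_at d (Suc r) k)" 1] record_count_geometric[of d "Suc r"]
      by simp
  qed
  from weights have "(\<Sum>n. emeasure noise {z. walk d z (Suc n) > 0} / ennreal (real (Suc n)))
     = (\<Sum>n. \<Sum>r. ennreal (1 / real (Suc r)) * emeasure noise (record_at d (Suc r) (Suc n)))"
    by simp
  also have "\<dots> = (\<Sum>r. ennreal (1 / real (Suc r)) * (\<Sum>n. emeasure noise (record_at d (Suc r) (Suc n))))"
    by (subst suminf_swap_ennreal) simp
  finally show ?thesis by (simp only: mass)
qed

text \<open>
  Markov's inequality for the exponential of half the walk.
\<close>
lemma measure_walk_pos_le:
  "measure noise {z. walk d z n > 0} \<le> exp (- d\<^sup>2 / 8) ^ n"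
proof -
  have "emeasure noise {z. walk d z n > 0} = (\<integral>\<^sup>+z. indicator {z. walk d z n > 0} z \<partial>noise)"
    by (subst nn_integral_indicator) (auto intro!: Collect_noise)
  also have "\<dots> \<le> (\<integral>\<^sup>+z. ennreal (exp (1/2 * walk d z n)) \<partial>noise)"
    by (intro nn_integral_mono) (auto simp: indicator_def)
  also have "\<dots> = ennreal (exp (- d\<^sup>2 / 8) ^ n)"
    unfolding nn_integral_exp_walk by (simp add: exp_of_nat_mult[symmetric] power2_eq_square field_simps)
  finally show ?thesis by (simp add: noise.emeasure_eq_measure)
qed

lemma stay_prob_eq: "stay_prob d = 1 - measure noise (exceeds d)"
proof -
  have "{z. \<forall>k. walk d z k \<le> 0} = space noise - exceeds d"
    by (simp add: exceeds_def set_eq_iff not_less)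
  then show ?thesis unfolding stay_prob_def using noise.prob_compl[OF exceeds_sets, of d] by simp
qed

text \<open>
  Spitzer's formula. With \<open>a\<close> the probability of ever becoming positive, the series
  of \<open>walk_positive_series\<close> is \<open>- ln (1 - a)\<close>.
\<close>
lemma stay_prob_formula:
  assumes "d \<noteq> 0"
  shows "summable (\<lambda>n. measure noise {z. walk d z (Suc n) > 0} / real (Suc n))"
    and "stay_prob d = exp (- (\<Sum>n. measure noise {z. walk d z (Suc n) > 0} / real (Suc n)))"
proof -
  let ?p = "\<lambda>n. measure noise {z. walk d z (Suc n) > 0} / real (Suc n)"
  define a where "a = measure noise (exceeds d)"
  have a: "0 \<le> a" "a \<le> 1" by (auto simp: a_def)
  have "exp (- d\<^sup>2 / 8) < 1" using assms by simp
  then have "summable (\<lambda>n. exp (- d\<^sup>2 / 8) ^ Suc n)" by (simp add: summable_geometric)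
  then show s: "summable ?p"
  proof (rule summable_comparison_test')
    fix n :: nat
    have "?p n \<le> measure noise {z. walk d z (Suc n) > 0} / 1"
      by (intro divide_left_mono) auto
    also have "\<dots> \<le> exp (- d\<^sup>2 / 8) ^ Suc n" using measure_walk_pos_le[of d "Suc n"] by simp
    finally show "norm (?p n) \<le> exp (- d\<^sup>2 / 8) ^ Suc n" by simp
  qed
  have eq: "(\<Sum>n. ennreal (?p n)) = (\<Sum>r. ennreal (a ^ Suc r / real (Suc r)))"
    using walk_positive_series[of d] a
    by (simp add: noise.emeasure_eq_measure a_def[symmetric] divide_ennreal ennreal_power ennreal_mult'[symmetric] del: power_Suc of_nat_Suc)
  have ne: "(\<Sum>n. ennreal (?p n)) \<noteq> top" by (rule ennreal_suminf_neq_top[OF s]) simp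
  have s2: "summable (\<lambda>r. a ^ Suc r / real (Suc r))"
    using ne a unfolding eq by (intro summable_suminf_not_top) auto
  \<comment> \<open>for \<open>a = 1\<close> the finite sum would be the harmonic series\<close>
  have "a \<noteq> 1"
  proof
    assume "a = 1"
    then have "summable (\<lambda>r. inverse (real (Suc r)))" using s2 by (simp add: inverse_eq_divide)
    then have "summable (\<lambda>r. inverse (real r))" by (subst (asm) summable_Suc_iff)
    then show False using not_summable_harmonic[where 'a=real] by simp
  qed
  then have "a < 1" using a by simp
  then have "(\<lambda>n. - ((- (- a)) ^ n) / of_nat n) sums ln (1 + (- a))"
    using a by (intro ln_series') auto
  then have "(\<lambda>n. a ^ n / real n) sums (- ln (1 - a))"
    by (drule_tac sums_minus) simp
  then have "(\<lambda>n. a ^ Suc n / real (Suc n)) sums (- ln (1 - a))"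
    by (subst sums_Suc_iff) simp
  then have "(\<Sum>r. a ^ Suc r / real (Suc r)) = - ln (1 - a)" by (rule sums_unique[symmetric])
  moreover have "ennreal (\<Sum>n. ?p n) = ennreal (\<Sum>r. a ^ Suc r / real (Suc r))"
    using eq s s2 a by (simp add: suminf_ennreal2 del: power_Suc of_nat_Suc)
  then have "(\<Sum>n. ?p n) = (\<Sum>r. a ^ Suc r / real (Suc r))"
    using s s2 a by (subst (asm) ennreal_inj) (auto intro!: suminf_nonneg)
  ultimately have "(\<Sum>n. ?p n) = - ln (1 - a)" by simp
  then show "stay_prob d = exp (- (\<Sum>n. ?p n))"
    using \<open>a < 1\<close> by (simp add: stay_prob_eq a_def)
qed

lemma noise_sum_standardized:
  assumes "n > 0" "s = 1 \<or> s = -1"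
  shows "distr noise borel (\<lambda>z. s * (\<Sum>i<n. z i) / sqrt n) = std_normal_distribution"
proof -
  have "distributed noise lborel (\<lambda>z. \<Sum>i<n. z i) (normal_density 0 (sqrt n))"
    using sum_coords_distributed[of "{..<n}"] assms by auto
  then have "distributed noise lborel (\<lambda>z. 0 + s / sqrt n * (\<Sum>i<n. z i)) (normal_density (0 + s / sqrt n * 0) (\<bar>s / sqrt n\<bar> * sqrt n))"
    using assms by (intro noise.normal_density_affine) auto
  moreover have "\<bar>s / sqrt n\<bar> * sqrt n = 1" using assms by auto
  ultimately have "distributed noise lborel (\<lambda>z. s * (\<Sum>i<n. z i) / sqrt n) std_normal_density"
    by (simp add: mult.commute)
  then show ?thesis by (simp add: distributed_def cong: distr_cong)
qed

lemma std_normal_no_atoms: "measure std_normal_distribution {t} = 0"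
proof -
  have "emeasure std_normal_distribution {t} = 0"
    by (subst emeasure_density) (auto intro!: nn_integral_null_set[where N="{t}"] simp: null_sets_def)
  then show ?thesis by (simp add: measure_def)
qed

lemma walk_pos_Phi:
  assumes "0 < d" "0 < n"
  shows "measure noise {z. walk d z n > 0} = Phi (- (d * sqrt n / 2))"
    and "measure noise {z. walk d z n = 0} = 0"
proof -
  interpret N: real_distribution std_normal_distribution by (rule real_dist_normal_dist)
  let ?Y = "\<lambda>z. (- 1) * (\<Sum>i<n. z i) / sqrt n"
  let ?t = "- (d * sqrt n / 2)"
  \<comment> \<open>the standardized sum with a minus sign must lie below the stated quantile\<close>
  have w: "walk d z n = d * sqrt n * (?t - ?Y z)" for z :: "nat \<Rightarrow> real"
  proof -
    have "walk d z n = d * (\<Sum>i<n. z i) - d\<^sup>2 * real n / 2"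
      by (simp add: walk_def sum_subtractf sum_distrib_left[symmetric])
    moreover have "d * sqrt n * (?t - ?Y z) = d * (\<Sum>i<n. z i) * (sqrt n / sqrt n) - d\<^sup>2 * (sqrt n * sqrt n) / 2"
      by (simp add: algebra_simps power2_eq_square)
    ultimately show ?thesis using assms by simp
  qed
  have pos: "d * sqrt n > 0" using assms by simp
  have law: "measure noise (?Y -` A) = measure std_normal_distribution A" if "A \<in> sets borel" for A
  proof -
    have "measure (distr noise borel ?Y) A = measure noise (?Y -` A \<inter> space noise)"
      using that by (intro measure_distr) auto
    then show ?thesis using noise_sum_standardized[of n "-1"] assms by simp
  qed
  have "{z. walk d z n > 0} = ?Y -` {..<?t}" "{z. walk d z n = 0} = ?Y -` {?t}"
  proof -
    have "walk d z n > 0 \<longleftrightarrow> 0 < ?t - ?Y z" for z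
      unfolding w using mult_less_cancel_left_pos[OF pos, of 0 "?t - ?Y z"] by (simp only: mult_zero_right)
    then show "{z. walk d z n > 0} = ?Y -` {..<?t}" by (simp add: set_eq_iff less_diff_eq)
    have "walk d z n = 0 \<longleftrightarrow> ?t - ?Y z = 0" for z
      unfolding w using assms by simp
    then show "{z. walk d z n = 0} = ?Y -` {?t}" by (auto simp: set_eq_iff)
  qed
  moreover have "measure std_normal_distribution {..<?t} = Phi ?t"
  proof -
    have "Phi ?t = measure std_normal_distribution ({..<?t} \<union> {?t})"
      unfolding Phi_def cdf_def by (intro arg_cong2[where f=measure]) auto
    also have "\<dots> = measure std_normal_distribution {..<?t} + measure std_normal_distribution {?t}"
      by (intro noise.M.finite_measure_Union) auto
    finally show ?thesis using std_normal_no_atoms by simp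
  qed
  ultimately show "measure noise {z. walk d z n > 0} = Phi ?t" "measure noise {z. walk d z n = 0} = 0"
    using law[of "{..<?t}"] law[of "{?t}"] std_normal_no_atoms by auto
qed

text \<open>
  The series in the definition of \<open>\<nu>\<close> is that of Spitzer's formula, and
  \<open>\<nu>\<close> contains its exponential squared.
\<close>
lemma nu_eq_stay_prob:
  assumes "0 < d" shows "nu d = 2 * (stay_prob d)\<^sup>2 / d\<^sup>2"
proof -
  have "measure noise {z. walk d z (Suc n) > 0} / real (Suc n) = 1 / real (Suc n) * Phi (- (d * sqrt (Suc n) / 2))" for n
    using walk_pos_Phi(1)[OF assms, of "Suc n"] by simp
  then have "stay_prob d = exp (- (\<Sum>n. 1 / real (Suc n) * Phi (- (d * sqrt (Suc n) / 2))))"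
    using stay_prob_formula(2)[of d] assms by (simp only:)
  moreover have "(exp (- s))\<^sup>2 = exp (- 2 * s)" for s :: real
    by (simp add: exp_double[symmetric])
  ultimately show ?thesis unfolding nu_def by simp
qed

section \<open>The maximum of the drifting random walk\<close>

definition stay :: "real \<Rightarrow> nat \<Rightarrow> (nat \<Rightarrow> real) set" where
  "stay d j = {z. \<forall>k\<le>j. walk d z k \<le> 0}"

lemma finite_Ball_noise:
  assumes "finite K" "\<And>k. Measurable.pred noise (P k)"
  shows "{z. \<forall>k\<in>K. P k z} \<in> sets noise"
  using sets.sets_Collect_finite_All[OF _ assms(1), of noise "\<lambda>k z. P k z"] assms(2)
  by (simp add: Collect_noise)

lemma pred_walk_le: "Measurable.pred noise (\<lambda>z. walk d z k \<le> 0)"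
  unfolding pred_def by (rule borel_measurable_le[OF walk_measurable borel_measurable_const])

lemma pred_walk_less: "Measurable.pred noise (\<lambda>z. walk d z k < 0)"
  unfolding pred_def by (rule borel_measurable_less[OF walk_measurable borel_measurable_const])

lemma stay_sets [measurable]: "stay d j \<in> sets noise"
proof -
  have "stay d j = {z. \<forall>k\<in>{..j}. walk d z k \<le> 0}" by (auto simp: stay_def)
  also have "\<dots> \<in> sets noise"
    by (rule finite_Ball_noise[of "{..j}" "\<lambda>k z. walk d z k \<le> 0", OF _ pred_walk_le]) simp
  finally show ?thesis .
qed

lemma all_stay_sets: "{z. \<forall>k. walk d z k \<le> 0} \<in> sets noise"
  by (rule Collect_noise) measurable

lemma stay_prob_le_stay: "stay_prob d \<le> measure noise (stay d j)"
  unfolding stay_prob_def by (rule noise.finite_measure_mono[OF _ stay_sets]) (auto simp: stay_def)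

text \<open>
  A path that is nonpositive up to time \<open>j\<close> but not for ever becomes positive at some
  later time; these times have geometrically small probabilities.
\<close>
lemma stay_le:
  assumes "d \<noteq> 0" defines "q \<equiv> exp (- d\<^sup>2 / 8)"
  shows "measure noise (stay d j) \<le> stay_prob d + q ^ j / (1 - q)"
proof -
  have q: "0 < q" "q < 1" using assms by auto
  let ?B = "\<lambda>i. {z. walk d z (Suc j + i) > 0}"
  have B [measurable]: "?B i \<in> sets noise" for i by (rule Collect_noise) measurable
  have le: "measure noise (?B i) \<le> q ^ (Suc j + i)" for i
    unfolding q_def by (rule measure_walk_pos_le)
  have sm: "summable (\<lambda>i. q ^ (Suc j + i))"
    using q unfolding power_add by (intro summable_mult summable_geometric) simp
  have sB: "summable (\<lambda>i. measure noise (?B i))"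
    by (rule summable_comparison_test'[OF sm]) (use le in auto)
  have "stay d j \<subseteq> {z. \<forall>k. walk d z k \<le> 0} \<union> (\<Union>i. ?B i)"
  proof
    fix z assume z: "z \<in> stay d j"
    show "z \<in> {z. \<forall>k. walk d z k \<le> 0} \<union> (\<Union>i. ?B i)"
    proof (cases "\<forall>k. walk d z k \<le> 0")
      case False
      then obtain k where k: "walk d z k > 0" by (auto simp: not_le)
      then have "\<not> k \<le> j" using z by (auto simp: stay_def not_le[symmetric])
      then have "k = Suc j + (k - Suc j)" by simp
      with k show ?thesis by (metis (mono_tags, lifting) UN_I UNIV_I UnI2 mem_Collect_eq)
    qed simp
  qed
  then have "measure noise (stay d j) \<le> measure noise ({z. \<forall>k. walk d z k \<le> 0} \<union> (\<Union>i. ?B i))"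
    using all_stay_sets B by (intro noise.finite_measure_mono) auto
  also have "\<dots> \<le> stay_prob d + measure noise (\<Union>i. ?B i)"
    unfolding stay_prob_def using all_stay_sets B by (intro measure_Un_le) auto
  also have "measure noise (\<Union>i. ?B i) \<le> (\<Sum>i. measure noise (?B i))"
    using B sB by (intro noise.finite_measure_subadditive_countably) auto
  also have "\<dots> \<le> (\<Sum>i. q ^ (Suc j + i))"
    using le sB sm by (intro suminf_le) auto
  also have "\<dots> = q ^ Suc j / (1 - q)"
    unfolding power_add using q by (subst suminf_mult) (auto simp: suminf_geometric summable_geometric divide_inverse)
  also have "\<dots> \<le> q ^ j / (1 - q)"
    using q by (intro divide_right_mono) (auto simp: mult_left_le_one_le)
  finally show ?thesis by simp
qed

lemma stay_strict:
  assumes "0 < d"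
  shows "emeasure noise {z. \<forall>k\<in>{1..j}. walk d z k < 0} = emeasure noise (stay d j)"
proof (rule emeasure_eq_AE)
  have "AE z in noise. \<forall>k\<in>{1..j}. walk d z k \<noteq> 0"
  proof (intro AE_finite_allI)
    fix k assume "k \<in> {1..j}"
    then have "measure noise {z. walk d z k = 0} = 0" using walk_pos_Phi(2)[OF assms, of k] by simp
    then have "{z. walk d z k = 0} \<in> null_sets noise"
      by (intro null_setsI Collect_noise) (auto simp: noise.emeasure_eq_measure)
    then show "AE z in noise. walk d z k \<noteq> 0" by (rule AE_I') auto
  qed simp
  then show "AE z in noise. (z \<in> {z. \<forall>k\<in>{1..j}. walk d z k < 0}) = (z \<in> stay d j)"
  proof eventually_elim
    case (elim z)
    have "walk d z k \<le> 0 \<longleftrightarrow> k \<in> {1..j} \<longrightarrow> walk d z k < 0" if "k \<le> j" for k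
    proof (cases "k = 0")
      case False
      then have k: "k \<in> {1..j}" using that by auto
      with elim have "walk d z k \<noteq> 0" by blast
      with k show ?thesis by (simp add: less_le)
    qed simp
    then have "(\<forall>k\<le>j. walk d z k \<le> 0) \<longleftrightarrow> (\<forall>k\<le>j. k \<in> {1..j} \<longrightarrow> walk d z k < 0)" by simp
    also have "\<dots> \<longleftrightarrow> (\<forall>k\<in>{1..j}. walk d z k < 0)" by auto
    finally show ?case by (simp add: stay_def)
  qed
qed (rule finite_Ball_noise[of "{1..j}" "\<lambda>k z. walk d z k < 0", OF _ pred_walk_less], simp, rule stay_sets)

text \<open>
  Tilting negates the walk, which turns a strict record at time \<open>j\<close> into a strict new
  minimum. Read backwards from time \<open>j\<close>, the walk then stays negative, and the
  boundary value zero has probability zero.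
\<close>
lemma tilted_record:
  assumes "0 < d"
  shows "(\<integral>\<^sup>+z. ennreal (exp (walk d z j)) * indicator {z. is_record (steps d z) j} z \<partial>noise) = emeasure noise (stay d j)"
proof -
  \<comment> \<open>reverses the first \<open>j\<close> steps\<close>
  define \<pi> where "\<pi> i = (if i < j then j - 1 - i else i)" for i
  have "inj \<pi>"
    by (auto simp: inj_def \<pi>_def split: if_splits)
  have [measurable]: "{z. is_record (steps d z) j} \<in> sets noise"
    by (rule Collect_noise, measurable)
  have [measurable]: "{z. \<forall>k\<in>{1..j}. walk d z k < 0} \<in> sets noise"
    by (rule finite_Ball_noise[of "{1..j}" "\<lambda>k z. walk d z k < 0", OF _ pred_walk_less]) simp
  have rev: "walk d (\<lambda>i. z (\<pi> i)) k = walk d z j - walk d z (j - k)" if "k \<le> j" for z k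
    using that
  proof (induction k)
    case (Suc k)
    then have "walk d z (j - k) = walk d z (j - Suc k) + (d * z (j - Suc k) - d\<^sup>2 / 2)"
      using walk_Suc[of d z "j - Suc k"] by (simp add: Suc_diff_Suc)
    with Suc show ?case by (simp add: walk_Suc \<pi>_def)
  qed simp
  have "(\<integral>\<^sup>+z. ennreal (exp (walk d z j)) * indicator {z. is_record (steps d z) j} z \<partial>noise)
     = (\<integral>\<^sup>+z. indicator {z. is_record (steps d z) j} (reflect d j z) \<partial>noise)"
    by (rule nn_integral_tilt) measurable
  also have "\<dots> = (\<integral>\<^sup>+z. indicator {z. \<forall>k\<in>{1..j}. walk d z k < 0} (\<lambda>i. z (\<pi> i)) \<partial>noise)"
  proof (intro nn_integral_cong)
    fix z :: "nat \<Rightarrow> real"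
    have "is_record (steps d (reflect d j z)) j \<longleftrightarrow> (\<forall>i<j. walk d z j < walk d z i)"
      unfolding is_record_def psum_steps by (auto simp: walk_reflect)
    also have "\<dots> \<longleftrightarrow> (\<forall>k\<in>{1..j}. walk d z j < walk d z (j - k))"
    proof
      assume a: "\<forall>k\<in>{1..j}. walk d z j < walk d z (j - k)"
      show "\<forall>i<j. walk d z j < walk d z i"
      proof safe
        fix i assume "i < j"
        then show "walk d z j < walk d z i" using a[rule_format, of "j - i"] by auto
      qed
    qed auto
    also have "\<dots> \<longleftrightarrow> (\<forall>k\<in>{1..j}. walk d (\<lambda>i. z (\<pi> i)) k < 0)"
      by (intro ball_cong refl) (auto simp: rev)
    finally show "indicator {z. is_record (steps d z) j} (reflect d j z)
       = (indicator {z. \<forall>k\<in>{1..j}. walk d z k < 0} (\<lambda>i. z (\<pi> i)) :: ennreal)"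
      by (simp add: indicator_def)
  qed
  also have "\<dots> = (\<integral>\<^sup>+z. indicator {z. \<forall>k\<in>{1..j}. walk d z k < 0} z \<partial>noise)"
    using \<open>inj \<pi>\<close> by (intro nn_integral_noise_reindex) measurable
  also have "\<dots> = emeasure noise (stay d j)"
    by (subst nn_integral_indicator) (measurable, rule stay_strict[OF assms])
  finally show ?thesis .
qed

definition walk_max :: "real \<Rightarrow> nat \<Rightarrow> (nat \<Rightarrow> real) \<Rightarrow> real" where
  "walk_max d n z = Max (walk d z ` {..n})"

lemma walk_max_measurable [measurable]: "walk_max d n \<in> borel_measurable noise"
  unfolding walk_max_def[abs_def] by measurable

lemma walk_max_ge: "j \<le> n \<Longrightarrow> walk d z j \<le> walk_max d n z"
  unfolding walk_max_def by (intro Max_ge) auto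

lemma walk_max_attained: obtains j where "j \<le> n" "walk_max d n z = walk d z j"
proof -
  have "walk_max d n z \<in> walk d z ` {..n}" unfolding walk_max_def by (intro Max_in) auto
  then show ?thesis using that by auto
qed

text \<open>
  Decompose according to the first time at which the maximum is attained: it is a strict record,
  and the walk restarted there never becomes positive in the remaining time. The two parts are
  independent.
\<close>
lemma nn_integral_exp_walk_max:
  assumes "0 < d"
  shows "(\<integral>\<^sup>+z. ennreal (exp (walk_max d n z)) \<partial>noise)
    = (\<Sum>j\<le>n. emeasure noise (stay d j) * emeasure noise (stay d (n - j)))"
proof -
  have S [measurable]: "{z. is_record (steps d z) j} \<in> sets noise" for j
    by (rule Collect_noise, measurable)
  let ?f = "\<lambda>j z. ennreal (exp (walk d z j)) * indicator {z. is_record (steps d z) j} z * indicator (stay d (n - j)) (\<lambda>i. z (j + i))"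
  have sh: "(\<lambda>z j. z (k + j)) \<in> noise \<rightarrow>\<^sub>M noise" for k by (rule measurable_into_noise) simp
  have [measurable]: "(\<lambda>z. indicator (stay d (n - j)) (\<lambda>i. z (j + i)) :: ennreal) \<in> borel_measurable noise" for j
    by (rule measurable_compose[OF sh]) measurable
  have "ennreal (exp (walk_max d n z)) = (\<Sum>j\<le>n. ?f j z)" for z
  proof -
    define J where "J = (LEAST j. j \<le> n \<and> walk_max d n z = walk d z j)"
    have "\<exists>j. j \<le> n \<and> walk_max d n z = walk d z j" using walk_max_attained[of n d z] by metis
    from LeastI_ex[OF this] have J: "J \<le> n" "walk_max d n z = walk d z J" unfolding J_def by auto
    have less: "walk d z i < walk d z J" if "i < J" for i
    proof -
      have "walk_max d n z \<noteq> walk d z i"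
        using not_less_Least[of i "\<lambda>j. j \<le> n \<and> walk_max d n z = walk d z j"] that J(1) unfolding J_def[symmetric] by auto
      then show ?thesis using walk_max_ge[of i n d z] that J by simp
    qed
    \<comment> \<open>exactly one summand is nonzero: the one of the first maximum\<close>
    have iff: "is_record (steps d z) j \<and> (\<lambda>i. z (j + i)) \<in> stay d (n - j) \<longleftrightarrow> j = J" if "j \<le> n" for j
    proof
      assume a: "is_record (steps d z) j \<and> (\<lambda>i. z (j + i)) \<in> stay d (n - j)"
      have "\<not> J < j" using a walk_max_ge[OF that, of d z] J by (auto simp: is_record_def psum_steps not_less[symmetric])
      moreover have "\<not> j < J"
      proof
        assume "j < J"
        then have "walk d (\<lambda>i. z (j + i)) (J - j) \<le> 0" using a J by (auto simp: stay_def)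
        then show False using less[OF \<open>j < J\<close>] walk_add[of d z j "J - j"] \<open>j < J\<close> by simp
      qed
      ultimately show "j = J" by simp
    next
      assume "j = J"
      have "walk d (\<lambda>i. z (J + i)) k \<le> 0" if "k \<le> n - J" for k
        using walk_max_ge[of "J + k" n d z] that J walk_add[of d z J k] by simp
      then show "is_record (steps d z) j \<and> (\<lambda>i. z (j + i)) \<in> stay d (n - j)"
        using less unfolding \<open>j = J\<close> by (auto simp: is_record_def psum_steps stay_def)
    qed
    have "(\<Sum>j\<le>n. ?f j z) = (\<Sum>j\<le>n. if j = J then ennreal (exp (walk d z J)) else 0)"
      using iff by (intro sum.cong) (auto simp: indicator_def)
    then show ?thesis using J by simp
  qed
  then have "(\<integral>\<^sup>+z. ennreal (exp (walk_max d n z)) \<partial>noise) = (\<integral>\<^sup>+z. (\<Sum>j\<le>n. ?f j z) \<partial>noise)"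
    by (intro nn_integral_cong)
  also have "\<dots> = (\<Sum>j\<le>n. \<integral>\<^sup>+z. ?f j z \<partial>noise)"
    by (rule nn_integral_sum) measurable
  also have "\<dots> = (\<Sum>j\<le>n. emeasure noise (stay d j) * emeasure noise (stay d (n - j)))"
  proof (intro sum.cong refl)
    fix j
    have "(\<integral>\<^sup>+z. ?f j z \<partial>noise) = (\<integral>\<^sup>+z. ennreal (exp (walk d z j)) * indicator {z. is_record (steps d z) j} z \<partial>noise)
        * (\<integral>\<^sup>+z. indicator (stay d (n - j)) z \<partial>noise)"
    proof (intro nn_integral_noise_indep)
      fix z z' :: "nat \<Rightarrow> real" assume e: "\<And>i. i < j \<Longrightarrow> z i = z' i"
      have "is_record (steps d z) j = is_record (steps d z') j"
        using e by (intro is_record_cong) (simp add: steps_def)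
      moreover have "walk d z j = walk d z' j" using e by (simp add: walk_def)
      ultimately show "ennreal (exp (walk d z j)) * indicator {z. is_record (steps d z) j} z
         = ennreal (exp (walk d z' j)) * indicator {z. is_record (steps d z) j} z'"
        by (simp add: indicator_def)
    qed measurable
    then show "(\<integral>\<^sup>+z. ?f j z \<partial>noise) = emeasure noise (stay d j) * emeasure noise (stay d (n - j))"
      by (simp add: tilted_record[OF assms])
  qed
  finally show ?thesis .
qed

lemma stay_prob_bounds: "0 \<le> stay_prob d" "stay_prob d \<le> 1"
  by (auto simp: stay_prob_def)

lemma sum_powers_le:
  fixes q :: real
  assumes "0 \<le> q" "q < 1" "finite I"
  shows "(\<Sum>j\<in>I. q ^ j) \<le> 1 / (1 - q)"
proof -
  have "(\<Sum>j\<in>I. q ^ j) \<le> (\<Sum>j. q ^ j)"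
    using assms by (intro sum_le_suminf summable_geometric) auto
  then show ?thesis using assms by (simp add: suminf_geometric)
qed

text \<open>
  Each factor exceeds its limit by a geometrically small amount, so all products but boundedly
  many are close to the limit.
\<close>
lemma stay_convolution_le:
  assumes "0 < c" "c \<le> d"
  defines "q \<equiv> exp (- c\<^sup>2 / 8)"
  shows "(\<Sum>j\<le>N. measure noise (stay d j) * measure noise (stay d (N - j)))
    \<le> (real N + 1) * (stay_prob d)\<^sup>2 + 2 / (1 - q)\<^sup>2"
proof -
  let ?s = "\<lambda>j. measure noise (stay d j)" and ?p = "stay_prob d"
  have q: "0 < q" "q < 1" using assms by auto
  have s: "?s j \<le> ?p + q ^ j / (1 - q)" for j
  proof -
    have le: "exp (- d\<^sup>2 / 8) \<le> q" using assms by (simp add: power_mono q_def)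
    have "?s j \<le> ?p + exp (- d\<^sup>2 / 8) ^ j / (1 - exp (- d\<^sup>2 / 8))"
      using assms by (intro stay_le) auto
    also have "\<dots> \<le> ?p + q ^ j / (1 - q)"
      using le q by (intro add_left_mono frac_le power_mono) auto
    finally show ?thesis .
  qed
  have "?s j * ?s (N - j) \<le> ?p\<^sup>2 + (q ^ j / (1 - q) + q ^ (N - j) / (1 - q))" for j
  proof -
    have "?s j * ?s (N - j) \<le> ?s j * (?p + q ^ (N - j) / (1 - q))"
      by (intro mult_left_mono s) auto
    also have "\<dots> = ?s j * ?p + ?s j * (q ^ (N - j) / (1 - q))" by (simp add: distrib_left)
    also have "\<dots> \<le> (?p + q ^ j / (1 - q)) * ?p + 1 * (q ^ (N - j) / (1 - q))"
      using q stay_prob_bounds by (intro add_mono mult_right_mono s) auto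
    also have "(?p + q ^ j / (1 - q)) * ?p \<le> ?p\<^sup>2 + q ^ j / (1 - q)"
      using mult_left_le[of ?p "q ^ j / (1 - q)"] q stay_prob_bounds[of d] by (simp add: distrib_right power2_eq_square)
    finally show ?thesis by simp
  qed
  then have "(\<Sum>j\<le>N. ?s j * ?s (N - j)) \<le> (\<Sum>j\<le>N. ?p\<^sup>2 + (q ^ j / (1 - q) + q ^ (N - j) / (1 - q)))"
    by (rule sum_mono)
  also have "\<dots> = (real N + 1) * ?p\<^sup>2 + 2 * ((\<Sum>j\<le>N. q ^ j) / (1 - q))"
    using sum.nat_diff_reindex[of "\<lambda>j. q ^ j" "Suc N"]
    by (simp add: sum.distrib sum_divide_distrib[symmetric] lessThan_Suc_atMost algebra_simps)
  also have "\<dots> \<le> (real N + 1) * ?p\<^sup>2 + 2 * ((1 / (1 - q)) / (1 - q))"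
    using q sum_powers_le[of q "{..N}"] by (intro add_left_mono mult_left_mono divide_right_mono) auto
  finally show ?thesis by (simp add: power2_eq_square)
qed

lemma stay_convolution_ge: "(real N + 1) * (stay_prob d)\<^sup>2 \<le> (\<Sum>j\<le>N. measure noise (stay d j) * measure noise (stay d (N - j)))"
proof -
  have "(\<Sum>j\<le>N. stay_prob d * stay_prob d) \<le> (\<Sum>j\<le>N. measure noise (stay d j) * measure noise (stay d (N - j)))"
    by (intro sum_mono mult_mono stay_prob_le_stay stay_prob_bounds) auto
  then show ?thesis by (simp add: power2_eq_square algebra_simps)
qed

lemma nn_integral_exp_walk_max_real:
  "0 < d \<Longrightarrow> (\<integral>\<^sup>+z. ennreal (exp (walk_max d n z)) \<partial>noise)
    = ennreal (\<Sum>j\<le>n. measure noise (stay d j) * measure noise (stay d (n - j)))"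
  by (simp add: nn_integral_exp_walk_max noise.emeasure_eq_measure ennreal_mult[symmetric])

lemma nn_integral_exp_walk_shift:
  "(\<integral>\<^sup>+z. ennreal (exp (\<theta> * walk d z j + b)) \<partial>noise) = ennreal (exp ((\<theta>\<^sup>2 - \<theta>) * d\<^sup>2 / 2 * j + b))"
proof -
  have "(\<integral>\<^sup>+z. ennreal (exp (\<theta> * walk d z j + b)) \<partial>noise) = (\<integral>\<^sup>+z. ennreal (exp b) * ennreal (exp (\<theta> * walk d z j)) \<partial>noise)"
    by (simp add: exp_add ennreal_mult mult.commute)
  also have "\<dots> = ennreal (exp b) * ennreal (exp ((\<theta>\<^sup>2 - \<theta>) * d\<^sup>2 / 2 * j))"
    by (subst nn_integral_cmult) (simp_all only: nn_integral_exp_walk, measurable)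
  finally show ?thesis by (simp add: exp_add ennreal_mult mult.commute)
qed

lemma nn_integral_add_sum:
  assumes "f \<in> borel_measurable K" "\<And>j. g j \<in> borel_measurable K"
  shows "(\<integral>\<^sup>+z. f z + (\<Sum>j\<in>I. g j z) \<partial>K) = (\<integral>\<^sup>+z. f z \<partial>K) + (\<Sum>j\<in>I. \<integral>\<^sup>+z. g j z \<partial>K)"
  using assms by (simp add: nn_integral_add nn_integral_sum)

text \<open>
  Under the tilted law the walk has drift \<open>d\<^sup>2 / 2\<close>, so it passes the level
  \<open>A\<close> after about \<open>2 * A / d\<^sup>2\<close> steps. Up to a slightly later time
  \<open>N\<close> the truncation is dropped and the exact formula for the exponential of the
  maximum is used, with about \<open>N\<close> summands close to the square of
  \<open>stay_prob\<close>. Later positions contribute only a geometric series, because there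
  \<open>min w A\<close> may be replaced by a convex combination of \<open>w\<close> and
  \<open>A\<close>.
\<close>
lemma walk_max_texp_upper:
  assumes c: "0 < c" and \<eta>: "0 < \<eta>"
  obtains C where "\<And>d n A. c \<le> d \<Longrightarrow> 0 \<le> A \<Longrightarrow>
    (\<integral>\<^sup>+z. ennreal (exp (min (walk_max d n z) A)) \<partial>noise) \<le> ennreal ((1 + \<eta>) * nu d * A + C)"
proof -
  \<comment> \<open>\<open>\<theta> * (1 + \<eta>) = 1\<close> gives \<open>A \<le> \<theta> * d\<^sup>2 / 2 * N\<close> below, so the terms beyond \<open>N\<close> decay\<close>
  define \<theta> where "\<theta> = 1 / (1 + \<eta>)"
  have \<theta>: "0 < \<theta>" "\<theta> < 1" using \<eta> by (auto simp: \<theta>_def)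
  define r where "r = exp (- ((1 - \<theta>) * \<theta> * c\<^sup>2 / 2))"
  have "0 < (1 - \<theta>) * \<theta> * c\<^sup>2 / 2" using \<theta> c by simp
  then have r: "0 < r" "r < 1" unfolding r_def by auto
  define q where "q = exp (- c\<^sup>2 / 8)"
  have q: "0 < q" "q < 1" using c by (auto simp: q_def)
  define C where "C = 2 + 2 / (1 - q)\<^sup>2 + 1 / (1 - r)"
  have "(\<integral>\<^sup>+z. ennreal (exp (min (walk_max d n z) A)) \<partial>noise) \<le> ennreal ((1 + \<eta>) * nu d * A + C)"
    if d: "c \<le> d" and A: "0 \<le> A" for d n A
  proof -
    have d0: "0 < d" using c d by simp
    \<comment> \<open>slightly later than the passage time of the tilted walk\<close>
    define N where "N = nat \<lceil>(1 + \<eta>) * (2 * A / d\<^sup>2)\<rceil>"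
    have N0: "0 \<le> (1 + \<eta>) * (2 * A / d\<^sup>2)" using \<eta> A by simp
    have N1: "(1 + \<eta>) * (2 * A / d\<^sup>2) \<le> real N" unfolding N_def by linarith
    have N2: "real N \<le> (1 + \<eta>) * (2 * A / d\<^sup>2) + 1" unfolding N_def using N0 by linarith
    have path: "ennreal (exp (min (walk_max d n z) A)) \<le> ennreal (exp (walk_max d N z))
       + (\<Sum>j\<in>{N<..n}. ennreal (exp (\<theta> * walk d z j + (1 - \<theta>) * A)))" for z
    proof -
      obtain j where j: "j \<le> n" "walk_max d n z = walk d z j" by (rule walk_max_attained)
      show ?thesis
      proof (cases "j \<le> N")
        case True
        then have "ennreal (exp (min (walk_max d n z) A)) \<le> ennreal (exp (walk_max d N z))"
          using walk_max_ge[of j N d z] j by (intro ennreal_leI) auto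
        then show ?thesis by (simp add: add_increasing2)
      next
        case False
        have "min (walk d z j) A = \<theta> * min (walk d z j) A + (1 - \<theta>) * min (walk d z j) A" by (simp add: algebra_simps)
        also have "\<dots> \<le> \<theta> * walk d z j + (1 - \<theta>) * A"
          using \<theta> by (intro add_mono mult_left_mono) auto
        finally have "ennreal (exp (min (walk_max d n z) A)) \<le> ennreal (exp (\<theta> * walk d z j + (1 - \<theta>) * A))"
          using j by (intro ennreal_leI) auto
        also have "\<dots> \<le> (\<Sum>j\<in>{N<..n}. ennreal (exp (\<theta> * walk d z j + (1 - \<theta>) * A)))"
          using False j by (intro member_le_sum) auto
        finally show ?thesis by (simp add: add_increasing)
      qed
    qed
    have far: "exp ((\<theta>\<^sup>2 - \<theta>) * d\<^sup>2 / 2 * j + (1 - \<theta>) * A) \<le> r ^ (j - N)" if "j \<in> {N<..n}" for j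
    proof -
      have "A \<le> \<theta> * d\<^sup>2 / 2 * N"
      proof -
        have "\<theta> * d\<^sup>2 / 2 * ((1 + \<eta>) * (2 * A / d\<^sup>2)) \<le> \<theta> * d\<^sup>2 / 2 * N"
          using N1 \<theta> by (intro mult_left_mono) auto
        moreover have "\<theta> * d\<^sup>2 / 2 * ((1 + \<eta>) * (2 * A / d\<^sup>2)) = A"
        proof -
          have "\<theta> * (1 + \<eta>) = 1" using \<eta> by (simp add: \<theta>_def)
          moreover have "\<theta> * d\<^sup>2 / 2 * ((1 + \<eta>) * (2 * A / d\<^sup>2)) = \<theta> * (1 + \<eta>) * A * (d\<^sup>2 / d\<^sup>2)" by simp
          ultimately show ?thesis using d0 by simp
        qed
        ultimately show ?thesis by simp
      qed
      moreover have "\<theta> * c\<^sup>2 / 2 * real (j - N) \<le> \<theta> * d\<^sup>2 / 2 * real (j - N)"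
        using \<theta> c d by (intro mult_right_mono divide_right_mono mult_left_mono power_mono) auto
      moreover have "real j = real N + real (j - N)" using that by (simp add: of_nat_diff)
      then have "\<theta> * d\<^sup>2 / 2 * real j = \<theta> * d\<^sup>2 / 2 * real N + \<theta> * d\<^sup>2 / 2 * real (j - N)"
        by (simp only: distrib_left)
      ultimately have "A - \<theta> * d\<^sup>2 / 2 * j \<le> - (\<theta> * c\<^sup>2 / 2 * real (j - N))"
        by linarith
      then have "(1 - \<theta>) * (A - \<theta> * d\<^sup>2 / 2 * j) \<le> (1 - \<theta>) * - (\<theta> * c\<^sup>2 / 2 * real (j - N))"
        using \<theta> by (intro mult_left_mono) auto
      moreover have "(\<theta>\<^sup>2 - \<theta>) * d\<^sup>2 / 2 * j + (1 - \<theta>) * A = (1 - \<theta>) * (A - \<theta> * d\<^sup>2 / 2 * j)"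
        by (simp add: power2_eq_square field_simps)
      moreover have "real (j - N) * - ((1 - \<theta>) * \<theta> * c\<^sup>2 / 2) = (1 - \<theta>) * - (\<theta> * c\<^sup>2 / 2 * real (j - N))"
        by simp
      ultimately have "(\<theta>\<^sup>2 - \<theta>) * d\<^sup>2 / 2 * j + (1 - \<theta>) * A \<le> real (j - N) * - ((1 - \<theta>) * \<theta> * c\<^sup>2 / 2)"
        by linarith
      then show ?thesis unfolding r_def exp_of_nat_mult[symmetric] by simp
    qed
    have "(\<integral>\<^sup>+z. ennreal (exp (min (walk_max d n z) A)) \<partial>noise) \<le>
       (\<integral>\<^sup>+z. ennreal (exp (walk_max d N z)) + (\<Sum>j\<in>{N<..n}. ennreal (exp (\<theta> * walk d z j + (1 - \<theta>) * A))) \<partial>noise)"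
      by (intro nn_integral_mono path)
    also have "\<dots> = (\<integral>\<^sup>+z. ennreal (exp (walk_max d N z)) \<partial>noise)
       + (\<Sum>j\<in>{N<..n}. \<integral>\<^sup>+z. ennreal (exp (\<theta> * walk d z j + (1 - \<theta>) * A)) \<partial>noise)"
      by (rule nn_integral_add_sum) measurable
    also have "\<dots> = ennreal ((\<Sum>j\<le>N. measure noise (stay d j) * measure noise (stay d (N - j)))
       + (\<Sum>j\<in>{N<..n}. exp ((\<theta>\<^sup>2 - \<theta>) * d\<^sup>2 / 2 * j + (1 - \<theta>) * A)))"
      unfolding nn_integral_exp_walk_max_real[OF d0] nn_integral_exp_walk_shift
      by (simp add: sum_nonneg)
    also have "\<dots> \<le> ennreal ((1 + \<eta>) * nu d * A + C)"
    proof (rule ennreal_leI)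
      have "(\<Sum>j\<in>{N<..n}. exp ((\<theta>\<^sup>2 - \<theta>) * d\<^sup>2 / 2 * j + (1 - \<theta>) * A)) \<le> (\<Sum>j\<in>{N<..n}. r ^ (j - N))"
        by (intro sum_mono far)
      also have "\<dots> = (\<Sum>j\<in>(\<lambda>j. j - N) ` {N<..n}. r ^ j)"
        by (subst sum.reindex) (auto simp: inj_on_def)
      also have "\<dots> \<le> 1 / (1 - r)" using r by (intro sum_powers_le) auto
      finally have 1: "(\<Sum>j\<in>{N<..n}. exp ((\<theta>\<^sup>2 - \<theta>) * d\<^sup>2 / 2 * j + (1 - \<theta>) * A)) \<le> 1 / (1 - r)" .
      have "(real N + 1) * (stay_prob d)\<^sup>2 \<le> ((1 + \<eta>) * (2 * A / d\<^sup>2) + 2) * (stay_prob d)\<^sup>2"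
        using N2 by (intro mult_right_mono) auto
      also have "\<dots> \<le> (1 + \<eta>) * nu d * A + 2"
      proof -
        have "(1 + \<eta>) * nu d * A = (1 + \<eta>) * (2 * A / d\<^sup>2) * (stay_prob d)\<^sup>2"
          using d0 by (simp add: nu_eq_stay_prob[OF d0] field_simps)
        moreover have "(stay_prob d)\<^sup>2 \<le> 1" using stay_prob_bounds[of d] by (simp add: power_le_one)
        ultimately show ?thesis by (simp only: distrib_right)
      qed
      finally show "(\<Sum>j\<le>N. measure noise (stay d j) * measure noise (stay d (N - j)))
         + (\<Sum>j\<in>{N<..n}. exp ((\<theta>\<^sup>2 - \<theta>) * d\<^sup>2 / 2 * j + (1 - \<theta>) * A)) \<le> (1 + \<eta>) * nu d * A + C"
        using 1 stay_convolution_le[OF c d, of N] unfolding C_def q_def by linarith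
    qed
    finally show ?thesis .
  qed
  then show ?thesis using that by blast
qed

lemma mult_exp_minus_le: "0 < (k::real) \<Longrightarrow> A * exp (- (k * A)) \<le> 1 / k"
proof -
  assume k: "0 < k"
  have "k * A \<le> exp (k * A)" using exp_ge_add_one_self[of "k * A"] by linarith
  then have "k * A * exp (- (k * A)) \<le> exp (k * A) * exp (- (k * A))" by (intro mult_right_mono) auto
  then show ?thesis using k by (simp add: exp_minus field_simps)
qed

text \<open>
  At a time \<open>N\<close> slightly before the passage time \<open>2 * A / d\<^sup>2\<close>
  truncation hardly matters: an excess over \<open>A\<close> is controlled by a moment of order
  slightly larger than one.
\<close>
lemma walk_max_texp_lower:
  assumes c: "0 < c" and \<eta>: "0 < \<eta>" "\<eta> < 1"
  obtains C where "0 \<le> C" "\<And>d n A. c \<le> d \<Longrightarrow> 0 \<le> A \<Longrightarrow> 2 * A / d\<^sup>2 \<le> real n \<Longrightarrow>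
    ennreal ((1 - \<eta>) * nu d * A) \<le> (\<integral>\<^sup>+z. ennreal (exp (min (walk_max d n z) A)) \<partial>noise) + ennreal C"
proof -
  define C where "C = 2 / (c\<^sup>2 * \<eta> ^ 3) + 1"
  have "ennreal ((1 - \<eta>) * nu d * A) \<le> (\<integral>\<^sup>+z. ennreal (exp (min (walk_max d n z) A)) \<partial>noise) + ennreal C"
    if d: "c \<le> d" and A: "0 \<le> A" and n: "2 * A / d\<^sup>2 \<le> real n" for d n A
  proof -
    have d0: "0 < d" using c d by simp
    \<comment> \<open>slightly earlier than the passage time of the tilted walk\<close>
    define N where "N = nat \<lfloor>(1 - \<eta>) * (2 * A / d\<^sup>2)\<rfloor>"
    have N0: "0 \<le> (1 - \<eta>) * (2 * A / d\<^sup>2)" using \<eta> A by simp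
    have N1: "(1 - \<eta>) * (2 * A / d\<^sup>2) \<le> real N + 1" unfolding N_def by linarith
    have N2: "real N \<le> (1 - \<eta>) * (2 * A / d\<^sup>2)" unfolding N_def using N0 by linarith
    also have "\<dots> \<le> 1 * (2 * A / d\<^sup>2)" using \<eta> A by (intro mult_right_mono) auto
    finally have N3: "real N \<le> 2 * A / d\<^sup>2" by simp
    then have Nn: "N \<le> n" using n by linarith
    have path: "ennreal (exp (walk_max d N z)) \<le> ennreal (exp (min (walk_max d n z) A))
       + (\<Sum>j\<le>N. ennreal (exp ((1 + \<eta>) * walk d z j + - \<eta> * A)))" for z
    proof -
      obtain j where j: "j \<le> N" "walk_max d N z = walk d z j" by (rule walk_max_attained)
      show ?thesis
      proof (cases "walk d z j \<le> A")
        case True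
        then have "ennreal (exp (walk_max d N z)) \<le> ennreal (exp (min (walk_max d n z) A))"
          using walk_max_ge[of j n d z] j Nn by (intro ennreal_leI) auto
        then show ?thesis by (simp add: add_increasing2)
      next
        case False
        have "\<eta> * A \<le> \<eta> * walk d z j" using False \<eta> by (intro mult_left_mono) auto
        then have "walk d z j \<le> (1 + \<eta>) * walk d z j + - \<eta> * A" by (simp add: algebra_simps)
        then have "ennreal (exp (walk_max d N z)) \<le> ennreal (exp ((1 + \<eta>) * walk d z j + - \<eta> * A))"
          using j by (intro ennreal_leI) auto
        also have "\<dots> \<le> (\<Sum>j\<le>N. ennreal (exp ((1 + \<eta>) * walk d z j + - \<eta> * A)))"
          using j by (intro member_le_sum) auto
        finally show ?thesis by (simp add: add_increasing)
      qed
    qed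
    \<comment> \<open>\<open>(1 - \<eta>) * (1 + \<eta>) < 1\<close> leaves a factor that decays exponentially in \<open>A\<close>\<close>
    have over: "exp (((1 + \<eta>)\<^sup>2 - (1 + \<eta>)) * d\<^sup>2 / 2 * j + - \<eta> * A) \<le> exp (- (\<eta> ^ 3 * A))" if "j \<le> N" for j
    proof -
      have "d\<^sup>2 / 2 * real j \<le> d\<^sup>2 / 2 * ((1 - \<eta>) * (2 * A / d\<^sup>2))"
        using that N2 by (intro mult_left_mono) auto
      also have "\<dots> = (1 - \<eta>) * A" using d0 by (simp add: field_simps)
      finally have "\<eta> * (1 + \<eta>) * (d\<^sup>2 / 2 * real j) \<le> \<eta> * (1 + \<eta>) * ((1 - \<eta>) * A)"
        using \<eta> by (intro mult_left_mono) auto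
      moreover have "((1 + \<eta>)\<^sup>2 - (1 + \<eta>)) * d\<^sup>2 / 2 * j = \<eta> * (1 + \<eta>) * (d\<^sup>2 / 2 * real j)"
        by (simp add: power2_eq_square algebra_simps)
      moreover have "\<eta> * (1 + \<eta>) * ((1 - \<eta>) * A) = \<eta> * A - \<eta> ^ 3 * A"
        by (simp add: power3_eq_cube algebra_simps)
      ultimately have "((1 + \<eta>)\<^sup>2 - (1 + \<eta>)) * d\<^sup>2 / 2 * j + - \<eta> * A \<le> - (\<eta> ^ 3 * A)" by linarith
      then show ?thesis by (simp only: exp_le_cancel_iff)
    qed
    have "ennreal ((1 - \<eta>) * nu d * A) \<le> ennreal ((real N + 1) * (stay_prob d)\<^sup>2)"
    proof (rule ennreal_leI)
      have "(1 - \<eta>) * (2 * A / d\<^sup>2) * (stay_prob d)\<^sup>2 \<le> (real N + 1) * (stay_prob d)\<^sup>2"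
        using N1 by (intro mult_right_mono) auto
      moreover have "(1 - \<eta>) * nu d * A = (1 - \<eta>) * (2 * A / d\<^sup>2) * (stay_prob d)\<^sup>2"
        using d0 by (simp add: nu_eq_stay_prob[OF d0] field_simps)
      ultimately show "(1 - \<eta>) * nu d * A \<le> (real N + 1) * (stay_prob d)\<^sup>2" by simp
    qed
    also have "\<dots> \<le> (\<integral>\<^sup>+z. ennreal (exp (walk_max d N z)) \<partial>noise)"
      unfolding nn_integral_exp_walk_max_real[OF d0] by (intro ennreal_leI stay_convolution_ge)
    also have "\<dots> \<le> (\<integral>\<^sup>+z. ennreal (exp (min (walk_max d n z) A))
       + (\<Sum>j\<le>N. ennreal (exp ((1 + \<eta>) * walk d z j + - \<eta> * A))) \<partial>noise)"
      by (intro nn_integral_mono path)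
    also have "\<dots> = (\<integral>\<^sup>+z. ennreal (exp (min (walk_max d n z) A)) \<partial>noise)
       + (\<Sum>j\<le>N. \<integral>\<^sup>+z. ennreal (exp ((1 + \<eta>) * walk d z j + - \<eta> * A)) \<partial>noise)"
      by (rule nn_integral_add_sum) measurable
    also have "(\<Sum>j\<le>N. \<integral>\<^sup>+z. ennreal (exp ((1 + \<eta>) * walk d z j + - \<eta> * A)) \<partial>noise)
       = ennreal (\<Sum>j\<le>N. exp (((1 + \<eta>)\<^sup>2 - (1 + \<eta>)) * d\<^sup>2 / 2 * j + - \<eta> * A))"
      unfolding nn_integral_exp_walk_shift by simp
    also have "\<dots> \<le> ennreal C"
    proof (rule ennreal_leI)
      have "(\<Sum>j\<le>N. exp (((1 + \<eta>)\<^sup>2 - (1 + \<eta>)) * d\<^sup>2 / 2 * j + - \<eta> * A)) \<le> (\<Sum>j\<le>N. exp (- (\<eta> ^ 3 * A)))"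
        by (intro sum_mono over) auto
      also have "\<dots> = real N * exp (- (\<eta> ^ 3 * A)) + exp (- (\<eta> ^ 3 * A))" by (simp add: algebra_simps)
      also have "\<dots> \<le> 2 * A / c\<^sup>2 * exp (- (\<eta> ^ 3 * A)) + 1"
      proof (intro add_mono mult_right_mono)
        show "real N \<le> 2 * A / c\<^sup>2"
          by (rule order_trans[OF N3]) (use c d A in \<open>auto intro!: divide_left_mono power_mono\<close>)
      qed (use \<eta> A in auto)
      also have "\<dots> = 2 / c\<^sup>2 * (A * exp (- (\<eta> ^ 3 * A))) + 1" by simp
      also have "\<dots> \<le> 2 / c\<^sup>2 * (1 / \<eta> ^ 3) + 1"
        using \<eta> by (intro add_right_mono mult_left_mono mult_exp_minus_le) auto
      finally show "(\<Sum>j\<le>N. exp (((1 + \<eta>)\<^sup>2 - (1 + \<eta>)) * d\<^sup>2 / 2 * j + - \<eta> * A)) \<le> C" by (simp add: C_def)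
    qed
    finally show ?thesis by (simp add: add_left_mono)
  qed
  moreover have "0 \<le> C" using c \<eta> by (simp add: C_def)
  ultimately show ?thesis using that by blast
qed

section \<open>Two-sided windows with a quadratic perturbation\<close>

abbreviation noise2 :: "((nat \<Rightarrow> real) \<times> (nat \<Rightarrow> real)) measure" where
  "noise2 \<equiv> noise \<Otimes>\<^sub>M noise"

interpretation noise2: pair_prob_space noise noise ..

text \<open>
  The product with the standard normal density stays below twice a normal density of standard
  deviation \<open>2\<close>.
\<close>
lemma nn_integral_gauss_square:
  assumes "0 \<le> \<gamma>" "\<gamma> * real k \<le> 3 / 8"
  shows "(\<integral>\<^sup>+z. ennreal (exp (\<gamma> * (\<Sum>i<k. z i)\<^sup>2)) \<partial>noise) \<le> 2"
proof (cases "k = 0")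
  case True
  then show ?thesis using noise.emeasure_space_1 by simp
next
  case False
  let ?\<beta> = "\<gamma> * real k"
  have "(\<integral>\<^sup>+z. ennreal (exp (\<gamma> * (\<Sum>i<k. z i)\<^sup>2)) \<partial>noise)
     = (\<integral>\<^sup>+z. ennreal (exp (?\<beta> * (1 * (\<Sum>i<k. z i) / sqrt (real k))\<^sup>2)) \<partial>noise)"
    using False by (simp add: power_divide)
  also have "\<dots> = (\<integral>\<^sup>+g. ennreal (exp (?\<beta> * g\<^sup>2)) \<partial>distr noise borel (\<lambda>z. 1 * (\<Sum>i<k. z i) / sqrt (real k)))"
    by (subst nn_integral_distr) auto
  also have "\<dots> = (\<integral>\<^sup>+g. ennreal (exp (?\<beta> * g\<^sup>2)) \<partial>std_normal_distribution)"
    using noise_sum_standardized[of k 1] False by simp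
  also have "\<dots> = (\<integral>\<^sup>+g. ennreal (std_normal_density g * exp (?\<beta> * g\<^sup>2)) \<partial>lborel)"
    by (subst nn_integral_density) (auto simp: ennreal_mult)
  also have "\<dots> \<le> (\<integral>\<^sup>+g. ennreal 2 * ennreal (normal_density 0 2 g) \<partial>lborel)"
  proof (intro nn_integral_mono)
    fix g :: real
    \<comment> \<open>\<open>3 / 8 = 1 / 2 - 1 / 8\<close>, where \<open>1 / 8\<close> belongs to the variance \<open>4\<close>\<close>
    have "- g\<^sup>2 / 2 + ?\<beta> * g\<^sup>2 \<le> - g\<^sup>2 / 8"
      using mult_right_mono[OF assms(2), of "g\<^sup>2"] by simp
    then have "exp (- g\<^sup>2 / 2) * exp (?\<beta> * g\<^sup>2) \<le> exp (- g\<^sup>2 / 8)"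
      unfolding exp_add[symmetric] by simp
    then have "std_normal_density g * exp (?\<beta> * g\<^sup>2) \<le> 2 * normal_density 0 2 g"
      using real_sqrt_mult[of 4 2]
      by (simp add: std_normal_density_def normal_density_def real_sqrt_mult divide_right_mono)
    then show "ennreal (std_normal_density g * exp (?\<beta> * g\<^sup>2)) \<le> ennreal 2 * ennreal (normal_density 0 2 g)"
      by (simp add: ennreal_mult'[symmetric] ennreal_leI del: ennreal_numeral)
  qed
  also have "\<dots> = 2"
    by (subst nn_integral_cmult) (auto simp: nn_integral_eq_integral)
  finally show ?thesis .
qed

text \<open>
  The quadratic error made by separating windows and cores when the split point is moved by
  \<open>j\<close> steps into the side with noise \<open>x\<close>; \<open>z\<close> is the noise
  on the other side of the change point. The middle sum is centred at \<open>d\<close> because the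
  passed observations are then counted with the wrong mean.
\<close>
definition pert :: "real \<Rightarrow> real \<Rightarrow> nat \<Rightarrow> (nat \<Rightarrow> real) \<Rightarrow> (nat \<Rightarrow> real) \<Rightarrow> nat \<Rightarrow> real" where
  "pert \<kappa> d n x z j = 2 * \<kappa> * ((\<Sum>i<n. z i)\<^sup>2 + (\<Sum>i<j. x i - d)\<^sup>2 + (\<Sum>i=j..<n. x i)\<^sup>2)"

lemma pert_nonneg: "0 \<le> \<kappa> \<Longrightarrow> 0 \<le> pert \<kappa> d n x z j"
  by (simp add: pert_def)

lemma pert_measurable [measurable]:
  assumes [measurable]: "f \<in> K \<rightarrow>\<^sub>M noise" "g \<in> K \<rightarrow>\<^sub>M noise"
  shows "(\<lambda>w. pert \<kappa> d n (f w) (g w) j) \<in> borel_measurable K"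
proof -
  have [measurable]: "(\<lambda>w. f w i) \<in> borel_measurable K" "(\<lambda>w. g w i) \<in> borel_measurable K" for i
    using measurable_compose[OF assms(1) coord_measurable] measurable_compose[OF assms(2) coord_measurable] by auto
  show ?thesis unfolding pert_def by measurable
qed

lemma walk_measurable' [measurable]:
  assumes [measurable]: "f \<in> K \<rightarrow>\<^sub>M noise"
  shows "(\<lambda>w. walk d (f w) j) \<in> borel_measurable K"
  by (rule measurable_compose[OF assms walk_measurable])

lemma nn_integral_noise2_swap:
  assumes [measurable]: "f \<in> borel_measurable noise2"
  shows "(\<integral>\<^sup>+w. f (snd w, fst w) \<partial>noise2) = (\<integral>\<^sup>+w. f w \<partial>noise2)"
proof -
  have "(\<integral>\<^sup>+w. f w \<partial>noise2) = (\<integral>\<^sup>+w. f w \<partial>distr noise2 noise2 (\<lambda>(x, y). (y, x)))"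
    using noise2.distr_pair_swap by simp
  also have "\<dots> = (\<integral>\<^sup>+w. f (snd w, fst w) \<partial>noise2)"
    by (subst nn_integral_distr) (auto simp: split_beta')
  finally show ?thesis ..
qed

lemma nn_integral_noise2_fst:
  assumes [measurable]: "f \<in> borel_measurable noise"
  shows "(\<integral>\<^sup>+w. f (fst w) \<partial>noise2) = (\<integral>\<^sup>+x. f x \<partial>noise)"
  by (subst noise.nn_integral_fst[symmetric]) (auto simp: noise.emeasure_space_1[simplified])

lemma nn_integral_noise2_prod:
  assumes [measurable]: "f \<in> borel_measurable noise" "g \<in> borel_measurable noise"
  shows "(\<integral>\<^sup>+w. f (fst w) * g (snd w) \<partial>noise2) = (\<integral>\<^sup>+x. f x \<partial>noise) * (\<integral>\<^sup>+x. g x \<partial>noise)"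
proof -
  have "(\<integral>\<^sup>+w. f (fst w) * g (snd w) \<partial>noise2) = (\<integral>\<^sup>+x. (\<integral>\<^sup>+y. f x * g y \<partial>noise) \<partial>noise)"
    by (subst noise.nn_integral_fst[symmetric]) auto
  also have "\<dots> = (\<integral>\<^sup>+x. f x * (\<integral>\<^sup>+y. g y \<partial>noise) \<partial>noise)"
    by (intro nn_integral_cong nn_integral_cmult assms)
  also have "\<dots> = (\<integral>\<^sup>+x. f x \<partial>noise) * (\<integral>\<^sup>+x. g x \<partial>noise)"
    by (rule nn_integral_multc[OF assms(1)])
  finally show ?thesis .
qed

lemma walk_scale: "\<theta> * walk d x j = walk (\<theta> * d) x j - \<theta> * (1 - \<theta>) / 2 * d\<^sup>2 * j"
  by (induction j) (auto simp: walk_Suc power2_eq_square field_simps)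

text \<open>
  Tilting by the multiple \<open>\<theta>\<close> of the walk leaves the square of a Gaussian sum
  with drift, whose drift part is absorbed into the exponent.
\<close>
lemma nn_integral_exp_walk_pert_left:
  assumes \<theta>: "0 \<le> \<theta>" "\<theta> \<le> 1" and \<gamma>: "0 \<le> \<gamma>" "\<gamma> * real j \<le> 1 / 16"
  shows "(\<integral>\<^sup>+x. ennreal (exp (\<theta> * walk d x j + \<gamma> * (\<Sum>i<j. x i - d)\<^sup>2)) \<partial>noise)
    \<le> ennreal (2 * exp ((- \<theta> * (1 - \<theta>) / 2 + (1 - \<theta>)\<^sup>2 / 8) * d\<^sup>2 * j))"
proof -
  let ?b = "- \<theta> * (1 - \<theta>) / 2 * d\<^sup>2 * j"
  let ?e = "(1 - \<theta>)\<^sup>2 / 8 * d\<^sup>2 * j"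
  let ?I = "\<integral>\<^sup>+x. ennreal (exp (walk (\<theta> * d) x j)) * ennreal (exp (\<gamma> * (\<Sum>i<j. x i - d)\<^sup>2)) \<partial>noise"
  have "(\<integral>\<^sup>+x. ennreal (exp (\<theta> * walk d x j + \<gamma> * (\<Sum>i<j. x i - d)\<^sup>2)) \<partial>noise)
     = (\<integral>\<^sup>+x. ennreal (exp ?b) * (ennreal (exp (walk (\<theta> * d) x j)) * ennreal (exp (\<gamma> * (\<Sum>i<j. x i - d)\<^sup>2))) \<partial>noise)"
  proof (intro nn_integral_cong)
    fix x :: "nat \<Rightarrow> real"
    let ?S = "\<gamma> * (\<Sum>i<j. x i - d)\<^sup>2"
    have "\<theta> * walk d x j + ?S = ?b + (walk (\<theta> * d) x j + ?S)"
      unfolding walk_scale by simp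
    then show "ennreal (exp (\<theta> * walk d x j + ?S)) = ennreal (exp ?b) * (ennreal (exp (walk (\<theta> * d) x j)) * ennreal (exp ?S))"
      by (simp only: exp_add ennreal_mult' exp_ge_zero)
  qed
  also have "\<dots> = ennreal (exp ?b) * ?I"
    by (rule nn_integral_cmult) measurable
  finally have left: "(\<integral>\<^sup>+x. ennreal (exp (\<theta> * walk d x j + \<gamma> * (\<Sum>i<j. x i - d)\<^sup>2)) \<partial>noise) = ennreal (exp ?b) * ?I" .
  have "?I = (\<integral>\<^sup>+x. ennreal (exp (\<gamma> * (\<Sum>i<j. reflect (\<theta> * d) j x i - d)\<^sup>2)) \<partial>noise)"
    by (rule nn_integral_tilt) measurable
  also have "\<dots> \<le> (\<integral>\<^sup>+x. ennreal (exp ?e) * ennreal (exp (2 * \<gamma> * (\<Sum>i<j. x i)\<^sup>2)) \<partial>noise)"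
  proof (intro nn_integral_mono)
    fix x :: "nat \<Rightarrow> real"
    have "(\<Sum>i<j. reflect (\<theta> * d) j x i - d) = - (1 - \<theta>) * d * real j - (\<Sum>i<j. x i)"
    proof -
      have "(\<Sum>i<j. reflect (\<theta> * d) j x i - d) = (\<Sum>i<j. - (1 - \<theta>) * d - x i)"
        by (intro sum.cong) (auto simp: reflect_def algebra_simps)
      then show ?thesis by (simp add: sum_subtractf)
    qed
    also have "(- (1 - \<theta>) * d * real j - (\<Sum>i<j. x i))\<^sup>2 \<le> 2 * ((1 - \<theta>) * d * real j)\<^sup>2 + 2 * (\<Sum>i<j. x i)\<^sup>2"
      using sum_squares_bound[of "(1 - \<theta>) * d * real j" "\<Sum>i<j. x i"]
      by (simp add: power2_eq_square algebra_simps)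
    finally have "\<gamma> * (\<Sum>i<j. reflect (\<theta> * d) j x i - d)\<^sup>2 \<le> \<gamma> * (2 * ((1 - \<theta>) * d * real j)\<^sup>2 + 2 * (\<Sum>i<j. x i)\<^sup>2)"
      using \<gamma> by (intro mult_left_mono)
    also have "\<dots> = (\<gamma> * real j) * (2 * (1 - \<theta>)\<^sup>2 * d\<^sup>2 * real j) + 2 * \<gamma> * (\<Sum>i<j. x i)\<^sup>2"
      by (simp add: power2_eq_square algebra_simps)
    also have "\<dots> \<le> 1 / 16 * (2 * (1 - \<theta>)\<^sup>2 * d\<^sup>2 * real j) + 2 * \<gamma> * (\<Sum>i<j. x i)\<^sup>2"
      using \<gamma> by (intro add_right_mono mult_right_mono) auto
    finally show "ennreal (exp (\<gamma> * (\<Sum>i<j. reflect (\<theta> * d) j x i - d)\<^sup>2)) \<le> ennreal (exp ?e) * ennreal (exp (2 * \<gamma> * (\<Sum>i<j. x i)\<^sup>2))"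
      by (simp add: ennreal_mult[symmetric] exp_add[symmetric] ennreal_leI mult_ac)
  qed
  also have "\<dots> = ennreal (exp ?e) * (\<integral>\<^sup>+x. ennreal (exp (2 * \<gamma> * (\<Sum>i<j. x i)\<^sup>2)) \<partial>noise)"
    by (rule nn_integral_cmult) measurable
  also have "\<dots> \<le> ennreal (exp ?e) * 2"
    using \<gamma> by (intro mult_left_mono nn_integral_gauss_square) auto

  finally have "ennreal (exp ?b) * ?I \<le> ennreal (exp ?b) * (ennreal (exp ?e) * 2)"
    by (rule mult_left_mono) simp
  also have "ennreal (exp ?b) * (ennreal (exp ?e) * 2) = ennreal (2 * exp ((- \<theta> * (1 - \<theta>) / 2 + (1 - \<theta>)\<^sup>2 / 8) * d\<^sup>2 * j))"
  proof -
    have "?b + ?e = (- \<theta> * (1 - \<theta>) / 2 + (1 - \<theta>)\<^sup>2 / 8) * d\<^sup>2 * j" by (simp only: distrib_right)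
    moreover have "exp ?b * (exp ?e * 2) = 2 * exp (?b + ?e)" by (simp only: exp_add mult_ac)
    ultimately show ?thesis
      by (simp only: ennreal_numeral[symmetric] ennreal_mult'[symmetric] exp_ge_zero)
  qed
  finally show ?thesis unfolding left .
qed

text \<open>
  The walk with the first square, and the other two squares, depend on three disjoint groups of
  coordinates.
\<close>
lemma nn_integral_exp_walk_pert:
  assumes \<theta>: "0 \<le> \<theta>" "\<theta> \<le> 1" and "0 \<le> s" "0 \<le> \<kappa>" and sn: "s * \<kappa> * real n \<le> 1 / 32" and "j \<le> n"
  shows "(\<integral>\<^sup>+w. ennreal (exp (\<theta> * walk d (fst w) j + s * pert \<kappa> d n (fst w) (snd w) j)) \<partial>noise2)
    \<le> ennreal (8 * exp ((- \<theta> * (1 - \<theta>) / 2 + (1 - \<theta>)\<^sup>2 / 8) * d\<^sup>2 * j))"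
proof -
  define \<gamma> where "\<gamma> = 2 * s * \<kappa>"
  have \<gamma>: "0 \<le> \<gamma>" "\<gamma> * real n \<le> 1 / 16" using assms by (auto simp: \<gamma>_def)
  have \<gamma>k: "\<gamma> * real k \<le> 1 / 16" if "k \<le> n" for k
    using mult_left_mono[of "real k" "real n" \<gamma>] \<gamma> that by linarith
  let ?F = "\<lambda>x. ennreal (exp (\<theta> * walk d x j + \<gamma> * (\<Sum>i<j. x i - d)\<^sup>2))"
  let ?G = "\<lambda>k x. ennreal (exp (\<gamma> * (\<Sum>i<k. x i)\<^sup>2))"
  have tail: "(\<Sum>i=j..<n. x i) = (\<Sum>i<n - j. x (j + i))" for x :: "nat \<Rightarrow> real"
    using sum.shift_bounds_nat_ivl[of x 0 j "n - j"] \<open>j \<le> n\<close> by (simp add: atLeast0LessThan add.commute)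
  have [measurable]: "(\<lambda>x. ?G (n - j) (\<lambda>i. x (j + i))) \<in> borel_measurable noise" by measurable
  have "(\<integral>\<^sup>+w. ennreal (exp (\<theta> * walk d (fst w) j + s * pert \<kappa> d n (fst w) (snd w) j)) \<partial>noise2)
     = (\<integral>\<^sup>+w. (?F (fst w) * ?G (n - j) (\<lambda>i. fst w (j + i))) * ?G n (snd w) \<partial>noise2)"
    by (intro nn_integral_cong)
      (simp add: ennreal_mult[symmetric] exp_add[symmetric] pert_def tail \<gamma>_def algebra_simps)
  also have "\<dots> = (\<integral>\<^sup>+x. ?F x * ?G (n - j) (\<lambda>i. x (j + i)) \<partial>noise) * (\<integral>\<^sup>+x. ?G n x \<partial>noise)"
    by (rule nn_integral_noise2_prod) measurable
  also have "(\<integral>\<^sup>+x. ?F x * ?G (n - j) (\<lambda>i. x (j + i)) \<partial>noise) = (\<integral>\<^sup>+x. ?F x \<partial>noise) * (\<integral>\<^sup>+x. ?G (n - j) x \<partial>noise)"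
  proof (rule nn_integral_noise_indep)
    fix z z' :: "nat \<Rightarrow> real" assume e: "\<And>i. i < j \<Longrightarrow> z i = z' i"
    have "walk d z j = walk d z' j" "(\<Sum>i<j. z i - d) = (\<Sum>i<j. z' i - d)"
      using e by (auto simp: walk_def)
    then show "?F z = ?F z'" by simp
  qed measurable
  also have "(\<integral>\<^sup>+x. ?F x \<partial>noise) * (\<integral>\<^sup>+x. ?G (n - j) x \<partial>noise) * (\<integral>\<^sup>+x. ?G n x \<partial>noise)
     \<le> ennreal (2 * exp ((- \<theta> * (1 - \<theta>) / 2 + (1 - \<theta>)\<^sup>2 / 8) * d\<^sup>2 * j)) * 2 * 2"
    using \<gamma>k[of j] \<gamma>k[of "n - j"] \<gamma>k[of n] \<open>j \<le> n\<close> \<gamma>(1) \<theta>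
    by (intro mult_mono nn_integral_exp_walk_pert_left nn_integral_gauss_square) auto
  also have "\<dots> = ennreal (8 * exp ((- \<theta> * (1 - \<theta>) / 2 + (1 - \<theta>)\<^sup>2 / 8) * d\<^sup>2 * j))"
    by (simp add: ennreal_numeral[symmetric] ennreal_mult[symmetric] del: ennreal_numeral)
  finally show ?thesis .
qed

text \<open>
  The sign \<open>\<sigma>\<close> is \<open>1\<close> for upper bounds of the statistic and
  \<open>-1\<close> for lower bounds.
\<close>
definition window_side :: "real \<Rightarrow> real \<Rightarrow> real \<Rightarrow> nat \<Rightarrow> (nat \<Rightarrow> real) \<Rightarrow> (nat \<Rightarrow> real) \<Rightarrow> real" where
  "window_side \<sigma> \<kappa> d n x z = Max ((\<lambda>j. walk d x j + \<sigma> * pert \<kappa> d n x z j) ` {..n})"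

definition window_max :: "real \<Rightarrow> real \<Rightarrow> real \<Rightarrow> nat \<Rightarrow> (nat \<Rightarrow> real) \<times> (nat \<Rightarrow> real) \<Rightarrow> real" where
  "window_max \<sigma> \<kappa> d n w = max (window_side \<sigma> \<kappa> d n (fst w) (snd w)) (window_side \<sigma> \<kappa> d n (snd w) (fst w))"

lemma window_side_measurable [measurable]:
  assumes [measurable]: "f \<in> K \<rightarrow>\<^sub>M noise" "g \<in> K \<rightarrow>\<^sub>M noise"
  shows "(\<lambda>w. window_side \<sigma> \<kappa> d n (f w) (g w)) \<in> borel_measurable K"
  unfolding window_side_def by measurable

lemma window_max_measurable [measurable]: "window_max \<sigma> \<kappa> d n \<in> borel_measurable noise2"
  unfolding window_max_def[abs_def] by measurable

lemma window_side_ge: "j \<le> n \<Longrightarrow> walk d x j + \<sigma> * pert \<kappa> d n x z j \<le> window_side \<sigma> \<kappa> d n x z"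
  unfolding window_side_def by (intro Max_ge) auto

lemma window_side_attained: obtains j where "j \<le> n" "window_side \<sigma> \<kappa> d n x z = walk d x j + \<sigma> * pert \<kappa> d n x z j"
proof -
  have "window_side \<sigma> \<kappa> d n x z \<in> (\<lambda>j. walk d x j + \<sigma> * pert \<kappa> d n x z j) ` {..n}"
    unfolding window_side_def by (intro Max_in) auto
  then show ?thesis using that by auto
qed

text \<open>
  Dominates the exponential of the walk at the positions up to \<open>J\<close>; the multiple
  \<open>s\<close> of the perturbation pays for paths with a large perturbation. The far positions
  below need only half of the exponent.
\<close>
definition near_excess :: "real \<Rightarrow> real \<Rightarrow> nat \<Rightarrow> nat \<Rightarrow> real \<Rightarrow> (nat \<Rightarrow> real) \<times> (nat \<Rightarrow> real) \<Rightarrow> ennreal" where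
  "near_excess \<kappa> d n J s w = (\<Sum>j\<le>J. ennreal (exp (1 * walk d (fst w) j + s * pert \<kappa> d n (fst w) (snd w) j)))"

definition far_excess :: "real \<Rightarrow> real \<Rightarrow> nat \<Rightarrow> nat \<Rightarrow> (nat \<Rightarrow> real) \<times> (nat \<Rightarrow> real) \<Rightarrow> ennreal" where
  "far_excess \<kappa> d n J w = (\<Sum>j\<in>{J<..n}. ennreal (exp (1/2 * walk d (fst w) j + 1/2 * pert \<kappa> d n (fst w) (snd w) j)))"

lemma near_excess_measurable [measurable]: "near_excess \<kappa> d n J s \<in> borel_measurable noise2"
  unfolding near_excess_def[abs_def] by measurable

lemma far_excess_measurable [measurable]: "far_excess \<kappa> d n J \<in> borel_measurable noise2"
  unfolding far_excess_def[abs_def] by measurable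

lemma near_excess_integral:
  assumes "0 \<le> s" "0 \<le> \<kappa>" "s * \<kappa> * real n \<le> 1 / 32" "J \<le> n"
  shows "(\<integral>\<^sup>+w. near_excess \<kappa> d n J s w \<partial>noise2) \<le> ennreal (8 * (real J + 1))"
proof -
  have "(\<integral>\<^sup>+w. near_excess \<kappa> d n J s w \<partial>noise2)
     = (\<Sum>j\<le>J. \<integral>\<^sup>+w. ennreal (exp (1 * walk d (fst w) j + s * pert \<kappa> d n (fst w) (snd w) j)) \<partial>noise2)"
    unfolding near_excess_def by (rule nn_integral_sum) measurable
  also have "\<dots> \<le> (\<Sum>j\<le>J. ennreal (8 * exp ((- 1 * (1 - 1) / 2 + (1 - 1)\<^sup>2 / 8) * d\<^sup>2 * j)))"
    using assms by (intro sum_mono nn_integral_exp_walk_pert) auto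
  also have "\<dots> = ennreal (8 * (real J + 1))"
    by (subst sum_ennreal) (simp_all add: algebra_simps)
  finally show ?thesis .
qed

lemma far_excess_integral:
  assumes c: "0 < c" "c \<le> d" and "0 \<le> \<kappa>" "\<kappa> * real n \<le> 1 / 32"
  defines "r \<equiv> exp (- (3 * c\<^sup>2 / 32))"
  shows "(\<integral>\<^sup>+w. far_excess \<kappa> d n J w \<partial>noise2) \<le> ennreal (8 * (r ^ J / (1 - r)))"
proof -
  have r: "0 < r" "r < 1" using c by (auto simp: r_def)
  have "(\<integral>\<^sup>+w. far_excess \<kappa> d n J w \<partial>noise2)
     = (\<Sum>j\<in>{J<..n}. \<integral>\<^sup>+w. ennreal (exp (1/2 * walk d (fst w) j + 1/2 * pert \<kappa> d n (fst w) (snd w) j)) \<partial>noise2)"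
    unfolding far_excess_def by (rule nn_integral_sum) measurable
  also have "\<dots> \<le> (\<Sum>j\<in>{J<..n}. ennreal (8 * exp ((- (1/2) * (1 - 1/2) / 2 + (1 - 1/2)\<^sup>2 / 8) * d\<^sup>2 * j)))"
    using assms by (intro sum_mono nn_integral_exp_walk_pert) auto
  also have "\<dots> \<le> (\<Sum>j\<in>{J<..n}. ennreal (8 * (r ^ J * r ^ (j - J))))"
  proof (intro sum_mono ennreal_leI mult_left_mono)
    fix j assume "j \<in> {J<..n}"
    then have "r ^ J * r ^ (j - J) = r ^ j" by (simp add: power_add[symmetric])
    moreover have "exp ((- (1/2) * (1 - 1/2) / 2 + (1 - 1/2)\<^sup>2 / 8) * d\<^sup>2 * j) = exp (- (3 * d\<^sup>2 / 32)) ^ j"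
      unfolding exp_of_nat_mult[symmetric] by (simp add: power2_eq_square field_simps)
    moreover have "exp (- (3 * d\<^sup>2 / 32)) ^ j \<le> r ^ j"
      unfolding r_def using c by (intro power_mono) (auto intro!: power_mono)
    ultimately show "exp ((- (1/2) * (1 - 1/2) / 2 + (1 - 1/2)\<^sup>2 / 8) * d\<^sup>2 * j) \<le> r ^ J * r ^ (j - J)" by simp
  qed auto
  also have "\<dots> = ennreal (8 * (r ^ J * (\<Sum>j\<in>{J<..n}. r ^ (j - J))))"
    using r by (simp add: sum_distrib_left)
  also have "\<dots> \<le> ennreal (8 * (r ^ J / (1 - r)))"
  proof (rule ennreal_leI)
    have "(\<Sum>j\<in>{J<..n}. r ^ (j - J)) = (\<Sum>j\<in>(\<lambda>j. j - J) ` {J<..n}. r ^ j)"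
      by (subst sum.reindex) (auto simp: inj_on_def)
    also have "\<dots> \<le> 1 / (1 - r)" using r by (intro sum_powers_le) auto
    finally have "r ^ J * (\<Sum>j\<in>{J<..n}. r ^ (j - J)) \<le> r ^ J * (1 / (1 - r))"
      using r by (intro mult_left_mono) auto
    then show "8 * (r ^ J * (\<Sum>j\<in>{J<..n}. r ^ (j - J))) \<le> 8 * (r ^ J / (1 - r))" by simp
  qed
  finally show ?thesis .
qed

text \<open>
  At the maximizing position \<open>j\<close> either the perturbation is at most
  \<open>\<eta>\<close> and costs a factor \<open>exp \<eta>\<close>; or it exceeds
  \<open>\<eta>\<close>, which gains a factor \<open>exp (- L * \<eta>)\<close> from
  \<open>L\<close> further multiples of it; or the position is beyond \<open>J\<close> and
  \<open>min v A \<le> (v + A) / 2\<close> suffices.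
\<close>
lemma exp_window_side_le:
  assumes "0 \<le> \<kappa>" "0 \<le> L" "0 \<le> \<eta>"
  shows "ennreal (exp (min (window_side 1 \<kappa> d n x z) A)) \<le>
    ennreal (exp \<eta>) * ennreal (exp (min (walk_max d n x) A)) + ennreal (exp (- L * \<eta>)) * near_excess \<kappa> d n J (1 + L) (x, z)
     + ennreal (exp (A / 2)) * far_excess \<kappa> d n J (x, z)"
    (is "_ \<le> ?T1 + ?T2 + ?T3")
proof -
  obtain j where j: "j \<le> n" "window_side 1 \<kappa> d n x z = walk d x j + 1 * pert \<kappa> d n x z j"
    by (rule window_side_attained)
  let ?p = "pert \<kappa> d n x z j" and ?w = "walk d x j"
  have p: "0 \<le> ?p" using assms pert_nonneg by simp
  consider "?p \<le> \<eta>" | "\<eta> < ?p" "j \<le> J" | "J < j" by linarith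
  then show ?thesis
  proof cases
    case 1
    have "min (?w + ?p) A \<le> \<eta> + min (walk_max d n x) A"
      using walk_max_ge[OF j(1), of d x] 1 \<open>0 \<le> \<eta>\<close> by (auto simp: min_def)
    then have "ennreal (exp (min (window_side 1 \<kappa> d n x z) A)) \<le> ?T1"
      by (simp add: j ennreal_mult[symmetric] exp_add[symmetric] ennreal_leI)
    then show ?thesis by (simp add: add_increasing2)
  next
    case 2
    have "L * \<eta> \<le> L * ?p" using 2 assms by (intro mult_left_mono) auto
    then have "?w + ?p \<le> - L * \<eta> + (1 * ?w + (1 + L) * ?p)" by (simp add: distrib_right)
    then have "ennreal (exp (min (window_side 1 \<kappa> d n x z) A)) \<le> ennreal (exp (- L * \<eta>)) * ennreal (exp (1 * ?w + (1 + L) * ?p))"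
      unfolding ennreal_mult[symmetric, OF exp_ge_zero exp_ge_zero] exp_add[symmetric] j(2) by (intro ennreal_leI) simp
    also have "\<dots> \<le> ?T2"
      unfolding near_excess_def fst_conv snd_conv using 2 by (intro mult_left_mono member_le_sum) auto
    finally show ?thesis by (simp add: add_increasing add_increasing2)
  next
    case 3
    have "min (?w + ?p) A \<le> A / 2 + (1/2 * ?w + 1/2 * ?p)" by (simp add: min_def)
    then have "ennreal (exp (min (window_side 1 \<kappa> d n x z) A)) \<le> ennreal (exp (A / 2)) * ennreal (exp (1/2 * ?w + 1/2 * ?p))"
      unfolding ennreal_mult[symmetric, OF exp_ge_zero exp_ge_zero] exp_add[symmetric] j(2) by (intro ennreal_leI) simp
    also have "\<dots> \<le> ?T3"
      unfolding far_excess_def fst_conv snd_conv using 3 j by (intro mult_left_mono member_le_sum) auto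
    finally show ?thesis by (simp add: add_increasing)
  qed
qed

text \<open>
  The counterpart of the previous bound for lower estimates: a small perturbation costs a factor,
  a large one is rare.
\<close>
lemma exp_walk_max_le:
  assumes "0 \<le> \<kappa>" "0 \<le> L" "0 \<le> \<eta>" "J \<le> n" "0 \<le> A"
    and R: "window_side (-1) \<kappa> d n x z \<le> R"
  shows "ennreal (exp (min (walk_max d J x) A)) \<le>
    ennreal (exp \<eta>) * ennreal (exp (min (max 0 R) A)) + ennreal (exp (- L * \<eta>)) * near_excess \<kappa> d n J L (x, z)"
    (is "_ \<le> ?T1 + ?T2")
proof -
  obtain j where j: "j \<le> J" "walk_max d J x = walk d x j" by (rule walk_max_attained)
  let ?p = "pert \<kappa> d n x z j" and ?w = "walk d x j"
  have p: "0 \<le> ?p" using assms pert_nonneg by simp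
  have ge: "?w - ?p \<le> R" using window_side_ge[of j n d x "-1" \<kappa> z] j assms by simp
  show ?thesis
  proof (cases "?p \<le> \<eta>")
    case True
    have "min ?w A \<le> \<eta> + min (max 0 R) A"
      using True ge assms by (auto simp: min_def max_def)
    then have "ennreal (exp (min (walk_max d J x) A)) \<le> ?T1"
      by (simp add: j ennreal_mult[symmetric] exp_add[symmetric] ennreal_leI)
    then show ?thesis by (simp add: add_increasing2)
  next
    case False
    have "L * \<eta> \<le> L * ?p" using False assms by (intro mult_left_mono) auto
    then have "?w \<le> - L * \<eta> + (1 * ?w + L * ?p)" by simp
    then have "ennreal (exp (min (walk_max d J x) A)) \<le> ennreal (exp (- L * \<eta>)) * ennreal (exp (1 * ?w + L * ?p))"
      unfolding ennreal_mult[symmetric, OF exp_ge_zero exp_ge_zero] exp_add[symmetric] j(2) by (intro ennreal_leI) simp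
    also have "\<dots> \<le> ?T2"
      unfolding near_excess_def fst_conv snd_conv using j by (intro mult_left_mono member_le_sum) auto
    finally show ?thesis by (simp add: add_increasing)
  qed
qed

text \<open>
  Half of the walk has geometrically decaying exponential moments, so this bound does not depend
  on the horizon.
\<close>
lemma exp_half_walk_max:
  assumes "0 < c" "c \<le> d"
  shows "(\<integral>\<^sup>+x. ennreal (exp (walk_max d J x / 2)) \<partial>noise) \<le> ennreal (1 / (1 - exp (- c\<^sup>2 / 8)))"
proof -
  have "(\<integral>\<^sup>+x. ennreal (exp (walk_max d J x / 2)) \<partial>noise) \<le> (\<integral>\<^sup>+x. (\<Sum>j\<le>J. ennreal (exp (1/2 * walk d x j))) \<partial>noise)"
  proof (intro nn_integral_mono)
    fix x
    obtain j where j: "j \<le> J" "walk_max d J x = walk d x j" by (rule walk_max_attained)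
    have "ennreal (exp (1/2 * walk d x j)) \<le> (\<Sum>j\<le>J. ennreal (exp (1/2 * walk d x j)))"
      using j by (intro member_le_sum) auto
    then show "ennreal (exp (walk_max d J x / 2)) \<le> (\<Sum>j\<le>J. ennreal (exp (1/2 * walk d x j)))"
      using j by simp
  qed
  also have "\<dots> = (\<Sum>j\<le>J. \<integral>\<^sup>+x. ennreal (exp (1/2 * walk d x j)) \<partial>noise)"
    by (rule nn_integral_sum) measurable
  also have "\<dots> = (\<Sum>j\<le>J. ennreal (exp (((1/2)\<^sup>2 - 1/2) * d\<^sup>2 / 2 * j)))"
    by (simp only: nn_integral_exp_walk)
  also have "\<dots> \<le> (\<Sum>j\<le>J. ennreal (exp (- c\<^sup>2 / 8) ^ j))"
  proof (intro sum_mono ennreal_leI)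
    fix j
    have "exp (((1/2)\<^sup>2 - 1/2) * d\<^sup>2 / 2 * j) = exp (- d\<^sup>2 / 8) ^ j"
      unfolding exp_of_nat_mult[symmetric] by (simp add: power2_eq_square field_simps)
    also have "\<dots> \<le> exp (- c\<^sup>2 / 8) ^ j" using assms by (intro power_mono) (auto intro!: power_mono)
    finally show "exp (((1/2)\<^sup>2 - 1/2) * d\<^sup>2 / 2 * j) \<le> exp (- c\<^sup>2 / 8) ^ j" .
  qed
  also have "\<dots> = ennreal (\<Sum>j\<le>J. exp (- c\<^sup>2 / 8) ^ j)" by simp
  also have "\<dots> \<le> ennreal (1 / (1 - exp (- c\<^sup>2 / 8)))"
    using assms by (intro ennreal_leI sum_powers_le) auto
  finally show ?thesis .
qed

lemma nu_bounds: assumes "0 < c" "c \<le> d" shows "0 \<le> nu d" "nu d \<le> 2 / c\<^sup>2"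
proof -
  have d: "0 < d" using assms by simp
  show "0 \<le> nu d" unfolding nu_eq_stay_prob[OF d] by simp
  have "2 * (stay_prob d)\<^sup>2 / d\<^sup>2 \<le> 2 * 1 / c\<^sup>2"
    using stay_prob_bounds[of d] assms by (intro frac_le mult_left_mono power_le_one power_mono) auto
  then show "nu d \<le> 2 / c\<^sup>2" unfolding nu_eq_stay_prob[OF d] by simp
qed

lemma nn_integral_exp_min:
  assumes [measurable]: "f \<in> borel_measurable noise2"
  shows "(\<integral>\<^sup>+w. ennreal (exp (min (f w) A)) \<partial>noise2) = ennreal (\<integral>w. exp (min (f w) A) \<partial>noise2)"
  by (intro nn_integral_eq_integral noise2.integrable_const_bound[where B="exp A"]) auto

lemma small_parameter:
  fixes D \<zeta> :: real
  assumes "0 < \<zeta>"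
  obtains \<eta> where "0 < \<eta>" "\<eta> < 1" "(exp \<eta> * (1 + \<eta>) - 1) * D \<le> \<zeta>" "(exp \<eta> - (1 - \<eta>)) * D \<le> \<zeta>"
proof -
  have "((\<lambda>\<eta>. (exp \<eta> * (1 + \<eta>) - 1) * D) \<longlongrightarrow> (exp 0 * (1 + 0) - 1) * D) (at_right 0)"
       "((\<lambda>\<eta>. (exp \<eta> - (1 - \<eta>)) * D) \<longlongrightarrow> (exp 0 - (1 - 0)) * D) (at_right 0)"
    by (intro tendsto_intros)+
  then have "eventually (\<lambda>\<eta>. (exp \<eta> * (1 + \<eta>) - 1) * D < \<zeta>) (at_right 0)"
       "eventually (\<lambda>\<eta>. (exp \<eta> - (1 - \<eta>)) * D < \<zeta>) (at_right 0)"
    using assms by (auto elim: order_tendstoD)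
  moreover have "eventually (\<lambda>\<eta>::real. 0 < \<eta> \<and> \<eta> < 1) (at_right 0)"
    by (auto simp: eventually_at_right_field intro!: exI[of _ 1])
  ultimately have "eventually (\<lambda>\<eta>. 0 < \<eta> \<and> \<eta> < 1 \<and> (exp \<eta> * (1 + \<eta>) - 1) * D < \<zeta> \<and> (exp \<eta> - (1 - \<eta>)) * D < \<zeta>) (at_right 0)"
    by eventually_elim auto
  then obtain \<eta> where "0 < \<eta> \<and> \<eta> < 1 \<and> (exp \<eta> * (1 + \<eta>) - 1) * D < \<zeta> \<and> (exp \<eta> - (1 - \<eta>)) * D < \<zeta>"
    using eventually_happens[of _ "at_right (0::real)"] by (auto simp: trivial_limit_at_right_real)
  then show ?thesis using that by auto
qed

lemma small_exponential:
  fixes D \<zeta> \<eta> :: real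
  assumes "0 < \<zeta>" "0 < \<eta>" "0 < D"
  obtains L where "0 \<le> L" "D * exp (- L * \<eta>) \<le> \<zeta>"
proof -
  define L where "L = max 0 (ln (D / \<zeta>) / \<eta>)"
  have "ln (D / \<zeta>) / \<eta> * \<eta> \<le> L * \<eta>" using assms unfolding L_def by (intro mult_right_mono) auto
  then have "ln (D / \<zeta>) \<le> L * \<eta>" using assms by simp
  then have "exp (ln (D / \<zeta>)) \<le> exp (L * \<eta>)" by simp
  then have "D / \<zeta> \<le> exp (L * \<eta>)" using assms by simp
  then have "D * exp (- L * \<eta>) \<le> \<zeta>" using assms by (simp add: exp_minus field_simps)
  moreover have "0 \<le> L" by (simp add: L_def)
  ultimately show ?thesis using that by blast
qed

text \<open>
  The perturbation changes one side by a factor close to one and an error \<open>o(a)\<close>. The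
  two sides are independent and nearly additive: \<open>exp (max x z) = exp x + exp z - exp (min x
  z)\<close>, and \<open>exp (min x z) \<le> exp (x / 2) * exp (z / 2)\<close> has bounded
  expectation. The constants depend only on \<open>\<zeta>\<close> and on the lower bound
  \<open>c\<close> of the jump sizes, so that they are uniform along sequences of models.
\<close>
lemma window_max_texp:
  assumes c: "0 < c" and \<zeta>: "0 < \<zeta>"
  obtains \<epsilon> K a0 where "0 < \<epsilon>" "0 < K" "1 \<le> a0"
    "\<And>d n \<kappa> a A. c \<le> d \<Longrightarrow> 0 \<le> \<kappa> \<Longrightarrow> \<kappa> * real n \<le> \<epsilon> \<Longrightarrow> a0 \<le> a \<Longrightarrow> K * a \<le> real n \<Longrightarrow> 0 \<le> A \<Longrightarrow> A \<le> a \<Longrightarrow>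
       (\<integral>w. exp (min (window_max 1 \<kappa> d n w) A) \<partial>noise2) \<le> 2 * nu d * A + \<zeta> * a \<and>
       2 * nu d * A - \<zeta> * a \<le> (\<integral>w. exp (min (max 0 (window_max (-1) \<kappa> d n w)) A) \<partial>noise2)"
proof -
  obtain \<eta> where \<eta>: "0 < \<eta>" "\<eta> < 1" "(exp \<eta> * (1 + \<eta>) - 1) * (4 / c\<^sup>2) \<le> \<zeta> / 4" "(exp \<eta> - (1 - \<eta>)) * (4 / c\<^sup>2) \<le> \<zeta> / 4"
    using small_parameter[of "\<zeta> / 4" "4 / c\<^sup>2"] \<zeta> by auto
  \<comment> \<open>\<open>J\<close> is about \<open>H * a\<close>; this \<open>H\<close> makes the far decay \<open>exp (- 3 * c\<^sup>2 / 32 * J)\<close> cancel \<open>exp (a / 2)\<close>\<close>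
  define H where "H = 16 / (3 * c\<^sup>2)"
  have H: "0 < H" using c by (simp add: H_def)
  obtain L where L: "0 \<le> L" "16 * (H + 2) * exp (- L * \<eta>) \<le> \<zeta> / 4"
    using small_exponential[of "\<zeta> / 4" \<eta> "16 * (H + 2)"] \<zeta> \<eta> H by auto
  obtain C1 where C1: "\<And>d n A. c \<le> d \<Longrightarrow> 0 \<le> A \<Longrightarrow>
    (\<integral>\<^sup>+z. ennreal (exp (min (walk_max d n z) A)) \<partial>noise) \<le> ennreal ((1 + \<eta>) * nu d * A + C1)"
    using walk_max_texp_upper[OF c \<eta>(1)] by metis
  obtain C2 where C2: "0 \<le> C2" "\<And>d n A. c \<le> d \<Longrightarrow> 0 \<le> A \<Longrightarrow> 2 * A / d\<^sup>2 \<le> real n \<Longrightarrow>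
    ennreal ((1 - \<eta>) * nu d * A) \<le> (\<integral>\<^sup>+z. ennreal (exp (min (walk_max d n z) A)) \<partial>noise) + ennreal C2"
    using walk_max_texp_lower[OF c \<eta>(1,2)] by metis
  define r where "r = exp (- (3 * c\<^sup>2 / 32))"
  have r: "0 < r" "r < 1" using c by (auto simp: r_def)
  define K1 where "K1 = 1 / (1 - exp (- c\<^sup>2 / 8))"
  have K1: "0 < K1" using c by (simp add: K1_def)
  define C where "C = exp \<eta> * 2 * max 0 C1 + 16 / (1 - r) + 2 * C2 + K1\<^sup>2"
  have Cge: "exp \<eta> * 2 * max 0 C1 + 16 / (1 - r) \<le> C" "2 * C2 + K1\<^sup>2 \<le> C"
    unfolding C_def using C2(1) r by auto
  define a0 where "a0 = max 1 (2 * C / \<zeta>)"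
  \<comment> \<open>keeps the multiples up to \<open>1 + L\<close> of the perturbation within the range of the moment bounds\<close>
  define \<epsilon> where "\<epsilon> = 1 / (32 * (1 + L))"
  have \<epsilon>: "0 < \<epsilon>" using L by (simp add: \<epsilon>_def)
  have main: "(\<integral>w. exp (min (window_max 1 \<kappa> d n w) A) \<partial>noise2) \<le> 2 * nu d * A + \<zeta> * a \<and>
       2 * nu d * A - \<zeta> * a \<le> (\<integral>w. exp (min (max 0 (window_max (-1) \<kappa> d n w)) A) \<partial>noise2)"
    if d: "c \<le> d" and \<kappa>: "0 \<le> \<kappa>" and \<kappa>n: "\<kappa> * real n \<le> \<epsilon>" and a: "a0 \<le> a" and n: "(H + 2) * a \<le> real n"
      and A: "0 \<le> A" "A \<le> a" for d n \<kappa> a A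
  proof -
    have a1: "1 \<le> a" "C \<le> \<zeta> / 2 * a"
      using a \<zeta> by (auto simp: a0_def field_simps)
    define J where "J = nat \<lceil>H * a\<rceil>"
    have J1: "H * a \<le> real J" unfolding J_def by linarith
    have J2: "real J \<le> H * a + 1" unfolding J_def using mult_nonneg_nonneg[of H a] H a1 by linarith
    have J3: "real J + 1 \<le> (H + 2) * a" using J2 a1 by (simp add: algebra_simps)
    have Jn: "J \<le> n" using J3 n by linarith
    have sn: "s * \<kappa> * real n \<le> 1 / 32" if "0 \<le> s" "s \<le> 1 + L" for s
    proof -
      have "s * (\<kappa> * real n) \<le> (1 + L) * \<epsilon>" using that \<kappa> \<kappa>n \<epsilon> by (intro mult_mono) auto
      also have "\<dots> = 1 / 32" using L by (simp add: \<epsilon>_def)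
      finally show ?thesis by (simp add: mult.assoc)
    qed
    have nu: "0 \<le> nu d" "nu d \<le> 2 / c\<^sup>2" using nu_bounds[OF c d] by auto
    have nuA: "2 * nu d * A \<le> 4 / c\<^sup>2 * a"
      using mult_mono[of "nu d" "2 / c\<^sup>2" A a] nu A a1 c by simp
    have nuA0: "0 \<le> 2 * nu d * A" using nu A by simp
    have rJ: "exp (A / 2) * r ^ J \<le> 1"
    proof -
      have "3 * c\<^sup>2 / 32 * (H * a) \<le> 3 * c\<^sup>2 / 32 * real J" using J1 by (intro mult_left_mono) auto
      then have "a / 2 \<le> real J * (3 * c\<^sup>2 / 32)" using c by (simp add: H_def mult.commute)
      then show ?thesis unfolding r_def exp_of_nat_mult[symmetric] exp_add[symmetric] using A by simp
    qed
    let ?M = "\<lambda>n. \<lambda>x. ennreal (exp (min (walk_max d n x) A))"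
    have sw: "(\<integral>\<^sup>+w. f (snd w, fst w) \<partial>noise2) = (\<integral>\<^sup>+w. f w \<partial>noise2)" if "f \<in> borel_measurable noise2" for f
      by (rule nn_integral_noise2_swap[OF that])
    have upper: "(\<integral>w. exp (min (window_max 1 \<kappa> d n w) A) \<partial>noise2) \<le> 2 * nu d * A + \<zeta> * a"
    proof -
      define B where "B w = ennreal (exp \<eta>) * ?M n (fst w) + ennreal (exp (- L * \<eta>)) * near_excess \<kappa> d n J (1 + L) w
         + ennreal (exp (A / 2)) * far_excess \<kappa> d n J w" for w
      have B [measurable]: "B \<in> borel_measurable noise2" unfolding B_def[abs_def] by measurable
      have B': "(\<lambda>w. B (snd w, fst w)) \<in> borel_measurable noise2" by measurable
      have IB: "(\<integral>\<^sup>+w. B w \<partial>noise2) \<le> ennreal (exp \<eta> * ((1 + \<eta>) * nu d * A + max 0 C1) + exp (- L * \<eta>) * (8 * (real J + 1)) + 8 / (1 - r))"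
      proof -
        have "(\<integral>\<^sup>+w. B w \<partial>noise2) = ennreal (exp \<eta>) * (\<integral>\<^sup>+w. ?M n (fst w) \<partial>noise2)
           + ennreal (exp (- L * \<eta>)) * (\<integral>\<^sup>+w. near_excess \<kappa> d n J (1 + L) w \<partial>noise2)
           + ennreal (exp (A / 2)) * (\<integral>\<^sup>+w. far_excess \<kappa> d n J w \<partial>noise2)"
          unfolding B_def by (simp add: nn_integral_add nn_integral_cmult)
        also have "\<dots> \<le> ennreal (exp \<eta>) * ennreal ((1 + \<eta>) * nu d * A + max 0 C1)
           + ennreal (exp (- L * \<eta>)) * ennreal (8 * (real J + 1)) + ennreal (exp (A / 2)) * ennreal (8 * (r ^ J / (1 - r)))"
        proof (intro add_mono mult_left_mono)
          have "(\<integral>\<^sup>+w. ?M n (fst w) \<partial>noise2) = (\<integral>\<^sup>+x. ?M n x \<partial>noise)"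
            by (rule nn_integral_noise2_fst) measurable
          also have "\<dots> \<le> ennreal ((1 + \<eta>) * nu d * A + C1)" by (rule C1[OF d A(1)])
          also have "\<dots> \<le> ennreal ((1 + \<eta>) * nu d * A + max 0 C1)" by (intro ennreal_leI) auto
          finally show "(\<integral>\<^sup>+w. ?M n (fst w) \<partial>noise2) \<le> ennreal ((1 + \<eta>) * nu d * A + max 0 C1)" .
          show "(\<integral>\<^sup>+w. near_excess \<kappa> d n J (1 + L) w \<partial>noise2) \<le> ennreal (8 * (real J + 1))"
            using sn[of "1 + L"] L \<kappa> Jn by (intro near_excess_integral) auto
          show "(\<integral>\<^sup>+w. far_excess \<kappa> d n J w \<partial>noise2) \<le> ennreal (8 * (r ^ J / (1 - r)))"
            unfolding r_def using sn[of 1] L \<kappa> c d by (intro far_excess_integral) auto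
        qed auto
        also have "\<dots> = ennreal (exp \<eta> * ((1 + \<eta>) * nu d * A + max 0 C1) + exp (- L * \<eta>) * (8 * (real J + 1)) + exp (A / 2) * (8 * (r ^ J / (1 - r))))"
          using nu A \<eta> r by (simp add: ennreal_mult[symmetric] ennreal_plus[symmetric] del: ennreal_plus)
        also have "\<dots> \<le> ennreal (exp \<eta> * ((1 + \<eta>) * nu d * A + max 0 C1) + exp (- L * \<eta>) * (8 * (real J + 1)) + 8 / (1 - r))"
        proof (intro ennreal_leI add_left_mono)
          have "exp (A / 2) * (8 * (r ^ J / (1 - r))) = (exp (A / 2) * r ^ J) * (8 / (1 - r))" by simp
          also have "\<dots> \<le> 1 * (8 / (1 - r))" using rJ r by (intro mult_right_mono) auto
          finally show "exp (A / 2) * (8 * (r ^ J / (1 - r))) \<le> 8 / (1 - r)" by simp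
        qed
        finally show ?thesis .
      qed
      have "ennreal (\<integral>w. exp (min (window_max 1 \<kappa> d n w) A) \<partial>noise2) = (\<integral>\<^sup>+w. ennreal (exp (min (window_max 1 \<kappa> d n w) A)) \<partial>noise2)"
        by (rule nn_integral_exp_min[symmetric]) measurable
      also have "\<dots> \<le> (\<integral>\<^sup>+w. B w + B (snd w, fst w) \<partial>noise2)"
      proof (intro nn_integral_mono)
        fix w :: "(nat \<Rightarrow> real) \<times> (nat \<Rightarrow> real)"
        have 1: "ennreal (exp (min (window_side 1 \<kappa> d n (fst w) (snd w)) A)) \<le> B w"
          using exp_window_side_le[OF \<kappa> L(1), of \<eta> d n "fst w" "snd w" A J] \<eta> by (simp add: B_def)
        have 2: "ennreal (exp (min (window_side 1 \<kappa> d n (snd w) (fst w)) A)) \<le> B (snd w, fst w)"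
          using exp_window_side_le[OF \<kappa> L(1), of \<eta> d n "snd w" "fst w" A J] \<eta> by (simp add: B_def)
        show "ennreal (exp (min (window_max 1 \<kappa> d n w) A)) \<le> B w + B (snd w, fst w)"
          unfolding window_max_def max_def using 1 2 by (auto intro: add_increasing add_increasing2)
      qed
      also have "\<dots> = (\<integral>\<^sup>+w. B w \<partial>noise2) + (\<integral>\<^sup>+w. B (snd w, fst w) \<partial>noise2)"
        by (rule nn_integral_add[OF B B'])
      also have "\<dots> = (\<integral>\<^sup>+w. B w \<partial>noise2) + (\<integral>\<^sup>+w. B w \<partial>noise2)" by (simp only: sw[OF B])
      also have "\<dots> \<le> ennreal (exp \<eta> * ((1 + \<eta>) * nu d * A + max 0 C1) + exp (- L * \<eta>) * (8 * (real J + 1)) + 8 / (1 - r))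
         + ennreal (exp \<eta> * ((1 + \<eta>) * nu d * A + max 0 C1) + exp (- L * \<eta>) * (8 * (real J + 1)) + 8 / (1 - r))"
        by (intro add_mono IB)
      also have "\<dots> = ennreal (2 * (exp \<eta> * ((1 + \<eta>) * nu d * A + max 0 C1) + exp (- L * \<eta>) * (8 * (real J + 1)) + 8 / (1 - r)))"
        using nu A \<eta> r by (subst ennreal_plus[symmetric]) auto
      finally have "(\<integral>w. exp (min (window_max 1 \<kappa> d n w) A) \<partial>noise2)
         \<le> 2 * (exp \<eta> * ((1 + \<eta>) * nu d * A + max 0 C1) + exp (- L * \<eta>) * (8 * (real J + 1)) + 8 / (1 - r))"
        using nu A \<eta> r by (subst (asm) ennreal_le_iff) auto
      also have "\<dots> = 2 * nu d * A + (exp \<eta> * (1 + \<eta>) - 1) * (2 * nu d * A) + exp (- L * \<eta>) * (16 * (real J + 1))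
          + (exp \<eta> * 2 * max 0 C1 + 16 / (1 - r))"
        by (simp add: algebra_simps)
      also have "\<dots> \<le> 2 * nu d * A + \<zeta> / 4 * a + \<zeta> / 4 * a + \<zeta> / 2 * a"
      proof (intro add_mono order_refl)
        have "1 \<le> exp \<eta> * (1 + \<eta>)" using mult_mono[of 1 "exp \<eta>" 1 "1 + \<eta>"] \<eta> by simp
        then have "(exp \<eta> * (1 + \<eta>) - 1) * (2 * nu d * A) \<le> (exp \<eta> * (1 + \<eta>) - 1) * (4 / c\<^sup>2 * a)"
          using nuA by (intro mult_left_mono) auto
        also have "\<dots> = (exp \<eta> * (1 + \<eta>) - 1) * (4 / c\<^sup>2) * a" by simp
        also have "\<dots> \<le> \<zeta> / 4 * a" using \<eta> a1 by (intro mult_right_mono) auto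
        finally show "(exp \<eta> * (1 + \<eta>) - 1) * (2 * nu d * A) \<le> \<zeta> / 4 * a" .
        have "exp (- L * \<eta>) * (16 * (real J + 1)) \<le> exp (- L * \<eta>) * (16 * ((H + 2) * a))"
          using J3 by (intro mult_left_mono) auto
        also have "\<dots> = (16 * (H + 2) * exp (- L * \<eta>)) * a" by simp
        also have "\<dots> \<le> \<zeta> / 4 * a" using L a1 by (intro mult_right_mono) auto
        finally show "exp (- L * \<eta>) * (16 * (real J + 1)) \<le> \<zeta> / 4 * a" .
        show "exp \<eta> * 2 * max 0 C1 + 16 / (1 - r) \<le> \<zeta> / 2 * a" using Cge a1 by linarith
      qed
      finally show ?thesis by simp
    qed
    have lower: "2 * nu d * A - \<zeta> * a \<le> (\<integral>w. exp (min (max 0 (window_max (-1) \<kappa> d n w)) A) \<partial>noise2)"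
    proof -
      let ?E = "\<integral>w. exp (min (max 0 (window_max (-1) \<kappa> d n w)) A) \<partial>noise2"
      let ?R = "\<lambda>w. max 0 (window_max (-1) \<kappa> d n w)"
      let ?h = "\<lambda>x. ennreal (exp (walk_max d J x / 2))"
      let ?N = "near_excess \<kappa> d n J L"
      define G where "G w = ennreal (exp (- L * \<eta>)) * ?N w" for w
      have G [measurable]: "G \<in> borel_measurable noise2" unfolding G_def[abs_def] by measurable
      have G': "(\<lambda>w. G (snd w, fst w)) \<in> borel_measurable noise2" by measurable
      have M1: "(\<lambda>w. ?M J (fst w)) \<in> borel_measurable noise2" "(\<lambda>w. ?M J (snd w)) \<in> borel_measurable noise2" by measurable
      have Jbig: "2 * A / d\<^sup>2 \<le> real J"
      proof -
        have "2 * A / d\<^sup>2 \<le> 2 * a / c\<^sup>2" using A c d by (intro frac_le power_mono) auto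
        also have "\<dots> \<le> H * a" unfolding H_def using a1 c by (simp add: divide_right_mono field_simps)
        finally show ?thesis using J1 by linarith
      qed
      have path: "?M J (fst w) + ?M J (snd w) \<le> (ennreal (exp \<eta>) * ennreal (exp (min (?R w) A)) + (G w + G (snd w, fst w))) + ?h (fst w) * ?h (snd w)" for w
      proof -
        let ?x = "walk_max d J (fst w)" and ?z = "walk_max d J (snd w)"
        have 1: "?M J (fst w) \<le> ennreal (exp \<eta>) * ennreal (exp (min (?R w) A)) + G w"
          using exp_walk_max_le[OF \<kappa> L(1) _ Jn A(1), of \<eta> d "fst w" "snd w" "window_max (-1) \<kappa> d n w"] \<eta>
          by (simp add: G_def window_max_def)
        have 2: "?M J (snd w) \<le> ennreal (exp \<eta>) * ennreal (exp (min (?R w) A)) + G (snd w, fst w)"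
          using exp_walk_max_le[OF \<kappa> L(1) _ Jn A(1), of \<eta> d "snd w" "fst w" "window_max (-1) \<kappa> d n w"] \<eta>
          by (simp add: G_def window_max_def)
        \<comment> \<open>the smaller of the two maxima is at most their mean\<close>
        have h: "?M J (fst w) \<le> ?h (fst w) * ?h (snd w) \<or> ?M J (snd w) \<le> ?h (fst w) * ?h (snd w)"
          unfolding ennreal_mult[symmetric, OF exp_ge_zero exp_ge_zero] exp_add[symmetric]
          by (cases "?x \<le> ?z") (auto intro!: ennreal_leI simp: min_def)
        from h show ?thesis
        proof
          assume "?M J (fst w) \<le> ?h (fst w) * ?h (snd w)"
          from add_mono[OF this 2] have "?M J (fst w) + ?M J (snd w) \<le> (ennreal (exp \<eta>) * ennreal (exp (min (?R w) A)) + G (snd w, fst w)) + ?h (fst w) * ?h (snd w)"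
            by (simp add: add.commute)
          also have "\<dots> \<le> (ennreal (exp \<eta>) * ennreal (exp (min (?R w) A)) + (G w + G (snd w, fst w))) + ?h (fst w) * ?h (snd w)"
            by (intro add_mono order_refl) (simp add: add_increasing)
          finally show ?thesis .
        next
          assume "?M J (snd w) \<le> ?h (fst w) * ?h (snd w)"
          from add_mono[OF 1 this] have "?M J (fst w) + ?M J (snd w) \<le> (ennreal (exp \<eta>) * ennreal (exp (min (?R w) A)) + G w) + ?h (fst w) * ?h (snd w)" .
          also have "\<dots> \<le> (ennreal (exp \<eta>) * ennreal (exp (min (?R w) A)) + (G w + G (snd w, fst w))) + ?h (fst w) * ?h (snd w)"
            by (intro add_mono order_refl) (simp add: add_increasing2)
          finally show ?thesis .
        qed
      qed
      have IM: "(\<integral>\<^sup>+w. ?M J (fst w) \<partial>noise2) = (\<integral>\<^sup>+x. ?M J x \<partial>noise)"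
        by (rule nn_integral_noise2_fst) measurable
      have IM': "(\<integral>\<^sup>+w. ?M J (snd w) \<partial>noise2) = (\<integral>\<^sup>+x. ?M J x \<partial>noise)"
        using sw[OF M1(2)] IM by simp
      define X where "X = exp (- L * \<eta>) * (8 * (real J + 1))"
      define u where "u = (1 - \<eta>) * nu d * A"
      have X0: "0 \<le> X" and u0: "0 \<le> u" using nu A \<eta> by (auto simp: X_def u_def)
      have IG: "(\<integral>\<^sup>+w. G w \<partial>noise2) \<le> ennreal X"
      proof -
        have "(\<integral>\<^sup>+w. G w \<partial>noise2) = ennreal (exp (- L * \<eta>)) * (\<integral>\<^sup>+w. ?N w \<partial>noise2)"
          unfolding G_def by (rule nn_integral_cmult) measurable
        also have "\<dots> \<le> ennreal (exp (- L * \<eta>)) * ennreal (8 * (real J + 1))"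
          using sn[of L] L \<kappa> Jn by (intro mult_left_mono near_excess_integral) auto
        also have "\<dots> = ennreal X"
          unfolding X_def by (rule ennreal_mult'[symmetric]) simp
        finally show ?thesis .
      qed
      have Ih: "(\<integral>\<^sup>+w. ?h (fst w) * ?h (snd w) \<partial>noise2) \<le> ennreal (K1\<^sup>2)"
      proof -
        have "(\<integral>\<^sup>+w. ?h (fst w) * ?h (snd w) \<partial>noise2) = (\<integral>\<^sup>+x. ?h x \<partial>noise) * (\<integral>\<^sup>+x. ?h x \<partial>noise)"
          by (rule nn_integral_noise2_prod) measurable
        also have "\<dots> \<le> ennreal K1 * ennreal K1"
          unfolding K1_def by (intro mult_mono exp_half_walk_max c d) auto
        finally show ?thesis using K1 by (simp add: ennreal_mult[symmetric] power2_eq_square)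
      qed
      have IMM: "(\<integral>\<^sup>+w. ?M J (fst w) + ?M J (snd w) \<partial>noise2) = (\<integral>\<^sup>+x. ?M J x \<partial>noise) + (\<integral>\<^sup>+x. ?M J x \<partial>noise)"
        by (subst nn_integral_add[OF M1]) (simp only: IM IM')
      have "ennreal u + ennreal u
         \<le> ((\<integral>\<^sup>+x. ?M J x \<partial>noise) + ennreal C2) + ((\<integral>\<^sup>+x. ?M J x \<partial>noise) + ennreal C2)"
        unfolding u_def by (intro add_mono C2(2) d A Jbig)
      also have "\<dots> = (\<integral>\<^sup>+w. ?M J (fst w) + ?M J (snd w) \<partial>noise2) + (ennreal C2 + ennreal C2)"
        unfolding IMM by (simp only: ac_simps)
      also have "\<dots> \<le> (\<integral>\<^sup>+w. (ennreal (exp \<eta>) * ennreal (exp (min (?R w) A)) + (G w + G (snd w, fst w))) + ?h (fst w) * ?h (snd w) \<partial>noise2) + (ennreal C2 + ennreal C2)"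
        by (intro add_right_mono nn_integral_mono path)
      also have "(\<integral>\<^sup>+w. (ennreal (exp \<eta>) * ennreal (exp (min (?R w) A)) + (G w + G (snd w, fst w))) + ?h (fst w) * ?h (snd w) \<partial>noise2)
         = (ennreal (exp \<eta>) * ennreal ?E + ((\<integral>\<^sup>+w. G w \<partial>noise2) + (\<integral>\<^sup>+w. G w \<partial>noise2))) + (\<integral>\<^sup>+w. ?h (fst w) * ?h (snd w) \<partial>noise2)"
        using G' by (simp add: nn_integral_add nn_integral_cmult sw[OF G] nn_integral_exp_min)
      also have "\<dots> + (ennreal C2 + ennreal C2) \<le> (ennreal (exp \<eta>) * ennreal ?E + (ennreal X + ennreal X))
           + ennreal (K1\<^sup>2) + (ennreal C2 + ennreal C2)"
        by (intro add_mono order_refl IG Ih)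
      finally have "ennreal (u + u) \<le> ennreal (exp \<eta> * ?E + (X + X) + K1\<^sup>2 + (C2 + C2))"
        using X0 u0 C2(1) by (simp add: ennreal_mult[symmetric] ennreal_plus[symmetric] del: ennreal_plus)
      then have "u + u \<le> exp \<eta> * ?E + (X + X) + K1\<^sup>2 + (C2 + C2)"
        using C2(1) X0 by (subst (asm) ennreal_le_iff) (auto intro!: add_nonneg_nonneg)
      then have "2 * ((1 - \<eta>) * nu d * A) \<le> exp \<eta> * ?E + exp (- L * \<eta>) * (16 * (real J + 1)) + (K1\<^sup>2 + 2 * C2)"
      proof -
        have "X + X = exp (- L * \<eta>) * (16 * (real J + 1))" by (simp add: X_def algebra_simps)
        moreover have "u + u = 2 * ((1 - \<eta>) * nu d * A)" by (simp add: u_def)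
        ultimately show ?thesis using \<open>u + u \<le> _\<close> by linarith
      qed
      moreover have "exp (- L * \<eta>) * (16 * (real J + 1)) \<le> \<zeta> / 4 * a"
      proof -
        have "exp (- L * \<eta>) * (16 * (real J + 1)) \<le> exp (- L * \<eta>) * (16 * ((H + 2) * a))"
          using J3 by (intro mult_left_mono) auto
        also have "\<dots> = (16 * (H + 2) * exp (- L * \<eta>)) * a" by simp
        also have "\<dots> \<le> \<zeta> / 4 * a" using L a1 by (intro mult_right_mono) auto
        finally show ?thesis .
      qed
      ultimately have ineq: "(1 - \<eta>) * (2 * nu d * A) \<le> exp \<eta> * ?E + 3 * \<zeta> / 4 * a"
        using Cge a1 by (simp add: mult_ac)
      show ?thesis
      proof (rule ccontr)
        assume "\<not> ?thesis"
        then have "?E < 2 * nu d * A - \<zeta> * a" by simp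
        then have "exp \<eta> * ?E \<le> exp \<eta> * (2 * nu d * A) - exp \<eta> * (\<zeta> * a)"
          by (simp add: right_diff_distrib[symmetric])
        moreover have "1 * (\<zeta> * a) < exp \<eta> * (\<zeta> * a)" using \<eta> \<zeta> a1 by (intro mult_strict_right_mono) auto
        moreover have "(exp \<eta> - (1 - \<eta>)) * (2 * nu d * A) \<le> \<zeta> / 4 * a"
        proof -
          have "0 \<le> a" using a1 by simp
          have "(exp \<eta> - (1 - \<eta>)) * (2 * nu d * A) \<le> (exp \<eta> - (1 - \<eta>)) * (4 / c\<^sup>2 * a)"
            using nuA \<eta> exp_ge_add_one_self[of \<eta>] by (intro mult_left_mono) linarith+
          also have "\<dots> \<le> \<zeta> / 4 * a"
            using mult_right_mono[OF \<eta>(4) \<open>0 \<le> a\<close>] by (simp only: mult.assoc)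
          finally show ?thesis .
        qed
        moreover have "(exp \<eta> - (1 - \<eta>)) * (2 * nu d * A) = exp \<eta> * (2 * nu d * A) - (1 - \<eta>) * (2 * nu d * A)"
          by (rule left_diff_distrib)
        ultimately show False using ineq by linarith
      qed
    qed
    show ?thesis using upper lower by blast
  qed
  show ?thesis
    by (rule that[of \<epsilon> "H + 2" a0]) (use \<epsilon> H main in \<open>auto simp: a0_def\<close>)
qed

section \<open>Sums of independent variables and a chi-squared variable\<close>

text \<open>
  The common structure of the limit and of the approximating variables. As in the definition of
  the limit model, independence is stated for the sequence with the chi-squared variable appended
  at position \<open>Suc M\<close>.
\<close>
definition sum_model :: "nat \<Rightarrow> 'a measure \<Rightarrow> (nat \<Rightarrow> 'a \<Rightarrow> real) \<Rightarrow> ('a \<Rightarrow> real) \<Rightarrow> bool" where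
  "sum_model M P Y C \<longleftrightarrow> prob_space P \<and>
     prob_space.indep_vars P (\<lambda>_. borel) (Y(Suc M := C)) {1..Suc M} \<and>
     distr P borel C = chi_squared_distribution (Suc M) \<and>
     (\<forall>k\<in>{1..M}. AE \<omega> in P. 0 \<le> Y k \<omega>)"

abbreviation partial_law :: "'a measure \<Rightarrow> (nat \<Rightarrow> 'a \<Rightarrow> real) \<Rightarrow> nat \<Rightarrow> real measure" where
  "partial_law P Y r \<equiv> distr P borel (\<lambda>\<omega>. \<Sum>k=1..r. Y k \<omega>)"

abbreviation law :: "'a measure \<Rightarrow> ('a \<Rightarrow> real) \<Rightarrow> real measure" where
  "law P X \<equiv> distr P borel X"

lemma sum_model_measurable:
  assumes "sum_model M P Y C"
  shows "k \<in> {1..M} \<Longrightarrow> Y k \<in> borel_measurable P" "C \<in> borel_measurable P"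
proof -
  interpret prob_space P using assms by (simp add: sum_model_def)
  have "indep_vars (\<lambda>_. borel) (Y(Suc M := C)) {1..Suc M}" using assms by (simp add: sum_model_def)
  then have *: "\<And>i. i \<in> {1..Suc M} \<Longrightarrow> (Y(Suc M := C)) i \<in> borel_measurable P"
    unfolding indep_vars_def by auto
  show "k \<in> {1..M} \<Longrightarrow> Y k \<in> borel_measurable P" using *[of k] by auto
  show "C \<in> borel_measurable P" using *[of "Suc M"] by simp
qed

lemma nonneg_law_distr:
  assumes "prob_space P" "X \<in> borel_measurable P" "AE \<omega> in P. 0 \<le> X \<omega>"
  shows "nonneg_law (law P X)"
  using assms prob_space.real_distribution_distr[of P X] by (auto simp: AE_distr_iff)

lemma partial_sum_measurable:
  assumes "sum_model M P Y C" "r \<le> M"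
  shows "(\<lambda>\<omega>. \<Sum>k=1..r. Y k \<omega>) \<in> borel_measurable P"
  using sum_model_measurable(1)[OF assms(1)] assms(2) by (intro borel_measurable_sum) auto

lemma partial_law_nonneg:
  assumes "sum_model M P Y C" "r \<le> M"
  shows "nonneg_law (partial_law P Y r)"
proof (rule nonneg_law_distr)
  show "prob_space P" using assms by (simp add: sum_model_def)
  show "(\<lambda>\<omega>. \<Sum>k=1..r. Y k \<omega>) \<in> borel_measurable P" by (rule partial_sum_measurable[OF assms])
  have "AE \<omega> in P. \<forall>k\<in>{1..M}. 0 \<le> Y k \<omega>"
    using assms by (intro AE_finite_allI) (auto simp: sum_model_def)
  then show "AE \<omega> in P. 0 \<le> (\<Sum>k=1..r. Y k \<omega>)"
    by eventually_elim (use assms in \<open>auto intro!: sum_nonneg\<close>)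
qed

lemma summand_law_nonneg:
  assumes "sum_model M P Y C" "k \<in> {1..M}"
  shows "nonneg_law (law P (Y k))"
  using assms sum_model_measurable[OF assms(1)] by (intro nonneg_law_distr) (auto simp: sum_model_def)

lemma partial_law_Suc:
  assumes "sum_model M P Y C" "Suc r \<le> M"
  shows "partial_law P Y (Suc r) = (law P (Y (Suc r)) \<star> partial_law P Y r)"
proof -
  interpret prob_space P using assms by (simp add: sum_model_def)
  have ind: "indep_vars (\<lambda>_. borel) (Y(Suc M := C)) {1..Suc M}" using assms by (simp add: sum_model_def)
  have eq: "insert (Suc r) {1..r} = {1..Suc r}" by auto
  have "indep_vars (\<lambda>_. borel) (Y(Suc M := C)) (insert (Suc r) {1..r})"
    unfolding eq by (rule indep_vars_subset[OF ind]) (use assms in auto)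
  then have "indep_vars (\<lambda>_. borel) Y (insert (Suc r) {1..r})"
    by (rule indep_vars_cong[THEN iffD1, rotated -1]) (use assms in auto)
  then have "indep_var borel (Y (Suc r)) borel (\<lambda>\<omega>. \<Sum>k\<in>{1..r}. Y k \<omega>)"
    by (intro indep_vars_sum) auto
  from sum_indep_random_variable[OF this]
  have "distr P borel (\<lambda>\<omega>. Y (Suc r) \<omega> + (\<Sum>k\<in>{1..r}. Y k \<omega>)) = (law P (Y (Suc r)) \<star> partial_law P Y r)"
    using sum_model_measurable(1)[OF assms(1), of "Suc r"] partial_sum_measurable[OF assms(1), of r] assms(2) by simp
  then show ?thesis by (simp add: add.commute)
qed

text \<open>
  Of the \<open>M + 1 = Suc (Suc d)\<close> squares two form the exponential variable, so \<open>d
  = M - 1\<close> squares remain.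
\<close>
lemma sum_model_tail:
  assumes "sum_model (Suc d) P Y C"
  shows "measure P {\<omega> \<in> space P. (\<Sum>k=1..Suc d. Y k \<omega>) + C \<omega> / 2 > a}
    = exp (- a) * texp (partial_law P Y (Suc d) \<star> half_chi d) a"
proof -
  let ?M = "Suc d"
  interpret prob_space P using assms by (simp add: sum_model_def)
  have ind: "indep_vars (\<lambda>_. borel) (Y(Suc ?M := C)) {1..Suc ?M}" using assms by (simp add: sum_model_def)
  have eq: "insert (Suc ?M) {1..?M} = {1..Suc ?M}" by auto
  have ind': "indep_vars (\<lambda>_. borel) (Y(Suc ?M := C)) (insert (Suc ?M) {1..?M})" unfolding eq by (rule ind)
  have "indep_var borel ((Y(Suc ?M := C)) (Suc ?M)) borel (\<lambda>\<omega>. \<Sum>k\<in>{1..?M}. (Y(Suc ?M := C)) k \<omega>)"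
    by (rule indep_vars_sum[OF _ _ ind']) simp_all
  moreover have "(\<lambda>\<omega>. \<Sum>k\<in>{1..?M}. (Y(Suc ?M := C)) k \<omega>) = (\<lambda>\<omega>. \<Sum>k\<in>{1..?M}. Y k \<omega>)"
    by (intro ext sum.cong) auto
  ultimately have i: "indep_var borel C borel (\<lambda>\<omega>. \<Sum>k\<in>{1..?M}. Y k \<omega>)"
    by (simp only: fun_upd_same)
  have "indep_var borel ((\<lambda>x. x / 2) \<circ> C) borel ((\<lambda>x. x) \<circ> (\<lambda>\<omega>. \<Sum>k\<in>{1..?M}. Y k \<omega>))"
    by (rule indep_var_compose[OF i]) auto
  then have i2: "indep_var borel (\<lambda>\<omega>. C \<omega> / 2) borel (\<lambda>\<omega>. \<Sum>k\<in>{1..?M}. Y k \<omega>)"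
    by (simp add: comp_def)
  note m = sum_model_measurable(2)[OF assms] partial_sum_measurable[OF assms order_refl]
  have "distr P borel (\<lambda>\<omega>. C \<omega> / 2 + (\<Sum>k\<in>{1..?M}. Y k \<omega>)) = (law P (\<lambda>\<omega>. C \<omega> / 2) \<star> partial_law P Y ?M)"
    using m by (intro sum_indep_random_variable i2) auto
  also have "law P (\<lambda>\<omega>. C \<omega> / 2) = half_chi (Suc ?M)"
  proof -
    have "half_chi (Suc ?M) = distr (distr P borel C) borel (\<lambda>x. x / 2)"
      using assms by (simp add: half_chi_def sum_model_def)
    then show ?thesis using m by (simp add: distr_distr comp_def)
  qed
  also have "(half_chi (Suc ?M) \<star> partial_law P Y ?M) = (partial_law P Y ?M \<star> half_chi (Suc ?M))"
    using nonneg_law_half_chi[of "Suc ?M"] partial_law_nonneg[OF assms order_refl]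
    by (intro convolution_commutative) (auto simp: real_distribution_def prob_space.finite_measure real_distribution_axioms_def)
  finally have "measure (distr P borel (\<lambda>\<omega>. C \<omega> / 2 + (\<Sum>k\<in>{1..?M}. Y k \<omega>))) {a<..}
     = exp (- a) * texp (partial_law P Y ?M \<star> half_chi d) a"
    using half_chi_plus2_tail[of "partial_law P Y ?M" d a] partial_law_nonneg[OF assms order_refl] by simp
  moreover have "measure (distr P borel (\<lambda>\<omega>. C \<omega> / 2 + (\<Sum>k\<in>{1..?M}. Y k \<omega>))) {a<..}
     = measure P {\<omega> \<in> space P. (\<Sum>k=1..?M. Y k \<omega>) + C \<omega> / 2 > a}"
    using m by (subst measure_distr) (auto intro!: arg_cong2[where f=measure] simp: add.commute)
  ultimately show ?thesis by simp
qed

lemma texp_partial_law_0: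
  assumes "sum_model M P Y C" "0 \<le> A" shows "texp (partial_law P Y 0) A = 1"
proof -
  interpret prob_space P using assms by (simp add: sum_model_def)
  show ?thesis using assms(2) by (simp add: texp_def distr_const integral_return)
qed

lemma texp_partial_law_le:
  assumes m: "sum_model M P Y C" and "r \<le> M" "0 \<le> A"
    and B: "\<And>k. k \<in> {1..M} \<Longrightarrow> texp (law P (Y k)) A \<le> B k"
  shows "texp (partial_law P Y r) A \<le> (\<Prod>k=1..r. B k)"
  using \<open>r \<le> M\<close>
proof (induction r)
  case 0 then show ?case using texp_partial_law_0[OF m \<open>0 \<le> A\<close>] by simp
next
  case (Suc r)
  have "texp (partial_law P Y (Suc r)) A \<le> texp (law P (Y (Suc r))) A * texp (partial_law P Y r) A"
    unfolding partial_law_Suc[OF m Suc.prems]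
    using Suc.prems \<open>0 \<le> A\<close> by (intro texp_convolution_le summand_law_nonneg[OF m] partial_law_nonneg[OF m]) auto
  also have "\<dots> \<le> B (Suc r) * (\<Prod>k=1..r. B k)"
    using Suc order_trans[OF texp_nonneg B[of "Suc r"]] by (intro mult_mono B texp_nonneg) auto
  finally show ?case by (simp add: mult.commute)
qed

lemma texp_partial_law_ge:
  assumes m: "sum_model M P Y C" and "r \<le> M" "0 \<le> x" "0 \<le> l"
    and B: "\<And>k. k \<in> {1..M} \<Longrightarrow> l \<le> texp (law P (Y k)) x"
  shows "l ^ r \<le> texp (partial_law P Y r) (real r * x)"
  using \<open>r \<le> M\<close>
proof (induction r)
  case 0 then show ?case using texp_partial_law_0[OF m, of 0] by simp
next
  case (Suc r)
  have "l * l ^ r \<le> texp (law P (Y (Suc r))) x * texp (partial_law P Y r) (real r * x)"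
    using Suc \<open>0 \<le> l\<close> by (intro mult_mono B texp_nonneg) auto
  also have "\<dots> \<le> texp (law P (Y (Suc r)) \<star> partial_law P Y r) (x + real r * x)"
    using Suc.prems summand_law_nonneg[OF m, of "Suc r"] partial_law_nonneg[OF m, of r] by (intro texp_convolution_ge) auto
  finally show ?case unfolding partial_law_Suc[OF m Suc.prems] by (simp add: algebra_simps)
qed

text \<open>
  Exchange the summands one at a time; each exchange costs \<open>\<zeta> * B\<close> times the
  bounds of the other summands.
\<close>
lemma texp_partial_law_compare:
  assumes m: "sum_model M P Y C" and m': "sum_model M Q W C'" and "r \<le> M" and "0 \<le> \<zeta>" "0 \<le> B"
    and close: "\<And>k A. k \<in> {1..M} \<Longrightarrow> 0 \<le> A \<Longrightarrow> A \<le> a \<Longrightarrow> \<bar>texp (law P (Y k)) A - texp (law Q (W k)) A\<bar> \<le> \<zeta> * B"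
    and B1: "\<And>k A. k \<in> {1..M} \<Longrightarrow> 0 \<le> A \<Longrightarrow> A \<le> a \<Longrightarrow> texp (law P (Y k)) A \<le> B"
    and B2: "\<And>k A. k \<in> {1..M} \<Longrightarrow> 0 \<le> A \<Longrightarrow> A \<le> a \<Longrightarrow> texp (law Q (W k)) A \<le> B"
    and A: "0 \<le> A" "A \<le> a"
  shows "\<bar>texp (partial_law P Y r) A - texp (partial_law Q W r) A\<bar> \<le> real r * \<zeta> * B ^ r"
  using \<open>r \<le> M\<close> A
proof (induction r arbitrary: A)
  case 0 then show ?case using texp_partial_law_0[OF m] texp_partial_law_0[OF m'] by simp
next
  case (Suc r)
  let ?k = "Suc r"
  have k: "?k \<in> {1..M}" "r \<le> M" using Suc.prems by auto
  note n1 = summand_law_nonneg[OF m k(1)] summand_law_nonneg[OF m' k(1)]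
    partial_law_nonneg[OF m k(2)] partial_law_nonneg[OF m' k(2)]
  have fin: "finite_measure \<alpha>" "sets \<alpha> = sets borel" if "nonneg_law \<alpha>" for \<alpha>
    using that by (auto simp: real_distribution_def prob_space.finite_measure real_distribution_axioms_def)
  have 1: "\<bar>texp (law P (Y ?k) \<star> partial_law P Y r) A - texp (law Q (W ?k) \<star> partial_law P Y r) A\<bar>
     \<le> \<zeta> * B * texp (partial_law P Y r) A"
    using Suc.prems k \<open>0 \<le> \<zeta>\<close> \<open>0 \<le> B\<close> by (intro texp_swap n1 close) auto
  have "\<bar>texp (partial_law P Y r \<star> law Q (W ?k)) A - texp (partial_law Q W r \<star> law Q (W ?k)) A\<bar>
     \<le> (real r * \<zeta> * B ^ r) * texp (law Q (W ?k)) A"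
    using Suc.prems k \<open>0 \<le> \<zeta>\<close> \<open>0 \<le> B\<close> by (intro texp_swap n1 Suc.IH) auto
  then have 2: "\<bar>texp (law Q (W ?k) \<star> partial_law P Y r) A - texp (law Q (W ?k) \<star> partial_law Q W r) A\<bar>
     \<le> (real r * \<zeta> * B ^ r) * texp (law Q (W ?k)) A"
    using convolution_commutative[of "law Q (W ?k)" "partial_law P Y r"]
      convolution_commutative[of "law Q (W ?k)" "partial_law Q W r"] fin[OF n1(2)] fin[OF n1(3)] fin[OF n1(4)] by simp
  have 3: "\<zeta> * B * texp (partial_law P Y r) A \<le> \<zeta> * B * B ^ r"
    using Suc.prems k \<open>0 \<le> \<zeta>\<close> \<open>0 \<le> B\<close> texp_partial_law_le[OF m k(2), of A "\<lambda>_. B"] B1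
    by (intro mult_left_mono) auto
  have 4: "(real r * \<zeta> * B ^ r) * texp (law Q (W ?k)) A \<le> (real r * \<zeta> * B ^ r) * B"
    using Suc.prems k \<open>0 \<le> \<zeta>\<close> \<open>0 \<le> B\<close> by (intro mult_left_mono B2) auto
  have "\<zeta> * B * B ^ r + (real r * \<zeta> * B ^ r) * B = real (Suc r) * \<zeta> * B ^ Suc r"
    by (simp add: algebra_simps)
  then show ?case
    unfolding partial_law_Suc[OF m Suc.prems(1)] partial_law_Suc[OF m' Suc.prems(1)]
    using 1 2 3 4 by linarith
qed

text \<open>
  Write \<open>exp (min W A)\<close> as \<open>1\<close> plus the integral of \<open>exp x\<close>
  over \<open>0 \<le> x \<le> A\<close>, \<open>x < W\<close>, and insert the tail.
\<close>
lemma texp_limit_law: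
  assumes "prob_space Q" and W [measurable]: "W \<in> borel_measurable Q" and nn: "AE \<omega> in Q. 0 \<le> W \<omega>"
    and tail: "\<And>x. 0 \<le> x \<Longrightarrow> measure Q {\<omega> \<in> space Q. W \<omega> > x} = 2 * v * exp (- x) - v\<^sup>2 * exp (- 2 * x)"
    and A: "0 \<le> A"
  shows "texp (law Q W) A = 1 + 2 * v * A - v\<^sup>2 * (1 - exp (- A))"
proof -
  interpret prob_space Q by fact
  let ?F = "\<lambda>x. 2 * v * x + v\<^sup>2 * exp (- x)"
  have tail': "exp x * measure Q {\<omega> \<in> space Q. W \<omega> > x} = 2 * v - v\<^sup>2 * exp (- x)" if "0 \<le> x" for x
  proof -
    have "exp x * exp (- x) = 1" "exp x * exp (- 2 * x) = exp (- x)"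
      by (simp_all add: exp_add[symmetric])
    then show ?thesis using tail[OF that] by (simp add: right_diff_distrib mult.left_commute[of "exp x"])
  qed
  have pos: "0 \<le> 2 * v - v\<^sup>2 * exp (- x)" if "0 \<le> x" for x
    unfolding tail'[OF that, symmetric] by simp
  have id: "ennreal (exp (min w A)) = 1 + (\<integral>\<^sup>+x. ennreal (exp x) * indicator {0..A} x * indicator {..<w} x \<partial>lborel)"
    if "0 \<le> w" for w
  proof -
    have "(\<integral>\<^sup>+x. ennreal (exp x) * indicator {0..A} x * indicator {..<w} x \<partial>lborel)
       = (\<integral>\<^sup>+x. ennreal (exp x) * indicator {0..min w A} x \<partial>lborel)"
    proof (rule nn_integral_cong_AE)
      have "AE x in lborel. x \<noteq> w" by (rule AE_lborel_singleton)
      then show "AE x in lborel. ennreal (exp x) * indicator {0..A} x * indicator {..<w} x = ennreal (exp x) * indicator {0..min w A} x"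
        by eventually_elim (auto simp: indicator_def)
    qed
    also have "\<dots> = exp (min w A) - exp 0"
      using that A by (intro nn_integral_FTC_Icc) (auto intro!: derivative_eq_intros)
    finally show ?thesis using that A by (simp add: ennreal_plus[symmetric] ennreal_1[symmetric] del: ennreal_plus ennreal_1)
  qed
  have "ennreal (texp (law Q W) A) = (\<integral>\<^sup>+\<omega>. ennreal (exp (min (W \<omega>) A)) \<partial>Q)"
    unfolding texp_def by (subst nn_integral_eq_integral)
      (auto simp: integral_distr intro!: integrable_const_bound[where B="exp A"])
  also have "\<dots> = (\<integral>\<^sup>+\<omega>. 1 + (\<integral>\<^sup>+x. ennreal (exp x) * indicator {0..A} x * indicator {..<W \<omega>} x \<partial>lborel) \<partial>Q)"
    using nn by (intro nn_integral_cong_AE) (auto elim!: eventually_mono simp: id)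
  also have "\<dots> = 1 + (\<integral>\<^sup>+\<omega>. (\<integral>\<^sup>+x. ennreal (exp x) * indicator {0..A} x * indicator {..<W \<omega>} x \<partial>lborel) \<partial>Q)"
    by (subst nn_integral_add) (auto simp: emeasure_space_1 indicator_def[of "{..<_}"] intro!: lborel.borel_measurable_nn_integral)
  also have "(\<integral>\<^sup>+\<omega>. (\<integral>\<^sup>+x. ennreal (exp x) * indicator {0..A} x * indicator {..<W \<omega>} x \<partial>lborel) \<partial>Q)
     = (\<integral>\<^sup>+x. (\<integral>\<^sup>+\<omega>. ennreal (exp x) * indicator {0..A} x * indicator {..<W \<omega>} x \<partial>Q) \<partial>lborel)"
  proof -
    interpret p: pair_sigma_finite lborel Q ..
    show ?thesis by (rule p.Fubini') (simp add: indicator_def[of "{..<_}"] split_beta')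
  qed
  also have "\<dots> = (\<integral>\<^sup>+x. ennreal (2 * v - v\<^sup>2 * exp (- x)) * indicator {0..A} x \<partial>lborel)"
  proof (intro nn_integral_cong)
    fix x :: real
    show "(\<integral>\<^sup>+\<omega>. ennreal (exp x) * indicator {0..A} x * indicator {..<W \<omega>} x \<partial>Q) = ennreal (2 * v - v\<^sup>2 * exp (- x)) * indicator {0..A} x"
    proof (cases "x \<in> {0..A}")
      case True
      have "(\<integral>\<^sup>+\<omega>. ennreal (exp x) * indicator {0..A} x * indicator {..<W \<omega>} x \<partial>Q)
         = (\<integral>\<^sup>+\<omega>. ennreal (exp x) * indicator {\<omega> \<in> space Q. W \<omega> > x} \<omega> \<partial>Q)"
        using True by (intro nn_integral_cong) (auto simp: indicator_def)
      also have "\<dots> = ennreal (exp x) * ennreal (measure Q {\<omega> \<in> space Q. W \<omega> > x})"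
        by (subst nn_integral_cmult_indicator) (auto simp: emeasure_eq_measure)
      also have "\<dots> = ennreal (2 * v - v\<^sup>2 * exp (- x))"
        using True tail'[of x] by (simp add: ennreal_mult'[symmetric])
      finally show ?thesis using True by simp
    qed simp
  qed
  also have "\<dots> = ennreal (?F A - ?F 0)"
    by (rule nn_integral_FTC_Icc[where F="?F"]) (use A pos in \<open>auto intro!: derivative_eq_intros\<close>)
  finally have eq: "ennreal (texp (law Q W) A) = 1 + ennreal (?F A - ?F 0)" .
  have ge: "0 \<le> ?F A - ?F 0"
  proof -
    have "\<exists>y. (?F has_real_derivative y) (at x) \<and> 0 \<le> y" if "0 \<le> x" "x \<le> A" for x
      using pos[OF that(1)] by (intro exI[of _ "2 * v - v\<^sup>2 * exp (- x)"]) (auto intro!: derivative_eq_intros)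
    then have "?F 0 \<le> ?F A" by (rule DERIV_nonneg_imp_nondecreasing[OF A])
    then show ?thesis by simp
  qed
  from eq have "ennreal (texp (law Q W) A) = ennreal (1 + (?F A - ?F 0))"
    using ge by (simp add: ennreal_plus[symmetric] ennreal_1[symmetric] del: ennreal_plus ennreal_1)
  then have "texp (law Q W) A = 1 + (?F A - ?F 0)"
    using ge texp_nonneg[of "law Q W" A] by (subst (asm) ennreal_inj) auto
  then show ?thesis by (simp add: algebra_simps)
qed

lemma sum_model_zero:
  assumes m: "sum_model M P Y C" and k: "k \<in> {1..M}"
  shows "sum_model M P (Y(k := \<lambda>_. 0)) C"
proof -
  interpret prob_space P using m by (simp add: sum_model_def)
  have ind: "indep_vars (\<lambda>_. borel) (Y(Suc M := C)) {1..Suc M}" using m unfolding sum_model_def by blast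
  have "indep_vars (\<lambda>_. borel) (\<lambda>i. (if i = k then (\<lambda>_. 0) else (\<lambda>x. x)) \<circ> (Y(Suc M := C)) i) {1..Suc M}"
    by (rule indep_vars_compose[OF ind]) auto
  also have "?this \<longleftrightarrow> indep_vars (\<lambda>_. borel) ((Y(k := \<lambda>_. 0))(Suc M := C)) {1..Suc M}"
    using k by (intro indep_vars_cong) (auto simp: fun_eq_iff)
  finally show ?thesis using m by (auto simp: sum_model_def)
qed

text \<open>
  For \<open>M = Suc d\<close> summands. The chi-squared part has two degrees of freedom fewer
  than the constant term of the model, as these are used up by the exponential variable.
\<close>
definition total_texp :: "nat \<Rightarrow> 'a measure \<Rightarrow> (nat \<Rightarrow> 'a \<Rightarrow> real) \<Rightarrow> real \<Rightarrow> real" where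
  "total_texp d P Y A = texp (partial_law P Y (Suc d) \<star> half_chi d) A"

lemma total_law:
  assumes "sum_model (Suc d) P Y C"
  shows "nonneg_law (partial_law P Y (Suc d) \<star> half_chi d)"
  by (rule nonneg_law_convolution[OF partial_law_nonneg[OF assms order_refl] nonneg_law_half_chi])

text \<open>
  The moment of the model \<open>W\<close> is at least of the order \<open>a\<^sup>M\<close> times
  \<open>a\<^sup>d\<^sup>/\<^sup>2\<close>: reserve the share \<open>a / (2 * M)\<close> of the
  level for each summand and for each square. An exchange of summands costs an arbitrarily small
  multiple of this order, and a model in which one summand is replaced by zero is smaller by a
  factor of order \<open>a\<close>.
\<close>
lemma total_texp_compare:
  fixes d :: nat and K0 c0 \<theta> :: real
  assumes K0: "0 < K0" and c0: "0 < c0" and \<theta>: "0 < \<theta>"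
  obtains \<zeta> a0 where "0 < \<zeta>" "1 \<le> a0"
    "\<And>a (P :: 'a measure) Y C (Q :: 'b measure) W C' . a0 \<le> a \<Longrightarrow> sum_model (Suc d) P Y C \<Longrightarrow> sum_model (Suc d) Q W C' \<Longrightarrow>
      (\<And>k A. k \<in> {1..Suc d} \<Longrightarrow> 0 \<le> A \<Longrightarrow> A \<le> a \<Longrightarrow> \<bar>texp (law P (Y k)) A - texp (law Q (W k)) A\<bar> \<le> \<zeta> * a) \<Longrightarrow>
      (\<And>k A. k \<in> {1..Suc d} \<Longrightarrow> 0 \<le> A \<Longrightarrow> A \<le> a \<Longrightarrow> texp (law P (Y k)) A \<le> K0 * a) \<Longrightarrow>
      (\<And>k A. k \<in> {1..Suc d} \<Longrightarrow> 0 \<le> A \<Longrightarrow> A \<le> a \<Longrightarrow> texp (law Q (W k)) A \<le> K0 * a) \<Longrightarrow>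
      (\<And>k. k \<in> {1..Suc d} \<Longrightarrow> c0 * a \<le> texp (law Q (W k)) (a / (2 * real (Suc d)))) \<Longrightarrow>
      \<bar>total_texp d P Y a - total_texp d Q W a\<bar> \<le> \<theta> * total_texp d Q W a \<and>
      (\<forall>k\<in>{1..Suc d}. total_texp d P (Y(k := \<lambda>_. 0)) a \<le> \<theta> * total_texp d Q W a)"
proof -
  let ?M = "real (Suc d)"
  \<comment> \<open>the ratio of the upper and the lower bound for the moments of the two models\<close>
  define \<Gamma> where "\<Gamma> = K0 ^ Suc d * (4 * sqrt (2 * ?M)) ^ d / c0 ^ Suc d"
  have \<Gamma>: "0 < \<Gamma>" unfolding \<Gamma>_def using K0 c0 by (intro divide_pos_pos mult_pos_pos zero_less_power) auto
  define \<zeta> where "\<zeta> = K0 * \<theta> / (?M * \<Gamma>)"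
  have \<zeta>: "0 < \<zeta>" using K0 \<theta> \<Gamma> by (simp add: \<zeta>_def)
  define a0 where "a0 = max 1 (\<Gamma> / (K0 * \<theta>))"
  have "\<bar>total_texp d P Y a - total_texp d Q W a\<bar> \<le> \<theta> * total_texp d Q W a \<and>
      (\<forall>k\<in>{1..Suc d}. total_texp d P (Y(k := \<lambda>_. 0)) a \<le> \<theta> * total_texp d Q W a)"
    if a: "a0 \<le> a" and mP: "sum_model (Suc d) P Y C" and mQ: "sum_model (Suc d) Q W C'"
      and close: "\<And>k A. k \<in> {1..Suc d} \<Longrightarrow> 0 \<le> A \<Longrightarrow> A \<le> a \<Longrightarrow> \<bar>texp (law P (Y k)) A - texp (law Q (W k)) A\<bar> \<le> \<zeta> * a"
      and B1: "\<And>k A. k \<in> {1..Suc d} \<Longrightarrow> 0 \<le> A \<Longrightarrow> A \<le> a \<Longrightarrow> texp (law P (Y k)) A \<le> K0 * a"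
      and B2: "\<And>k A. k \<in> {1..Suc d} \<Longrightarrow> 0 \<le> A \<Longrightarrow> A \<le> a \<Longrightarrow> texp (law Q (W k)) A \<le> K0 * a"
      and low: "\<And>k. k \<in> {1..Suc d} \<Longrightarrow> c0 * a \<le> texp (law Q (W k)) (a / (2 * real (Suc d)))"
    for a and P :: "'a measure" and Y C and Q :: "'b measure" and W C'
  proof -
    have a1: "1 \<le> a" and a2: "\<Gamma> / (K0 * \<theta>) \<le> a" using a by (auto simp: a0_def)
    have a0': "0 < a" using a1 by simp
    define E where "E = (K0 * a) ^ Suc d * (4 * sqrt a) ^ d"
    have E0: "0 \<le> E" using K0 a1 by (simp add: E_def)
    \<comment> \<open>half of the level is shared by the summands, the other half by the squares\<close>
    let ?x = "a / (2 * ?M)"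
    have main: "E \<le> \<Gamma> * total_texp d Q W a"
    proof -
      have p: "(c0 * a) ^ Suc d \<le> texp (partial_law Q W (Suc d)) (a / 2)"
      proof -
        have "(c0 * a) ^ Suc d \<le> texp (partial_law Q W (Suc d)) (real (Suc d) * ?x)"
          using c0 a1 by (intro texp_partial_law_ge[OF mQ order_refl] low) auto
        also have "real (Suc d) * ?x = a / 2"
        proof -
          have "b * (a / (2 * b)) = a / 2" if "0 < b" for b :: real using that by simp
          from this[of ?M] show ?thesis by (simp only: of_nat_0_less_iff zero_less_Suc)
        qed
        finally show ?thesis .
      qed
      have h: "sqrt ?x ^ d \<le> texp (half_chi d) (a / 2)"
      proof -
        have "sqrt ?x ^ d \<le> texp (half_chi d) (real d * ?x)" using a1 by (intro texp_half_chi_ge) auto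
        also have "\<dots> \<le> texp (half_chi d) (a / 2)"
          using nonneg_law_half_chi[of d] a1 by (intro texp_mono) (auto simp: field_simps)
        finally show ?thesis .
      qed
      have "(c0 * a) ^ Suc d * sqrt ?x ^ d \<le> texp (partial_law Q W (Suc d)) (a / 2) * texp (half_chi d) (a / 2)"
        using p h a1 c0 by (intro mult_mono texp_nonneg) auto
      also have "\<dots> \<le> total_texp d Q W (a / 2 + a / 2)"
        unfolding total_texp_def using partial_law_nonneg[OF mQ order_refl] nonneg_law_half_chi[of d]
        by (intro texp_convolution_ge) auto
      finally have "(c0 * a) ^ Suc d * sqrt ?x ^ d \<le> total_texp d Q W a" by simp
      then have "\<Gamma> * ((c0 * a) ^ Suc d * sqrt ?x ^ d) \<le> \<Gamma> * total_texp d Q W a"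
        using \<Gamma> by (intro mult_left_mono) auto
      moreover have "\<Gamma> * ((c0 * a) ^ Suc d * sqrt ?x ^ d) = E"
      proof -
        have "sqrt (2 * b) * sqrt (a / (2 * b)) = sqrt a" if "0 < b" for b :: real
          using that by (simp add: real_sqrt_mult[symmetric])
        from this[of ?M] have "sqrt (2 * ?M) * sqrt ?x = sqrt a" by (simp only: of_nat_0_less_iff zero_less_Suc)
        then have "(4 * sqrt (2 * ?M)) ^ d * sqrt ?x ^ d = (4 * sqrt a) ^ d"
          by (simp only: power_mult_distrib[symmetric] mult.assoc)
        moreover have "\<Gamma> * ((c0 * a) ^ Suc d * sqrt ?x ^ d)
           = K0 ^ Suc d * a ^ Suc d * (c0 ^ Suc d / c0 ^ Suc d) * ((4 * sqrt (2 * ?M)) ^ d * sqrt ?x ^ d)"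
          unfolding \<Gamma>_def power_mult_distrib[of c0 a] by (simp only: times_divide_eq_left times_divide_eq_right mult_ac)
        ultimately show ?thesis unfolding E_def using c0 by (simp add: power_mult_distrib[of K0 a])
      qed
      ultimately show ?thesis by simp
    qed
    have half: "texp (half_chi d) a \<le> (4 * sqrt a) ^ d" using a1 by (rule texp_half_chi_le)
    have pl: "nonneg_law (partial_law P Y (Suc d))" "nonneg_law (partial_law Q W (Suc d))"
      using partial_law_nonneg[OF mP order_refl] partial_law_nonneg[OF mQ order_refl] by auto
    have 1: "\<bar>total_texp d P Y a - total_texp d Q W a\<bar> \<le> \<theta> * total_texp d Q W a"
    proof -
      have "\<bar>texp (partial_law P Y (Suc d)) A - texp (partial_law Q W (Suc d)) A\<bar> \<le> ?M * (\<zeta> / K0) * (K0 * a) ^ Suc d"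
        if "0 \<le> A" "A \<le> a" for A
        using K0 \<zeta> a1 that by (intro texp_partial_law_compare[OF mP mQ order_refl _ _ _ B1 B2]) (auto intro: close)
      then have "\<bar>total_texp d P Y a - total_texp d Q W a\<bar> \<le> ?M * (\<zeta> / K0) * (K0 * a) ^ Suc d * texp (half_chi d) a"
        unfolding total_texp_def using K0 \<zeta> a1 nonneg_law_half_chi by (intro texp_swap pl) auto
      also have "\<dots> \<le> ?M * (\<zeta> / K0) * (K0 * a) ^ Suc d * (4 * sqrt a) ^ d"
        using half K0 \<zeta> a1 by (intro mult_left_mono) auto
      also have "\<dots> = ?M * (\<zeta> / K0) * E" by (simp add: E_def)
      also have "\<dots> \<le> ?M * (\<zeta> / K0) * (\<Gamma> * total_texp d Q W a)"
        using main K0 \<zeta> by (intro mult_left_mono) auto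
      also have "\<dots> = (?M * (\<zeta> / K0) * \<Gamma>) * total_texp d Q W a" by simp
      also have "?M * (\<zeta> / K0) * \<Gamma> = \<theta>" unfolding \<zeta>_def using K0 \<Gamma> by simp
      finally show ?thesis .
    qed
    have 2: "total_texp d P (Y(k := \<lambda>_. 0)) a \<le> \<theta> * total_texp d Q W a" if k: "k \<in> {1..Suc d}" for k
    proof -
      note mz = sum_model_zero[OF mP k]
      interpret P: prob_space P using mP by (simp add: sum_model_def)
      have z: "texp (law P (\<lambda>_. 0)) a = 1"
        using a1 by (simp add: texp_def P.distr_const integral_return)
      have "total_texp d P (Y(k := \<lambda>_. 0)) a \<le> texp (partial_law P (Y(k := \<lambda>_. 0)) (Suc d)) a * texp (half_chi d) a"
        unfolding total_texp_def using partial_law_nonneg[OF mz order_refl] nonneg_law_half_chi a1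
        by (intro texp_convolution_le) auto
      also have "\<dots> \<le> (\<Prod>i=1..Suc d. if i = k then 1 else K0 * a) * (4 * sqrt a) ^ d"
      proof (intro mult_mono half texp_nonneg prod_nonneg)
        show "texp (partial_law P (Y(k := \<lambda>_. 0)) (Suc d)) a \<le> (\<Prod>i=1..Suc d. if i = k then 1 else K0 * a)"
        proof (rule texp_partial_law_le[OF mz order_refl])
          fix i assume i: "i \<in> {1..Suc d}"
          show "texp (law P ((Y(k := \<lambda>_. 0)) i)) a \<le> (if i = k then 1 else K0 * a)"
          proof (cases "i = k")
            case True then show ?thesis using z by (simp only: fun_upd_same simp_thms if_True order_refl)
          next
            case False then show ?thesis using B1[OF i, of a] a1 by simp
          qed
        qed (use a1 in simp)
      qed (use K0 a1 in auto)
      also have "(\<Prod>i=1..Suc d. if i = k then 1 else K0 * a) = (K0 * a) ^ d"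
        using k by (simp add: prod.If_cases Int_absorb2 Collect_neg_eq[symmetric] card_Diff_subset Diff_eq[symmetric] del: prod.cl_ivl_Suc)
      also have "(K0 * a) ^ d * (4 * sqrt a) ^ d = E / (K0 * a)" using K0 a0' by (simp add: E_def)
      also have "\<dots> \<le> \<Gamma> * total_texp d Q W a / (K0 * a)" using main K0 a0' by (intro divide_right_mono) auto
      also have "\<dots> = (\<Gamma> / (K0 * a)) * total_texp d Q W a" by simp
      also have "\<dots> \<le> \<theta> * total_texp d Q W a"
      proof (intro mult_right_mono)
        show "\<Gamma> / (K0 * a) \<le> \<theta>" using a2 K0 \<theta> a0' by (simp add: field_simps)
        show "0 \<le> total_texp d Q W a" unfolding total_texp_def by (rule texp_nonneg)
      qed
      finally show ?thesis .
    qed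
    show ?thesis using 1 2 by blast
  qed
  then show ?thesis using that[OF \<zeta>, of a0] by (simp add: a0_def)
qed

section \<open>Pathwise decomposition of the statistic\<close>

lemma summation_by_parts:
  fixes c f :: "nat \<Rightarrow> real"
  shows "(\<Sum>k=1..Suc M. c k * (f k - f (k - 1))) = (\<Sum>k=1..M. (c k - c (Suc k)) * f k) + c (Suc M) * f (Suc M) - c 1 * f 0"
  by (induction M) (auto simp: algebra_simps)

text \<open>
  The logarithm of the likelihood ratio between a \<open>k\<close>-th change point at
  \<open>s\<close> and one at \<open>r\<close>.
\<close>
definition drift :: "(nat \<Rightarrow> real) \<Rightarrow> nat \<Rightarrow> nat \<Rightarrow> nat \<Rightarrow> (nat \<Rightarrow> real) \<Rightarrow> real" where
  "drift \<mu> k r s S = - jump \<mu> k * (S s - S r) + ((\<mu> (Suc k))\<^sup>2 - (\<mu> k)\<^sup>2) / 2 * (real s - real r)"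

text \<open>
  Completing each square at the true mean leaves linear terms, and the difference of these at
  \<open>t\<close> and at \<open>\<tau>\<close> is summed by parts.
\<close>
lemma U_stat_decomposition:
  fixes X :: "nat \<Rightarrow> 'a \<Rightarrow> real" and \<omega> :: 'a
  assumes t: "split_points M m t" and \<tau>: "split_points M m \<tau>"
  defines "S \<equiv> \<lambda>i. partial_sum X i \<omega>"
  shows "U_stat M X t \<tau> \<mu> \<omega> = (\<Sum>k=1..M. drift \<mu> k (\<tau> k) (t k) S)
     + (\<Sum>k=1..Suc M. (S (t k) - S (t (k - 1)) - \<mu> k * (real (t k) - real (t (k - 1))))\<^sup>2 / (2 * (real (t k) - real (t (k - 1)))))"
proof -
  have inc: "t (k - 1) < t k" "\<tau> (k - 1) < \<tau> k" if "k \<in> {1..Suc M}" for k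
  proof -
    have "k - 1 \<le> M" "Suc (k - 1) = k" using that by auto
    then show "t (k - 1) < t k" "\<tau> (k - 1) < \<tau> k" using t \<tau> unfolding split_points_def by metis+
  qed
  have sq: "D\<^sup>2 / (2 * L) = (D - \<mu>' * L)\<^sup>2 / (2 * L) + (\<mu>' * D - \<mu>'\<^sup>2 / 2 * L)" if "0 < L" for D L \<mu>' :: real
    using that by (simp add: power2_eq_square field_simps)
  let ?f = "\<lambda>k. S (t k) - S (\<tau> k)" and ?g = "\<lambda>k. real (t k) - real (\<tau> k)"
  have lin: "(u * (a - b) - q / 2 * (c - d)) - (u * (e - f) - q / 2 * (g - h)) = u * ((a - e) - (b - f)) - q / 2 * ((c - g) - (d - h))"
    for u q a b c d e f g h :: real by (simp add: field_simps)
  let ?Q = "\<lambda>k. (S (t k) - S (t (k - 1)) - \<mu> k * (real (t k) - real (t (k - 1))))\<^sup>2 / (2 * (real (t k) - real (t (k - 1))))"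
  let ?lt = "\<lambda>k. \<mu> k * (S (t k) - S (t (k - 1))) - (\<mu> k)\<^sup>2 / 2 * (real (t k) - real (t (k - 1)))"
  let ?l\<tau> = "\<lambda>k. \<mu> k * (S (\<tau> k) - S (\<tau> (k - 1))) - (\<mu> k)\<^sup>2 / 2 * (real (\<tau> k) - real (\<tau> (k - 1)))"
  have ends: "t 0 = \<tau> 0" "t (Suc M) = \<tau> (Suc M)" using t \<tau> by (auto simp: split_points_def)
  have "U_stat M X t \<tau> \<mu> \<omega> = (\<Sum>k=1..Suc M. (S (t k) - S (t (k - 1)))\<^sup>2 / (2 * (real (t k) - real (t (k - 1)))))
     - (\<Sum>k=1..Suc M. \<mu> k * (S (\<tau> k) - S (\<tau> (k - 1))) - (\<mu> k)\<^sup>2 / 2 * (real (\<tau> k) - real (\<tau> (k - 1))))"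
    unfolding U_stat_def seg_length_def S_def
  proof -
    have e: "real (t k - t (k - 1)) = real (t k) - real (t (k - 1))" "real (\<tau> k - \<tau> (k - 1)) = real (\<tau> k) - real (\<tau> (k - 1))"
      if "k \<in> {1..Suc M}" for k using inc[OF that] by (simp_all add: of_nat_diff)
    show "(\<Sum>k=1..Suc M. (partial_sum X (t k) \<omega> - partial_sum X (t (k - 1)) \<omega>)\<^sup>2 / (2 * real (t k - t (k - 1))))
       - (\<Sum>k=1..Suc M. \<mu> k * (partial_sum X (\<tau> k) \<omega> - partial_sum X (\<tau> (k - 1)) \<omega>) - (\<mu> k)\<^sup>2 / 2 * real (\<tau> k - \<tau> (k - 1)))
       = (\<Sum>k=1..Suc M. (partial_sum X (t k) \<omega> - partial_sum X (t (k - 1)) \<omega>)\<^sup>2 / (2 * (real (t k) - real (t (k - 1)))))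
       - (\<Sum>k=1..Suc M. \<mu> k * (partial_sum X (\<tau> k) \<omega> - partial_sum X (\<tau> (k - 1)) \<omega>) - (\<mu> k)\<^sup>2 / 2 * (real (\<tau> k) - real (\<tau> (k - 1))))"
      by (simp only: e cong: sum.cong)
  qed
  also have "(\<Sum>k=1..Suc M. (S (t k) - S (t (k - 1)))\<^sup>2 / (2 * (real (t k) - real (t (k - 1)))))
     = (\<Sum>k=1..Suc M. (S (t k) - S (t (k - 1)) - \<mu> k * (real (t k) - real (t (k - 1))))\<^sup>2 / (2 * (real (t k) - real (t (k - 1))))
       + (\<mu> k * (S (t k) - S (t (k - 1))) - (\<mu> k)\<^sup>2 / 2 * (real (t k) - real (t (k - 1)))))"
    using inc(1) by (intro sum.cong refl sq) auto
  finally have "U_stat M X t \<tau> \<mu> \<omega> = (\<Sum>k=1..Suc M. ?Q k + ?lt k) - (\<Sum>k=1..Suc M. ?l\<tau> k)" .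
  also have "\<dots> = (\<Sum>k=1..Suc M. ?Q k) + (\<Sum>k=1..Suc M. ?lt k - ?l\<tau> k)"
    by (simp only: sum.distrib sum_subtractf)
  also have "(\<Sum>k=1..Suc M. ?lt k - ?l\<tau> k) = (\<Sum>k=1..Suc M. \<mu> k * (?f k - ?f (k - 1)) - (\<mu> k)\<^sup>2 / 2 * (?g k - ?g (k - 1)))"
    by (intro sum.cong refl) (rule lin)
  also have "\<dots> = (\<Sum>k=1..Suc M. \<mu> k * (?f k - ?f (k - 1))) - (\<Sum>k=1..Suc M. (\<mu> k)\<^sup>2 / 2 * (?g k - ?g (k - 1)))"
    by (rule sum_subtractf)
  also have "(\<Sum>k=1..Suc M. \<mu> k * (?f k - ?f (k - 1))) - (\<Sum>k=1..Suc M. (\<mu> k)\<^sup>2 / 2 * (?g k - ?g (k - 1)))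
     = (\<Sum>k=1..M. drift \<mu> k (\<tau> k) (t k) S)"
  proof -
    have p1: "(\<Sum>k=1..Suc M. \<mu> k * (?f k - ?f (k - 1))) = (\<Sum>k=1..M. (\<mu> k - \<mu> (Suc k)) * ?f k)"
      using summation_by_parts[where c=\<mu> and f="?f" and M=M] ends by simp
    have p2: "(\<Sum>k=1..Suc M. (\<mu> k)\<^sup>2 / 2 * (?g k - ?g (k - 1))) = (\<Sum>k=1..M. ((\<mu> k)\<^sup>2 / 2 - (\<mu> (Suc k))\<^sup>2 / 2) * ?g k)"
      using summation_by_parts[where c="\<lambda>k. (\<mu> k)\<^sup>2 / 2" and f="?g" and M=M] ends by simp
    show ?thesis unfolding p1 p2 sum_subtractf[symmetric]
      by (intro sum.cong refl) (simp add: drift_def jump_def diff_divide_distrib left_diff_distrib)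
  qed
  finally show ?thesis by simp
qed

text \<open>
  Standardized noise to the right and to the left of a change point, read away from it. The sign
  makes the likelihood ratio a \<open>walk\<close> with positive parameter \<open>\<bar>jump \<mu>
  k\<bar>\<close> on both sides. Values beyond the window are replaced by zero, so that only
  finitely many observations enter.
\<close>
definition right_noise :: "(nat \<Rightarrow> nat) \<Rightarrow> (nat \<Rightarrow> real) \<Rightarrow> (nat \<Rightarrow> nat) \<Rightarrow> (nat \<Rightarrow> real) \<Rightarrow> nat \<Rightarrow> nat \<Rightarrow> real" where
  "right_noise \<tau> \<mu> n x k i = (if i < n k then - sgn (jump \<mu> k) * (x (\<tau> k + 1 + i) - \<mu> (Suc k)) else 0)"

definition left_noise :: "(nat \<Rightarrow> nat) \<Rightarrow> (nat \<Rightarrow> real) \<Rightarrow> (nat \<Rightarrow> nat) \<Rightarrow> (nat \<Rightarrow> real) \<Rightarrow> nat \<Rightarrow> nat \<Rightarrow> real" where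
  "left_noise \<tau> \<mu> n x k i = (if i < n k then sgn (jump \<mu> k) * (x (\<tau> k - i) - \<mu> k) else 0)"

definition window_width :: "nat \<Rightarrow> (nat \<Rightarrow> nat) \<Rightarrow> nat \<Rightarrow> nat" where
  "window_width M n k = (if k \<in> {1..M} then n k else 0)"

definition core_length :: "nat \<Rightarrow> (nat \<Rightarrow> nat) \<Rightarrow> (nat \<Rightarrow> nat) \<Rightarrow> nat \<Rightarrow> real" where
  "core_length M \<tau> n k = real (\<tau> k) - real (window_width M n k) - real (\<tau> (k - 1)) - real (window_width M n (k - 1))"

definition core_sum :: "nat \<Rightarrow> (nat \<Rightarrow> nat) \<Rightarrow> (nat \<Rightarrow> real) \<Rightarrow> (nat \<Rightarrow> nat) \<Rightarrow> (nat \<Rightarrow> real) \<Rightarrow> nat \<Rightarrow> real" where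
  "core_sum M \<tau> \<mu> n S k = S (\<tau> k - window_width M n k) - S (\<tau> (k - 1) + window_width M n (k - 1)) - \<mu> k * core_length M \<tau> n k"

locale window_setup =
  fixes M m :: nat and \<tau> n :: "nat \<Rightarrow> nat" and \<mu> x :: "nat \<Rightarrow> real"
  assumes \<tau>: "split_points M m \<tau>"
    and sep: "\<And>k. k \<in> {1..Suc M} \<Longrightarrow> \<tau> (k - 1) + window_width M n (k - 1) + window_width M n k < \<tau> k"
    and jump: "\<And>k. k \<in> {1..M} \<Longrightarrow> jump \<mu> k \<noteq> 0"
begin

definition S where "S i = (\<Sum>j=1..i. x j)"

abbreviation "\<xi> k \<equiv> right_noise \<tau> \<mu> n x k"
abbreviation "\<zeta> k \<equiv> left_noise \<tau> \<mu> n x k"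
abbreviation "d k \<equiv> \<bar>jump \<mu> k\<bar>"

lemma S_right: "S (r + j) - S r = (\<Sum>i<j. x (r + 1 + i))"
  by (induction j) (auto simp: S_def)

lemma S_left: "j \<le> r \<Longrightarrow> S r - S (r - j) = (\<Sum>i<j. x (r - i))"
proof (induction j)
  case (Suc j)
  then have "S (r - j) = S (r - Suc j) + x (r - j)"
    by (cases "r - j") (auto simp: S_def Suc_diff_Suc[symmetric] simp del: Suc_diff_Suc)
  with Suc show ?case by simp
qed simp

lemma width: "k \<in> {1..M} \<Longrightarrow> window_width M n k = n k"
  and width_ends: "window_width M n 0 = 0" "window_width M n (Suc M) = 0"
  by (auto simp: window_width_def)

lemma n_le_\<tau>: "k \<in> {1..M} \<Longrightarrow> n k \<le> \<tau> k"
  using sep[of k] width[of k] by auto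

lemma sgn_sq: "k \<in> {1..M} \<Longrightarrow> sgn (jump \<mu> k) * sgn (jump \<mu> k) = 1"
  using jump by (auto simp: sgn_if)

lemma right_dev:
  assumes k: "k \<in> {1..M}" and j: "j \<le> n k"
  shows "S (\<tau> k + j) - S (\<tau> k) - \<mu> (Suc k) * real j = - sgn (jump \<mu> k) * (\<Sum>i<j. \<xi> k i)"
proof -
  have "sgn (jump \<mu> k) * (\<Sum>i<j. \<xi> k i) = (\<Sum>i<j. - (sgn (jump \<mu> k) * sgn (jump \<mu> k)) * (x (\<tau> k + 1 + i) - \<mu> (Suc k)))"
    unfolding sum_distrib_left using j by (intro sum.cong) (auto simp: right_noise_def)
  also have "\<dots> = - ((\<Sum>i<j. x (\<tau> k + 1 + i)) - \<mu> (Suc k) * real j)"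
    unfolding sgn_sq[OF k] by (simp add: sum_negf sum_subtractf)
  finally show ?thesis unfolding S_right by simp
qed

lemma left_dev:
  assumes k: "k \<in> {1..M}" and j: "j \<le> n k"
  shows "S (\<tau> k) - S (\<tau> k - j) - \<mu> k * real j = sgn (jump \<mu> k) * (\<Sum>i<j. \<zeta> k i)"
proof -
  have "sgn (jump \<mu> k) * (\<Sum>i<j. \<zeta> k i) = (\<Sum>i<j. (sgn (jump \<mu> k) * sgn (jump \<mu> k)) * (x (\<tau> k - i) - \<mu> k))"
    unfolding sum_distrib_left using j by (intro sum.cong) (auto simp: left_noise_def)
  also have "\<dots> = (\<Sum>i<j. x (\<tau> k - i)) - \<mu> k * real j"
    unfolding sgn_sq[OF k] by (simp add: sum_subtractf)
  finally show ?thesis using S_left[of j "\<tau> k"] n_le_\<tau>[OF k] j by simp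
qed

lemma d_sgn: "d k = jump \<mu> k * sgn (jump \<mu> k)" "sgn (jump \<mu> k) * d k = jump \<mu> k"
  by (simp_all add: abs_sgn sgn_mult_abs)

lemma d_square: "(d k)\<^sup>2 = (jump \<mu> k)\<^sup>2"
  by simp

lemma walk_sum: "walk e y j = e * (\<Sum>i<j. y i) - e\<^sup>2 / 2 * real j"
  by (simp add: walk_def sum_subtractf sum_distrib_left)

lemma drift_right:
  assumes k: "k \<in> {1..M}" and j: "j \<le> n k"
  shows "drift \<mu> k (\<tau> k) (\<tau> k + j) S = walk (d k) (\<xi> k) j"
proof -
  have "drift \<mu> k (\<tau> k) (\<tau> k + j) S = - jump \<mu> k * (S (\<tau> k + j) - S (\<tau> k) - \<mu> (Suc k) * real j) - (jump \<mu> k)\<^sup>2 / 2 * real j"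
    by (simp add: drift_def jump_def power2_eq_square field_simps)
  also have "\<dots> = (jump \<mu> k * sgn (jump \<mu> k)) * (\<Sum>i<j. \<xi> k i) - (jump \<mu> k)\<^sup>2 / 2 * real j"
    unfolding right_dev[OF k j] by simp
  finally show ?thesis unfolding walk_sum d_square d_sgn(1)[of k, symmetric] .
qed

lemma drift_left:
  assumes k: "k \<in> {1..M}" and j: "j \<le> n k"
  shows "drift \<mu> k (\<tau> k) (\<tau> k - j) S = walk (d k) (\<zeta> k) j"
proof -
  have "real (\<tau> k - j) = real (\<tau> k) - real j" using n_le_\<tau>[OF k] j by simp
  then have "drift \<mu> k (\<tau> k) (\<tau> k - j) S = jump \<mu> k * (S (\<tau> k) - S (\<tau> k - j) - \<mu> k * real j) - (jump \<mu> k)\<^sup>2 / 2 * real j"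
    by (simp add: drift_def jump_def power2_eq_square field_simps)
  also have "\<dots> = (jump \<mu> k * sgn (jump \<mu> k)) * (\<Sum>i<j. \<zeta> k i) - (jump \<mu> k)\<^sup>2 / 2 * real j"
    unfolding left_dev[OF k j] by simp
  finally show ?thesis unfolding walk_sum d_square d_sgn(1)[of k, symmetric] .
qed

text \<open>
  For a split point at \<open>s\<close>, the deviations from the expected growth in the two parts
  of the \<open>k\<close>-th window: the part before \<open>s\<close> counts towards segment
  \<open>k\<close>, the part after \<open>s\<close> towards segment \<open>k + 1\<close>.
\<close>
definition before :: "nat \<Rightarrow> nat \<Rightarrow> real" where
  "before k s = S s - S (\<tau> k - window_width M n k) - \<mu> k * (real s - (real (\<tau> k) - real (window_width M n k)))"

definition after :: "nat \<Rightarrow> nat \<Rightarrow> real" where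
  "after k s = S (\<tau> k + window_width M n k) - S s - \<mu> (Suc k) * (real (\<tau> k) + real (window_width M n k) - real s)"

lemma square_add_le: "(u + v)\<^sup>2 \<le> 2 * u\<^sup>2 + 2 * (v::real)\<^sup>2"
  using sum_squares_bound[of u v] by (simp add: power2_eq_square algebra_simps)

lemma sum_le_twice:
  fixes b :: real
  assumes "b \<le> 2 * p + 2 * q" "0 \<le> r"
  shows "b + r \<le> 2 * (p + q + r)" "r + b \<le> 2 * (p + q + r)"
  using assms by simp_all

lemma sgn_square_mult: "k \<in> {1..M} \<Longrightarrow> (sgn (jump \<mu> k) * y)\<^sup>2 = y\<^sup>2"
  using sgn_sq[of k] by (simp add: power_mult_distrib power2_eq_square)

text \<open>
  Measured against the mean of its new segment, the part before the split point is the noise of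
  the whole left half of the window plus noise with the wrong mean; the part after it is pure
  noise.
\<close>
lemma pert_right:
  assumes k: "k \<in> {1..M}" and j: "j \<le> n k" and \<kappa>: "0 \<le> \<kappa>"
  shows "\<kappa> * ((before k (\<tau> k + j))\<^sup>2 + (after k (\<tau> k + j))\<^sup>2) \<le> pert \<kappa> (d k) (n k) (\<xi> k) (\<zeta> k) j"
proof -
  let ?s = "sgn (jump \<mu> k)"
  have "before k (\<tau> k + j) = (S (\<tau> k) - S (\<tau> k - n k) - \<mu> k * real (n k)) + (S (\<tau> k + j) - S (\<tau> k) - \<mu> (Suc k) * real j) + jump \<mu> k * real j"
    by (simp add: before_def width[OF k] jump_def algebra_simps)
  also have "\<dots> = ?s * ((\<Sum>i<n k. \<zeta> k i) + - (\<Sum>i<j. \<xi> k i - d k))"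
    unfolding left_dev[OF k order_refl] right_dev[OF k j] using d_sgn(2)[of k]
    by (simp add: sum_subtractf algebra_simps)
  finally have 1: "(before k (\<tau> k + j))\<^sup>2 \<le> 2 * (\<Sum>i<n k. \<zeta> k i)\<^sup>2 + 2 * (\<Sum>i<j. \<xi> k i - d k)\<^sup>2"
    using square_add_le[of "\<Sum>i<n k. \<zeta> k i" "- (\<Sum>i<j. \<xi> k i - d k)"] by (simp only: sgn_square_mult[OF k] power2_minus)
  have "after k (\<tau> k + j) = (S (\<tau> k + n k) - S (\<tau> k) - \<mu> (Suc k) * real (n k)) - (S (\<tau> k + j) - S (\<tau> k) - \<mu> (Suc k) * real j)"
    by (simp add: after_def width[OF k] algebra_simps)
  also have "\<dots> = ?s * (- ((\<Sum>i<n k. \<xi> k i) - (\<Sum>i<j. \<xi> k i)))"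
    unfolding right_dev[OF k order_refl] right_dev[OF k j] by (simp add: algebra_simps)
  also have "(\<Sum>i<n k. \<xi> k i) - (\<Sum>i<j. \<xi> k i) = (\<Sum>i=j..<n k. \<xi> k i)"
    using sum_diff_nat_ivl[of 0 j "n k" "\<xi> k"] j by (simp add: atLeast0LessThan)
  finally have 2: "(after k (\<tau> k + j))\<^sup>2 = (\<Sum>i=j..<n k. \<xi> k i)\<^sup>2"
    by (simp only: sgn_square_mult[OF k] power2_minus)
  have "(before k (\<tau> k + j))\<^sup>2 + (after k (\<tau> k + j))\<^sup>2
     \<le> 2 * ((\<Sum>i<n k. \<zeta> k i)\<^sup>2 + (\<Sum>i<j. \<xi> k i - d k)\<^sup>2 + (\<Sum>i=j..<n k. \<xi> k i)\<^sup>2)"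
    unfolding 2 by (rule sum_le_twice(1)[OF 1 zero_le_power2])
  from mult_left_mono[OF this \<kappa>] show ?thesis by (simp add: pert_def mult.assoc mult.left_commute)
qed

lemma pert_left:
  assumes k: "k \<in> {1..M}" and j: "j \<le> n k" and \<kappa>: "0 \<le> \<kappa>"
  shows "\<kappa> * ((before k (\<tau> k - j))\<^sup>2 + (after k (\<tau> k - j))\<^sup>2) \<le> pert \<kappa> (d k) (n k) (\<zeta> k) (\<xi> k) j"
proof -
  let ?s = "sgn (jump \<mu> k)"
  have r: "real (\<tau> k - j) = real (\<tau> k) - real j" using n_le_\<tau>[OF k] j by simp
  have "after k (\<tau> k - j) = (S (\<tau> k + n k) - S (\<tau> k) - \<mu> (Suc k) * real (n k)) + (S (\<tau> k) - S (\<tau> k - j) - \<mu> k * real j) - jump \<mu> k * real j"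
    by (simp add: after_def width[OF k] jump_def r algebra_simps)
  also have "\<dots> = ?s * (- (\<Sum>i<n k. \<xi> k i) + (\<Sum>i<j. \<zeta> k i - d k))"
    unfolding right_dev[OF k order_refl] left_dev[OF k j] using d_sgn(2)[of k]
    by (simp add: sum_subtractf algebra_simps)
  finally have 1: "(after k (\<tau> k - j))\<^sup>2 \<le> 2 * (\<Sum>i<n k. \<xi> k i)\<^sup>2 + 2 * (\<Sum>i<j. \<zeta> k i - d k)\<^sup>2"
    using square_add_le[of "- (\<Sum>i<n k. \<xi> k i)" "\<Sum>i<j. \<zeta> k i - d k"] by (simp only: sgn_square_mult[OF k] power2_minus)
  have "before k (\<tau> k - j) = (S (\<tau> k) - S (\<tau> k - n k) - \<mu> k * real (n k)) - (S (\<tau> k) - S (\<tau> k - j) - \<mu> k * real j)"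
    by (simp add: before_def width[OF k] r algebra_simps)
  also have "\<dots> = ?s * ((\<Sum>i<n k. \<zeta> k i) - (\<Sum>i<j. \<zeta> k i))"
    unfolding left_dev[OF k order_refl] left_dev[OF k j] by (simp add: algebra_simps)
  also have "(\<Sum>i<n k. \<zeta> k i) - (\<Sum>i<j. \<zeta> k i) = (\<Sum>i=j..<n k. \<zeta> k i)"
    using sum_diff_nat_ivl[of 0 j "n k" "\<zeta> k"] j by (simp add: atLeast0LessThan)
  finally have 2: "(before k (\<tau> k - j))\<^sup>2 = (\<Sum>i=j..<n k. \<zeta> k i)\<^sup>2"
    by (simp only: sgn_square_mult[OF k])
  have "(before k (\<tau> k - j))\<^sup>2 + (after k (\<tau> k - j))\<^sup>2
     \<le> 2 * ((\<Sum>i<n k. \<xi> k i)\<^sup>2 + (\<Sum>i<j. \<zeta> k i - d k)\<^sup>2 + (\<Sum>i=j..<n k. \<zeta> k i)\<^sup>2)"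
    unfolding 2 by (rule sum_le_twice(2)[OF 1 zero_le_power2])
  from mult_left_mono[OF this \<kappa>] show ?thesis by (simp add: pert_def mult.assoc mult.left_commute)
qed

lemma deviation_split:
  "S (t k) - S (t (k - 1)) - \<mu> k * (real (t k) - real (t (k - 1)))
     = core_sum M \<tau> \<mu> n S k + (before k (t k) + after (k - 1) (t (k - 1)))" if k: "k \<in> {1..Suc M}"
proof -
  have "Suc (k - 1) = k" using k by auto
  moreover have "real (\<tau> k - window_width M n k) = real (\<tau> k) - real (window_width M n k)"
    using sep[OF k] by simp
  ultimately show ?thesis
    by (simp add: core_sum_def core_length_def before_def after_def algebra_simps)
qed

lemma core_length_pos: "k \<in> {1..Suc M} \<Longrightarrow> 0 < core_length M \<tau> n k"
  using sep[of k] by (simp add: core_length_def)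

lemma nearby_cases:
  assumes t: "t \<in> nearby_splits M m \<tau> n" and k: "k \<in> {1..M}"
  obtains j where "j \<le> n k" "t k = \<tau> k + j" | j where "j \<le> n k" "t k = \<tau> k - j"
proof -
  have c: "\<bar>int (t k) - int (\<tau> k)\<bar> \<le> int (n k)" using t k by (auto simp: nearby_splits_def)
  show ?thesis
  proof (cases "\<tau> k \<le> t k")
    case True
    then show ?thesis using c by (intro that(1)[of "t k - \<tau> k"]) auto
  next
    case False
    then show ?thesis using c by (intro that(2)[of "\<tau> k - t k"]) auto
  qed
qed

lemma edge_terms:
  assumes t: "split_points M m t"
  shows "after 0 (t 0) = 0" "before (Suc M) (t (Suc M)) = 0"
  using t \<tau> by (auto simp: after_def before_def split_points_def width_ends)

text \<open>
  Regroups the window contributions by change points instead of segments.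
\<close>
lemma edge_sum_le:
  fixes c \<kappa> :: "nat \<Rightarrow> real"
  assumes t: "split_points M m t"
    and c: "\<And>k. k \<in> {1..M} \<Longrightarrow> c k \<le> \<kappa> k" "\<And>k. k \<in> {1..M} \<Longrightarrow> c (Suc k) \<le> \<kappa> k"
  shows "(\<Sum>k=1..Suc M. c k * ((before k (t k))\<^sup>2 + (after (k - 1) (t (k - 1)))\<^sup>2))
    \<le> (\<Sum>k=1..M. \<kappa> k * ((before k (t k))\<^sup>2 + (after k (t k))\<^sup>2))"
proof -
  let ?b = "\<lambda>k. (before k (t k))\<^sup>2" and ?a = "\<lambda>k. (after k (t k))\<^sup>2"
  have "(\<Sum>k=1..Suc M. c k * (?b k + ?a (k - 1))) = (\<Sum>k=1..Suc M. c k * ?b k) + (\<Sum>k=1..Suc M. c k * ?a (k - 1))"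
    by (simp only: distrib_left sum.distrib)
  also have "(\<Sum>k=1..Suc M. c k * ?b k) = (\<Sum>k=1..M. c k * ?b k)"
    using edge_terms(2)[OF t] by simp
  also have "(\<Sum>k=1..Suc M. c k * ?a (k - 1)) = (\<Sum>k=0..M. c (Suc k) * ?a k)"
    using sum.shift_bounds_cl_Suc_ivl[of "\<lambda>k. c k * ?a (k - 1)" 0 M] by simp
  also have "\<dots> = (\<Sum>k=1..M. c (Suc k) * ?a k)"
    using edge_terms(1)[OF t] by (simp add: sum.atLeast_Suc_atMost)
  also have "(\<Sum>k=1..M. c k * ?b k) + (\<Sum>k=1..M. c (Suc k) * ?a k) \<le> (\<Sum>k=1..M. \<kappa> k * ?b k) + (\<Sum>k=1..M. \<kappa> k * ?a k)"
    using c by (intro add_mono sum_mono mult_right_mono) auto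
  finally show ?thesis by (simp only: distrib_left sum.distrib)
qed

text \<open>
  The weighted bound \<open>2 * g * y \<le> \<delta> * g\<^sup>2 + y\<^sup>2 / \<delta>\<close>,
  with the sum divided by the smaller length.
\<close>
lemma square_upper:
  fixes g y l L \<delta> :: real
  assumes "0 < \<delta>" "0 < l" "l \<le> L"
  shows "(g + y)\<^sup>2 / (2 * L) \<le> (1 + \<delta>) * (g\<^sup>2 / l) / 2 + (1 + 1 / \<delta>) / (2 * l) * y\<^sup>2"
proof -
  have "0 \<le> (\<delta> * g - y)\<^sup>2 / \<delta>" using assms by simp
  also have "\<dots> = \<delta> * g\<^sup>2 - 2 * g * y + y\<^sup>2 / \<delta>"
    using assms by (simp add: power2_eq_square field_simps)
  finally have "(g + y)\<^sup>2 \<le> (1 + \<delta>) * g\<^sup>2 + (1 + 1 / \<delta>) * y\<^sup>2"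
    by (simp add: power2_sum distrib_right)
  then have "(g + y)\<^sup>2 / (2 * l) \<le> ((1 + \<delta>) * g\<^sup>2 + (1 + 1 / \<delta>) * y\<^sup>2) / (2 * l)"
    using assms by (intro divide_right_mono) auto
  moreover have "(g + y)\<^sup>2 / (2 * L) \<le> (g + y)\<^sup>2 / (2 * l)"
    using assms by (intro divide_left_mono) auto
  moreover have "((1 + \<delta>) * g\<^sup>2 + (1 + 1 / \<delta>) * y\<^sup>2) / (2 * l) = (1 + \<delta>) * (g\<^sup>2 / l) / 2 + (1 + 1 / \<delta>) / (2 * l) * y\<^sup>2"
    using assms by (simp add: field_simps)
  ultimately show ?thesis by linarith
qed

text \<open>
  The weighted bound \<open>- 2 * g * y \<le> \<delta> * g\<^sup>2 + y\<^sup>2 / \<delta>\<close>;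
  the other factor \<open>1 - \<delta>\<close> makes up for the excess of \<open>L\<close> over
  \<open>l\<close>.
\<close>
lemma square_lower:
  fixes g y l L \<delta> :: real
  assumes "0 < \<delta>" "\<delta> < 1" "0 < l" "l \<le> L" "L \<le> l * (1 + \<delta>)"
  shows "(1 - 2 * \<delta>) * (g\<^sup>2 / l) / 2 - (1 + 1 / \<delta>) / (2 * l) * y\<^sup>2 \<le> (g + y)\<^sup>2 / (2 * L)"
proof -
  have "0 \<le> (\<delta> * g + y)\<^sup>2 / \<delta>" using assms by simp
  also have "\<dots> = \<delta> * g\<^sup>2 + 2 * g * y + y\<^sup>2 / \<delta>"
    using assms by (simp add: power2_eq_square field_simps)
  finally have "0 \<le> \<delta> * g\<^sup>2 + 2 * g * y + y\<^sup>2 / \<delta>" .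
  moreover have "(g + y)\<^sup>2 = g\<^sup>2 + y\<^sup>2 + 2 * g * y" by (rule power2_sum)
  moreover have "(1 - \<delta>) * g\<^sup>2 = g\<^sup>2 - \<delta> * g\<^sup>2" by (simp add: left_diff_distrib)
  ultimately have "(1 - \<delta>) * g\<^sup>2 - y\<^sup>2 / \<delta> \<le> (g + y)\<^sup>2"
    using zero_le_power2[of y] by linarith
  then have "((1 - \<delta>) * g\<^sup>2 - y\<^sup>2 / \<delta>) / (2 * L) \<le> (g + y)\<^sup>2 / (2 * L)"
    using assms by (intro divide_right_mono) auto
  moreover have "(1 - 2 * \<delta>) * (g\<^sup>2 / l) / 2 \<le> (1 - \<delta>) * g\<^sup>2 / (2 * L)"
  proof -
    have "(1 - 2 * \<delta>) * L \<le> (1 - \<delta>) * l"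
    proof (cases "0 \<le> 1 - 2 * \<delta>")
      case True
      then have "(1 - 2 * \<delta>) * L \<le> (1 - 2 * \<delta>) * (l * (1 + \<delta>))" using assms by (intro mult_left_mono) auto
      also have "\<dots> = (1 - \<delta>) * l - 2 * \<delta>\<^sup>2 * l" by (simp add: power2_eq_square algebra_simps)
      also have "\<dots> \<le> (1 - \<delta>) * l" using assms by simp
      finally show ?thesis .
    next
      case False
      then have "(1 - 2 * \<delta>) * L \<le> 0" using assms by (simp add: mult_nonpos_nonneg)
      also have "0 \<le> (1 - \<delta>) * l" using assms by simp
      finally show ?thesis .
    qed
    then have "(1 - 2 * \<delta>) * L * g\<^sup>2 \<le> (1 - \<delta>) * l * g\<^sup>2" by (intro mult_right_mono) auto
    then show ?thesis using assms by (simp add: field_simps)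
  qed
  moreover have "(y\<^sup>2 / \<delta>) / (2 * L) \<le> (1 + 1 / \<delta>) / (2 * l) * y\<^sup>2"
  proof -
    have "(y\<^sup>2 / \<delta>) / (2 * L) \<le> (y\<^sup>2 / \<delta>) / (2 * l)"
      using assms by (intro divide_left_mono) auto
    also have "\<dots> \<le> y\<^sup>2 / (2 * l) + (y\<^sup>2 / \<delta>) / (2 * l)" using assms by simp
    also have "\<dots> = (1 + 1 / \<delta>) / (2 * l) * y\<^sup>2" by (simp add: add_divide_distrib distrib_right)
    finally show ?thesis .
  qed
  ultimately show ?thesis by (simp add: diff_divide_distrib)
qed

lemma partial_sum_eq: "x = (\<lambda>i. X i \<omega>) \<Longrightarrow> partial_sum X i \<omega> = S i"
  unfolding partial_sum_def S_def by simp

lemma near_bounds: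
  assumes t: "t \<in> nearby_splits M m \<tau> n" and k: "k \<le> Suc M"
  shows "\<bar>real (t k) - real (\<tau> k)\<bar> \<le> real (window_width M n k)"
proof (cases "k \<in> {1..M}")
  case True
  then have "\<bar>int (t k) - int (\<tau> k)\<bar> \<le> int (n k)" using t by (auto simp: nearby_splits_def)
  then show ?thesis using width[OF True] by linarith
next
  case False
  then have "k = 0 \<or> k = Suc M" using k by auto
  then show ?thesis using t \<tau> by (auto simp: nearby_splits_def split_points_def window_width_def)
qed

lemma segment_bounds:
  assumes t: "t \<in> nearby_splits M m \<tau> n" and k: "k \<in> {1..Suc M}"
  shows "core_length M \<tau> n k \<le> real (t k) - real (t (k - 1))"
    and "real (t k) - real (t (k - 1)) \<le> core_length M \<tau> n k + 2 * real (window_width M n k) + 2 * real (window_width M n (k - 1))"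
proof -
  have "k \<le> Suc M" "k - 1 \<le> Suc M" using k by auto
  from near_bounds[OF t this(1)] near_bounds[OF t this(2)]
  show "core_length M \<tau> n k \<le> real (t k) - real (t (k - 1))"
    and "real (t k) - real (t (k - 1)) \<le> core_length M \<tau> n k + 2 * real (window_width M n k) + 2 * real (window_width M n (k - 1))"
    unfolding core_length_def abs_le_iff by linarith+
qed

lemma diff_le_trans: "p - q \<le> (u :: real) \<Longrightarrow> q \<le> r \<Longrightarrow> r = s \<Longrightarrow> p - s \<le> u"
  by linarith

lemma half_double: "c / (2 * l) * (2 * e) = c / l * (e :: real)"
  by simp

text \<open>
  Each segment deviation is the core deviation plus contributions of the adjacent windows. The
  mixed terms are split by a weighted inequality, and the window contributions are charged to the
  perturbation of the corresponding walk.
\<close>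
lemma U_upper:
  fixes X :: "nat \<Rightarrow> 'a \<Rightarrow> real"
  assumes x: "x = (\<lambda>i. X i \<omega>)" and t: "t \<in> nearby_splits M m \<tau> n" and \<delta>: "0 < \<delta>"
    and \<kappa>: "\<And>k. k \<in> {1..M} \<Longrightarrow> (1 + 1 / \<delta>) / core_length M \<tau> n k \<le> \<kappa> k"
      "\<And>k. k \<in> {1..M} \<Longrightarrow> (1 + 1 / \<delta>) / core_length M \<tau> n (Suc k) \<le> \<kappa> k"
  shows "U_stat M X t \<tau> \<mu> \<omega> \<le> (\<Sum>k=1..M. window_max 1 (\<kappa> k) (d k) (n k) (\<xi> k, \<zeta> k))
    + (1 + \<delta>) * ((\<Sum>k=1..Suc M. (core_sum M \<tau> \<mu> n S k)\<^sup>2 / core_length M \<tau> n k) / 2)"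
proof -
  let ?l = "core_length M \<tau> n" and ?g = "core_sum M \<tau> \<mu> n S"
  let ?L = "\<lambda>k. real (t k) - real (t (k - 1))"
  let ?e = "\<lambda>k. (before k (t k))\<^sup>2 + (after (k - 1) (t (k - 1)))\<^sup>2"
  let ?c = "\<lambda>k. (1 + 1 / \<delta>) / ?l k"
  have sp: "split_points M m t" using t by (simp add: nearby_splits_def)
  have trm: "(S (t k) - S (t (k - 1)) - \<mu> k * ?L k)\<^sup>2 / (2 * ?L k) \<le> (1 + \<delta>) * ((?g k)\<^sup>2 / ?l k) / 2 + ?c k * ?e k"
    if k: "k \<in> {1..Suc M}" for k
  proof -
    let ?y = "before k (t k) + after (k - 1) (t (k - 1))"
    have "(S (t k) - S (t (k - 1)) - \<mu> k * ?L k)\<^sup>2 / (2 * ?L k) \<le> (1 + \<delta>) * ((?g k)\<^sup>2 / ?l k) / 2 + (1 + 1 / \<delta>) / (2 * ?l k) * ?y\<^sup>2"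
      unfolding deviation_split[OF k] using \<delta> core_length_pos[OF k] segment_bounds(1)[OF t k] by (rule square_upper)
    also have "(1 + 1 / \<delta>) / (2 * ?l k) * ?y\<^sup>2 \<le> (1 + 1 / \<delta>) / (2 * ?l k) * (2 * ?e k)"
      using \<delta> core_length_pos[OF k] square_add_le[of "before k (t k)" "after (k - 1) (t (k - 1))"]
      by (intro mult_left_mono) auto
    also have "\<dots> = ?c k * ?e k" by (rule half_double)
    finally show ?thesis by simp
  qed
  have dr: "drift \<mu> k (\<tau> k) (t k) S + \<kappa> k * ((before k (t k))\<^sup>2 + (after k (t k))\<^sup>2) \<le> window_max 1 (\<kappa> k) (d k) (n k) (\<xi> k, \<zeta> k)"
    if k: "k \<in> {1..M}" for k
  proof -
    have k0: "0 \<le> \<kappa> k" using \<kappa>(1)[OF k] \<delta> core_length_pos[of k] k by (auto intro: order_trans[rotated])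
    show ?thesis
    proof (cases rule: nearby_cases[OF t k])
      case (1 j)
      have "walk (d k) (\<xi> k) j + \<kappa> k * ((before k (\<tau> k + j))\<^sup>2 + (after k (\<tau> k + j))\<^sup>2)
         \<le> window_side 1 (\<kappa> k) (d k) (n k) (\<xi> k) (\<zeta> k)"
        using add_left_mono[OF pert_right[OF k 1(1) k0], of "walk (d k) (\<xi> k) j"]
          window_side_ge[OF 1(1), of "d k" "\<xi> k" 1 "\<kappa> k" "\<zeta> k"] unfolding mult_1_left by (rule order_trans)
      then show ?thesis using 1(2) drift_right[OF k 1(1)] by (simp add: window_max_def le_max_iff_disj)
    next
      case (2 j)
      have "walk (d k) (\<zeta> k) j + \<kappa> k * ((before k (\<tau> k - j))\<^sup>2 + (after k (\<tau> k - j))\<^sup>2)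
         \<le> window_side 1 (\<kappa> k) (d k) (n k) (\<zeta> k) (\<xi> k)"
        using add_left_mono[OF pert_left[OF k 2(1) k0], of "walk (d k) (\<zeta> k) j"]
          window_side_ge[OF 2(1), of "d k" "\<zeta> k" 1 "\<kappa> k" "\<xi> k"] unfolding mult_1_left by (rule order_trans)
      then show ?thesis using 2(2) drift_left[OF k 2(1)] by (simp add: window_max_def le_max_iff_disj)
    qed
  qed
  have "U_stat M X t \<tau> \<mu> \<omega> = (\<Sum>k=1..M. drift \<mu> k (\<tau> k) (t k) S)
     + (\<Sum>k=1..Suc M. (S (t k) - S (t (k - 1)) - \<mu> k * ?L k)\<^sup>2 / (2 * ?L k))"
    using U_stat_decomposition[OF sp \<tau>, of X \<mu> \<omega>] by (simp only: partial_sum_eq[where X=X and \<omega>=\<omega>, OF x])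
  also have "\<dots> \<le> (\<Sum>k=1..M. drift \<mu> k (\<tau> k) (t k) S) + (\<Sum>k=1..Suc M. (1 + \<delta>) * ((?g k)\<^sup>2 / ?l k) / 2 + ?c k * ?e k)"
    by (intro add_left_mono sum_mono trm)
  also have "(\<Sum>k=1..Suc M. (1 + \<delta>) * ((?g k)\<^sup>2 / ?l k) / 2 + ?c k * ?e k)
     = (1 + \<delta>) * ((\<Sum>k=1..Suc M. (?g k)\<^sup>2 / ?l k) / 2) + (\<Sum>k=1..Suc M. ?c k * ?e k)"
    by (simp only: sum.distrib sum_distrib_left sum_divide_distrib times_divide_eq_right)
  also have "(\<Sum>k=1..Suc M. ?c k * ?e k) \<le> (\<Sum>k=1..M. \<kappa> k * ((before k (t k))\<^sup>2 + (after k (t k))\<^sup>2))"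
    by (rule edge_sum_le[where c="?c" and \<kappa>=\<kappa>, OF sp \<kappa>])
  finally have "U_stat M X t \<tau> \<mu> \<omega> \<le> (\<Sum>k=1..M. drift \<mu> k (\<tau> k) (t k) S + \<kappa> k * ((before k (t k))\<^sup>2 + (after k (t k))\<^sup>2))
     + (1 + \<delta>) * ((\<Sum>k=1..Suc M. (?g k)\<^sup>2 / ?l k) / 2)"
    by (simp only: sum.distrib add_le_cancel_left add_ac)
  also have "(\<Sum>k=1..M. drift \<mu> k (\<tau> k) (t k) S + \<kappa> k * ((before k (t k))\<^sup>2 + (after k (t k))\<^sup>2))
     \<le> (\<Sum>k=1..M. window_max 1 (\<kappa> k) (d k) (n k) (\<xi> k, \<zeta> k))"
    by (intro sum_mono dr)
  finally show ?thesis by simp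
qed

text \<open>
  A maximizing step of the perturbed walk is a split point inside the window.
\<close>
lemma window_attained:
  assumes k: "k \<in> {1..M}" and k0: "0 \<le> \<kappa>"
  obtains s where "\<bar>int s - int (\<tau> k)\<bar> \<le> int (n k)"
    "window_max (-1) \<kappa> (d k) (n k) (\<xi> k, \<zeta> k) \<le> drift \<mu> k (\<tau> k) s S - \<kappa> * ((before k s)\<^sup>2 + (after k s)\<^sup>2)"
proof -
  have "window_max (-1) \<kappa> (d k) (n k) (\<xi> k, \<zeta> k) = window_side (-1) \<kappa> (d k) (n k) (\<xi> k) (\<zeta> k)
     \<or> window_max (-1) \<kappa> (d k) (n k) (\<xi> k, \<zeta> k) = window_side (-1) \<kappa> (d k) (n k) (\<zeta> k) (\<xi> k)"
    by (auto simp: window_max_def max_def)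
  then show ?thesis
  proof
    assume w: "window_max (-1) \<kappa> (d k) (n k) (\<xi> k, \<zeta> k) = window_side (-1) \<kappa> (d k) (n k) (\<xi> k) (\<zeta> k)"
    obtain j where j: "j \<le> n k" "window_side (-1) \<kappa> (d k) (n k) (\<xi> k) (\<zeta> k) = walk (d k) (\<xi> k) j + - 1 * pert \<kappa> (d k) (n k) (\<xi> k) (\<zeta> k) j"
      by (rule window_side_attained)
    show ?thesis
      using drift_right[OF k j(1)] pert_right[OF k j(1) k0] j w by (intro that[of "\<tau> k + j"]) auto
  next
    assume w: "window_max (-1) \<kappa> (d k) (n k) (\<xi> k, \<zeta> k) = window_side (-1) \<kappa> (d k) (n k) (\<zeta> k) (\<xi> k)"
    obtain j where j: "j \<le> n k" "window_side (-1) \<kappa> (d k) (n k) (\<zeta> k) (\<xi> k) = walk (d k) (\<zeta> k) j + - 1 * pert \<kappa> (d k) (n k) (\<zeta> k) (\<xi> k) j"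
      by (rule window_side_attained)
    show ?thesis
      using drift_left[OF k j(1)] pert_left[OF k j(1) k0] j w n_le_\<tau>[OF k] by (intro that[of "\<tau> k - j"]) auto
  qed
qed

lemma \<tau>_le_m: "k \<le> Suc M \<Longrightarrow> \<tau> k + window_width M n k \<le> m"
proof (induction "Suc M - k" arbitrary: k)
  case 0
  then have "k = Suc M" by simp
  then show ?case using \<tau> by (simp add: split_points_def width_ends)
next
  case (Suc j)
  then have "\<tau> (Suc k) + window_width M n (Suc k) \<le> m" by (intro Suc.hyps(1)) auto
  moreover have "k \<le> M" using Suc.hyps(2) by linarith
  then have "\<tau> k + window_width M n k < \<tau> (Suc k)" using sep[of "Suc k"] by simp
  ultimately show ?case by simp
qed

lemma nearby_splitsI:
  assumes t: "t \<in> extensional {0..Suc M}" and ends: "t 0 = 0" "t (Suc M) = m"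
    and near: "\<And>k. k \<in> {1..M} \<Longrightarrow> \<bar>int (t k) - int (\<tau> k)\<bar> \<le> int (n k)"
  shows "t \<in> nearby_splits M m \<tau> n"
proof -
  have w: "t k \<le> \<tau> k + window_width M n k" "\<tau> k \<le> t k + window_width M n k" if "k \<le> Suc M" for k
  proof -
    consider "k \<in> {1..M}" | "k = 0" | "k = Suc M" using \<open>k \<le> Suc M\<close> by force
    then have "t k \<le> \<tau> k + window_width M n k \<and> \<tau> k \<le> t k + window_width M n k"
    proof cases
      case 1 then show ?thesis using near[OF 1] width[OF 1] by linarith
    qed (use ends \<tau> in \<open>simp_all add: split_points_def\<close>)
    then show "t k \<le> \<tau> k + window_width M n k" "\<tau> k \<le> t k + window_width M n k" by auto
  qed
  have "t k < t (Suc k)" if "k \<le> M" for k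
    using w(1)[of k] w(2)[of "Suc k"] sep[of "Suc k"] that by simp
  moreover have "t k \<le> m" if "k \<le> Suc M" for k
    using w(1)[OF that] \<tau>_le_m[OF that] by simp
  ultimately show ?thesis using t ends near by (auto simp: nearby_splits_def split_points_def PiE_def)
qed

text \<open>
  The maximizers of the perturbed walks can be chosen independently of each other, since any split
  points within the windows are admissible.
\<close>
lemma U_lower:
  fixes X :: "nat \<Rightarrow> 'a \<Rightarrow> real"
  assumes x: "x = (\<lambda>i. X i \<omega>)" and \<delta>: "0 < \<delta>" "\<delta> < 1"
    and \<kappa>: "\<And>k. k \<in> {1..M} \<Longrightarrow> (1 + 1 / \<delta>) / core_length M \<tau> n k \<le> \<kappa> k"
      "\<And>k. k \<in> {1..M} \<Longrightarrow> (1 + 1 / \<delta>) / core_length M \<tau> n (Suc k) \<le> \<kappa> k"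
    and short: "\<And>k. k \<in> {1..Suc M} \<Longrightarrow> 2 * real (window_width M n k) + 2 * real (window_width M n (k - 1)) \<le> \<delta> * core_length M \<tau> n k"
  obtains t where "t \<in> nearby_splits M m \<tau> n"
    "(\<Sum>k=1..M. window_max (-1) (\<kappa> k) (d k) (n k) (\<xi> k, \<zeta> k))
    + (1 - 2 * \<delta>) * ((\<Sum>k=1..Suc M. (core_sum M \<tau> \<mu> n S k)\<^sup>2 / core_length M \<tau> n k) / 2) \<le> U_stat M X t \<tau> \<mu> \<omega>"
proof -
  let ?l = "core_length M \<tau> n" and ?g = "core_sum M \<tau> \<mu> n S"
  have "\<forall>k\<in>{1..M}. \<exists>s. \<bar>int s - int (\<tau> k)\<bar> \<le> int (n k) \<and>
    window_max (-1) (\<kappa> k) (d k) (n k) (\<xi> k, \<zeta> k) \<le> drift \<mu> k (\<tau> k) s S - \<kappa> k * ((before k s)\<^sup>2 + (after k s)\<^sup>2)"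
  proof
    fix k assume k: "k \<in> {1..M}"
    have k0: "0 \<le> \<kappa> k" using \<kappa>(1)[OF k] \<delta> core_length_pos[of k] k by (auto intro: order_trans[rotated])
    show "\<exists>s. \<bar>int s - int (\<tau> k)\<bar> \<le> int (n k) \<and>
    window_max (-1) (\<kappa> k) (d k) (n k) (\<xi> k, \<zeta> k) \<le> drift \<mu> k (\<tau> k) s S - \<kappa> k * ((before k s)\<^sup>2 + (after k s)\<^sup>2)"
      by (rule window_attained[OF k k0]) blast
  qed
  then obtain s where s: "\<And>k. k \<in> {1..M} \<Longrightarrow> \<bar>int (s k) - int (\<tau> k)\<bar> \<le> int (n k)"
    "\<And>k. k \<in> {1..M} \<Longrightarrow> window_max (-1) (\<kappa> k) (d k) (n k) (\<xi> k, \<zeta> k) \<le> drift \<mu> k (\<tau> k) (s k) S - \<kappa> k * ((before k (s k))\<^sup>2 + (after k (s k))\<^sup>2)"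
    by metis
  define t where "t = (\<lambda>k. if k \<in> {1..M} then s k else if k = 0 then 0 else if k = Suc M then m else undefined)"
  have ts: "t k = s k" if "k \<in> {1..M}" for k using that by (simp add: t_def)
  have t: "t \<in> nearby_splits M m \<tau> n"
    using s(1) by (intro nearby_splitsI) (auto simp: t_def extensional_def)
  let ?L = "\<lambda>k. real (t k) - real (t (k - 1))"
  let ?e = "\<lambda>k. (before k (t k))\<^sup>2 + (after (k - 1) (t (k - 1)))\<^sup>2"
  let ?c = "\<lambda>k. (1 + 1 / \<delta>) / ?l k"
  have sp: "split_points M m t" using t by (simp add: nearby_splits_def)
  have trm: "(1 - 2 * \<delta>) * ((?g k)\<^sup>2 / ?l k) / 2 - ?c k * ?e k \<le> (S (t k) - S (t (k - 1)) - \<mu> k * ?L k)\<^sup>2 / (2 * ?L k)"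
    if k: "k \<in> {1..Suc M}" for k
  proof -
    let ?y = "before k (t k) + after (k - 1) (t (k - 1))"
    have "?L k \<le> ?l k * (1 + \<delta>)"
      using segment_bounds(2)[OF t k] short[OF k] by (simp add: algebra_simps)
    then have "(1 - 2 * \<delta>) * ((?g k)\<^sup>2 / ?l k) / 2 - (1 + 1 / \<delta>) / (2 * ?l k) * ?y\<^sup>2 \<le> (S (t k) - S (t (k - 1)) - \<mu> k * ?L k)\<^sup>2 / (2 * ?L k)"
      unfolding deviation_split[OF k] using \<delta> core_length_pos[OF k] segment_bounds(1)[OF t k] by (intro square_lower)
    moreover have "(1 + 1 / \<delta>) / (2 * ?l k) * ?y\<^sup>2 \<le> (1 + 1 / \<delta>) / (2 * ?l k) * (2 * ?e k)"
      using \<delta> core_length_pos[OF k] square_add_le[of "before k (t k)" "after (k - 1) (t (k - 1))"]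
      by (intro mult_left_mono) auto
    moreover have "(1 + 1 / \<delta>) / (2 * ?l k) * (2 * ?e k) = ?c k * ?e k" by (rule half_double)
    ultimately show ?thesis by (rule diff_le_trans)
  qed
  have eqU: "U_stat M X t \<tau> \<mu> \<omega> = (\<Sum>k=1..M. drift \<mu> k (\<tau> k) (t k) S)
     + (\<Sum>k=1..Suc M. (S (t k) - S (t (k - 1)) - \<mu> k * ?L k)\<^sup>2 / (2 * ?L k))"
    using U_stat_decomposition[OF sp \<tau>, of X \<mu> \<omega>] by (simp only: partial_sum_eq[where X=X and \<omega>=\<omega>, OF x])
  have "(\<Sum>k=1..Suc M. (1 - 2 * \<delta>) * ((?g k)\<^sup>2 / ?l k) / 2 - ?c k * ?e k)
     \<le> (\<Sum>k=1..Suc M. (S (t k) - S (t (k - 1)) - \<mu> k * ?L k)\<^sup>2 / (2 * ?L k))"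
    by (intro sum_mono trm)
  moreover have "(\<Sum>k=1..Suc M. (1 - 2 * \<delta>) * ((?g k)\<^sup>2 / ?l k) / 2 - ?c k * ?e k)
     = (1 - 2 * \<delta>) * ((\<Sum>k=1..Suc M. (?g k)\<^sup>2 / ?l k) / 2) - (\<Sum>k=1..Suc M. ?c k * ?e k)"
    by (simp only: sum_subtractf sum_distrib_left sum_divide_distrib times_divide_eq_right)
  moreover have "(\<Sum>k=1..Suc M. ?c k * ?e k) \<le> (\<Sum>k=1..M. \<kappa> k * ((before k (t k))\<^sup>2 + (after k (t k))\<^sup>2))"
    by (rule edge_sum_le[where c="?c" and \<kappa>=\<kappa>, OF sp \<kappa>])
  moreover have "(\<Sum>k=1..M. window_max (-1) (\<kappa> k) (d k) (n k) (\<xi> k, \<zeta> k))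
     \<le> (\<Sum>k=1..M. drift \<mu> k (\<tau> k) (t k) S - \<kappa> k * ((before k (t k))\<^sup>2 + (after k (t k))\<^sup>2))"
    using s(2) ts by (intro sum_mono) simp
  moreover have "(\<Sum>k=1..M. drift \<mu> k (\<tau> k) (t k) S - \<kappa> k * ((before k (t k))\<^sup>2 + (after k (t k))\<^sup>2))
     = (\<Sum>k=1..M. drift \<mu> k (\<tau> k) (t k) S) - (\<Sum>k=1..M. \<kappa> k * ((before k (t k))\<^sup>2 + (after k (t k))\<^sup>2))"
    by (rule sum_subtractf)
  ultimately show ?thesis using eqU by (intro that[OF t]) linarith
qed

end

section \<open>Independent windows and cores\<close>

context prob_space
begin

lemma indep_blocks:
  fixes X :: "'i \<Rightarrow> 'a \<Rightarrow> real" and F :: "'j \<Rightarrow> ('i \<Rightarrow> real) \<Rightarrow> real"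
  assumes "indep_vars (\<lambda>_. borel) X J" "\<And>j. j \<in> L \<Longrightarrow> K j \<subseteq> J" "disjoint_family_on K L"
    and "\<And>j. j \<in> L \<Longrightarrow> F j \<in> borel_measurable (Pi\<^sub>M (K j) (\<lambda>_. borel))"
  shows "indep_vars (\<lambda>_. borel) (\<lambda>j \<omega>. F j (restrict (\<lambda>i. X i \<omega>) (K j))) L"
  using indep_vars_restrict[OF assms(1-3)] assms(4) by (rule indep_vars_compose2)

text \<open>
  Singleton blocks of an independent family.
\<close>
lemma indep_vars_reindex:
  fixes X :: "'i \<Rightarrow> 'a \<Rightarrow> real"
  assumes "indep_vars (\<lambda>_. borel) X J" "f ` I \<subseteq> J" "inj_on f I"
  shows "indep_vars (\<lambda>_. borel) (\<lambda>i. X (f i)) I"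
proof -
  have "indep_vars (\<lambda>_. borel) (\<lambda>j \<omega>. (\<lambda>w. w (f j)) (restrict (\<lambda>i. X i \<omega>) {f j})) I"
    using assms by (intro indep_blocks[OF assms(1), where K="\<lambda>j. {f j}"])
      (auto simp: disjoint_family_on_def inj_on_def)
  then show ?thesis by simp
qed

lemma std_normals_law:
  assumes ind: "indep_vars (\<lambda>_. borel) Z {..<N::nat}" and "0 < N"
    and Z: "\<And>i. i < N \<Longrightarrow> distributed M lborel (Z i) std_normal_density"
  shows "distr M (Pi\<^sub>M {..<N} (\<lambda>_. borel)) (\<lambda>\<omega>. \<lambda>i\<in>{..<N}. Z i \<omega>) = Pi\<^sub>M {..<N} (\<lambda>_. std_normal_distribution)"
proof -
  have rv: "Z i \<in> borel_measurable M" if "i < N" for i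
    using Z[OF that] by (simp add: distributed_def)
  have "distr M (Pi\<^sub>M {..<N} (\<lambda>_. borel)) (\<lambda>\<omega>. \<lambda>i\<in>{..<N}. Z i \<omega>) = Pi\<^sub>M {..<N} (\<lambda>i. distr M borel (Z i))"
    by (rule indep_vars_iff_distr_eq_PiM'[THEN iffD1, OF _ _ ind]) (use \<open>0 < N\<close> rv in auto)
  also have "\<dots> = Pi\<^sub>M {..<N} (\<lambda>_. std_normal_distribution)"
  proof (intro PiM_cong refl)
    fix i assume "i \<in> {..<N}"
    then have "distr M lborel (Z i) = std_normal_distribution" using Z[of i] by (simp add: distributed_def)
    moreover have "distr M borel (Z i) = distr M lborel (Z i)" by (intro distr_cong) auto
    ultimately show "distr M borel (Z i) = std_normal_distribution" by simp
  qed
  finally show ?thesis .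
qed

lemma sum_squares_law:
  assumes ind: "indep_vars (\<lambda>_. borel) Z {..<N::nat}" and "0 < N"
    and Z: "\<And>i. i < N \<Longrightarrow> distributed M lborel (Z i) std_normal_density"
  shows "distr M borel (\<lambda>\<omega>. \<Sum>i<N. (Z i \<omega>)\<^sup>2) = chi_squared_distribution N"
proof -
  have rv: "Z i \<in> borel_measurable M" if "i < N" for i
    using Z[OF that] by (simp add: distributed_def)
  have m: "(\<lambda>\<omega>. \<lambda>i\<in>{..<N}. Z i \<omega>) \<in> M \<rightarrow>\<^sub>M Pi\<^sub>M {..<N} (\<lambda>_. borel)"
    using rv by (intro measurable_restrict) auto
  have "chi_squared_distribution N = distr (distr M (Pi\<^sub>M {..<N} (\<lambda>_. borel)) (\<lambda>\<omega>. \<lambda>i\<in>{..<N}. Z i \<omega>)) borel (\<lambda>z. \<Sum>i<N. (z i)\<^sup>2)"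
    unfolding chi_squared_distribution_def
    by (rule arg_cong[where f="\<lambda>L. distr L borel (\<lambda>z. \<Sum>i<N. (z i)\<^sup>2)"]) (rule std_normals_law[OF assms, symmetric])
  also have "\<dots> = distr M borel (\<lambda>\<omega>. \<Sum>i<N. (Z i \<omega>)\<^sup>2)"
    by (subst distr_distr[OF _ m]) (auto simp: comp_def)
  finally show ?thesis ..
qed

end

text \<open>
  The window maximum reads only the first \<open>n\<close> coordinates on each side, so the law of
  a finite noise vector determines its law.
\<close>
definition truncate :: "nat \<Rightarrow> (nat \<Rightarrow> real) \<Rightarrow> nat \<Rightarrow> real" where
  "truncate n x i = (if i < n then x i else 0)"

lemma window_max_truncate: "window_max \<sigma> \<kappa> d n (truncate n x, truncate n z) = window_max \<sigma> \<kappa> d n (x, z)"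
proof -
  have w: "walk d (truncate n x) j = walk d x j" if "j \<le> n" for x j
    using that by (auto simp: walk_def truncate_def intro!: sum.cong)
  have p: "pert \<kappa> d n (truncate n x) (truncate n z) j = pert \<kappa> d n x z j" if "j \<le> n" for x z j
  proof -
    have "(\<Sum>i<n. truncate n z i) = (\<Sum>i<n. z i)" "(\<Sum>i<j. truncate n x i - d) = (\<Sum>i<j. x i - d)"
      "(\<Sum>i=j..<n. truncate n x i) = (\<Sum>i=j..<n. x i)"
      using that by (auto simp: truncate_def intro!: sum.cong)
    then show ?thesis by (simp add: pert_def)
  qed
  have "window_side \<sigma> \<kappa> d n (truncate n x) (truncate n z) = window_side \<sigma> \<kappa> d n x z" for x z
    unfolding window_side_def by (intro arg_cong[where f=Max] image_cong) (auto simp: w p)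
  then show ?thesis by (simp add: window_max_def)
qed

text \<open>
  Here \<open>2 * n\<close> independent standard normal variables provide both halves of a window.
\<close>
lemma (in prob_space) window_max_law:
  assumes ind: "indep_vars (\<lambda>_. borel) Z {..<2 * n}" and "0 < n"
    and Z: "\<And>i. i < 2 * n \<Longrightarrow> distributed M lborel (Z i) std_normal_density"
  shows "distr M borel (\<lambda>\<omega>. window_max \<sigma> \<kappa> d n (\<lambda>i. if i < n then Z i \<omega> else 0, \<lambda>i. if i < n then Z (n + i) \<omega> else 0))
    = distr noise2 borel (window_max \<sigma> \<kappa> d n)"
proof -
  let ?P = "Pi\<^sub>M {..<2 * n} (\<lambda>_. borel) :: (nat \<Rightarrow> real) measure" and ?N = "Pi\<^sub>M {..<2 * n} (\<lambda>_. std_normal_distribution)"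
  define h where "h w = ((\<lambda>i. if i < n then w i else 0, \<lambda>i. if i < n then w (n + i) else 0) :: (nat \<Rightarrow> real) \<times> (nat \<Rightarrow> real))" for w :: "nat \<Rightarrow> real"
  have rv: "Z i \<in> borel_measurable M" if "i < 2 * n" for i
    using Z[OF that] by (simp add: distributed_def)
  have m: "(\<lambda>\<omega>. \<lambda>i\<in>{..<2 * n}. Z i \<omega>) \<in> M \<rightarrow>\<^sub>M ?P"
    using rv by (intro measurable_restrict) auto
  have h1: "(\<lambda>w. (\<lambda>i. if i < n then w i else 0)) \<in> ?P \<rightarrow>\<^sub>M noise"
  proof (rule measurable_into_noise)
    fix i show "(\<lambda>w. if i < n then w i else 0) \<in> borel_measurable ?P"
      by (cases "i < n") auto
  qed
  have h2: "(\<lambda>w. (\<lambda>i. if i < n then w (n + i) else 0)) \<in> ?P \<rightarrow>\<^sub>M noise"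
  proof (rule measurable_into_noise)
    fix i show "(\<lambda>w. if i < n then w (n + i) else 0) \<in> borel_measurable ?P"
      by (cases "i < n") auto
  qed
  have h: "h \<in> ?P \<rightarrow>\<^sub>M noise2" unfolding h_def using h1 h2 by measurable
  define g where "g w = window_max \<sigma> \<kappa> d n (h w)" for w
  have g: "g \<in> borel_measurable ?P" unfolding g_def[abs_def] using h by measurable
  have setsPN: "sets ?N = sets ?P" by (intro sets_PiM_cong) auto
  have r: "(\<lambda>x. \<lambda>i\<in>{..<2 * n}. x i) \<in> noise \<rightarrow>\<^sub>M ?P"
    by (intro measurable_restrict) auto
  have c: "(\<lambda>w. comb_seq n (fst w) (snd w)) \<in> noise2 \<rightarrow>\<^sub>M noise" by measurable
  have "distr M borel (\<lambda>\<omega>. window_max \<sigma> \<kappa> d n (\<lambda>i. if i < n then Z i \<omega> else 0, \<lambda>i. if i < n then Z (n + i) \<omega> else 0))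
     = distr (distr M ?P (\<lambda>\<omega>. \<lambda>i\<in>{..<2 * n}. Z i \<omega>)) borel g"
    by (subst distr_distr[OF g m]) (auto intro!: distr_cong arg_cong[where f="window_max \<sigma> \<kappa> d n"] simp: g_def h_def fun_eq_iff)
  also have "distr M ?P (\<lambda>\<omega>. \<lambda>i\<in>{..<2 * n}. Z i \<omega>) = ?N"
    using std_normals_law[OF ind _ Z] \<open>0 < n\<close> by simp
  also have "?N = distr noise ?N (\<lambda>x. \<lambda>i\<in>{..<2 * n}. x i)"
    using distr_PiM_reindex[of UNIV "\<lambda>_. std_normal_distribution" "\<lambda>i. i" "{..<2 * n}"] prob_space_std_normal by simp
  also have "\<dots> = distr noise ?P (\<lambda>x. \<lambda>i\<in>{..<2 * n}. x i)"
    by (intro distr_cong setsPN) auto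
  also have "distr (distr noise ?P (\<lambda>x. \<lambda>i\<in>{..<2 * n}. x i)) borel g = distr noise borel (\<lambda>x. g (\<lambda>i\<in>{..<2 * n}. x i))"
    by (subst distr_distr[OF g r]) (simp add: comp_def)
  also have "\<dots> = distr (distr noise2 noise (\<lambda>(x, y). comb_seq n x y)) borel (\<lambda>x. g (\<lambda>i\<in>{..<2 * n}. x i))"
    by (simp only: noise.PiM_comb_seq)
  also have "\<dots> = distr noise2 borel (\<lambda>w. g (\<lambda>i\<in>{..<2 * n}. comb_seq n (fst w) (snd w) i))"
    using measurable_compose[OF r g] c by (subst distr_distr) (auto simp: comp_def split_beta')
  also have "\<dots> = distr noise2 borel (window_max \<sigma> \<kappa> d n)"
  proof (intro distr_cong refl)
    fix w :: "(nat \<Rightarrow> real) \<times> (nat \<Rightarrow> real)"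
    have "h (\<lambda>i\<in>{..<2 * n}. comb_seq n (fst w) (snd w) i) = (truncate n (fst w), truncate n (snd w))"
      by (auto simp: h_def truncate_def comb_seq_def fun_eq_iff)
    then show "g (\<lambda>i\<in>{..<2 * n}. comb_seq n (fst w) (snd w) i) = window_max \<sigma> \<kappa> d n w"
      by (simp add: g_def window_max_truncate)
  qed
  finally show ?thesis .
qed

locale window_model = prob_space P for P :: "'a measure" +
  fixes M m :: nat and \<tau> n :: "nat \<Rightarrow> nat" and \<mu> :: "nat \<Rightarrow> real" and X :: "nat \<Rightarrow> 'a \<Rightarrow> real"
  assumes model: "change_point_model M m \<tau> \<mu> P X"
    and sp: "split_points M m \<tau>"
    and sep': "\<And>k. k \<in> {1..Suc M} \<Longrightarrow> \<tau> (k - 1) + window_width M n (k - 1) + window_width M n k < \<tau> k"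
    and jump': "\<And>k. k \<in> {1..M} \<Longrightarrow> jump \<mu> k \<noteq> 0"
    and n_pos: "\<And>k. k \<in> {1..M} \<Longrightarrow> 0 < n k"
begin

sublocale ws: window_setup M m \<tau> n \<mu> "\<lambda>i. X i \<omega>" for \<omega>
  by unfold_locales (use sp sep' jump' in auto)

lemma indep_X: "indep_vars (\<lambda>_. borel) X {1..m}"
  using model by (simp add: change_point_model_def)

lemma X_measurable: "i \<in> {1..m} \<Longrightarrow> X i \<in> borel_measurable P"
  using indep_X unfolding indep_vars_def by auto

lemma X_distributed: "k \<in> {1..Suc M} \<Longrightarrow> \<tau> (k - 1) < i \<Longrightarrow> i \<le> \<tau> k \<Longrightarrow> distributed P lborel (X i) (normal_density (\<mu> k) 1)"
  using model by (auto simp: change_point_model_def)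

definition R :: "real \<Rightarrow> real \<Rightarrow> nat \<Rightarrow> 'a \<Rightarrow> real" where
  "R \<sigma> \<kappa> k \<omega> = window_max \<sigma> \<kappa> \<bar>jump \<mu> k\<bar> (n k) (right_noise \<tau> \<mu> n (\<lambda>i. X i \<omega>) k, left_noise \<tau> \<mu> n (\<lambda>i. X i \<omega>) k)"

definition C :: "'a \<Rightarrow> real" where
  "C \<omega> = (\<Sum>k=1..Suc M. (core_sum M \<tau> \<mu> n (\<lambda>i. \<Sum>j=1..i. X j \<omega>) k)\<^sup>2 / core_length M \<tau> n k)"

lemma window_inside:
  assumes "k \<in> {1..M}"
  shows "\<tau> (k - 1) + n k < \<tau> k" "\<tau> k + n k < \<tau> (Suc k)" "\<tau> (Suc k) \<le> m"
proof -
  show "\<tau> (k - 1) + n k < \<tau> k" using sep'[of k] assms by (auto simp: window_width_def)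
  show "\<tau> k + n k < \<tau> (Suc k)" using sep'[of "Suc k"] assms by (auto simp: window_width_def)
  show "\<tau> (Suc k) \<le> m" using ws.\<tau>_le_m[of "Suc k"] assms by simp
qed

lemma standardize:
  assumes "distributed P lborel Y (normal_density \<nu> 1)" "s = 1 \<or> s = (-1::real)"
  shows "distributed P lborel (\<lambda>\<omega>. s * (Y \<omega> - \<nu>)) std_normal_density"
proof -
  have "distributed P lborel (\<lambda>\<omega>. - s * \<nu> + s * Y \<omega>) (normal_density (- s * \<nu> + s * \<nu>) (\<bar>s\<bar> * 1))"
    using assms by (intro normal_density_affine) auto
  moreover have "\<bar>s\<bar> = 1" using assms(2) by auto
  ultimately show ?thesis by (simp add: algebra_simps)
qed

lemma R_law:
  assumes k: "k \<in> {1..M}"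
  shows "distr P borel (R \<sigma> \<kappa> k) = distr noise2 borel (window_max \<sigma> \<kappa> \<bar>jump \<mu> k\<bar> (n k))"
proof -
  let ?n = "n k" and ?s = "sgn (jump \<mu> k)"
  \<comment> \<open>the observations right of the change point first, then those left of it, both read outwards\<close>
  define f where "f i = (if i < ?n then \<tau> k + 1 + i else \<tau> k - (i - ?n))" for i
  define Z where "Z i \<omega> = (if i < ?n then - ?s * (X (\<tau> k + 1 + i) \<omega> - \<mu> (Suc k)) else ?s * (X (\<tau> k - (i - ?n)) \<omega> - \<mu> k))" for i \<omega>
  have s: "?s = 1 \<or> ?s = -1" "- ?s = 1 \<or> - ?s = -1" using jump'[OF k] by (auto simp: sgn_if)
  note w = window_inside[OF k]
  have inj: "inj_on f {..<2 * ?n}" using w by (auto simp: inj_on_def f_def split: if_splits)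
  have rng: "f ` {..<2 * ?n} \<subseteq> {1..m}" using w by (auto simp: f_def)
  have "indep_vars (\<lambda>_. borel) (\<lambda>i. X (f i)) {..<2 * ?n}"
    by (rule indep_vars_reindex[OF indep_X rng inj])
  then have "indep_vars (\<lambda>_. borel) (\<lambda>i \<omega>. (\<lambda>y. if i < ?n then - ?s * (y - \<mu> (Suc k)) else ?s * (y - \<mu> k)) (X (f i) \<omega>)) {..<2 * ?n}"
    by (rule indep_vars_compose2) auto
  also have "?this \<longleftrightarrow> indep_vars (\<lambda>_. borel) Z {..<2 * ?n}"
    by (intro indep_vars_cong) (auto simp: Z_def f_def fun_eq_iff)
  finally have ind: "indep_vars (\<lambda>_. borel) Z {..<2 * ?n}" .
  have Zd: "distributed P lborel (Z i) std_normal_density" if "i < 2 * ?n" for i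
  proof (cases "i < ?n")
    case True
    then have "distributed P lborel (X (\<tau> k + 1 + i)) (normal_density (\<mu> (Suc k)) 1)"
      using w k by (intro X_distributed) auto
    from standardize[OF this s(2)] True show ?thesis by (simp add: Z_def[abs_def])
  next
    case False
    then have "distributed P lborel (X (\<tau> k - (i - ?n))) (normal_density (\<mu> k) 1)"
      using w k that by (intro X_distributed) auto
    from standardize[OF this s(1)] False show ?thesis by (simp add: Z_def[abs_def])
  qed
  have "R \<sigma> \<kappa> k = (\<lambda>\<omega>. window_max \<sigma> \<kappa> \<bar>jump \<mu> k\<bar> ?n (\<lambda>i. if i < ?n then Z i \<omega> else 0, \<lambda>i. if i < ?n then Z (?n + i) \<omega> else 0))"
    unfolding R_def by (intro ext arg_cong[where f="window_max \<sigma> \<kappa> \<bar>jump \<mu> k\<bar> ?n"])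
      (auto simp: right_noise_def left_noise_def Z_def fun_eq_iff)
  then show ?thesis using window_max_law[OF ind n_pos[OF k] Zd] by simp
qed

lemma core_sum_eq:
  assumes k: "k \<in> {1..Suc M}"
  shows "core_sum M \<tau> \<mu> n (\<lambda>i. \<Sum>j=1..i. x j) k
    = (\<Sum>i\<in>{\<tau> (k - 1) + window_width M n (k - 1)<..\<tau> k - window_width M n k}. x i) - \<mu> k * core_length M \<tau> n k"
proof -
  let ?lo = "\<tau> (k - 1) + window_width M n (k - 1)" and ?hi = "\<tau> k - window_width M n k"
  have "?lo \<le> ?hi" using sep'[OF k] by simp
  then have "{1..?hi} = {1..?lo} \<union> {?lo<..?hi}" by auto
  then have "(\<Sum>j=1..?hi. x j) = (\<Sum>j=1..?lo. x j) + (\<Sum>j\<in>{?lo<..?hi}. x j)"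
    by (simp add: sum.union_disjoint[symmetric] ivl_disj_int)
  then show ?thesis unfolding core_sum_def by simp
qed

abbreviation core :: "nat \<Rightarrow> nat set" where
  "core k \<equiv> {\<tau> (k - 1) + window_width M n (k - 1)<..\<tau> k - window_width M n k}"

lemma core_card: "k \<in> {1..Suc M} \<Longrightarrow> real (card (core k)) = core_length M \<tau> n k"
  using sep'[of k] by (simp add: core_length_def of_nat_diff)

lemma \<tau>_mono: "i \<le> j \<Longrightarrow> j \<le> Suc M \<Longrightarrow> \<tau> i + (if i < j then window_width M n i + window_width M n j else 0) \<le> \<tau> j"
proof (induction j)
  case (Suc j)
  show ?case
  proof (cases "i = Suc j")
    case False
    then have ij: "i \<le> j" "j \<le> M" using Suc.prems by auto
    have s: "\<tau> j + window_width M n j + window_width M n (Suc j) < \<tau> (Suc j)" using sep'[of "Suc j"] ij by simp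
    show ?thesis using Suc.IH ij s False by (cases "i = j") auto
  qed simp
qed simp

lemma \<tau>_le: "i \<le> j \<Longrightarrow> j \<le> Suc M \<Longrightarrow> \<tau> i \<le> \<tau> j"
  using \<tau>_mono[of i j] by (simp split: if_splits)

lemma core_subset: "k \<in> {1..Suc M} \<Longrightarrow> core k \<subseteq> {1..m}"
  using \<tau>_mono[of k "Suc M"] sp by (auto simp: split_points_def split: if_splits)

lemma core_disjoint: "disjoint_family_on core {1..Suc M}"
proof -
  have "core k \<inter> core l = {}" if "k < l" "l \<in> {1..Suc M}" for k l
  proof -
    have "\<tau> k \<le> \<tau> (l - 1)" using that by (intro \<tau>_le) auto
    then show ?thesis by auto
  qed
  then show ?thesis unfolding disjoint_family_on_def by (metis Int_commute linorder_neqE_nat)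
qed

text \<open>
  The core sums are independent normal variables because the cores are disjoint.
\<close>
lemma C_law: "distr P borel C = chi_squared_distribution (Suc M)"
proof -
  define F where "F k w = ((\<Sum>i\<in>core k. w i) - \<mu> k * core_length M \<tau> n k) / sqrt (core_length M \<tau> n k)" for k and w :: "nat \<Rightarrow> real"
  define G where "G k \<omega> = F k (restrict (\<lambda>i. X i \<omega>) (core k))" for k \<omega>
  have G: "G k \<omega> = ((\<Sum>i\<in>core k. X i \<omega>) - \<mu> k * core_length M \<tau> n k) / sqrt (core_length M \<tau> n k)" for k \<omega>
    by (simp add: G_def F_def)
  have "indep_vars (\<lambda>_. borel) G {1..Suc M}"
    unfolding G_def
    by (rule indep_blocks[OF indep_X core_subset core_disjoint]) (auto simp: F_def intro!: borel_measurable_diff borel_measurable_divide borel_measurable_sum)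
  then have ind: "indep_vars (\<lambda>_. borel) (\<lambda>i. G (Suc i)) {..<Suc M}"
    by (rule indep_vars_reindex) auto
  have Gd: "distributed P lborel (G k) std_normal_density" if k: "k \<in> {1..Suc M}" for k
  proof -
    have l: "0 < core_length M \<tau> n k" using ws.core_length_pos[OF k] .
    have ne: "core k \<noteq> {}" using sep'[OF k] by auto
    have "distributed P lborel (\<lambda>\<omega>. \<Sum>i\<in>core k. X i \<omega>) (normal_density (\<Sum>i\<in>core k. \<mu> k) (sqrt (\<Sum>i\<in>core k. 1\<^sup>2)))"
    proof (rule sum_indep_normal)
      show "indep_vars (\<lambda>_. borel) X (core k)" by (rule indep_vars_subset[OF indep_X core_subset[OF k]])
      fix i assume "i \<in> core k"
      then show "distributed P lborel (X i) (normal_density (\<mu> k) 1)" using k by (intro X_distributed) auto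
    qed (use ne in auto)
    then have "distributed P lborel (\<lambda>\<omega>. \<Sum>i\<in>core k. X i \<omega>) (normal_density (\<mu> k * core_length M \<tau> n k) (sqrt (core_length M \<tau> n k)))"
      using core_card[OF k] by (simp add: mult.commute)
    then show ?thesis unfolding G[abs_def] using l by (subst (asm) normal_standard_normal_convert) auto
  qed
  have "C = (\<lambda>\<omega>. \<Sum>i<Suc M. (G (Suc i) \<omega>)\<^sup>2)"
  proof
    fix \<omega>
    have "C \<omega> = (\<Sum>k=1..Suc M. (G k \<omega>)\<^sup>2)"
      unfolding C_def
    proof (intro sum.cong refl)
      fix k assume k: "k \<in> {1..Suc M}"
      have l: "0 < core_length M \<tau> n k" using ws.core_length_pos[OF k] .
      then show "(core_sum M \<tau> \<mu> n (\<lambda>i. \<Sum>j=1..i. X j \<omega>) k)\<^sup>2 / core_length M \<tau> n k = (G k \<omega>)\<^sup>2"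
        unfolding core_sum_eq[OF k] G by (simp add: power_divide)
    qed
    also have "\<dots> = (\<Sum>i=0..<Suc M. (G (Suc i) \<omega>)\<^sup>2)"
      using sum.shift_bounds_Suc_ivl[of "\<lambda>k. (G k \<omega>)\<^sup>2" 0 "Suc M"] by (simp add: atLeastLessThanSuc_atLeastAtMost)
    finally show "C \<omega> = (\<Sum>i<Suc M. (G (Suc i) \<omega>)\<^sup>2)" by (simp only: atLeast0LessThan)
  qed
  then show ?thesis using sum_squares_law[OF ind] Gd by simp
qed

text \<open>
  The value at \<open>Suc M\<close> collects all cores, so that the windows and the chi-squared
  variable are functions of disjoint blocks of observations.
\<close>
definition window :: "nat \<Rightarrow> nat set" where
  "window k = (if k \<in> {1..M} then {\<tau> k - n k<..\<tau> k + n k} else (\<Union>k\<in>{1..Suc M}. core k))"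

lemma window_subset: "k \<in> {1..Suc M} \<Longrightarrow> window k \<subseteq> {1..m}"
proof -
  assume "k \<in> {1..Suc M}"
  show ?thesis
  proof (cases "k \<in> {1..M}")
    case True
    then show ?thesis using window_inside[OF True] by (auto simp: window_def)
  next
    case False
    then show ?thesis using core_subset unfolding window_def if_not_P[OF False] by (intro UN_least)
  qed
qed

lemma window_disjoint: "disjoint_family_on window {1..Suc M}"
proof -
  have ww: "window k \<inter> window l = {}" if kl: "k < l" "k \<in> {1..M}" "l \<in> {1..M}" for k l
    using \<tau>_mono[of k l] kl by (auto simp: window_def window_width_def)
  have wc: "window k \<inter> core l = {}" if kl: "k \<in> {1..M}" "l \<in> {1..Suc M}" for k l
  proof (cases "k < l")
    case True
    then have "\<tau> k + n k \<le> \<tau> (l - 1) + window_width M n (l - 1)"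
    proof (cases "k = l - 1")
      case False
      then have "k < l - 1" "l - 1 \<le> M" "l - 1 \<le> Suc M" using True kl by auto
      then show ?thesis using \<tau>_mono[of k "l - 1"] kl by (simp add: window_width_def)
    qed (use kl in \<open>auto simp: window_width_def\<close>)
    then show ?thesis using kl by (auto simp: window_def)
  next
    case False
    then have "\<tau> l - window_width M n l \<le> \<tau> k - n k"
      using \<tau>_mono[of l k] kl by (cases "k = l") (auto simp: window_width_def)
    then show ?thesis using kl by (auto simp: window_def)
  qed
  have "window k \<inter> window l = {}" if kl: "k < l" "k \<in> {1..Suc M}" "l \<in> {1..Suc M}" for k l
  proof (cases "l = Suc M")
    case True
    then have "window l = (\<Union>k\<in>{1..Suc M}. core k)" by (simp add: window_def)
    moreover have "window k \<inter> core j = {}" if "j \<in> {1..Suc M}" for j using wc that kl by auto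
    ultimately show ?thesis by blast
  next
    case False
    then show ?thesis using kl by (intro ww) auto
  qed
  then show ?thesis unfolding disjoint_family_on_def by (metis Int_commute linorder_neqE_nat)
qed

lemma sum_model_windows: "sum_model M P (\<lambda>k \<omega>. max 0 (R \<sigma> (\<kappa> k) k \<omega>)) C"
proof -
  define F where "F k w = (if k \<in> {1..M} then max 0 (window_max \<sigma> (\<kappa> k) \<bar>jump \<mu> k\<bar> (n k) (right_noise \<tau> \<mu> n w k, left_noise \<tau> \<mu> n w k))
     else (\<Sum>j=1..Suc M. ((\<Sum>i\<in>core j. w i) - \<mu> j * core_length M \<tau> n j)\<^sup>2 / core_length M \<tau> n j))" for k and w :: "nat \<Rightarrow> real"
  have "indep_vars (\<lambda>_. borel) (\<lambda>k \<omega>. F k (restrict (\<lambda>i. X i \<omega>) (window k))) {1..Suc M}"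
  proof (rule indep_blocks[OF indep_X window_subset window_disjoint])
    fix k assume "k \<in> {1..Suc M}"
    show "F k \<in> borel_measurable (Pi\<^sub>M (window k) (\<lambda>_. borel))"
    proof (cases "k \<in> {1..M}")
      case True
      let ?P = "Pi\<^sub>M (window k) (\<lambda>_. borel) :: (nat \<Rightarrow> real) measure"
      note w = window_inside[OF True]
      have comp: "(\<lambda>w. w i) \<in> borel_measurable ?P" if "i \<in> window k" for i
        using that by (rule measurable_component_singleton)
      have r: "(\<lambda>w. right_noise \<tau> \<mu> n w k) \<in> ?P \<rightarrow>\<^sub>M noise"
      proof (rule measurable_into_noise)
        fix i show "(\<lambda>w. right_noise \<tau> \<mu> n w k i) \<in> borel_measurable ?P"
          using comp[of "\<tau> k + 1 + i"] True by (cases "i < n k") (auto simp: right_noise_def window_def)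
      qed
      have l: "(\<lambda>w. left_noise \<tau> \<mu> n w k) \<in> ?P \<rightarrow>\<^sub>M noise"
      proof (rule measurable_into_noise)
        fix i show "(\<lambda>w. left_noise \<tau> \<mu> n w k i) \<in> borel_measurable ?P"
        proof (cases "i < n k")
          case i: True
          then have "\<tau> k - i \<in> window k" using True w by (auto simp: window_def)
          from comp[OF this] show ?thesis using i by (simp add: left_noise_def)
        qed (simp add: left_noise_def)
      qed
      have "(\<lambda>w. (right_noise \<tau> \<mu> n w k, left_noise \<tau> \<mu> n w k)) \<in> ?P \<rightarrow>\<^sub>M noise2" using r l by measurable
      from measurable_compose[OF this window_max_measurable] show ?thesis using True by (simp add: F_def[abs_def])
    next
      case False
      have comp: "(\<lambda>w. w i) \<in> borel_measurable (Pi\<^sub>M (window k) (\<lambda>_. borel))" if "j \<in> {1..Suc M}" "i \<in> core j" for i j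
      proof (rule measurable_component_singleton)
        show "i \<in> window k" unfolding window_def if_not_P[OF False] using that by (rule UN_I)
      qed
      have eq: "F k = (\<lambda>w. \<Sum>j=1..Suc M. ((\<Sum>i\<in>core j. w i) - \<mu> j * core_length M \<tau> n j)\<^sup>2 / core_length M \<tau> n j)"
        using False by (simp only: F_def[abs_def] if_False)
      show ?thesis unfolding eq
        by (intro borel_measurable_sum borel_measurable_divide borel_measurable_power borel_measurable_diff borel_measurable_const)
          (rule comp)
    qed
  qed
  also have "?this \<longleftrightarrow> indep_vars (\<lambda>_. borel) ((\<lambda>k \<omega>. max 0 (R \<sigma> (\<kappa> k) k \<omega>))(Suc M := C)) {1..Suc M}"
  proof (intro indep_vars_cong refl)
    fix k assume k: "k \<in> {1..Suc M}"
    show "(\<lambda>\<omega>. F k (restrict (\<lambda>i. X i \<omega>) (window k))) = ((\<lambda>k \<omega>. max 0 (R \<sigma> (\<kappa> k) k \<omega>))(Suc M := C)) k"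
    proof (cases "k = Suc M")
      case True
      have "F (Suc M) (restrict (\<lambda>i. X i \<omega>) (window (Suc M))) = C \<omega>" for \<omega>
      proof -
        have eq: "(\<Sum>i\<in>core j. restrict (\<lambda>i. X i \<omega>) (window (Suc M)) i) = (\<Sum>i\<in>core j. X i \<omega>)" if "j \<in> {1..Suc M}" for j
          using that by (intro sum.cong) (auto simp: window_def)
        have notin: "Suc M \<notin> {1..M}" by simp
        show ?thesis unfolding F_def C_def if_not_P[OF notin]
          by (intro sum.cong refl) (simp only: eq core_sum_eq)
      qed
      then show ?thesis using True by auto
    next
      case False
      then have kM: "k \<in> {1..M}" using k by auto
      note w = window_inside[OF kM]
      have "right_noise \<tau> \<mu> n (restrict (\<lambda>i. X i \<omega>) (window k)) k = right_noise \<tau> \<mu> n (\<lambda>i. X i \<omega>) k"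
        "left_noise \<tau> \<mu> n (restrict (\<lambda>i. X i \<omega>) (window k)) k = left_noise \<tau> \<mu> n (\<lambda>i. X i \<omega>) k" for \<omega>
        using kM w by (auto simp: right_noise_def left_noise_def window_def fun_eq_iff)
      then show ?thesis using False kM by (simp add: F_def R_def)
    qed
  qed
  finally show ?thesis unfolding sum_model_def using C_law prob_space_axioms by auto
qed

end

section \<open>Tails of the maximum and of the model sum\<close>

lemma window_max_nonneg: "0 \<le> \<kappa> \<Longrightarrow> 0 \<le> window_max 1 \<kappa> d n w"
  using window_side_ge[of 0 n d "fst w" 1 \<kappa> "snd w"] pert_nonneg[of \<kappa> d n "fst w" "snd w" 0]
  by (auto simp: window_max_def le_max_iff_disj)

lemma window_max_mono: "0 \<le> \<kappa> \<Longrightarrow> window_max (-1) \<kappa> d n w \<le> window_max 1 \<kappa> d n w"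
proof -
  assume \<kappa>: "0 \<le> \<kappa>"
  have "window_side (-1) \<kappa> d n x z \<le> window_side 1 \<kappa> d n x z" for x z
  proof -
    obtain j where j: "j \<le> n" "window_side (-1) \<kappa> d n x z = walk d x j + - 1 * pert \<kappa> d n x z j" by (rule window_side_attained)
    then show ?thesis using window_side_ge[OF j(1), of d x 1 \<kappa> z] pert_nonneg[OF \<kappa>, of d n x z j] by simp
  qed
  then show ?thesis unfolding window_max_def by (intro max.mono)
qed

text \<open>
  By Spitzer's formula with the geometric bound for the probabilities of positive values.
\<close>
lemma nu_lower:
  assumes "0 < c" "c \<le> d" "d \<le> c2"
  shows "2 * exp (- 2 / (1 - exp (- c\<^sup>2 / 8))) / c2\<^sup>2 \<le> nu d"
proof -
  let ?q = "exp (- c\<^sup>2 / 8)"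
  have d: "0 < d" using assms by simp
  have q: "0 < ?q" "?q < 1" using assms by auto
  have le: "measure noise {z. walk d z (Suc n) > 0} / real (Suc n) \<le> ?q ^ n" for n
  proof -
    have "measure noise {z. walk d z (Suc n) > 0} / real (Suc n) \<le> measure noise {z. walk d z (Suc n) > 0} / 1"
      by (intro divide_left_mono) auto
    also have "\<dots> \<le> exp (- d\<^sup>2 / 8) ^ Suc n" using measure_walk_pos_le[of d "Suc n"] by simp
    also have "\<dots> \<le> ?q ^ Suc n" using assms by (intro power_mono) (auto intro!: power_mono)
    also have "\<dots> \<le> ?q ^ n" using q by (simp add: mult_left_le_one_le)
    finally show ?thesis .
  qed
  have "(\<Sum>n. measure noise {z. walk d z (Suc n) > 0} / real (Suc n)) \<le> (\<Sum>n. ?q ^ n)"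
    using d q stay_prob_formula(1)[of d] by (intro suminf_le le summable_geometric) auto
  also have "\<dots> = 1 / (1 - ?q)" using q by (simp add: suminf_geometric)
  finally have "exp (- (1 / (1 - ?q))) \<le> stay_prob d" using stay_prob_formula(2)[of d] d by simp
  then have "(exp (- (1 / (1 - ?q))))\<^sup>2 \<le> (stay_prob d)\<^sup>2" by (intro power_mono) auto
  then have "2 * exp (- 2 / (1 - ?q)) \<le> 2 * (stay_prob d)\<^sup>2"
    by (simp add: exp_double[symmetric])
  then show ?thesis unfolding nu_eq_stay_prob[OF d] using assms by (intro frac_le power_mono) auto
qed

lemma measure_tail_le_texp:
  assumes "real_distribution \<alpha>" shows "measure \<alpha> {b<..} \<le> exp (- b) * texp \<alpha> b"
proof -
  interpret real_distribution \<alpha> by fact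
  have i: "integrable \<alpha> (\<lambda>x. exp b * indicator {b<..} x)"
    by (intro integrable_mult_right integrable_real_indicator) (auto simp: emeasure_eq_measure)
  have "(\<integral>x. exp b * indicator {b<..} x \<partial>\<alpha>) \<le> texp \<alpha> b"
    unfolding texp_def by (intro integral_mono i texp_integrable assms) (auto simp: indicator_def)
  then have "exp b * measure \<alpha> {b<..} \<le> texp \<alpha> b" by simp
  then show ?thesis by (simp add: exp_minus field_simps)
qed

context window_model
begin

abbreviation U where "U t \<omega> \<equiv> U_stat M X t \<tau> \<mu> \<omega>"

lemma S_eq: "ws.S \<omega> = (\<lambda>i. \<Sum>j=1..i. X j \<omega>)"
  by (simp add: ws.S_def fun_eq_iff)

lemma C_eq: "C \<omega> = (\<Sum>k=1..Suc M. (core_sum M \<tau> \<mu> n (ws.S \<omega>) k)\<^sup>2 / core_length M \<tau> n k)"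
  by (simp only: C_def S_eq)

lemma finite_nearby: "finite (nearby_splits M m \<tau> n)"
proof -
  have "finite ({0..Suc M} \<rightarrow>\<^sub>E {0..m})" by (intro finite_PiE) auto
  then show ?thesis by (rule finite_subset[rotated]) (auto simp: nearby_splits_def)
qed

lemma nearby_nonempty: "nearby_splits M m \<tau> n \<noteq> {}"
proof -
  have "restrict \<tau> {0..Suc M} \<in> nearby_splits M m \<tau> n"
    using sp by (intro ws.nearby_splitsI) (auto simp: split_points_def)
  then show ?thesis by auto
qed

lemma partial_sum_measurable': "i \<le> m \<Longrightarrow> partial_sum X i \<in> borel_measurable P"
  unfolding partial_sum_def[abs_def] using X_measurable by (intro borel_measurable_sum) auto

lemma U_measurable:
  assumes t: "t \<in> nearby_splits M m \<tau> n" shows "U t \<in> borel_measurable P"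
proof -
  have t1: "partial_sum X (t k) \<in> borel_measurable P" if "k \<le> Suc M" for k
    using t that by (intro partial_sum_measurable') (auto simp: nearby_splits_def PiE_iff)
  have t2: "partial_sum X (\<tau> k) \<in> borel_measurable P" if "k \<le> Suc M" for k
    using ws.\<tau>_le_m[OF that] by (intro partial_sum_measurable') auto
  show ?thesis unfolding U_stat_def[abs_def]
    by (intro borel_measurable_diff borel_measurable_sum borel_measurable_divide borel_measurable_power borel_measurable_times
        borel_measurable_const t1 t2) auto
qed

abbreviation max_event :: "real \<Rightarrow> 'a set" where
  "max_event a \<equiv> {\<omega> \<in> space P. Max ((\<lambda>t. U t \<omega>) ` nearby_splits M m \<tau> n) > a}"

lemma max_event_sets: "max_event a \<in> sets P"
proof -
  have "(\<lambda>\<omega>. Max ((\<lambda>t. U t \<omega>) ` nearby_splits M m \<tau> n)) \<in> borel_measurable P"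
    by (intro borel_measurable_Max finite_nearby U_measurable)
  then show ?thesis by measurable
qed

text \<open>
  The window maximum with negative perturbation may be negative, whereas the comparison of
  truncated moments needs nonnegative summands.
\<close>
definition Y :: "real \<Rightarrow> (nat \<Rightarrow> real) \<Rightarrow> nat \<Rightarrow> 'a \<Rightarrow> real" where
  "Y \<sigma> \<kappa> k \<omega> = max 0 (R \<sigma> (\<kappa> k) k \<omega>)"

lemma Y_model: "sum_model M P (Y \<sigma> \<kappa>) C"
  unfolding Y_def[abs_def] by (rule sum_model_windows)

lemma sum_event_sets:
  assumes "sum_model M P Z C" shows "{\<omega> \<in> space P. (\<Sum>k=1..M. Z k \<omega>) + C \<omega> / 2 > b} \<in> sets P"
  using partial_sum_measurable[OF assms order_refl] sum_model_measurable(2)[OF assms] by measurable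

lemma C_event_sets: "{\<omega> \<in> space P. C \<omega> / 2 > b} \<in> sets P"
  using sum_model_measurable(2)[OF Y_model] by measurable

context
  fixes \<eta> a :: real and \<kappa> :: "nat \<Rightarrow> real"
  assumes \<eta>: "0 < \<eta>" and a: "\<eta> < a"
    and \<kappa>: "\<And>k. k \<in> {1..M} \<Longrightarrow> (1 + 1 / (\<eta> / a)) / core_length M \<tau> n k \<le> \<kappa> k"
      "\<And>k. k \<in> {1..M} \<Longrightarrow> (1 + 1 / (\<eta> / a)) / core_length M \<tau> n (Suc k) \<le> \<kappa> k"
begin

text \<open>
  Unless half the chi-squared variable exceeds \<open>2 * a\<close>, its relative error
  \<open>\<eta> / a\<close> costs at most \<open>2 * \<eta>\<close>.
\<close>
lemma tail_upper:
  "measure P (max_event a) \<le> measure P {\<omega> \<in> space P. (\<Sum>k=1..M. Y 1 \<kappa> k \<omega>) + C \<omega> / 2 > a - 2 * \<eta>}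
    + measure P {\<omega> \<in> space P. C \<omega> / 2 > 2 * a}" (is "_ \<le> measure P ?A + measure P ?B")
proof -
  have sub: "max_event a \<subseteq> ?A \<union> ?B"
  proof
    fix \<omega> assume \<omega>: "\<omega> \<in> max_event a"
    have "Max ((\<lambda>t. U t \<omega>) ` nearby_splits M m \<tau> n) \<in> (\<lambda>t. U t \<omega>) ` nearby_splits M m \<tau> n"
      using finite_nearby nearby_nonempty by (intro Max_in) auto
    then obtain t where t: "t \<in> nearby_splits M m \<tau> n" "U t \<omega> > a" using \<omega> by auto
    have "U t \<omega> \<le> (\<Sum>k=1..M. R 1 (\<kappa> k) k \<omega>) + (1 + \<eta> / a) * (C \<omega> / 2)"
      unfolding R_def C_eq using \<eta> a by (intro ws.U_upper[where \<omega>=\<omega>] refl t \<kappa>) auto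
    also have "(\<Sum>k=1..M. R 1 (\<kappa> k) k \<omega>) \<le> (\<Sum>k=1..M. Y 1 \<kappa> k \<omega>)"
      by (intro sum_mono) (simp add: Y_def)
    finally have U: "U t \<omega> \<le> (\<Sum>k=1..M. Y 1 \<kappa> k \<omega>) + (C \<omega> / 2 + \<eta> / a * (C \<omega> / 2))"
      by (simp only: distrib_right mult_1_left)
    show "\<omega> \<in> ?A \<union> ?B"
    proof (cases "C \<omega> / 2 > 2 * a")
      case False
      then have "\<eta> / a * (C \<omega> / 2) \<le> \<eta> / a * (2 * a)" using \<eta> a by (intro mult_left_mono) auto
      also have "\<dots> = 2 * \<eta>" using \<eta> a by simp
      finally show ?thesis using U t \<omega> by auto
    qed (use \<omega> in auto)
  qed
  have "measure P (max_event a) \<le> measure P (?A \<union> ?B)"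
    by (rule finite_measure_mono[OF sub sets.Un[OF sum_event_sets[OF Y_model] C_event_sets]])
  also have "\<dots> \<le> measure P ?A + measure P ?B"
    by (rule measure_Un_le[OF sum_event_sets[OF Y_model] C_event_sets])
  finally show ?thesis .
qed

text \<open>
  Replacing a negative window maximum by zero is an error only on an event on which the sum
  without that summand is large; these events are subtracted.
\<close>
lemma tail_lower:
  assumes short: "\<And>k. k \<in> {1..Suc M} \<Longrightarrow> 2 * real (window_width M n k) + 2 * real (window_width M n (k - 1)) \<le> \<eta> / a * core_length M \<tau> n k"
  shows "measure P {\<omega> \<in> space P. (\<Sum>k=1..M. Y (-1) \<kappa> k \<omega>) + C \<omega> / 2 > a + 4 * \<eta>}
    \<le> measure P (max_event a) + (\<Sum>k=1..M. measure P {\<omega> \<in> space P. (\<Sum>i=1..M. ((Y (-1) \<kappa>)(k := \<lambda>_. 0)) i \<omega>) + C \<omega> / 2 > a + 4 * \<eta>})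
      + measure P {\<omega> \<in> space P. C \<omega> / 2 > 2 * a}" (is "measure P ?A \<le> _ + (\<Sum>k=1..M. measure P (?D k)) + measure P ?B")
proof -
  have \<delta>: "0 < \<eta> / a" "\<eta> / a < 1" using \<eta> a by auto
  have D: "?D k \<in> sets P" if "k \<in> {1..M}" for k
    by (rule sum_event_sets[OF sum_model_zero[OF Y_model that]])
  have DU: "(\<Union>k\<in>{1..M}. ?D k) \<in> sets P" using D by (rule sets.finite_UN[OF finite_atLeastAtMost])
  have sub: "?A \<subseteq> max_event a \<union> (\<Union>k\<in>{1..M}. ?D k) \<union> ?B"
  proof
    fix \<omega> assume \<omega>: "\<omega> \<in> ?A"
    show "\<omega> \<in> max_event a \<union> (\<Union>k\<in>{1..M}. ?D k) \<union> ?B"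
    proof (cases "C \<omega> / 2 > 2 * a")
      case C: False
      show ?thesis
      proof (cases "\<exists>k\<in>{1..M}. R (-1) (\<kappa> k) k \<omega> < 0")
        case True
        then obtain k where k: "k \<in> {1..M}" "R (-1) (\<kappa> k) k \<omega> < 0" by auto
        have "(\<Sum>i=1..M. ((Y (-1) \<kappa>)(k := \<lambda>_. 0)) i \<omega>) = (\<Sum>i=1..M. Y (-1) \<kappa> i \<omega>)"
          using k by (intro sum.cong) (auto simp: Y_def)
        then have "\<omega> \<in> ?D k" using \<omega> by simp
        then show ?thesis using k by blast
      next
        case False
        then have eq: "(\<Sum>k=1..M. Y (-1) \<kappa> k \<omega>) = (\<Sum>k=1..M. R (-1) (\<kappa> k) k \<omega>)"
          by (intro sum.cong) (auto simp: Y_def not_less max_def)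
        obtain t where t: "t \<in> nearby_splits M m \<tau> n"
          "(\<Sum>k=1..M. R (-1) (\<kappa> k) k \<omega>) + (1 - 2 * (\<eta> / a)) * (C \<omega> / 2) \<le> U t \<omega>"
          unfolding R_def C_eq
          by (rule ws.U_lower[where \<omega>=\<omega> and X=X and \<delta>="\<eta> / a" and \<kappa>=\<kappa>, OF refl \<delta> \<kappa> short]) blast+
        have "\<eta> / a * (C \<omega> / 2) \<le> \<eta> / a * (2 * a)" using \<eta> a C by (intro mult_left_mono) auto
        also have "\<dots> = 2 * \<eta>" using \<eta> a by simp
        finally have e: "\<eta> / a * (C \<omega> / 2) \<le> 2 * \<eta>" .
        have "(1 - 2 * (\<eta> / a)) * (C \<omega> / 2) = C \<omega> / 2 - 2 * (\<eta> / a * (C \<omega> / 2))"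
          by (simp only: left_diff_distrib mult_1_left mult.assoc)
        moreover have "a + 4 * \<eta> < (\<Sum>k=1..M. Y (-1) \<kappa> k \<omega>) + C \<omega> / 2" using \<omega> by simp
        ultimately have "U t \<omega> > a" using t(2) e unfolding eq by linarith
        moreover have "U t \<omega> \<le> Max ((\<lambda>t. U t \<omega>) ` nearby_splits M m \<tau> n)"
          using finite_nearby t by (intro Max_ge) auto
        ultimately show ?thesis using \<omega> by auto
      qed
    qed (use \<omega> in auto)
  qed
  have "measure P ?A \<le> measure P (max_event a \<union> (\<Union>k\<in>{1..M}. ?D k) \<union> ?B)"
    by (rule finite_measure_mono[OF sub sets.Un[OF sets.Un[OF max_event_sets DU] C_event_sets]])
  also have "\<dots> \<le> measure P (max_event a \<union> (\<Union>k\<in>{1..M}. ?D k)) + measure P ?B"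
    by (rule measure_Un_le[OF sets.Un[OF max_event_sets DU] C_event_sets])
  also have "measure P (max_event a \<union> (\<Union>k\<in>{1..M}. ?D k)) \<le> measure P (max_event a) + measure P (\<Union>k\<in>{1..M}. ?D k)"
    by (rule measure_Un_le[OF max_event_sets DU])
  also have "measure P (\<Union>k\<in>{1..M}. ?D k) \<le> (\<Sum>k=1..M. measure P (?D k))"
    by (rule measure_UNION_le[OF finite_atLeastAtMost D])
  finally show ?thesis by simp
qed

end

lemma C_tail: "measure P {\<omega> \<in> space P. C \<omega> / 2 > b} \<le> exp (- b) * texp (half_chi (Suc M)) b"
proof -
  have mC: "C \<in> borel_measurable P" using sum_model_measurable(2)[OF Y_model] .
  have "half_chi (Suc M) = distr (distr P borel C) borel (\<lambda>x. x / 2)" by (simp add: half_chi_def C_law)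
  also have "\<dots> = distr P borel (\<lambda>\<omega>. C \<omega> / 2)" using mC by (simp add: distr_distr comp_def)
  finally have "measure (half_chi (Suc M)) {b<..} = measure P {\<omega> \<in> space P. C \<omega> / 2 > b}"
    using mC by (auto simp: measure_distr intro!: arg_cong2[where f=measure])
  then show ?thesis using measure_tail_le_texp[of "half_chi (Suc M)" b] nonneg_law_half_chi by simp
qed

lemma R_measurable:
  assumes k: "k \<in> {1..M}" shows "R \<sigma> \<kappa>' k \<in> borel_measurable P"
proof -
  note w = window_inside[OF k]
  have r: "(\<lambda>\<omega>. right_noise \<tau> \<mu> n (\<lambda>i. X i \<omega>) k) \<in> P \<rightarrow>\<^sub>M noise"
  proof (rule measurable_into_noise)
    fix i show "(\<lambda>\<omega>. right_noise \<tau> \<mu> n (\<lambda>i. X i \<omega>) k i) \<in> borel_measurable P"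
      using X_measurable[of "\<tau> k + 1 + i"] w by (cases "i < n k") (auto simp: right_noise_def)
  qed
  have l: "(\<lambda>\<omega>. left_noise \<tau> \<mu> n (\<lambda>i. X i \<omega>) k) \<in> P \<rightarrow>\<^sub>M noise"
  proof (rule measurable_into_noise)
    fix i show "(\<lambda>\<omega>. left_noise \<tau> \<mu> n (\<lambda>i. X i \<omega>) k i) \<in> borel_measurable P"
    proof (cases "i < n k")
      case True
      then have "\<tau> k - i \<in> {1..m}" using w by auto
      from X_measurable[OF this] show ?thesis using True by (simp add: left_noise_def)
    qed (simp add: left_noise_def)
  qed
  have "(\<lambda>\<omega>. (right_noise \<tau> \<mu> n (\<lambda>i. X i \<omega>) k, left_noise \<tau> \<mu> n (\<lambda>i. X i \<omega>) k)) \<in> P \<rightarrow>\<^sub>M noise2"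
    using r l by measurable
  from measurable_compose[OF this window_max_measurable] show ?thesis by (simp add: R_def[abs_def])
qed

lemma texp_Y:
  assumes k: "k \<in> {1..M}"
  shows "texp (law P (Y \<sigma> \<kappa> k)) A = (\<integral>w. exp (min (max 0 (window_max \<sigma> (\<kappa> k) \<bar>jump \<mu> k\<bar> (n k) w)) A) \<partial>noise2)"
proof -
  have mY: "Y \<sigma> \<kappa> k \<in> borel_measurable P" by (rule sum_model_measurable(1)[OF Y_model k])
  note mR = R_measurable[OF k, of \<sigma> "\<kappa> k"]
  have "texp (law P (Y \<sigma> \<kappa> k)) A = (\<integral>\<omega>. exp (min (max 0 (R \<sigma> (\<kappa> k) k \<omega>)) A) \<partial>P)"
    unfolding texp_def using mY by (subst integral_distr) (auto simp: Y_def)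
  also have "\<dots> = (\<integral>x. exp (min (max 0 x) A) \<partial>distr P borel (R \<sigma> (\<kappa> k) k))"
    using mR by (subst integral_distr) auto
  also have "\<dots> = (\<integral>w. exp (min (max 0 (window_max \<sigma> (\<kappa> k) \<bar>jump \<mu> k\<bar> (n k) w)) A) \<partial>noise2)"
    unfolding R_law[OF k] by (subst integral_distr) auto
  finally show ?thesis .
qed

text \<open>
  All tails are \<open>exp (- a)\<close> times truncated moments. Shifting the level by
  \<open>h\<close> costs a factor \<open>exp h\<close>, and since truncated moments are at least
  one, the terms of size \<open>\<eta> * exp (- a)\<close> are bounded by \<open>\<eta>\<close>
  times the limit probability.
\<close>
lemma tail_comparison:
  fixes Q :: "'b measure"
  assumes M: "M = Suc d" and \<eta>: "0 < \<eta>" "\<eta> < a"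
    and \<kappa>: "\<And>k. k \<in> {1..M} \<Longrightarrow> (1 + 1 / (\<eta> / a)) / core_length M \<tau> n k \<le> \<kappa> k"
      "\<And>k. k \<in> {1..M} \<Longrightarrow> (1 + 1 / (\<eta> / a)) / core_length M \<tau> n (Suc k) \<le> \<kappa> k"
    and short: "\<And>k. k \<in> {1..Suc M} \<Longrightarrow> 2 * real (window_width M n k) + 2 * real (window_width M n (k - 1)) \<le> \<eta> / a * core_length M \<tau> n k"
    and Q: "sum_model M Q W C'"
    and upper: "\<bar>total_texp d P (Y 1 \<kappa>) a - total_texp d Q W a\<bar> \<le> \<theta> * total_texp d Q W a"
    and lower: "\<bar>total_texp d P (Y (-1) \<kappa>) a - total_texp d Q W a\<bar> \<le> \<theta> * total_texp d Q W a"
    and zero: "\<And>k. k \<in> {1..M} \<Longrightarrow> total_texp d P ((Y (-1) \<kappa>)(k := \<lambda>_. 0)) a \<le> \<theta> * total_texp d Q W a"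
    and C_small: "exp (- (2 * a)) * texp (half_chi (Suc M)) (2 * a) \<le> \<eta> * exp (- a)"
  defines "q \<equiv> measure Q {\<omega> \<in> space Q. (\<Sum>k=1..M. W k \<omega>) + C' \<omega> / 2 > a}"
  shows "measure P (max_event a) \<le> (exp (2 * \<eta>) * (1 + \<theta>) + \<eta>) * q"
    and "(exp (- (4 * \<eta>)) * (1 - \<theta>) - real M * \<theta> - \<eta>) * q \<le> measure P (max_event a)"
proof -
  let ?T = "total_texp d Q W a"
  have tail: "measure P {\<omega> \<in> space P. (\<Sum>k=1..M. Z k \<omega>) + D \<omega> / 2 > b} = exp (- b) * total_texp d P Z b"
    if "sum_model M P Z D" for Z D b
    using sum_model_tail[of d P Z D b] that unfolding M total_texp_def by simp
  have shift: "total_texp d P Z (b + h) \<le> exp h * total_texp d P Z b" "total_texp d P Z b \<le> total_texp d P Z (b + h)"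
    if "sum_model M P Z D" "0 \<le> h" for Z D b h
    using total_law[of d P Z D] that texp_add_le[of "partial_law P Z (Suc d) \<star> half_chi d" h b]
      texp_mono[of "partial_law P Z (Suc d) \<star> half_chi d" b "b + h"] unfolding M total_texp_def by auto
  have q: "q = exp (- a) * ?T"
  proof -
    have "sum_model (Suc d) Q W C'" using Q M by simp
    from sum_model_tail[OF this, of a] show ?thesis unfolding q_def M total_texp_def by simp
  qed
  have T: "1 \<le> ?T"
    using total_law[of d Q W C'] Q \<eta> unfolding M total_texp_def by (intro texp_ge_1) auto
  have small: "measure P {\<omega> \<in> space P. C \<omega> / 2 > 2 * a} \<le> \<eta> * q"
  proof -
    have "measure P {\<omega> \<in> space P. C \<omega> / 2 > 2 * a} \<le> \<eta> * exp (- a)"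
      using C_tail[of "2 * a"] C_small by simp
    also have "\<dots> \<le> \<eta> * q" unfolding q using T \<eta> by (intro mult_left_mono) auto
    finally show ?thesis .
  qed
  have "measure P {\<omega> \<in> space P. (\<Sum>k=1..M. Y 1 \<kappa> k \<omega>) + C \<omega> / 2 > a - 2 * \<eta>} \<le> exp (2 * \<eta>) * (1 + \<theta>) * q"
  proof -
    have "total_texp d P (Y 1 \<kappa>) (a - 2 * \<eta>) \<le> (1 + \<theta>) * ?T"
      using shift(2)[OF Y_model, of "2 * \<eta>" 1 \<kappa> "a - 2 * \<eta>"] upper \<eta> by (simp add: distrib_right)
    then have "exp (- (a - 2 * \<eta>)) * total_texp d P (Y 1 \<kappa>) (a - 2 * \<eta>) \<le> exp (- (a - 2 * \<eta>)) * ((1 + \<theta>) * ?T)"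
      by (intro mult_left_mono) auto
    also have "\<dots> = exp (2 * \<eta>) * (1 + \<theta>) * q"
      by (simp only: q minus_diff_eq exp_diff exp_minus) (simp add: divide_inverse)
    finally show ?thesis unfolding tail[OF Y_model] .
  qed
  then show "measure P (max_event a) \<le> (exp (2 * \<eta>) * (1 + \<theta>) + \<eta>) * q"
    using tail_upper[OF \<eta> \<kappa>] small by (simp add: distrib_right)
  have low: "exp (- (4 * \<eta>)) * (1 - \<theta>) * q \<le> measure P {\<omega> \<in> space P. (\<Sum>k=1..M. Y (-1) \<kappa> k \<omega>) + C \<omega> / 2 > a + 4 * \<eta>}"
  proof -
    have "(1 - \<theta>) * ?T \<le> total_texp d P (Y (-1) \<kappa>) (a + 4 * \<eta>)"
      using shift(2)[OF Y_model, of "4 * \<eta>" "-1" \<kappa> a] lower \<eta> by (simp add: left_diff_distrib)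
    then have "exp (- (a + 4 * \<eta>)) * ((1 - \<theta>) * ?T) \<le> exp (- (a + 4 * \<eta>)) * total_texp d P (Y (-1) \<kappa>) (a + 4 * \<eta>)"
      by (intro mult_left_mono) auto
    moreover have "exp (- (4 * \<eta>)) * (1 - \<theta>) * q = exp (- (a + 4 * \<eta>)) * ((1 - \<theta>) * ?T)"
      by (simp only: q minus_add_distrib exp_add mult_ac)
    ultimately show ?thesis unfolding tail[OF Y_model] by (simp only:)
  qed
  have "measure P {\<omega> \<in> space P. (\<Sum>i=1..M. ((Y (-1) \<kappa>)(k := \<lambda>_. 0)) i \<omega>) + C \<omega> / 2 > a + 4 * \<eta>} \<le> \<theta> * q"
    if k: "k \<in> {1..M}" for k
  proof -
    note mz = sum_model_zero[OF Y_model[of "-1" \<kappa>] k]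
    have "exp (- (a + 4 * \<eta>)) * total_texp d P ((Y (-1) \<kappa>)(k := \<lambda>_. 0)) (a + 4 * \<eta>)
       \<le> exp (- (a + 4 * \<eta>)) * (exp (4 * \<eta>) * (\<theta> * ?T))"
      using shift(1)[OF mz, of "4 * \<eta>" a] zero[OF k] \<eta>
      by (intro mult_left_mono order_trans[OF shift(1)[OF mz]] zero[OF k]) auto
    also have "\<dots> = (exp (- (4 * \<eta>)) * exp (4 * \<eta>)) * (\<theta> * q)"
      by (simp only: q minus_add_distrib exp_add mult_ac)
    also have "\<dots> = \<theta> * q" by (simp add: exp_minus)
    finally show ?thesis unfolding tail[OF mz] .
  qed
  then have "(\<Sum>k=1..M. measure P {\<omega> \<in> space P. (\<Sum>i=1..M. ((Y (-1) \<kappa>)(k := \<lambda>_. 0)) i \<omega>) + C \<omega> / 2 > a + 4 * \<eta>}) \<le> (\<Sum>k=1..M. \<theta> * q)"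
    by (rule sum_mono)
  also have "\<dots> = real M * \<theta> * q" by simp
  finally show "(exp (- (4 * \<eta>)) * (1 - \<theta>) - real M * \<theta> - \<eta>) * q \<le> measure P (max_event a)"
    using tail_lower[OF \<eta> \<kappa> short] low small by (simp add: left_diff_distrib)
qed

end

section \<open>Asymptotic equivalence\<close>

lemma limit_model_sum_model: "limit_model M \<mu> Q W C \<Longrightarrow> sum_model M Q W C"
  by (simp add: limit_model_def sum_model_def)

lemma limit_model_texp:
  assumes lm: "limit_model M \<mu> Q W C" and k: "k \<in> {1..M}" and "0 \<le> A"
  shows "texp (law Q (W k)) A = 1 + 2 * nu \<bar>jump \<mu> k\<bar> * A - (nu \<bar>jump \<mu> k\<bar>)\<^sup>2 * (1 - exp (- A))"
proof (rule texp_limit_law)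
  show "W k \<in> borel_measurable Q"
    by (rule sum_model_measurable(1)[OF limit_model_sum_model[OF lm] k])
qed (use assms in \<open>auto simp: limit_model_def\<close>)

text \<open>
  Only the linear term in \<open>A\<close> matters on the scale of the comparison.
\<close>
lemma limit_model_texp_bounds:
  assumes lm: "limit_model M \<mu> Q W C" and k: "k \<in> {1..M}" and A: "0 \<le> A" and c: "0 < c" "c \<le> \<bar>jump \<mu> k\<bar>"
  shows "\<bar>texp (law Q (W k)) A - 2 * nu \<bar>jump \<mu> k\<bar> * A\<bar> \<le> 1 + (2 / c\<^sup>2)\<^sup>2"
    and "texp (law Q (W k)) A \<le> 1 + 4 / c\<^sup>2 * A"
proof -
  let ?v = "nu \<bar>jump \<mu> k\<bar>"
  note v = nu_bounds[OF c]
  have "?v\<^sup>2 * (1 - exp (- A)) \<le> ?v\<^sup>2 * 1" "0 \<le> ?v\<^sup>2 * (1 - exp (- A))"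
    using A by (intro mult_left_mono mult_nonneg_nonneg; simp)+
  moreover have "?v\<^sup>2 \<le> (2 / c\<^sup>2)\<^sup>2" using v by (intro power_mono) auto
  moreover have "?v * A \<le> 2 / c\<^sup>2 * A" using v A by (intro mult_right_mono) auto
  ultimately show "\<bar>texp (law Q (W k)) A - 2 * ?v * A\<bar> \<le> 1 + (2 / c\<^sup>2)\<^sup>2"
    "texp (law Q (W k)) A \<le> 1 + 4 / c\<^sup>2 * A"
    unfolding limit_model_texp[OF lm k A] by auto
qed

context window_model
begin

lemma texp_Y_upper:
  "k \<in> {1..M} \<Longrightarrow> 0 \<le> \<kappa> k \<Longrightarrow> texp (law P (Y 1 \<kappa> k)) A = (\<integral>w. exp (min (window_max 1 (\<kappa> k) \<bar>jump \<mu> k\<bar> (n k) w) A) \<partial>noise2)"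
  by (simp add: texp_Y max_absorb2[OF window_max_nonneg])

lemma texp_Y_le:
  assumes k: "k \<in> {1..M}" and "0 \<le> \<kappa> k"
  shows "texp (law P (Y (-1) \<kappa> k)) A \<le> texp (law P (Y 1 \<kappa> k)) A"
  unfolding texp_Y[OF k]
proof (rule integral_mono)
  show "exp (min (max 0 (window_max (-1) (\<kappa> k) \<bar>jump \<mu> k\<bar> (n k) w)) A) \<le> exp (min (max 0 (window_max 1 (\<kappa> k) \<bar>jump \<mu> k\<bar> (n k) w)) A)" for w
    using window_max_mono[OF assms(2), of "\<bar>jump \<mu> k\<bar>" "n k" w] by (auto simp: min_def max_def)
qed (auto intro!: noise2.integrable_const_bound[where B="exp A"])

end

lemma small_tolerance:
  fixes \<epsilon> :: real assumes "0 < \<epsilon>"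
  obtains \<eta> where "0 < \<eta>" "\<eta> < 1" "exp (2 * \<eta>) * (1 + \<eta>) + \<eta> \<le> 1 + \<epsilon>"
    "1 - \<epsilon> \<le> exp (- (4 * \<eta>)) * (1 - \<eta>) - N * \<eta> - \<eta>"
proof -
  have "((\<lambda>\<eta>::real. exp (2 * \<eta>) * (1 + \<eta>) + \<eta>) \<longlongrightarrow> exp (2 * 0) * (1 + 0) + 0) (at_right 0)"
    by (intro tendsto_intros)
  then have 1: "\<forall>\<^sub>F \<eta> in at_right 0. exp (2 * \<eta>) * (1 + \<eta>) + \<eta> < 1 + \<epsilon>"
    by (rule order_tendstoD(2)) (use assms in simp)
  have "((\<lambda>\<eta>::real. exp (- (4 * \<eta>)) * (1 - \<eta>) - N * \<eta> - \<eta>) \<longlongrightarrow> exp (- (4 * 0)) * (1 - 0) - N * 0 - 0) (at_right 0)"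
    by (intro tendsto_intros)
  then have 2: "\<forall>\<^sub>F \<eta> in at_right 0. 1 - \<epsilon> < exp (- (4 * \<eta>)) * (1 - \<eta>) - N * \<eta> - \<eta>"
    by (rule order_tendstoD(1)) (use assms in simp)
  have "\<forall>\<^sub>F \<eta>::real in at_right 0. \<eta> \<in> {0<..<1}" by (rule eventually_at_right_real) simp
  from eventually_conj[OF this eventually_conj[OF 1 2]] obtain \<eta> where
    "\<eta> \<in> {0<..<1} \<and> exp (2 * \<eta>) * (1 + \<eta>) + \<eta> < 1 + \<epsilon> \<and> 1 - \<epsilon> < exp (- (4 * \<eta>)) * (1 - \<eta>) - N * \<eta> - \<eta>"
    by (auto dest!: eventually_happens simp: trivial_limit_at_right_real)
  then show ?thesis using that[of \<eta>] by auto
qed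

text \<open>
  The truncated moment grows polynomially.
\<close>
lemma chi_tail_negligible:
  assumes "0 < \<eta>"
  shows "\<forall>\<^sub>F a in at_top. exp (- (2 * a)) * texp (half_chi d) (2 * a) \<le> \<eta> * exp (- a)"
proof -
  have "((\<lambda>a::real. (8 * a) ^ d / exp a) \<longlongrightarrow> 0) at_top"
  proof -
    have "((\<lambda>a::real. 8 ^ d * (a ^ d / exp a)) \<longlongrightarrow> 8 ^ d * 0) at_top"
      by (rule tendsto_mult_left[OF tendsto_power_div_exp_0])
    then show ?thesis by (simp add: power_mult_distrib)
  qed
  then have "\<forall>\<^sub>F a::real in at_top. (8 * a) ^ d / exp a < \<eta>"
    by (rule order_tendstoD(2)) (rule assms)
  then show ?thesis using eventually_ge_at_top[of 1]
  proof eventually_elim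
    fix a :: real assume a: "(8 * a) ^ d / exp a < \<eta>" "1 \<le> a"
    have "sqrt (2 * a) \<le> 2 * a" using a by (intro real_le_lsqrt) (auto simp: power2_eq_square)
    then have "(4 * sqrt (2 * a)) ^ d \<le> (8 * a) ^ d" using a by (intro power_mono) auto
    moreover have "texp (half_chi d) (2 * a) \<le> (4 * sqrt (2 * a)) ^ d" using a by (intro texp_half_chi_le) simp
    ultimately have "texp (half_chi d) (2 * a) \<le> \<eta> * exp a" using a by (simp add: field_simps)
    then have "exp (- (2 * a)) * texp (half_chi d) (2 * a) \<le> exp (- (2 * a)) * (\<eta> * exp a)" by (intro mult_left_mono) auto
    also have "\<dots> = \<eta> * exp (- a)" by (simp add: exp_add[symmetric])
    finally show "exp (- (2 * a)) * texp (half_chi d) (2 * a) \<le> \<eta> * exp (- a)" .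
  qed
qed

text \<open>
  Here \<open>L\<close> is the length of a segment, and \<open>w\<close>, \<open>v\<close> are the
  radii of the windows that reach into it. Both are at most a small multiple of \<open>L /
  a\<close>, so the core keeps at least half of the segment.
\<close>
lemma segment_parameters:
  fixes a L w v \<eta> e :: real
  assumes a: "1 \<le> a" and \<eta>: "0 < \<eta>" "\<eta> < 1" and e: "0 < e"
    and L: "0 < L" and w: "0 \<le> w" "w * a \<le> min (\<eta> / 8) (e * \<eta> / 4) * L"
    and v: "0 \<le> v" "v * a \<le> min (\<eta> / 8) (e * \<eta> / 4) * L"
  shows "w + v < L" "2 * w + 2 * v \<le> \<eta> / a * (L - w - v)"
    and "0 < w \<Longrightarrow> (1 + 1 / (\<eta> / a)) / (L - w - v) \<le> e / w" "0 < v \<Longrightarrow> (1 + 1 / (\<eta> / a)) / (L - w - v) \<le> e / v"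
proof -
  have r: "x * a \<le> \<eta> * L / 8" "x * a \<le> e * \<eta> * L / 4" if "x * a \<le> min (\<eta> / 8) (e * \<eta> / 4) * L" for x
  proof -
    have "min (\<eta> / 8) (e * \<eta> / 4) * L \<le> \<eta> / 8 * L" "min (\<eta> / 8) (e * \<eta> / 4) * L \<le> e * \<eta> / 4 * L"
      using L by (intro mult_right_mono; simp)+
    from order_trans[OF that this(1)] order_trans[OF that this(2)]
    show "x * a \<le> \<eta> * L / 8" "x * a \<le> e * \<eta> * L / 4" by simp_all
  qed
  have small: "x \<le> L / 8" if "0 \<le> x" "x * a \<le> \<eta> * L / 8" for x
  proof -
    have "x * 1 \<le> x * a" using that a by (intro mult_left_mono) auto
    moreover have "\<eta> * L \<le> 1 * L" using \<eta> L by (intro mult_right_mono) auto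
    ultimately show ?thesis using that by simp
  qed
  note sw = small[OF w(1) r(1)[OF w(2)]] and sv = small[OF v(1) r(1)[OF v(2)]]
  show "w + v < L" using sw sv L by simp
  have l: "L / 2 \<le> L - w - v" using sw sv L by simp
  have "2 * w + 2 * v \<le> \<eta> / a * (L / 2)"
    using r(1)[OF w(2)] r(1)[OF v(2)] a by (simp add: field_simps)
  also have "\<dots> \<le> \<eta> / a * (L - w - v)" using l \<eta> a by (intro mult_left_mono) auto
  finally show "2 * w + 2 * v \<le> \<eta> / a * (L - w - v)" .
  have "(1 + 1 / (\<eta> / a)) / (L - w - v) \<le> e / x" if x: "0 < x" "x * a \<le> e * \<eta> * L / 4" for x
  proof -
    have "1 + 1 / (\<eta> / a) \<le> 2 * a / \<eta>" using a \<eta> by (simp add: field_simps)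
    then have "(1 + 1 / (\<eta> / a)) / (L - w - v) \<le> (2 * a / \<eta>) / (L / 2)"
      using l L a \<eta> by (intro frac_le) auto
    also have "\<dots> \<le> e / x" using x L \<eta> by (simp add: field_simps)
    finally show ?thesis .
  qed
  from this[OF _ r(2)[OF w(2)]] this[OF _ r(2)[OF v(2)]]
  show "0 < w \<Longrightarrow> (1 + 1 / (\<eta> / a)) / (L - w - v) \<le> e / w" "0 < v \<Longrightarrow> (1 + 1 / (\<eta> / a)) / (L - w - v) \<le> e / v" by auto
qed

text \<open>
  The asymptotic hypotheses enter through three constants only: the windows are at least \<open>K
  * a\<close> wide, at most the fraction \<open>\<rho> / a\<close> of the adjacent segments, and
  \<open>a \<ge> a1\<close>. The constants depend on \<open>\<epsilon>\<close>, \<open>M\<close>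
  and the bounds of the jump sizes but not on the model, which allows all data to vary with
  \<open>a\<close>.
\<close>
lemma uniform_comparison:
  fixes \<epsilon> c c2 :: real
  assumes \<epsilon>: "0 < \<epsilon>" and c: "0 < c" "c \<le> c2" and M: "M = Suc d"
  obtains \<rho> K a1 where "0 < \<rho>" "0 < K" "1 \<le> a1"
    "\<And>a m \<tau> \<mu> n (P :: 'a measure) X (Q :: 'b measure) W C.
      a1 \<le> a \<Longrightarrow> split_points M m \<tau> \<Longrightarrow> change_point_model M m \<tau> \<mu> P X \<Longrightarrow> limit_model M \<mu> Q W C \<Longrightarrow>
      (\<And>k. k \<in> {1..M} \<Longrightarrow> c \<le> \<bar>jump \<mu> k\<bar> \<and> \<bar>jump \<mu> k\<bar> \<le> c2) \<Longrightarrow>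
      (\<And>k. k \<in> {1..M} \<Longrightarrow> K * a \<le> real (n k)) \<Longrightarrow>
      (\<And>k. k \<in> {1..M} \<Longrightarrow> real (n k) * a \<le> \<rho> * real (min (seg_length \<tau> k) (seg_length \<tau> (Suc k)))) \<Longrightarrow>
      \<bar>measure P {\<omega> \<in> space P. Max ((\<lambda>t. U_stat M X t \<tau> \<mu> \<omega>) ` nearby_splits M m \<tau> n) > a}
        - measure Q {\<omega> \<in> space Q. (\<Sum>k=1..M. W k \<omega>) + C \<omega> / 2 > a}\<bar>
      \<le> \<epsilon> * measure Q {\<omega> \<in> space Q. (\<Sum>k=1..M. W k \<omega>) + C \<omega> / 2 > a}"
proof -
  obtain \<eta> where \<eta>: "0 < \<eta>" "\<eta> < 1" "exp (2 * \<eta>) * (1 + \<eta>) + \<eta> \<le> 1 + \<epsilon>"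
    "1 - \<epsilon> \<le> exp (- (4 * \<eta>)) * (1 - \<eta>) - real M * \<eta> - \<eta>"
    by (rule small_tolerance[OF \<epsilon>])
  define V where "V = 2 / c\<^sup>2"
  \<comment> \<open>\<open>V\<close> and \<open>v0\<close> bound \<open>\<nu>\<close> from above and below on the range of the jump sizes\<close>
  define v0 where "v0 = 2 * exp (- 2 / (1 - exp (- c\<^sup>2 / 8))) / c2\<^sup>2"
  have V: "0 < V" and v0: "0 < v0" using c by (auto simp: V_def v0_def)
  have M0: "0 < real M" using M by simp
  have K0: "0 < 2 * V + 1" and c0: "0 < v0 / (2 * real M)" using V v0 M0 by auto
  obtain \<zeta> ac where \<zeta>: "0 < \<zeta>" "1 \<le> ac" and comp:
    "\<And>a (P :: 'a measure) Y C (Q :: 'b measure) W C' . ac \<le> a \<Longrightarrow> sum_model (Suc d) P Y C \<Longrightarrow> sum_model (Suc d) Q W C' \<Longrightarrow>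
      (\<And>k A. k \<in> {1..Suc d} \<Longrightarrow> 0 \<le> A \<Longrightarrow> A \<le> a \<Longrightarrow> \<bar>texp (law P (Y k)) A - texp (law Q (W k)) A\<bar> \<le> \<zeta> * a) \<Longrightarrow>
      (\<And>k A. k \<in> {1..Suc d} \<Longrightarrow> 0 \<le> A \<Longrightarrow> A \<le> a \<Longrightarrow> texp (law P (Y k)) A \<le> (2 * V + 1) * a) \<Longrightarrow>
      (\<And>k A. k \<in> {1..Suc d} \<Longrightarrow> 0 \<le> A \<Longrightarrow> A \<le> a \<Longrightarrow> texp (law Q (W k)) A \<le> (2 * V + 1) * a) \<Longrightarrow>
      (\<And>k. k \<in> {1..Suc d} \<Longrightarrow> v0 / (2 * real M) * a \<le> texp (law Q (W k)) (a / (2 * real (Suc d)))) \<Longrightarrow>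
      \<bar>total_texp d P Y a - total_texp d Q W a\<bar> \<le> \<eta> * total_texp d Q W a \<and>
      (\<forall>k\<in>{1..Suc d}. total_texp d P (Y(k := \<lambda>_. 0)) a \<le> \<eta> * total_texp d Q W a)"
    using total_texp_compare[OF K0 c0 \<eta>(1), of d thesis] by blast
  \<comment> \<open>half of the tolerance for the windows, the rest for the bounded terms of the limit law\<close>
  define \<zeta>' where "\<zeta>' = min \<zeta> 1 / 2"
  have \<zeta>': "0 < \<zeta>'" "\<zeta>' \<le> \<zeta> / 2" "\<zeta>' \<le> 1" using \<zeta> by (auto simp: \<zeta>'_def)
  obtain e K aw where e: "0 < e" "0 < K" "1 \<le> aw" and win:
    "\<And>d n \<kappa> a A. c \<le> d \<Longrightarrow> 0 \<le> \<kappa> \<Longrightarrow> \<kappa> * real n \<le> e \<Longrightarrow> aw \<le> a \<Longrightarrow> K * a \<le> real n \<Longrightarrow> 0 \<le> A \<Longrightarrow> A \<le> a \<Longrightarrow>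
       (\<integral>w. exp (min (window_max 1 \<kappa> d n w) A) \<partial>noise2) \<le> 2 * nu d * A + \<zeta>' * a \<and>
       2 * nu d * A - \<zeta>' * a \<le> (\<integral>w. exp (min (max 0 (window_max (-1) \<kappa> d n w)) A) \<partial>noise2)"
    using window_max_texp[OF c(1) \<zeta>'(1), of thesis] by blast
  obtain ah where ah: "\<And>a. ah \<le> a \<Longrightarrow> exp (- (2 * a)) * texp (half_chi (Suc M)) (2 * a) \<le> \<eta> * exp (- a)"
    using chi_tail_negligible[OF \<eta>(1), of "Suc M"] unfolding eventually_at_top_linorder by blast
  define \<rho> where "\<rho> = min (\<eta> / 8) (e * \<eta> / 4)"
  define a1 where "a1 = Max {1, ac, aw, ah, 2 * (1 + V\<^sup>2) / \<zeta>, 2 * real M * V\<^sup>2 / v0}"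
  show ?thesis
  proof (rule that[of \<rho> K a1])
    show "0 < \<rho>" using \<eta> e by (simp add: \<rho>_def)
    show "0 < K" by fact
    show "1 \<le> a1" unfolding a1_def by (intro Max_ge) auto
    fix a m \<tau> \<mu> n X W C and P :: "'a measure" and Q :: "'b measure"
    assume "a1 \<le> a" and sp: "split_points M m \<tau>" and cp: "change_point_model M m \<tau> \<mu> P X"
      and lm: "limit_model M \<mu> Q W C"
      and J: "\<And>k. k \<in> {1..M} \<Longrightarrow> c \<le> \<bar>jump \<mu> k\<bar> \<and> \<bar>jump \<mu> k\<bar> \<le> c2"
      and nK: "\<And>k. k \<in> {1..M} \<Longrightarrow> K * a \<le> real (n k)"
      and nL: "\<And>k. k \<in> {1..M} \<Longrightarrow> real (n k) * a \<le> \<rho> * real (min (seg_length \<tau> k) (seg_length \<tau> (Suc k)))"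
    then have "x \<le> a" if "x \<in> {1, ac, aw, ah, 2 * (1 + V\<^sup>2) / \<zeta>, 2 * real M * V\<^sup>2 / v0}" for x
      using Max_ge[OF _ that] unfolding a1_def by fastforce
    then have a: "1 \<le> a" "ac \<le> a" "aw \<le> a" "ah \<le> a" "2 * (1 + V\<^sup>2) / \<zeta> \<le> a" "2 * real M * V\<^sup>2 / v0 \<le> a" by auto
    let ?w = "\<lambda>k. real (window_width M n k)" and ?L = "\<lambda>k. real (seg_length \<tau> k)"
    have inc: "\<tau> (k - 1) < \<tau> k" if "k \<in> {1..Suc M}" for k
    proof -
      have "k - 1 \<le> M" "Suc (k - 1) = k" using that by auto
      then show ?thesis using sp unfolding split_points_def by metis
    qed
    then have L: "0 < ?L k" "?L k = real (\<tau> k) - real (\<tau> (k - 1))" if "k \<in> {1..Suc M}" for k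
      using inc[OF that] by (auto simp: seg_length_def)
    have wL: "?w k * a \<le> \<rho> * ?L k" "?w (k - 1) * a \<le> \<rho> * ?L k" if k: "k \<in> {1..Suc M}" for k
    proof -
      have r: "\<rho> * real (min x y) \<le> \<rho> * real x" "\<rho> * real (min x y) \<le> \<rho> * real y" for x y
        using \<open>0 < \<rho>\<close> by (intro mult_left_mono; simp)+
      have "0 \<le> \<rho> * ?L k" using \<open>0 < \<rho>\<close> by simp
      show "?w k * a \<le> \<rho> * ?L k"
      proof (cases "k \<in> {1..M}")
        case True then show ?thesis using order_trans[OF nL[OF True] r(1)] by (simp add: window_width_def)
      next
        case False
        then have "window_width M n k = 0" by (simp only: window_width_def if_False)
        then show ?thesis using \<open>0 \<le> \<rho> * ?L k\<close> by simp
      qed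
      show "?w (k - 1) * a \<le> \<rho> * ?L k"
      proof (cases "k - 1 \<in> {1..M}")
        case True
        then have "Suc (k - 1) = k" by auto
        then show ?thesis using order_trans[OF nL[OF True] r(2)] True by (simp add: window_width_def)
      next
        case False
        then have "window_width M n (k - 1) = 0" by (simp only: window_width_def if_False)
        then show ?thesis using \<open>0 \<le> \<rho> * ?L k\<close> by simp
      qed
    qed
    have n0: "0 < n k" if "k \<in> {1..M}" for k
    proof -
      have "0 < K * a" using e a by simp
      then show ?thesis using nK[OF that] by linarith
    qed
    note seg = segment_parameters[OF a(1) \<eta>(1,2) e(1) L(1) _ _ _ _, of _ "?w _" "?w _", OF _ of_nat_0_le_iff _ of_nat_0_le_iff, folded \<rho>_def]
    have l: "core_length M \<tau> n k = ?L k - ?w k - ?w (k - 1)" if "k \<in> {1..Suc M}" for k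
      using L(2)[OF that] by (simp add: core_length_def)
    interpret P: prob_space P using cp by (simp add: change_point_model_def)
    interpret wm: window_model P M m \<tau> n \<mu> X
    proof
      show "\<tau> (k - 1) + window_width M n (k - 1) + window_width M n k < \<tau> k" if k: "k \<in> {1..Suc M}" for k
      proof -
        have "?w k + ?w (k - 1) < ?L k" using wL[OF k] by (intro seg(1) k)
        then show ?thesis using L(2)[OF k] by linarith
      qed
      show "jump \<mu> k \<noteq> 0" if "k \<in> {1..M}" for k using J[OF that] c by auto
    qed (use cp sp n0 in auto)
    \<comment> \<open>the largest perturbation that \<open>window_max_texp\<close> admits\<close>
    define \<kappa> where "\<kappa> k = e / real (n k)" for k
    have \<kappa>: "(1 + 1 / (\<eta> / a)) / core_length M \<tau> n k \<le> \<kappa> k" "(1 + 1 / (\<eta> / a)) / core_length M \<tau> n (Suc k) \<le> \<kappa> k"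
      if k: "k \<in> {1..M}" for k
    proof -
      have k': "k \<in> {1..Suc M}" "Suc k \<in> {1..Suc M}" using k by auto
      have wk: "?w k = real (n k)" "?w (Suc k - 1) = real (n k)" using k by (auto simp: window_width_def)
      show "(1 + 1 / (\<eta> / a)) / core_length M \<tau> n k \<le> \<kappa> k"
        using seg(3)[OF k'(1) wL[OF k'(1)]] n0[OF k] unfolding l[OF k'(1)] \<kappa>_def wk by simp
      show "(1 + 1 / (\<eta> / a)) / core_length M \<tau> n (Suc k) \<le> \<kappa> k"
        using seg(4)[OF k'(2) wL[OF k'(2)]] n0[OF k] unfolding l[OF k'(2)] \<kappa>_def wk by simp
    qed
    have short: "2 * ?w k + 2 * ?w (k - 1) \<le> \<eta> / a * core_length M \<tau> n k" if k: "k \<in> {1..Suc M}" for k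
      unfolding l[OF k] using wL[OF k] by (intro seg(2) k)
    have \<kappa>0: "0 \<le> \<kappa> k" "\<kappa> k * real (n k) \<le> e" for k using e by (auto simp: \<kappa>_def)
    have Y: "2 * nu \<bar>jump \<mu> k\<bar> * A - \<zeta>' * a \<le> texp (law P (wm.Y (-1) \<kappa> k)) A"
        "texp (law P (wm.Y (-1) \<kappa> k)) A \<le> texp (law P (wm.Y 1 \<kappa> k)) A"
        "texp (law P (wm.Y 1 \<kappa> k)) A \<le> 2 * nu \<bar>jump \<mu> k\<bar> * A + \<zeta>' * a"
      if k: "k \<in> {1..M}" and A: "0 \<le> A" "A \<le> a" for k A
    proof -
      have "c \<le> \<bar>jump \<mu> k\<bar>" using J[OF k] by simp
      note w = win[OF this \<kappa>0 a(3) nK[OF k] A]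
      show "2 * nu \<bar>jump \<mu> k\<bar> * A - \<zeta>' * a \<le> texp (law P (wm.Y (-1) \<kappa> k)) A"
        unfolding wm.texp_Y[OF k] using w by blast
      show "texp (law P (wm.Y (-1) \<kappa> k)) A \<le> texp (law P (wm.Y 1 \<kappa> k)) A"
        by (rule wm.texp_Y_le[OF k \<kappa>0(1)])
      show "texp (law P (wm.Y 1 \<kappa> k)) A \<le> 2 * nu \<bar>jump \<mu> k\<bar> * A + \<zeta>' * a"
        unfolding wm.texp_Y_upper[OF k \<kappa>0(1)] using w by blast
    qed
    have W: "\<bar>texp (law Q (W k)) A - 2 * nu \<bar>jump \<mu> k\<bar> * A\<bar> \<le> 1 + V\<^sup>2" "texp (law Q (W k)) A \<le> (2 * V + 1) * a"
      if k: "k \<in> {1..M}" and A: "0 \<le> A" "A \<le> a" for k A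
    proof -
      have "c \<le> \<bar>jump \<mu> k\<bar>" using J[OF k] by simp
      note b = limit_model_texp_bounds[OF lm k A(1) c(1) this]
      show "\<bar>texp (law Q (W k)) A - 2 * nu \<bar>jump \<mu> k\<bar> * A\<bar> \<le> 1 + V\<^sup>2" using b(1) by (simp add: V_def)
      have "V * A \<le> V * a" using V A by (intro mult_left_mono) auto
      then show "texp (law Q (W k)) A \<le> (2 * V + 1) * a" using b(2) a(1) by (simp add: V_def distrib_right)
    qed
    have z: "1 + V\<^sup>2 \<le> \<zeta> / 2 * a" "\<zeta>' * a \<le> \<zeta> / 2 * a" "\<zeta>' * a \<le> 1 * a"
    proof -
      show "1 + V\<^sup>2 \<le> \<zeta> / 2 * a" using a(5) \<zeta> by (simp add: field_simps)
      show "\<zeta>' * a \<le> \<zeta> / 2 * a" "\<zeta>' * a \<le> 1 * a" using \<zeta>' a(1) by (intro mult_right_mono; simp)+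
    qed
    have close: "\<bar>texp (law P (wm.Y \<sigma> \<kappa> k)) A - texp (law Q (W k)) A\<bar> \<le> \<zeta> * a"
        "texp (law P (wm.Y \<sigma> \<kappa> k)) A \<le> (2 * V + 1) * a"
      if k: "k \<in> {1..M}" and A: "0 \<le> A" "A \<le> a" and \<sigma>: "\<sigma> \<in> {-1, 1}" for \<sigma> k A
    proof -
      have c': "c \<le> \<bar>jump \<mu> k\<bar>" using J[OF k] by simp
      have Y': "2 * nu \<bar>jump \<mu> k\<bar> * A - \<zeta>' * a \<le> texp (law P (wm.Y \<sigma> \<kappa> k)) A"
        "texp (law P (wm.Y \<sigma> \<kappa> k)) A \<le> 2 * nu \<bar>jump \<mu> k\<bar> * A + \<zeta>' * a"
        using Y[OF k A] \<sigma> by auto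
      show "\<bar>texp (law P (wm.Y \<sigma> \<kappa> k)) A - texp (law Q (W k)) A\<bar> \<le> \<zeta> * a"
        using Y' W(1)[OF k A] z(1,2) by linarith
      have "nu \<bar>jump \<mu> k\<bar> * A \<le> V * a"
        using nu_bounds[OF c(1) c'] A by (intro mult_mono) (auto simp: V_def)
      then show "texp (law P (wm.Y \<sigma> \<kappa> k)) A \<le> (2 * V + 1) * a"
        using Y'(2) z(3) by (simp add: distrib_right)
    qed
    have low: "v0 / (2 * real M) * a \<le> texp (law Q (W k)) (a / (2 * real M))" if k: "k \<in> {1..M}" for k
    proof -
      have A: "0 \<le> a / (2 * real M)" using a by simp
      have c': "c \<le> \<bar>jump \<mu> k\<bar>" using J[OF k] by simp
      let ?v = "nu \<bar>jump \<mu> k\<bar>"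
      have v: "v0 \<le> ?v" unfolding v0_def using J[OF k] by (intro nu_lower c) auto
      have vV: "?v\<^sup>2 \<le> V\<^sup>2" using nu_bounds[OF c(1) c'] by (intro power_mono) (auto simp: V_def)
      have "?v\<^sup>2 * (1 - exp (- (a / (2 * real M)))) \<le> ?v\<^sup>2 * 1" by (intro mult_left_mono) auto
      then have "?v\<^sup>2 * (1 - exp (- (a / (2 * real M)))) \<le> V\<^sup>2" using vV by simp
      moreover have "V\<^sup>2 \<le> v0 * (a / (2 * real M))" using a(6) v0 M0 by (simp add: field_simps)
      moreover have "v0 / (2 * real M) * a = v0 * (a / (2 * real M))" by simp
      moreover have "v0 * (a / (2 * real M)) \<le> ?v * (a / (2 * real M))" using v A by (rule mult_right_mono)
      ultimately show ?thesis
        unfolding limit_model_texp[OF lm k A] mult.assoc[of 2 ?v] by linarith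
    qed
    have sQ: "sum_model (Suc d) Q W C" using limit_model_sum_model[OF lm] M by simp
    have sP: "sum_model (Suc d) P (wm.Y \<sigma> \<kappa>) wm.C" for \<sigma> using wm.Y_model M by simp
    have cmp: "\<bar>total_texp d P (wm.Y \<sigma> \<kappa>) a - total_texp d Q W a\<bar> \<le> \<eta> * total_texp d Q W a \<and>
      (\<forall>k\<in>{1..M}. total_texp d P ((wm.Y \<sigma> \<kappa>)(k := \<lambda>_. 0)) a \<le> \<eta> * total_texp d Q W a)"
      if \<sigma>: "\<sigma> \<in> {-1, 1}" for \<sigma>
      using comp[OF a(2) sP sQ, folded M, OF close(1)[OF _ _ _ \<sigma>] close(2)[OF _ _ _ \<sigma>] W(2) low] .
    let ?p = "measure P {\<omega> \<in> space P. Max ((\<lambda>t. U_stat M X t \<tau> \<mu> \<omega>) ` nearby_splits M m \<tau> n) > a}"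
    let ?q = "measure Q {\<omega> \<in> space Q. (\<Sum>k=1..M. W k \<omega>) + C \<omega> / 2 > a}"
    have \<eta>a: "\<eta> < a" using \<eta> a by simp
    have 1: "\<bar>total_texp d P (wm.Y 1 \<kappa>) a - total_texp d Q W a\<bar> \<le> \<eta> * total_texp d Q W a"
      and 2: "\<bar>total_texp d P (wm.Y (-1) \<kappa>) a - total_texp d Q W a\<bar> \<le> \<eta> * total_texp d Q W a"
      and 3: "\<And>k. k \<in> {1..M} \<Longrightarrow> total_texp d P ((wm.Y (-1) \<kappa>)(k := \<lambda>_. 0)) a \<le> \<eta> * total_texp d Q W a"
      using cmp[of 1] cmp[of "-1"] by auto
    note tc = wm.tail_comparison[OF M \<eta>(1) \<eta>a \<kappa> short limit_model_sum_model[OF lm] 1 2 3 ah[OF a(4)]]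
    have "?p \<le> (1 + \<epsilon>) * ?q"
      by (rule order_trans[OF tc(1) mult_right_mono[OF \<eta>(3) measure_nonneg]])
    moreover have "(1 - \<epsilon>) * ?q \<le> ?p"
      by (rule order_trans[OF mult_right_mono[OF \<eta>(4) measure_nonneg] tc(2)])
    ultimately show "\<bar>?p - ?q\<bar> \<le> \<epsilon> * ?q"
      by (simp only: abs_le_iff distrib_right left_diff_distrib mult_1_left) linarith
  qed
qed

theorem theorem3p1:
  fixes M :: nat
    and m :: "real \<Rightarrow> nat"
    and \<tau> :: "real \<Rightarrow> nat \<Rightarrow> nat"
    and \<mu> :: "real \<Rightarrow> nat \<Rightarrow> real"
    and n :: "real \<Rightarrow> nat \<Rightarrow> nat"
    and P :: "real \<Rightarrow> 'a measure" and X :: "real \<Rightarrow> nat \<Rightarrow> 'a \<Rightarrow> real"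
    and Q :: "real \<Rightarrow> 'b measure" and W :: "real \<Rightarrow> nat \<Rightarrow> 'b \<Rightarrow> real" and C :: "real \<Rightarrow> 'b \<Rightarrow> real"
  assumes "M \<ge> 1"
    and "\<forall>\<^sub>F a in at_top. split_points M (m a) (\<tau> a)"
    and "\<forall>\<^sub>F a in at_top. \<forall>k\<in>{1..M}. \<mu> a k \<noteq> \<mu> a (Suc k)"
    and "\<forall>\<^sub>F a in at_top. \<forall>k\<in>{1..M}. n a k > 0"
    and "\<forall>\<^sub>F a in at_top. change_point_model M (m a) (\<tau> a) (\<mu> a) (P a) (X a)"
    and "\<forall>\<^sub>F a in at_top. limit_model M (\<mu> a) (Q a) (W a) (C a)"
    and "\<And>k. k \<in> {1..M} \<Longrightarrow> (\<lambda>a. \<bar>jump (\<mu> a) k\<bar>) \<in> \<Theta>[at_top](\<lambda>_. 1)"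
    and "\<And>k. k \<in> {1..M} \<Longrightarrow> (\<lambda>a. a) \<in> o[at_top](\<lambda>a. real (n a k))"
    and "\<And>k. k \<in> {1..M} \<Longrightarrow> (\<lambda>a. real (n a k)) \<in>
           o[at_top](\<lambda>a. real (min (seg_length (\<tau> a) k) (seg_length (\<tau> a) (Suc k))) / a)"
  shows "(\<lambda>a. measure (P a) {\<omega> \<in> space (P a).
                Max ((\<lambda>t. U_stat M (X a) t (\<tau> a) (\<mu> a) \<omega>) ` nearby_splits M (m a) (\<tau> a) (n a)) > a})
         \<sim>[at_top]
         (\<lambda>a. measure (Q a) {\<omega> \<in> space (Q a). (\<Sum>k=1..M. W a k \<omega>) + C a \<omega> / 2 > a})"
proof -
  obtain d where M: "M = Suc d" using \<open>M \<ge> 1\<close> by (cases M) auto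
  have fin: "finite {1..M}" "{1..M} \<noteq> {}" using M by auto
  obtain c where c: "0 < c" "\<forall>k\<in>{1..M}. \<forall>\<^sub>F a in at_top. c \<le> \<bar>jump (\<mu> a) k\<bar>"
  proof -
    have "\<forall>k\<in>{1..M}. \<exists>c>0. \<forall>\<^sub>F a in at_top. c \<le> \<bar>jump (\<mu> a) k\<bar>"
    proof
      fix k assume "k \<in> {1..M}"
      from bigthetaD2[OF assms(7)[OF this]] show "\<exists>c>0. \<forall>\<^sub>F a in at_top. c \<le> \<bar>jump (\<mu> a) k\<bar>"
        by (elim landau_omega.bigE) auto
    qed
    then obtain f where f: "\<forall>k\<in>{1..M}. 0 < f k \<and> (\<forall>\<^sub>F a in at_top. f k \<le> \<bar>jump (\<mu> a) k\<bar>)"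
      by (auto dest!: bchoice)
    show ?thesis
    proof (rule that[of "Min (f ` {1..M})"])
      show "0 < Min (f ` {1..M})" using f fin by (subst Min_gr_iff) auto
      show "\<forall>k\<in>{1..M}. \<forall>\<^sub>F a in at_top. Min (f ` {1..M}) \<le> \<bar>jump (\<mu> a) k\<bar>"
      proof
        fix k assume k: "k \<in> {1..M}"
        have le: "Min (f ` {1..M}) \<le> f k" using k by (intro Min_le) auto
        from f k have "\<forall>\<^sub>F a in at_top. f k \<le> \<bar>jump (\<mu> a) k\<bar>" by blast
        then show "\<forall>\<^sub>F a in at_top. Min (f ` {1..M}) \<le> \<bar>jump (\<mu> a) k\<bar>"
          by eventually_elim (rule order_trans[OF le])
      qed
    qed
  qed
  obtain c2 where c2: "\<forall>k\<in>{1..M}. \<forall>\<^sub>F a in at_top. \<bar>jump (\<mu> a) k\<bar> \<le> c2"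
  proof -
    have "\<forall>k\<in>{1..M}. \<exists>c. \<forall>\<^sub>F a in at_top. \<bar>jump (\<mu> a) k\<bar> \<le> c"
    proof
      fix k assume "k \<in> {1..M}"
      from bigthetaD1[OF assms(7)[OF this]] show "\<exists>c. \<forall>\<^sub>F a in at_top. \<bar>jump (\<mu> a) k\<bar> \<le> c"
        by (elim landau_o.bigE) auto
    qed
    then obtain f where f: "\<forall>k\<in>{1..M}. \<forall>\<^sub>F a in at_top. \<bar>jump (\<mu> a) k\<bar> \<le> f k"
      by (auto dest!: bchoice)
    show ?thesis
    proof (rule that[of "Max (f ` {1..M})"])
      show "\<forall>k\<in>{1..M}. \<forall>\<^sub>F a in at_top. \<bar>jump (\<mu> a) k\<bar> \<le> Max (f ` {1..M})"
      proof
        fix k assume k: "k \<in> {1..M}"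
        have le: "f k \<le> Max (f ` {1..M})" using k by (intro Max_ge) auto
        from f k have "\<forall>\<^sub>F a in at_top. \<bar>jump (\<mu> a) k\<bar> \<le> f k" by blast
        then show "\<forall>\<^sub>F a in at_top. \<bar>jump (\<mu> a) k\<bar> \<le> Max (f ` {1..M})"
          by eventually_elim (rule order_trans[OF _ le])
      qed
    qed
  qed
  have J: "\<forall>\<^sub>F a in at_top. \<forall>k\<in>{1..M}. c \<le> \<bar>jump (\<mu> a) k\<bar> \<and> \<bar>jump (\<mu> a) k\<bar> \<le> max c c2"
  proof (rule eventually_ball_finite[OF fin(1)], rule ballI)
    fix k assume "k \<in> {1..M}"
    with c(2) c2 have "\<forall>\<^sub>F a in at_top. c \<le> \<bar>jump (\<mu> a) k\<bar>" "\<forall>\<^sub>F a in at_top. \<bar>jump (\<mu> a) k\<bar> \<le> c2" by auto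
    then show "\<forall>\<^sub>F a in at_top. c \<le> \<bar>jump (\<mu> a) k\<bar> \<and> \<bar>jump (\<mu> a) k\<bar> \<le> max c c2"
      by eventually_elim auto
  qed
  let ?p = "\<lambda>a. measure (P a) {\<omega> \<in> space (P a). Max ((\<lambda>t. U_stat M (X a) t (\<tau> a) (\<mu> a) \<omega>) ` nearby_splits M (m a) (\<tau> a) (n a)) > a}"
  let ?q = "\<lambda>a. measure (Q a) {\<omega> \<in> space (Q a). (\<Sum>k=1..M. W a k \<omega>) + C a \<omega> / 2 > a}"
  \<comment> \<open>the convention \<open>0 / 0 = 1\<close> in the definition covers vanishing probabilities\<close>
  show ?thesis unfolding asymp_equiv_def
  proof (rule tendstoI)
    fix \<epsilon> :: real assume \<epsilon>: "0 < \<epsilon>"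
    obtain \<rho> K a1 where par: "0 < \<rho>" "0 < K" "1 \<le> a1" and close:
      "\<And>a m \<tau> \<mu> n (P :: 'a measure) X (Q :: 'b measure) W C.
      a1 \<le> a \<Longrightarrow> split_points M m \<tau> \<Longrightarrow> change_point_model M m \<tau> \<mu> P X \<Longrightarrow> limit_model M \<mu> Q W C \<Longrightarrow>
      (\<And>k. k \<in> {1..M} \<Longrightarrow> c \<le> \<bar>jump \<mu> k\<bar> \<and> \<bar>jump \<mu> k\<bar> \<le> max c c2) \<Longrightarrow>
      (\<And>k. k \<in> {1..M} \<Longrightarrow> K * a \<le> real (n k)) \<Longrightarrow>
      (\<And>k. k \<in> {1..M} \<Longrightarrow> real (n k) * a \<le> \<rho> * real (min (seg_length \<tau> k) (seg_length \<tau> (Suc k)))) \<Longrightarrow>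
      \<bar>measure P {\<omega> \<in> space P. Max ((\<lambda>t. U_stat M X t \<tau> \<mu> \<omega>) ` nearby_splits M m \<tau> n) > a}
        - measure Q {\<omega> \<in> space Q. (\<Sum>k=1..M. W k \<omega>) + C \<omega> / 2 > a}\<bar>
      \<le> \<epsilon> / 2 * measure Q {\<omega> \<in> space Q. (\<Sum>k=1..M. W k \<omega>) + C \<omega> / 2 > a}"
      using uniform_comparison[OF half_gt_zero[OF \<epsilon>] c(1) max.cobounded1[of c c2] M, of thesis] by blast
    have wide: "\<forall>\<^sub>F a in at_top. \<forall>k\<in>{1..M}. K * a \<le> real (n a k)"
    proof (rule eventually_ball_finite[OF fin(1)], rule ballI)
      fix k assume "k \<in> {1..M}"
      from landau_o.smallD[OF assms(8)[OF this], of "1 / K"] par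
      have "\<forall>\<^sub>F a in at_top. norm a \<le> 1 / K * norm (real (n a k))" by simp
      then show "\<forall>\<^sub>F a in at_top. K * a \<le> real (n a k)"
      proof eventually_elim
        case (elim a)
        have "K * a \<le> K * \<bar>a\<bar>" using par by (intro mult_left_mono) auto
        moreover have "K * \<bar>a\<bar> \<le> real (n a k)" using elim par by (simp add: field_simps)
        ultimately show ?case by linarith
      qed
    qed
    have narrow: "\<forall>\<^sub>F a in at_top. \<forall>k\<in>{1..M}. real (n a k) * a \<le> \<rho> * real (min (seg_length (\<tau> a) k) (seg_length (\<tau> a) (Suc k)))"
    proof (rule eventually_ball_finite[OF fin(1)], rule ballI)
      fix k assume "k \<in> {1..M}"
      from landau_o.smallD[OF assms(9)[OF this] par(1)] eventually_gt_at_top[of 0]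
      show "\<forall>\<^sub>F a in at_top. real (n a k) * a \<le> \<rho> * real (min (seg_length (\<tau> a) k) (seg_length (\<tau> a) (Suc k)))"
        by eventually_elim (simp add: field_simps)
    qed
    show "\<forall>\<^sub>F a in at_top. dist (if ?p a = 0 \<and> ?q a = 0 then 1 else ?p a / ?q a) 1 < \<epsilon>"
      using assms(2,5,6) J wide narrow eventually_ge_at_top[of a1]
    proof eventually_elim
      case (elim a)
      have "\<bar>?p a - ?q a\<bar> \<le> \<epsilon> / 2 * ?q a"
        by (rule close[OF elim(7,1,2,3)]) (use elim in blast)+
      then show ?case
      proof (cases "?q a = 0")
        case True
        with \<open>\<bar>?p a - ?q a\<bar> \<le> \<epsilon> / 2 * ?q a\<close> have "?p a \<le> 0" by simp
        then have "?p a = 0" by (simp only: order_antisym measure_nonneg)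
        with True \<epsilon> show ?thesis by simp
      next
        case False
        then have q: "0 < ?q a" by (simp add: zero_less_measure_iff)
        have ratio: "x / y - 1 = (x - y) / y" if "0 < y" for x y :: real
          using that by (simp add: diff_divide_distrib)
        have "dist (?p a / ?q a) 1 = \<bar>?p a - ?q a\<bar> / ?q a"
          using q unfolding dist_real_def ratio[OF q] by (simp only: abs_divide abs_of_pos)
        also have "\<dots> \<le> \<epsilon> / 2" using q \<open>\<bar>?p a - ?q a\<bar> \<le> \<epsilon> / 2 * ?q a\<close> by (simp add: pos_divide_le_eq)
        also have "\<dots> < \<epsilon>" using \<epsilon> by simp
        finally show ?thesis using False by simp
      qed
    qed
  qed
qed

end
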